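(* Let $n, N$ be natural numbers with $n \leq N < 2n - I(n)$. Then for any $N$-dimensional vector subspace $\mathcal{F}^N \subset C^0(\mathbb{R}^1,\mathbb{R}^1)$ there exist independent $n$-chord diagrams $\{(a_1,b_1),\dots,(a_n,b_n)\}$ for each of which the codimension in $\mathcal{F}^N$ of the subspace consisting of all $f\in\mathcal{F}^N$ satisfying $f(a_i)=f(b_i)$ for $i=1,\dots,n$ is less than $n$. Moreover, the dimension of the set of such exceptional $n$-chord diagrams is at least $3n-N-1$ in the following exact sense: there exist non-trivial elements of the $(N-n+1)$-dimensional homology group $H_{N-n+1}(\,\cdot\,,\mathbb{Z}_2)$ of the $2n$-dimensional manifold of all independent $n$-chord diagrams such that each cycle representing such an element necessarily intersects the set of exceptional $n$-chord diagrams.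
   Context: $I(n)$ is the number of ones in the binary notation of $n$. $C^0(\mathbb{R}^1,\mathbb{R}^1)$ is the space of continuous functions $\mathbb{R}^1\to\mathbb{R}^1$. A chord is an unordered pair $(a,b)$ of distinct points of $\mathbb{R}^1$; an $n$-chord diagram is an unordered collection of $n$ pairwise distinct chords $\{(a_1,b_1),\dots,(a_n,b_n)\}$. The diagram (equivalently, the system of conditions $f(a_i)=f(b_i)$, $i=1,\dots,n$) is called independent if the subalgebra of $C^0(\mathbb{R}^1,\mathbb{R}^1)$ consisting of all functions satisfying these $n$ conditions has codimension exactly $n$ in $C^0(\mathbb{R}^1,\mathbb{R}^1)$. Identifying a chord with the point $(a,b)$, $a<b$, of the half-plane $\mathbb{R}^2_+=\{(a,b)\in\mathbb{R}^2 : a<b\}$, the set of all independent $n$-chord diagrams is a subset of the space of unordered $n$-point subsets of $\mathbb{R}^2_+$ with its natural topology, and it is a smooth $2n$-dimensional manifold. *)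

theory Defs
  imports "HOL-Homology.Homology" "HOL-Library.Function_Algebras" "HOL-Library.Z2"
begin

definition binary_ones :: "nat \<Rightarrow> nat"
  where "binary_ones n = card {k. bit n k}"

instantiation "fun" :: (type, real_vector) real_vector
begin

definition scaleR_fun :: "real \<Rightarrow> ('a \<Rightarrow> 'b) \<Rightarrow> 'a \<Rightarrow> 'b"
  where "scaleR_fun r f = (\<lambda>x. r *\<^sub>R f x)"

instance
  by standard (simp_all add: scaleR_fun_def fun_eq_iff scaleR_add_right scaleR_add_left)

end

definition C0 :: "(real \<Rightarrow> real) set"
  where "C0 = {f. continuous_on UNIV f}"

text \<open>The quotient space of \<open>V\<close> by its subspace \<open>U\<close> has dimension \<open>k\<close>: the cosets of the
  \<open>k\<close> elements of \<open>B\<close> form a basis of it. (The first condition on \<open>B\<close> also makes these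
  cosets pairwise distinct.)\<close>

definition has_codim :: "'v::real_vector set \<Rightarrow> 'v set \<Rightarrow> nat \<Rightarrow> bool"
  where "has_codim V U k \<longleftrightarrow>
    (\<exists>B. finite B \<and> card B = k \<and> B \<subseteq> V \<and>
      (\<forall>c. (\<Sum>b\<in>B. c b *\<^sub>R b) \<in> U \<longrightarrow> (\<forall>b\<in>B. c b = 0)) \<and>
      (\<forall>f\<in>V. \<exists>c. f - (\<Sum>b\<in>B. c b *\<^sub>R b) \<in> U))"

text \<open>A chord is encoded by its endpoints in increasing order, so a chord diagram is a finite set
  of points of the half-plane.\<close>

definition half_plane :: "(real \<times> real) set"
  where "half_plane = {(a, b). a < b}"

definition satisfying :: "(real \<times> real) set \<Rightarrow> (real \<Rightarrow> real) set"
  where "satisfying D = {f. \<forall>(a, b)\<in>D. f a = f b}"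

definition chord_diagrams :: "nat \<Rightarrow> (real \<times> real) set set"
  where "chord_diagrams n = {D. D \<subseteq> half_plane \<and> finite D \<and> card D = n}"

definition independent_diagrams :: "nat \<Rightarrow> (real \<times> real) set set"
  where "independent_diagrams n = {D \<in> chord_diagrams n. has_codim C0 (C0 \<inter> satisfying D) n}"

definition exceptional_diagrams :: "nat \<Rightarrow> (real \<Rightarrow> real) set \<Rightarrow> (real \<times> real) set set"
  where "exceptional_diagrams n F =
    {D \<in> independent_diagrams n. \<exists>k<n. has_codim F (F \<inter> satisfying D) k}"

definition quotient_topology :: "'a topology \<Rightarrow> ('a \<Rightarrow> 'b) \<Rightarrow> 'b topology"
  where "quotient_topology X q =
    topology (\<lambda>U. U \<subseteq> q ` topspace X \<and> openin X {x \<in> topspace X. q x \<in> U})"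

lemma openin_quotient_topology:
  "openin (quotient_topology X q) U \<longleftrightarrow>
     U \<subseteq> q ` topspace X \<and> openin X {x \<in> topspace X. q x \<in> U}"
proof -
  have "istopology (\<lambda>U. U \<subseteq> q ` topspace X \<and> openin X {x \<in> topspace X. q x \<in> U})"
    unfolding istopology_def
  proof (intro conjI allI impI)
    fix S T
    assume S: "S \<subseteq> q ` topspace X \<and> openin X {x \<in> topspace X. q x \<in> S}"
      and T: "T \<subseteq> q ` topspace X \<and> openin X {x \<in> topspace X. q x \<in> T}"
    show "S \<inter> T \<subseteq> q ` topspace X" using S by blast
    have "{x \<in> topspace X. q x \<in> S \<inter> T} =
        {x \<in> topspace X. q x \<in> S} \<inter> {x \<in> topspace X. q x \<in> T}" by blast
    then show "openin X {x \<in> topspace X. q x \<in> S \<inter> T}" using S T by auto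
  next
    fix K
    assume K: "\<forall>S\<in>K. S \<subseteq> q ` topspace X \<and> openin X {x \<in> topspace X. q x \<in> S}"
    show "\<Union>K \<subseteq> q ` topspace X" using K by blast
    have "{x \<in> topspace X. q x \<in> \<Union>K} = (\<Union>S\<in>K. {x \<in> topspace X. q x \<in> S})" by blast
    then show "openin X {x \<in> topspace X. q x \<in> \<Union>K}" using K by auto
  qed
  then show ?thesis
    unfolding quotient_topology_def by (simp add: topology_inverse')
qed

lemma topspace_quotient_topology: "topspace (quotient_topology X q) = q ` topspace X"
proof -
  have "{x \<in> topspace X. q x \<in> q ` topspace X} = topspace X" by blast
  then have "openin (quotient_topology X q) (q ` topspace X)"
    by (simp add: openin_quotient_topology)
  then show ?thesis
    by (metis openin_quotient_topology openin_subset openin_topspace subset_antisym)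
qed

lemma quotient_map_quotient_topology: "quotient_map X (quotient_topology X q) q"
  unfolding quotient_map_def
  by (auto simp: topspace_quotient_topology openin_quotient_topology)

definition ordered_configurations :: "nat \<Rightarrow> 'a topology \<Rightarrow> (nat \<Rightarrow> 'a) topology"
  where "ordered_configurations n X =
    subtopology (product_topology (\<lambda>_. X) {..<n}) {x. inj_on x {..<n}}"

definition unordered_configurations :: "nat \<Rightarrow> 'a topology \<Rightarrow> 'a set topology"
  where "unordered_configurations n X =
    quotient_topology (ordered_configurations n X) (\<lambda>x. x ` {..<n})"

lemma topspace_unordered_configurations:
  "topspace (unordered_configurations n X) = {S. S \<subseteq> topspace X \<and> finite S \<and> card S = n}"
proof -
  have "\<exists>x. S = x ` {..<n} \<and> x \<in> ({..<n} \<rightarrow>\<^sub>E topspace X) \<and> inj_on x {..<n}"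
    if S: "S \<subseteq> topspace X" "finite S" "card S = n" for S
  proof -
    obtain h where h: "bij_betw h {..<n} S"
      using S ex_bij_betw_nat_finite by (metis atLeast0LessThan)
    then have "S = restrict h {..<n} ` {..<n}" "inj_on (restrict h {..<n}) {..<n}"
      by (auto simp: bij_betw_def)
    moreover have "restrict h {..<n} \<in> ({..<n} \<rightarrow>\<^sub>E topspace X)"
      using h S by (auto simp: bij_betw_def)
    ultimately show ?thesis by blast
  qed
  then have "(\<lambda>x. x ` {..<n}) ` (({..<n} \<rightarrow>\<^sub>E topspace X) \<inter> {x. inj_on x {..<n}}) =
      {S. S \<subseteq> topspace X \<and> finite S \<and> card S = n}"
    by (auto simp only: image_iff Int_iff mem_Collect_eq finite_imageI finite_lessThan
        card_image card_lessThan) blast+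
  then show ?thesis
    by (simp add: unordered_configurations_def topspace_quotient_topology
        ordered_configurations_def)
qed

definition diagram_space :: "nat \<Rightarrow> (real \<times> real) set topology"
  where "diagram_space n =
    subtopology (unordered_configurations n (top_of_set half_plane)) (independent_diagrams n)"

lemma topspace_diagram_space: "topspace (diagram_space n) = independent_diagrams n"
  by (auto simp: diagram_space_def topspace_unordered_configurations
      independent_diagrams_def chord_diagrams_def)

text \<open>Singular homology with coefficients in an arbitrary commutative ring; the library only
  has integer coefficients.\<close>

type_synonym ('a, 'r) coeff_chain = "((nat \<Rightarrow> real) \<Rightarrow> 'a) \<Rightarrow>\<^sub>0 'r"

definition coeff_boundary :: "nat \<Rightarrow> ('a, 'r::comm_ring_1) coeff_chain \<Rightarrow> ('a, 'r) coeff_chain"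
  where "coeff_boundary p c =
    (if p = 0 then 0
     else \<Sum>f\<in>Poly_Mapping.keys c. \<Sum>k\<le>p.
            Poly_Mapping.single (singular_face p k f) ((-1) ^ k * Poly_Mapping.lookup c f))"

lemma coeff_boundary_int: "coeff_boundary p c = chain_boundary p c"
proof -
  have "frag_cmul a (frag_cmul b (frag_of x)) = Poly_Mapping.single x (b * a)"
    for a b :: int and x :: "(nat \<Rightarrow> real) \<Rightarrow> 'a"
    by (rule poly_mapping_eqI) (simp add: lookup_single when_def)
  then show ?thesis
    unfolding coeff_boundary_def chain_boundary_def frag_extend_def
    by (simp add: frag_cmul_sum)
qed

definition coeff_cycles :: "nat \<Rightarrow> 'a topology \<Rightarrow> ('a, 'r::comm_ring_1) coeff_chain set"
  where "coeff_cycles p X =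
    {c. Poly_Mapping.keys c \<subseteq> singular_simplex_set p X \<and> coeff_boundary p c = 0}"

definition coeff_boundaries :: "nat \<Rightarrow> 'a topology \<Rightarrow> ('a, 'r::comm_ring_1) coeff_chain set"
  where "coeff_boundaries p X =
    coeff_boundary (Suc p) ` {d. Poly_Mapping.keys d \<subseteq> singular_simplex_set (Suc p) X}"

definition coeff_homology_group ::
    "nat \<Rightarrow> 'a topology \<Rightarrow> ('a, 'r::comm_ring_1) coeff_chain set monoid"
  where "coeff_homology_group p X =
    \<lparr>carrier = coeff_cycles p X, mult = (+), one = 0\<rparr> Mod coeff_boundaries p X"

text \<open>As in the library, a homology class is a coset, i.e. the set of the cycles representing it.\<close>

definition homology_group_Z2 :: "nat \<Rightarrow> 'a topology \<Rightarrow> ('a, bit) coeff_chain set monoid"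
  where "homology_group_Z2 = coeff_homology_group"

definition chain_support :: "nat \<Rightarrow> ('a, 'r::zero) coeff_chain \<Rightarrow> 'a set"
  where "chain_support p c = (\<Union>f\<in>Poly_Mapping.keys c. f ` standard_simplex p)"

end

theory Submission
  imports Defs "HOL-Computational_Algebra.Polynomial" "HOL-Combinatorics.Permutations"
begin

text \<open>Let \<open>k = N - n + 1\<close> and let \<open>g(a, b) = (f\<^sub>t b - f\<^sub>t a)\<^sub>t\<close> for a basis \<open>(f\<^sub>t)\<close> of \<open>F\<close>. The vectors
  \<open>g z\<close>, \<open>z \<in> D\<close>, are linearly independent when \<open>D\<close> is not exceptional, and then the real linear map
  taking a complex polynomial \<open>P\<close> of degree less than \<open>n\<close> to the numbers \<open>Re (P z)\<close> and the vector
  \<open>\<Sum>z\<in>D. Im (P z) g z\<close> is injective. In this way every labelled diagram carries a matrix with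
  \<open>2 n\<close> columns and \<open>n + N = 2 n + k - 1\<close> rows, and relabelling permutes rows. The number mod 2 of
  degenerations of generic matrices over a \<open>k\<close>-cycle is a homotopy invariant; a cocycle on finely
  subdivided cycles computes it, and it vanishes on cycles avoiding the exceptional diagrams.

  Since \<open>q = n - k\<close> is at least the number of binary ones of \<open>n\<close>, there is a forest of \<open>q\<close> complete
  binary trees with \<open>n\<close> leaves, hence with \<open>k\<close> inner nodes. A cube with one coordinate per node
  parametrizes diagrams whose chords are the leaves: at each node the two subtrees revolve around each
  other by half a turn. Opposite faces of the cube carry the same diagrams, so the cube is a cycle mod 2.
  Deform the matrices to those whose columns are \<open>N\<close> unit vectors, the indicators of the trees
  and the left endpoints of the chords. They degenerate only where the left endpoints are constant
  on every tree, that is at the center of the cube, so the invariant of this cycle is \<open>1\<close>.\<close>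

section \<open>Convex dependence of generic vectors\<close>

text \<open>In disguise the invariant is a Stiefel-Whitney class. Let \<xi> be the vector bundle
  over the space of diagrams whose fibre at \<open>D\<close> consists of the real functions on
  \<open>D\<close>. Away from the exceptional diagrams the vectors \<open>g z\<close> embed \<xi>
  into a trivial bundle of rank \<open>N\<close>. Interpolation by complex polynomials trivializes
  the sum of two copies of \<xi>. Together they embed a trivial bundle of rank \<open>2 n\<close>
  into the sum of \<xi> and a trivial bundle of rank \<open>N\<close>, and the primary obstruction
  to such an embedding is the class of \<xi> in degree \<open>N - n + 1\<close>. Three obstacles
  shape the details. Diagrams are unordered, so rows are defined only up to a permutation, and a
  perturbation chosen once per diagram has to stay generic under all row permutations. Singular
  simplices may repeat vertices, so general position can be demanded of different vectors only.
  Finally, clusters of chords that revolve by half a turn pass through positions where chords may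
  share endpoints, and yet the conditions must stay independent; the unequal sizes of the clusters
  serve this purpose.\<close>

definition indep :: "nat \<Rightarrow> 't set \<Rightarrow> ('t \<Rightarrow> nat \<Rightarrow> real) \<Rightarrow> bool"
  where "indep d J V \<longleftrightarrow>
    (\<forall>c. (\<forall>r<d. (\<Sum>t\<in>J. c t * V t r) = 0) \<longrightarrow> (\<forall>t\<in>J. c t = 0))"

lemma indepD: "indep d J V \<Longrightarrow> (\<And>r. r < d \<Longrightarrow> (\<Sum>t\<in>J. c t * V t r) = 0) \<Longrightarrow> t \<in> J \<Longrightarrow> c t = 0"
  unfolding indep_def by blast

text \<open>Gaussian elimination, by induction on the number of equations: if the last equation
  involves the unknown \<open>s\<close>, it is solved for \<open>s\<close>, and one equation and one
  unknown disappear.\<close>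

lemma homogeneous_system_solution:
  fixes V :: "'t \<Rightarrow> nat \<Rightarrow> real"
  assumes "finite T" "d < card T"
  obtains c where "\<And>r. r < d \<Longrightarrow> (\<Sum>t\<in>T. c t * V t r) = 0" "\<exists>t\<in>T. c t \<noteq> 0"
proof -
  have "\<exists>c. (\<forall>r<d. (\<Sum>t\<in>T. c t * V t r) = 0) \<and> (\<exists>t\<in>T. c t \<noteq> 0)"
    using assms
  proof (induction d arbitrary: T V)
    case 0
    then have "T \<noteq> {}" by auto
    then show ?case by (intro exI[of _ "\<lambda>_. 1"]) auto
  next
    case (Suc d)
    show ?case
    proof (cases "\<exists>s\<in>T. V s d \<noteq> 0")
      case False
      then obtain c where "\<forall>r<d. (\<Sum>t\<in>T. c t * V t r) = 0" "\<exists>t\<in>T. c t \<noteq> 0"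
        using Suc.IH[of T V] Suc.prems by auto
      then show ?thesis
        using False by (intro exI[of _ c]) (auto simp: less_Suc_eq)
    next
      case True
      then obtain s where s: "s \<in> T" "V s d \<noteq> 0" by blast
      define W where "W = (\<lambda>t r. V t r - V t d / V s d * V s r)"
      have "finite (T - {s})" "d < card (T - {s})"
        using Suc.prems s by auto
      then obtain c where c: "\<forall>r<d. (\<Sum>t\<in>T-{s}. c t * W t r) = 0" "\<exists>t\<in>T-{s}. c t \<noteq> 0"
        using Suc.IH[of "T - {s}" W] by auto
      define c' where "c' = c(s := - (\<Sum>t\<in>T-{s}. c t * V t d) / V s d)"
      have eq: "(\<Sum>t\<in>T. c' t * V t r) = (\<Sum>t\<in>T-{s}. c t * W t r)" for r
      proof -
        have "(\<Sum>t\<in>T. c' t * V t r) = c' s * V s r + (\<Sum>t\<in>T-{s}. c' t * V t r)"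
          using Suc.prems s by (simp add: sum.remove)
        also have "(\<Sum>t\<in>T-{s}. c' t * V t r) = (\<Sum>t\<in>T-{s}. c t * V t r)"
          by (rule sum.cong) (auto simp: c'_def)
        also have "c' s * V s r = - (\<Sum>t\<in>T-{s}. c t * (V t d / V s d * V s r))"
          by (simp add: c'_def sum_distrib_left sum_divide_distrib sum_negf mult.commute
              mult.left_commute)
        finally show ?thesis
          by (simp add: W_def right_diff_distrib sum_subtractf)
      qed
      have "W t d = 0" for t using s by (simp add: W_def)
      then have "\<forall>r<Suc d. (\<Sum>t\<in>T. c' t * V t r) = 0"
        using c(1) by (auto simp: eq less_Suc_eq)
      moreover have "\<exists>t\<in>T. c' t \<noteq> 0" using c(2) by (auto simp: c'_def)
      ultimately show ?thesis by blast
    qed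
  qed
  then show ?thesis using that by blast
qed

lemma indep_cong:
  assumes "\<And>t r. t \<in> J \<Longrightarrow> r < d \<Longrightarrow> V t r = W t r"
  shows "indep d J V = indep d J W"
proof -
  have "(\<Sum>t\<in>J. c t * V t r) = (\<Sum>t\<in>J. c t * W t r)" if "r < d" for c r
    by (rule sum.cong) (use assms that in auto)
  then show ?thesis unfolding indep_def by auto
qed

lemma indep_reindex:
  assumes "inj_on h J"
  shows "indep d (h ` J) V = indep d J (\<lambda>t. V (h t))"
proof
  assume *: "indep d (h ` J) V"
  show "indep d J (\<lambda>t. V (h t))"
    unfolding indep_def
  proof (intro allI impI ballI)
    fix c t assume c: "\<forall>r<d. (\<Sum>t\<in>J. c t * V (h t) r) = 0" and t: "t \<in> J"
    have "(\<Sum>s\<in>h ` J. c (inv_into J h s) * V s r) = (\<Sum>t\<in>J. c t * V (h t) r)" for r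
      using assms by (simp add: sum.reindex)
    then have "c (inv_into J h s) = 0" if "s \<in> h ` J" for s
      using indepD[OF *, of "\<lambda>s. c (inv_into J h s)"] c that by simp
    then show "c t = 0" using t assms by (metis imageI inv_into_f_f)
  qed
next
  assume *: "indep d J (\<lambda>t. V (h t))"
  show "indep d (h ` J) V"
    unfolding indep_def
  proof (intro allI impI ballI)
    fix c s assume c: "\<forall>r<d. (\<Sum>t\<in>h ` J. c t * V t r) = 0" and s: "s \<in> h ` J"
    have "(\<Sum>t\<in>J. c (h t) * V (h t) r) = (\<Sum>s\<in>h ` J. c s * V s r)" for r
      using assms by (simp add: sum.reindex)
    then have "c (h t) = 0" if "t \<in> J" for t using indepD[OF *, of "\<lambda>t. c (h t)"] c that by simp
    then show "c s = 0" using s by auto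
  qed
qed

text \<open>The origin lies in the convex hull of the family, where only the first \<open>d\<close>
  coordinates count.\<close>

definition balanced :: "nat \<Rightarrow> 't set \<Rightarrow> ('t \<Rightarrow> nat \<Rightarrow> real) \<Rightarrow> bool"
  where "balanced d T V \<longleftrightarrow>
    (\<exists>\<mu>. (\<forall>t\<in>T. 0 \<le> \<mu> t) \<and> (\<exists>t\<in>T. 0 < \<mu> t) \<and> (\<forall>r<d. (\<Sum>t\<in>T. \<mu> t * V t r) = 0))"

lemma balanced_cong:
  assumes "\<And>t r. t \<in> T \<Longrightarrow> r < d \<Longrightarrow> V t r = W t r"
  shows "balanced d T V = balanced d T W"
proof -
  have "(\<Sum>t\<in>T. c t * V t r) = (\<Sum>t\<in>T. c t * W t r)" if "r < d" for c r
    by (rule sum.cong) (use assms that in auto)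
  then show ?thesis unfolding balanced_def by auto
qed

lemma balanced_reindex:
  assumes "inj_on h T"
  shows "balanced d (h ` T) V = balanced d T (\<lambda>t. V (h t))"
proof
  assume "balanced d (h ` T) V"
  then obtain \<mu> where "\<forall>t\<in>h ` T. 0 \<le> \<mu> t" "\<exists>t\<in>h ` T. 0 < \<mu> t"
      "\<forall>r<d. (\<Sum>t\<in>h ` T. \<mu> t * V t r) = 0" unfolding balanced_def by blast
  then show "balanced d T (\<lambda>t. V (h t))"
    unfolding balanced_def by (intro exI[of _ "\<mu> \<circ> h"]) (use assms in \<open>auto simp: sum.reindex\<close>)
next
  assume "balanced d T (\<lambda>t. V (h t))"
  then obtain \<mu> where "\<forall>t\<in>T. 0 \<le> \<mu> t" "\<exists>t\<in>T. 0 < \<mu> t"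
      "\<forall>r<d. (\<Sum>t\<in>T. \<mu> t * V (h t) r) = 0" unfolding balanced_def by blast
  then show "balanced d (h ` T) V"
    unfolding balanced_def
    by (intro exI[of _ "\<mu> \<circ> inv_into T h"]) (use assms in \<open>auto simp: sum.reindex\<close>)
qed

lemma balanced_row_permute:
  assumes "\<rho> permutes {..<d}"
  shows "balanced d T (\<lambda>t r. V t (\<rho> r)) = balanced d T V"
proof -
  have "(\<forall>r<d. P (\<rho> r)) \<longleftrightarrow> (\<forall>r<d. P r)" for P
    using permutes_in_image[OF assms] permutes_surj[OF assms] by (metis lessThan_iff surjD)
  from this[of "\<lambda>r. (\<Sum>t\<in>T. _ t * V t r) = 0"] show ?thesis
    unfolding balanced_def by simp
qed

lemma balanced_uminus: "balanced d T (\<lambda>t r. - V t r) = balanced d T V"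
  unfolding balanced_def by (simp add: sum_negf)

text \<open>A family in an open half-space does not have the origin in its convex hull. The
  vanishing results for perturbed matrices rest on this criterion, because strict positivity
  survives small changes.\<close>

lemma not_balanced_functional:
  assumes "finite T" "\<And>t. t \<in> T \<Longrightarrow> 0 < (\<Sum>r<d. y r * V t r)"
  shows "\<not> balanced d T V"
proof
  assume "balanced d T V"
  then obtain \<mu> where \<mu>: "\<forall>t\<in>T. 0 \<le> \<mu> t" "\<exists>t\<in>T. 0 < \<mu> t" "\<forall>r<d. (\<Sum>t\<in>T. \<mu> t * V t r) = 0"
    unfolding balanced_def by blast
  have "0 < (\<Sum>t\<in>T. \<mu> t * (\<Sum>r<d. y r * V t r))"
  proof -
    obtain s where s: "s \<in> T" "0 < \<mu> s" using \<mu> by blast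
    show ?thesis
    proof (rule sum_pos2[OF assms(1) s(1)])
      show "0 < \<mu> s * (\<Sum>r<d. y r * V s r)" using s assms(2) by simp
      show "0 \<le> \<mu> t * (\<Sum>r<d. y r * V t r)" if "t \<in> T" for t
        using assms(2)[OF that] \<mu>(1) that by (simp add: less_imp_le)
    qed
  qed
  also have "\<dots> = (\<Sum>r<d. y r * (\<Sum>t\<in>T. \<mu> t * V t r))"
    by (simp add: sum_distrib_left sum.swap[of _ T] algebra_simps)
  also have "\<dots> = 0" using \<mu>(3) by simp
  finally show False by simp
qed

lemma not_balanced_indep: "indep d T V \<Longrightarrow> \<not> balanced d T V"
  unfolding indep_def balanced_def by (metis less_irrefl)

text \<open>The keys record coincidences: equal keys stand for the same vector, and vectors with
  different keys are in general position.\<close>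

definition general_position :: "nat \<Rightarrow> 't set \<Rightarrow> ('t \<Rightarrow> 's) \<Rightarrow> ('t \<Rightarrow> nat \<Rightarrow> real) \<Rightarrow> bool"
  where "general_position d T \<kappa> V \<longleftrightarrow>
    (\<forall>s\<in>T. \<forall>t\<in>T. \<kappa> s = \<kappa> t \<longrightarrow> V s = V t) \<and>
    (\<forall>J\<subseteq>T. inj_on \<kappa> J \<longrightarrow> card J \<le> d \<longrightarrow> indep d J V)"

text \<open>One representative of every key is kept and receives the total weight of its key class;
  the weighted sums do not change, since the vectors of a class coincide.\<close>

lemma balanced_collapse:
  assumes "finite T" "\<And>s t. s \<in> T \<Longrightarrow> t \<in> T \<Longrightarrow> \<kappa> s = \<kappa> t \<Longrightarrow> V s = V t"
    and "balanced d T V"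
  obtains J where "J \<subseteq> T" "inj_on \<kappa> J" "\<kappa> ` J = \<kappa> ` T" "balanced d J V"
proof -
  obtain J where J: "J \<subseteq> T" "inj_on \<kappa> J" "\<kappa> ` J = \<kappa> ` T"
    using subset_image_inj[of "\<kappa> ` T" \<kappa> T] by (metis order_refl)
  obtain \<mu> where \<mu>: "\<forall>t\<in>T. 0 \<le> \<mu> t" "\<exists>t\<in>T. 0 < \<mu> t" "\<forall>r<d. (\<Sum>t\<in>T. \<mu> t * V t r) = 0"
    using assms(3) unfolding balanced_def by blast
  define \<nu> where "\<nu> j = (\<Sum>t\<in>{t\<in>T. \<kappa> t = \<kappa> j}. \<mu> t)" for j
  have "balanced d J V"
    unfolding balanced_def
  proof (intro exI[of _ \<nu>] conjI)
    show "\<forall>t\<in>J. 0 \<le> \<nu> t" using \<mu>(1) by (auto simp: \<nu>_def intro: sum_nonneg)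
    obtain s where s: "s \<in> T" "0 < \<mu> s" using \<mu>(2) by blast
    obtain j where j: "j \<in> J" "\<kappa> j = \<kappa> s" using J s by (metis imageE imageI)
    have "0 < \<nu> j" unfolding \<nu>_def
      by (rule sum_pos2[of _ s]) (use s j \<mu>(1) assms(1) in auto)
    then show "\<exists>t\<in>J. 0 < \<nu> t" using j by blast
    show "\<forall>r<d. (\<Sum>t\<in>J. \<nu> t * V t r) = 0"
    proof (intro allI impI)
      fix r assume "r < d"
      have finJ: "finite J" using J assms(1) finite_subset by blast
      have "(\<Sum>t\<in>T. \<mu> t * V t r) = (\<Sum>j\<in>J. \<Sum>t\<in>{t\<in>T. \<kappa> t = \<kappa> j}. \<mu> t * V t r)"
      proof -
        have "(\<Sum>j\<in>J. \<Sum>t\<in>{t\<in>T. \<kappa> t = \<kappa> j}. \<mu> t * V t r)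
            = (\<Sum>y\<in>\<kappa> ` J. \<Sum>t\<in>{t\<in>T. \<kappa> t = y}. \<mu> t * V t r)"
          by (subst sum.reindex[OF J(2)]) simp
        also have "\<dots> = (\<Sum>t\<in>T. \<mu> t * V t r)"
          by (rule sum.group) (use assms(1) finJ J in auto)
        finally show ?thesis by simp
      qed
      also have "\<dots> = (\<Sum>j\<in>J. \<nu> j * V j r)"
      proof (rule sum.cong[OF refl])
        fix j assume j: "j \<in> J"
        have "V t = V j" if "t \<in> T" "\<kappa> t = \<kappa> j" for t
          using assms(2)[of t j] that j J by blast
        then show "(\<Sum>t\<in>{t\<in>T. \<kappa> t = \<kappa> j}. \<mu> t * V t r) = \<nu> j * V j r"
          by (simp add: \<nu>_def sum_distrib_right)
      qed
      finally show "(\<Sum>t\<in>J. \<nu> t * V t r) = 0" using \<mu>(3) \<open>r < d\<close> by simp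
    qed
  qed
  then show ?thesis using that J by blast
qed

text \<open>If there is a balanced facet, the relations between the \<open>d + 2\<close> vectors
  with coefficient sum \<open>1\<close> form a line \<open>a + s * b\<close>, and the nonnegative
  ones a segment on it. At each end of the segment exactly one coefficient vanishes, so the ends are
  balanced facets, and every balanced facet is such an end. Hence there are none or two.\<close>

lemma facets_even_inj:
  fixes V :: "'t \<Rightarrow> nat \<Rightarrow> real"
  assumes "finite T" "card T = d + 2" "\<And>J. J \<subseteq> T \<Longrightarrow> card J \<le> d \<Longrightarrow> indep d J V"
  shows "even (card {t\<in>T. balanced d (T - {t}) V})"
proof (cases "\<exists>p\<in>T. balanced d (T - {p}) V")
  case False
  then have "{t\<in>T. balanced d (T - {t}) V} = {}" by blast
  then show ?thesis by (simp only: card.empty even_zero)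
next
  case True
  then obtain p where p: "p \<in> T" "balanced d (T - {p}) V" by blast
  define K where "K c \<longleftrightarrow> (\<forall>r<d. (\<Sum>t\<in>T. c t * V t r) = 0)" for c
  have K_comb: "K (\<lambda>t. x * c t + y * c' t)" if "K c" "K c'" for x y c c'
    using that by (simp add: K_def distrib_right sum.distrib mult.assoc flip: sum_distrib_left)
  \<comment> \<open>Without two of the indices only \<open>d\<close> vectors are left, and these are
    independent.\<close>
  have two: "\<forall>t\<in>T. c t = 0" if "K c" "s \<in> T" "t \<in> T" "s \<noteq> t" "c s = 0" "c t = 0" for c s t
  proof -
    have ind: "indep d (T - {s,t}) V"
      by (rule assms(3)) (use that assms in \<open>auto simp: card_Diff_subset\<close>)
    have "(\<Sum>u\<in>T - {s,t}. c u * V u r) = (\<Sum>u\<in>T. c u * V u r)" for r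
      by (rule sum.mono_neutral_left) (use assms that in auto)
    then have "c u = 0" if "u \<in> T - {s,t}" for u
      using indepD[OF ind, of c] that \<open>K c\<close> unfolding K_def by simp
    then show ?thesis using that by blast
  qed
  have bal: "\<exists>a. K a \<and> (\<Sum>t\<in>T. a t) = 1 \<and> a s = 0 \<and> (\<forall>t\<in>T - {s}. 0 < a t)"
    if s: "s \<in> T" and b: "balanced d (T - {s}) V" for s
  proof -
    obtain \<mu> where \<mu>: "\<forall>t\<in>T-{s}. 0 \<le> \<mu> t" "\<exists>t\<in>T-{s}. 0 < \<mu> t"
        "\<forall>r<d. (\<Sum>t\<in>T-{s}. \<mu> t * V t r) = 0"
      using b unfolding balanced_def by blast
    define a0 where "a0 = \<mu>(s := 0)"
    have a0: "(\<Sum>t\<in>T. a0 t * V t r) = (\<Sum>t\<in>T-{s}. \<mu> t * V t r)" for r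
      by (rule sum.mono_neutral_cong_right) (use assms(1) in \<open>auto simp: a0_def\<close>)
    have Ka0: "K a0" using \<mu>(3) by (simp add: K_def a0)
    have nn: "0 \<le> a0 t" if "t \<in> T" for t using \<mu>(1) that by (auto simp: a0_def)
    obtain q where q: "q \<in> T - {s}" "0 < a0 q" using \<mu>(2) by (auto simp: a0_def)
    define S where "S = (\<Sum>t\<in>T. a0 t)"
    have Spos: "0 < S" unfolding S_def
      by (rule sum_pos2[of _ q]) (use assms(1) q nn in auto)
    have pos: "0 < a0 t" if "t \<in> T - {s}" for t
    proof (rule ccontr)
      assume "\<not> 0 < a0 t"
      then have "a0 t = 0" using nn[of t] that by auto
      moreover have "a0 s = 0" by (simp add: a0_def)
      ultimately have "\<forall>t\<in>T. a0 t = 0" using two[OF Ka0, of s t] that s by blast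
      then show False using q by (metis DiffD1 less_irrefl)
    qed
    show ?thesis
    proof (intro exI conjI)
      show "K (\<lambda>t. a0 t / S)" using K_comb[OF Ka0 Ka0, of "1/S" 0] by simp
      show "(\<Sum>t\<in>T. a0 t / S) = 1" using Spos by (simp add: S_def flip: sum_divide_distrib)
      show "a0 s / S = 0" by (simp add: a0_def)
      show "\<forall>t\<in>T - {s}. 0 < a0 t / S" using pos Spos by simp
    qed
  qed
  obtain a where a: "K a" "(\<Sum>t\<in>T. a t) = 1" "a p = 0" "\<And>t. t \<in> T - {p} \<Longrightarrow> 0 < a t"
    using bal[OF p] by blast
  \<comment> \<open>The direction of the line: a relation with coefficient sum zero, obtained by
    adding a row of ones as equation number \<open>d\<close>.\<close>
  obtain b0 where b0: "\<And>r. r < Suc d \<Longrightarrow> (\<Sum>t\<in>T. b0 t * (if r = d then 1 else V t r)) = 0"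
      "\<exists>t\<in>T. b0 t \<noteq> 0"
    using homogeneous_system_solution[of T "Suc d" "\<lambda>t r. if r = d then 1 else V t r"] assms
    by (metis add_2_eq_Suc' lessI)
  have Kb0: "K b0" unfolding K_def
  proof (intro allI impI)
    fix r assume "r < d"
    then show "(\<Sum>t\<in>T. b0 t * V t r) = 0" using b0(1)[of r] by simp
  qed
  have sb0: "(\<Sum>t\<in>T. b0 t) = 0" using b0(1)[of d] by simp
  \<comment> \<open>A zero-sum relation that vanishes at \<open>p\<close> would be proportional to
    \<open>a\<close>, whose coefficient sum is \<open>1\<close>.\<close>
  have bp: "b0 p \<noteq> 0"
  proof
    assume bp: "b0 p = 0"
    obtain q where q: "q \<in> T" "b0 q \<noteq> 0" using b0(2) by blast
    then have qp: "q \<noteq> p" using bp by auto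
    have "\<forall>t\<in>T. b0 q * a t + (- a q) * b0 t = 0"
      using two[OF K_comb[OF a(1) Kb0], of p q "b0 q" "- a q"] p q qp bp a(3) by simp
    then have *: "b0 q * a t = a q * b0 t" if "t \<in> T" for t using that by auto
    have "b0 q * (\<Sum>t\<in>T. a t) = a q * (\<Sum>t\<in>T. b0 t)"
      unfolding sum_distrib_left by (rule sum.cong) (use * in auto)
    then show False using q a(2) sb0 by simp
  qed
  define b where "b t = b0 t / b0 p" for t
  have Kb: "K b" using K_comb[OF Kb0 Kb0, of "1 / b0 p" 0] by (simp add: b_def[abs_def])
  have sb: "(\<Sum>t\<in>T. b t) = 0" using sb0 by (simp add: b_def flip: sum_divide_distrib)
  have bp1: "b p = 1" using bp by (simp add: b_def)
  define Neg where "Neg = {t\<in>T. b t < 0}"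
  have finNeg: "finite Neg" using assms(1) by (simp add: Neg_def)
  have "Neg \<noteq> {}"
  proof
    assume "Neg = {}"
    then have "0 \<le> b t" if "t \<in> T" for t using that by (force simp: Neg_def)
    then have "0 < (\<Sum>t\<in>T. b t)"
      by (intro sum_pos2[of _ p]) (use assms(1) p bp1 in auto)
    then show False using sb by simp
  qed
  define f where "f t = a t / (- b t)" for t
  \<comment> \<open>Starting at the end \<open>a\<close> and moving so that the coefficient at
    \<open>p\<close> grows, \<open>s0\<close> is the first parameter at which another coefficient
    reaches zero.\<close>
  define s0 where "s0 = Min (f ` Neg)"
  have "s0 \<in> f ` Neg" unfolding s0_def by (rule Min_in) (use finNeg \<open>Neg \<noteq> {}\<close> in auto)
  then obtain q where q: "q \<in> Neg" "f q = s0" by auto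
  have s0_le: "s0 \<le> f t" if "t \<in> Neg" for t using that finNeg by (simp add: s0_def)
  have qp: "q \<noteq> p" "q \<in> T" using q bp1 by (auto simp: Neg_def)
  have "0 < f q" unfolding f_def
    by (rule divide_pos_pos) (use q a(4)[of q] qp in \<open>auto simp: Neg_def\<close>)
  then have s0pos: "0 < s0" using q by simp
  define e where "e t = a t + s0 * b t" for t
  have Ke: "K e" using K_comb[OF a(1) Kb, of 1 s0] by (simp add: e_def[abs_def])
  have eq0: "e q = 0" using q by (auto simp: e_def f_def Neg_def field_simps)
  have ennn: "0 \<le> e t" if t: "t \<in> T" for t
  proof (cases "b t < 0")
    case True
    then have "s0 \<le> a t / (- b t)" using s0_le[of t] t by (simp add: Neg_def f_def)
    then show ?thesis using True by (simp add: e_def field_simps)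
  next
    case False
    moreover have "0 \<le> a t" using a(3) a(4)[of t] t by (cases "t = p") auto
    ultimately show ?thesis using s0pos by (simp add: e_def)
  qed
  have "balanced d (T - {q}) V"
    unfolding balanced_def
  proof (intro exI[of _ e] conjI)
    show "\<forall>t\<in>T - {q}. 0 \<le> e t" using ennn by simp
    show "\<exists>t\<in>T - {q}. 0 < e t" using p qp s0pos bp1 a(3) by (intro bexI[of _ p]) (auto simp: e_def)
    have "(\<Sum>u\<in>T - {q}. e u * V u r) = (\<Sum>u\<in>T. e u * V u r)" for r
      by (rule sum.mono_neutral_left) (use assms eq0 in auto)
    then show "\<forall>r<d. (\<Sum>t\<in>T - {q}. e t * V t r) = 0" using Ke by (simp add: K_def)
  qed
  \<comment> \<open>A third balanced facet \<open>t\<close> would be another point of the line, with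
    parameter \<open>s = a' p\<close>. Its coefficient at \<open>t\<close> vanishes, so
    \<open>s0 \<le> s\<close>; its coefficient at \<open>q\<close> is positive, so
    \<open>s \<le> s0\<close>; then the coefficient at \<open>q\<close> vanishes too, a
    contradiction.\<close>
  moreover have "t = p \<or> t = q" if t: "t \<in> T" "balanced d (T - {t}) V" for t
  proof (rule ccontr)
    assume nt: "\<not> (t = p \<or> t = q)"
    obtain a' where a': "K a'" "(\<Sum>u\<in>T. a' u) = 1" "a' t = 0" "\<And>u. u \<in> T - {t} \<Longrightarrow> 0 < a' u"
      using bal[OF t] by blast
    define s where "s = a' p"
    have spos: "0 < s" using a'(4)[of p] p nt by (auto simp: s_def)
    define g where "g u = 1 * a' u + (-1) * (1 * a u + s * b u)" for u
    have Kg: "K g" using K_comb[OF a'(1) K_comb[OF a(1) Kb, of 1 s], of 1 "-1"] by (simp only: g_def[abs_def])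
    have gp: "g p = 0" by (simp add: g_def a(3) bp1 s_def)
    have sg: "(\<Sum>u\<in>T. g u) = 0"
      by (simp add: g_def sum_subtractf sum.distrib sum_negf a' a sb flip: sum_distrib_left)
    have g0: "g t = 0"
    proof -
      have "\<forall>u\<in>T. a t * g u + (- g t) * a u = 0"
        using two[OF K_comb[OF Kg a(1)], of p t "a t" "- g t"] p t nt gp a(3)
        by (metis (no_types, lifting) add.right_inverse mult.commute mult_minus_left mult_zero_right)
      then have *: "a t * g u = g t * a u" if "u \<in> T" for u using that by auto
      have "a t * (\<Sum>u\<in>T. g u) = g t * (\<Sum>u\<in>T. a u)"
        unfolding sum_distrib_left by (rule sum.cong) (use * in auto)
      then show ?thesis using sg a(2) by simp
    qed
    have g0': "\<forall>u\<in>T. g u = 0" using two[OF Kg p(1) t(1)] nt gp g0 by auto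
    then have a'eq: "a' u = a u + s * b u" if "u \<in> T" for u using that by (auto simp: g_def)
    have "a t + s * b t = 0" using a'eq[OF t(1)] a'(3) by simp
    moreover have "0 < a t" using a(4)[of t] t nt by auto
    ultimately have bt: "b t < 0" using spos by (smt (verit) mult_nonneg_nonneg)
    then have "s = f t" using \<open>a t + s * b t = 0\<close> by (simp add: f_def field_simps)
    then have "s0 \<le> s" using s0_le[of t] bt t by (simp add: Neg_def)
    moreover have "s \<le> s0"
    proof -
      have "0 < a q + s * b q" using a'(4)[of q] a'eq[of q] qp nt by auto
      then have "s * (- b q) < a q" by simp
      moreover have "0 < - b q" using q by (simp add: Neg_def)
      ultimately have "s < f q" unfolding f_def by (metis pos_less_divide_eq)
      then show ?thesis using q by simp
    qed
    ultimately have "s = s0" by simp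
    then have "a' q = 0" using a'eq[of q] qp eq0 by (simp add: e_def)
    then show False using a'(4)[of q] qp nt by auto
  qed
  ultimately have "{t\<in>T. balanced d (T - {t}) V} = {p, q}" using p qp by auto
  then show ?thesis using qp by simp
qed

text \<open>If \<open>s\<close> and \<open>t\<close> have the same key, the facets without
  \<open>s\<close> and without \<open>t\<close> consist of the same vectors, while every other facet
  has at most \<open>d\<close> different vectors, which are independent. So repeated vertices of a
  simplex do not disturb the parity.\<close>

lemma facets_even:
  fixes V :: "'t \<Rightarrow> nat \<Rightarrow> real"
  assumes "finite T" "card T = d + 2" "general_position d T \<kappa> V"
  shows "even (card {t\<in>T. balanced d (T - {t}) V})"
proof (cases "inj_on \<kappa> T")
  case True
  then have "indep d J V" if "J \<subseteq> T" "card J \<le> d" for J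
    using assms(3) that inj_on_subset unfolding general_position_def by blast
  then show ?thesis using facets_even_inj[OF assms(1,2)] by blast
next
  case False
  then obtain s t where st: "s \<in> T" "t \<in> T" "s \<noteq> t" "\<kappa> s = \<kappa> t" by (auto simp: inj_on_def)
  have Vst: "V s = V t" using assms(3) st unfolding general_position_def by blast
  have "\<not> balanced d (T - {u}) V" if u: "u \<in> T" "u \<noteq> s" "u \<noteq> t" for u
  proof
    assume "balanced d (T - {u}) V"
    then obtain J where J: "J \<subseteq> T - {u}" "inj_on \<kappa> J" "\<kappa> ` J = \<kappa> ` (T - {u})" "balanced d J V"
      using balanced_collapse[of "T - {u}" \<kappa> V d] assms unfolding general_position_def by blast
    have "\<kappa> ` (T - {u}) = \<kappa> ` (T - {u,s})" using st u by auto
    then have "card J = card (\<kappa> ` (T - {u,s}))" using J card_image by metis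
    also have "\<dots> \<le> card (T - {u,s})" using assms(1) by (simp add: card_image_le)
    also have "\<dots> = d" using assms st u by (simp add: card_Diff_subset)
    finally have "indep d J V" using assms(3) J unfolding general_position_def by blast
    then show False using J not_balanced_indep by blast
  qed
  moreover have "balanced d (T - {s}) V = balanced d (T - {t}) V"
  proof -
    define h where "h = (\<lambda>u. if u = t then s else u)"
    have im: "h ` (T - {s}) = T - {t}" and inj: "inj_on h (T - {s})"
      using st by (auto simp: h_def inj_on_def image_def)
    have "V (h u) = V u" for u using Vst by (simp add: h_def)
    then show ?thesis using balanced_reindex[OF inj, of d V] by (simp add: im)
  qed
  ultimately have "{u\<in>T. balanced d (T - {u}) V} = (if balanced d (T - {s}) V then {s,t} else {})"
    using st by auto
  then show ?thesis using st by simp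
qed

text \<open>The point is sought on a moment curve that starts at \<open>u\<close>. Each of the
  finitely many hyperplanes meets this curve in the roots of a nonzero polynomial, so only finitely
  many parameters are forbidden.\<close>

lemma separating_polynomial_point:
  fixes G :: "(nat \<Rightarrow> real) set"
  assumes "finite G" "\<And>h. h \<in> G \<Longrightarrow> \<exists>r<d. h r \<noteq> 0" "0 < \<eta>"
  obtains v where "\<And>r. \<bar>v r - u r\<bar> < \<eta>" "\<And>h. h \<in> G \<Longrightarrow> (\<Sum>r<d. h r * v r) \<noteq> 0"
proof -
  define P where "P h = [:(\<Sum>r<d. h r * u r):] + (\<Sum>r<d. monom (h r * (\<eta> / 2)) (Suc r))" for h
  have "P h \<noteq> 0" if h: "h \<in> G" for h
  proof -
    obtain r where r: "r < d" "h r \<noteq> 0" using assms(2)[OF h] by blast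
    have "coeff (P h) (Suc r) = (\<Sum>s<d. if s = r then h s * (\<eta> / 2) else 0)"
      by (simp add: P_def coeff_sum)
    also have "\<dots> = h r * (\<eta> / 2)" using r by simp
    finally show ?thesis using r assms(3) by auto
  qed
  then have "finite (\<Union>h\<in>G. {s. poly (P h) s = 0})"
    using assms(1) poly_roots_finite by blast
  then have "infinite ({0<..<1::real} - (\<Union>h\<in>G. {s. poly (P h) s = 0}))"
    by (simp add: Diff_infinite_finite infinite_Ioo)
  then have "{0<..<1::real} - (\<Union>h\<in>G. {s. poly (P h) s = 0}) \<noteq> {}"
    by (rule infinite_imp_nonempty)
  then obtain s where s: "s \<in> {0<..<1}" "\<And>h. h \<in> G \<Longrightarrow> poly (P h) s \<noteq> 0" by blast
  define v where "v r = u r + \<eta> / 2 * s ^ Suc r" for r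
  show ?thesis
  proof
    fix r
    have "0 \<le> s ^ Suc r" "s ^ Suc r \<le> 1" using s by (simp_all add: power_le_one del: power_Suc)
    then have "0 \<le> v r - u r" "v r - u r \<le> \<eta> / 2 * 1" unfolding v_def
      using assms(3) mult_left_mono[of "s ^ Suc r" 1 "\<eta> / 2"] by (simp_all del: power_Suc)
    then show "\<bar>v r - u r\<bar> < \<eta>" using assms(3) by simp
  next
    fix h assume "h \<in> G"
    have "(\<Sum>r<d. h r * v r) = poly (P h) s"
      by (simp add: P_def v_def poly_sum poly_monom algebra_simps sum.distrib del: power_Suc)
    then show "(\<Sum>r<d. h r * v r) \<noteq> 0" using s \<open>h \<in> G\<close> by simp
  qed
qed

text \<open>The vectors are chosen one after another, each off finitely many hyperplanes: one
  through every set of fewer than \<open>d\<close> earlier vectors with permuted rows. The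
  permutations vary from vector to vector, because different labellings of the diagrams read the
  rows of the stored matrices in different orders.\<close>

lemma generic_perturbation:
  fixes u :: "'s \<Rightarrow> nat \<Rightarrow> real"
  assumes "finite S" "0 < \<eta>"
  obtains u' where "\<And>x r. \<bar>u' x r - u x r\<bar> < \<eta>"
    "\<And>J \<rho>. J \<subseteq> S \<Longrightarrow> card J \<le> d \<Longrightarrow> (\<And>x. x \<in> J \<Longrightarrow> \<rho> x permutes {..<d}) \<Longrightarrow>
       indep d J (\<lambda>x r. u' x (\<rho> x r))"
proof -
  have "\<exists>u'. (\<forall>x r. \<bar>u' x r - u x r\<bar> < \<eta>) \<and>
    (\<forall>J \<rho>. J \<subseteq> S \<longrightarrow> card J \<le> d \<longrightarrow> (\<forall>x\<in>J. \<rho> x permutes {..<d}) \<longrightarrow>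
       indep d J (\<lambda>x r. u' x (\<rho> x r)))"
    using assms(1)
  proof (induction S)
    case empty
    show ?case using assms(2) by (intro exI[of _ u]) (auto simp: indep_def)
  next
    case (insert x0 S)
    then obtain u1 where u1: "\<And>x r. \<bar>u1 x r - u x r\<bar> < \<eta>"
      "\<And>J \<rho>. J \<subseteq> S \<Longrightarrow> card J \<le> d \<Longrightarrow> (\<And>x. x \<in> J \<Longrightarrow> \<rho> x permutes {..<d}) \<Longrightarrow>
         indep d J (\<lambda>x r. u1 x (\<rho> x r))" by metis
    define Perm where "Perm = {p. p permutes {..<d}}"
    have finP: "finite Perm" by (simp add: Perm_def finite_permutations)
    define I where "I = (SIGMA J:{J. J \<subseteq> S \<and> card J < d}. (PiE J (\<lambda>_. Perm)) \<times> Perm)"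
    have finI: "finite I" unfolding I_def
    proof (rule finite_SigmaI)
      show "finite {J. J \<subseteq> S \<and> card J < d}" using insert.hyps by simp
      fix J assume "J \<in> {J. J \<subseteq> S \<and> card J < d}"
      then have "finite J" using insert.hyps finite_subset by blast
      then show "finite (PiE J (\<lambda>_. Perm) \<times> Perm)" using finP by (simp add: finite_PiE)
    qed
    have ex: "\<exists>h. (\<forall>x\<in>J. (\<Sum>r<d. h r * u1 x (\<rho> x r)) = 0) \<and> (\<exists>r<d. h r \<noteq> 0)"
      if fJ: "finite J" and cJ: "card J < d" for J :: "'s set" and \<rho> :: "'s \<Rightarrow> nat \<Rightarrow> nat"
    proof -
      obtain e where e: "bij_betw e {..<card J} J"
        using ex_bij_betw_nat_finite[OF fJ] by (metis atLeast0LessThan)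
      have "card J < card {..<d}" using cJ by simp
      then obtain h where h: "\<And>i. i < card J \<Longrightarrow> (\<Sum>r<d. h r * u1 (e i) (\<rho> (e i) r)) = 0"
          "\<exists>r\<in>{..<d}. h r \<noteq> 0"
        using homogeneous_system_solution[of "{..<d}" "card J" "\<lambda>r i. u1 (e i) (\<rho> (e i) r)"]
        by blast
      have "(\<Sum>r<d. h r * u1 x (\<rho> x r)) = 0" if x: "x \<in> J" for x
      proof -
        obtain i where "i < card J" "x = e i" using e x by (auto simp: bij_betw_def)
        then show ?thesis using h(1) by simp
      qed
      then show ?thesis using h(2) by auto
    qed
    define H where "H J \<rho> = (SOME h. (\<forall>x\<in>J. (\<Sum>r<d. h r * u1 x (\<rho> x r)) = 0) \<and> (\<exists>r<d. h r \<noteq> 0))"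
      for J :: "'s set" and \<rho> :: "'s \<Rightarrow> nat \<Rightarrow> nat"
    have H: "x \<in> J \<Longrightarrow> (\<Sum>r<d. H J \<rho> r * u1 x (\<rho> x r)) = 0" "\<exists>r<d. H J \<rho> r \<noteq> 0"
      if "finite J" "card J < d" for J :: "'s set" and \<rho> :: "'s \<Rightarrow> nat \<Rightarrow> nat" and x
      using someI_ex[OF ex[OF that, of \<rho>]] unfolding H_def by blast+
    \<comment> \<open>The row permutation \<open>p\<close> of the new vector is moved over to the
      normal vector of the hyperplane, so that all conditions concern the one unpermuted point
      \<open>v\<close>.\<close>
    define G where "G = (\<lambda>(J, \<rho>, p). \<lambda>r. H J \<rho> (inv_into UNIV p r)) ` I"
    have "finite G" using finI by (simp add: G_def)
    moreover have "\<exists>r<d. g r \<noteq> 0" if g: "g \<in> G" for g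
    proof -
      obtain J \<rho> p where g: "J \<subseteq> S" "card J < d" "p \<in> Perm" "g = (\<lambda>r. H J \<rho> (inv_into UNIV p r))"
        using g by (auto simp: G_def I_def)
      have "finite J" using g insert.hyps finite_subset by blast
      then obtain r where r: "r < d" "H J \<rho> r \<noteq> 0" using H(2) g by blast
      have p: "p permutes {..<d}" using g by (simp add: Perm_def)
      then have "p r < d" using r permutes_in_image by fastforce
      moreover have "g (p r) \<noteq> 0" using r p g(4) by (simp add: permutes_inverses)
      ultimately show ?thesis by blast
    qed
    ultimately obtain v where v: "\<And>r. \<bar>v r - u x0 r\<bar> < \<eta>" "\<And>g. g \<in> G \<Longrightarrow> (\<Sum>r<d. g r * v r) \<noteq> 0"
      using separating_polynomial_point[of G d \<eta> "u x0"] assms(2) by blast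
    define u' where "u' = u1(x0 := v)"
    show ?case
    proof (intro exI[of _ u'] conjI allI impI)
      fix x r show "\<bar>u' x r - u x r\<bar> < \<eta>" using u1(1) v(1) by (simp add: u'_def)
    next
      fix J and \<rho> :: "'s \<Rightarrow> nat \<Rightarrow> nat"
      assume J: "J \<subseteq> insert x0 S" and cJ: "card J \<le> d" and perm: "\<forall>x\<in>J. \<rho> x permutes {..<d}"
      have finJ: "finite J" using J insert.hyps finite_subset by blast
      define J0 where "J0 = J - {x0}"
      have J0: "J0 \<subseteq> S" "finite J0" using J finJ by (auto simp: J0_def)
      have eq: "(\<lambda>r. u' x (\<rho> x r)) = (\<lambda>r. u1 x (\<rho> x r))" if "x \<in> J0" for x
        using that by (auto simp: u'_def J0_def)
      have cJ0: "card J0 \<le> d" using cJ card_mono[OF finJ, of J0] by (auto simp: J0_def)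
      have ind0: "indep d J0 (\<lambda>x r. u1 x (\<rho> x r))"
        by (rule u1(2)) (use J0 cJ0 perm in \<open>auto simp: J0_def\<close>)
      show "indep d J (\<lambda>x r. u' x (\<rho> x r))"
      proof (cases "x0 \<in> J")
        case False
        then have "J0 = J" by (auto simp: J0_def)
        moreover have "indep d J0 (\<lambda>x r. u' x (\<rho> x r)) = indep d J0 (\<lambda>x r. u1 x (\<rho> x r))"
          by (rule indep_cong) (auto simp: u'_def J0_def)
        ultimately show ?thesis using ind0 by simp
      next
        case True
        define p where "p = \<rho> x0"
        have p: "p permutes {..<d}" using True perm by (simp add: p_def)
        have cd: "card J0 < d" using card_Diff1_less[OF finJ True] cJ by (simp add: J0_def)
        define \<rho>' where "\<rho>' = restrict \<rho> J0"
        have "(J0, \<rho>', p) \<in> I" using J0 cd perm p by (auto simp: I_def \<rho>'_def Perm_def J0_def)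
        then have "(\<lambda>r. H J0 \<rho>' (inv_into UNIV p r)) \<in> G"
          unfolding G_def by (rule rev_image_eqI) simp
        then have g: "(\<Sum>r<d. H J0 \<rho>' (inv_into UNIV p r) * v r) \<noteq> 0" by (rule v(2))
        have "(\<Sum>r<d. H J0 \<rho>' (inv_into UNIV p r) * v r) = (\<Sum>r<d. H J0 \<rho>' r * v (p r))"
          by (rule sum.reindex_bij_witness[of _ p "inv_into UNIV p"])
             (use permutes_in_image[OF permutes_inv[OF p]] permutes_in_image[OF p] in
                \<open>auto simp: permutes_inverses[OF p]\<close>)
        then have g': "(\<Sum>r<d. H J0 \<rho>' r * v (p r)) \<noteq> 0" using g by simp
        show ?thesis
          unfolding indep_def
        proof (intro allI impI)
          fix c assume c: "\<forall>r<d. (\<Sum>x\<in>J. c x * u' x (\<rho> x r)) = 0"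
          have split: "(\<Sum>x\<in>J. c x * u' x (\<rho> x r)) = c x0 * v (p r) + (\<Sum>x\<in>J0. c x * u1 x (\<rho> x r))" for r
          proof -
            have "(\<Sum>x\<in>J0. c x * u' x (\<rho> x r)) = (\<Sum>x\<in>J0. c x * u1 x (\<rho> x r))"
              by (rule sum.cong) (auto simp: u'_def J0_def)
            then show ?thesis using True finJ by (simp add: sum.remove J0_def u'_def p_def)
          qed
          have "0 = (\<Sum>r<d. H J0 \<rho>' r * (c x0 * v (p r) + (\<Sum>x\<in>J0. c x * u1 x (\<rho> x r))))"
          proof (rule sum.neutral[symmetric], intro ballI)
            fix r assume "r \<in> {..<d}"
            then have "c x0 * v (p r) + (\<Sum>x\<in>J0. c x * u1 x (\<rho> x r)) = 0"
              using c split[of r] by simp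
            then show "H J0 \<rho>' r * (c x0 * v (p r) + (\<Sum>x\<in>J0. c x * u1 x (\<rho> x r))) = 0" by simp
          qed
          also have "\<dots> = c x0 * (\<Sum>r<d. H J0 \<rho>' r * v (p r)) +
              (\<Sum>x\<in>J0. c x * (\<Sum>r<d. H J0 \<rho>' r * u1 x (\<rho> x r)))"
            by (simp only: distrib_left sum.distrib sum_distrib_left sum.swap[of _ "{..<d}" J0]
                mult.left_commute)
          also have "(\<Sum>x\<in>J0. c x * (\<Sum>r<d. H J0 \<rho>' r * u1 x (\<rho> x r))) = 0"
          proof (rule sum.neutral, intro ballI)
            fix x assume x: "x \<in> J0"
            then show "c x * (\<Sum>r<d. H J0 \<rho>' r * u1 x (\<rho> x r)) = 0"
              using H(1)[OF J0(2) cd x, of \<rho>'] by (simp add: \<rho>'_def)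
          qed
          finally have cx0: "c x0 = 0" using g' by simp
          then have "\<forall>r<d. (\<Sum>x\<in>J0. c x * u1 x (\<rho> x r)) = 0" using c split by simp
          then have "\<forall>x\<in>J0. c x = 0" using ind0 unfolding indep_def by blast
          then show "\<forall>x\<in>J. c x = 0" using cx0 by (auto simp: J0_def)
        qed
      qed
    qed
  qed
  then obtain u' where u': "\<forall>x r. \<bar>u' x r - u x r\<bar> < \<eta>"
    "\<forall>J \<rho>. J \<subseteq> S \<longrightarrow> card J \<le> d \<longrightarrow> (\<forall>x\<in>J. \<rho> x permutes {..<d}) \<longrightarrow>
       indep d J (\<lambda>x r. u' x (\<rho> x r))"
    by (elim exE conjE)
  show ?thesis
  proof (rule that)
    show "\<bar>u' x r - u x r\<bar> < \<eta>" for x r using u'(1) by blast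
    show "indep d J (\<lambda>x r. u' x (\<rho> x r))"
      if "J \<subseteq> S" "card J \<le> d" "\<And>x. x \<in> J \<Longrightarrow> \<rho> x permutes {..<d}" for J \<rho>
      using u'(2)[rule_format, OF that] .
  qed
qed

text \<open>Independent vectors admit a linear functional with prescribed values; its values on the
  unit vectors are the coefficients \<open>y\<close>.\<close>

lemma indep_dual_functional:
  fixes T :: "'a set" and V :: "'a \<Rightarrow> nat \<Rightarrow> real" and \<epsilon> :: "'a \<Rightarrow> real"
  assumes "finite T" "indep d T V"
  obtains y where "\<And>t. t \<in> T \<Longrightarrow> (\<Sum>r<d. y r * V t r) = \<epsilon> t"
proof -
  \<comment> \<open>Cutting off the coordinates from \<open>d\<close> on turns every vector into a
    finite combination of unit vectors and keeps the relations in the first \<open>d\<close>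
    coordinates.\<close>
  define W :: "'a \<Rightarrow> nat \<Rightarrow> real" where "W t r = (if r < d then V t r else 0)" for t r
  have W_sum: "(\<Sum>t\<in>A. c t *\<^sub>R W t) r = (if r < d then \<Sum>t\<in>A. c t * V t r else 0)" for A c r
    by (induction A rule: infinite_finite_induct) (auto simp: W_def scaleR_fun_def)
  have inj: "inj_on W T"
  proof (rule inj_onI, rule ccontr)
    fix s t assume st: "s \<in> T" "t \<in> T" "W s = W t" "s \<noteq> t"
    define c :: "'a \<Rightarrow> real" where "c = (\<lambda>u. if u = s then 1 else if u = t then -1 else 0)"
    have "(\<Sum>u\<in>T. c u * V u r) = (\<Sum>u\<in>{s,t}. c u * V u r)" for r
      by (rule sum.mono_neutral_right) (use st assms(1) in \<open>auto simp: c_def\<close>)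
    also have "\<dots> r = V s r - V t r" for r using st by (simp add: c_def)
    also have "V s r - V t r = 0" if "r < d" for r
      using that fun_cong[OF st(3), of r] by (simp add: W_def)
    finally have "\<forall>r<d. (\<Sum>u\<in>T. c u * V u r) = 0" by simp
    then have "c s = 0" using indepD[OF assms(2), of c s] st by blast
    then show False by (simp add: c_def)
  qed
  have "independent (W ` T)"
  proof (rule independent_if_scalars_zero)
    fix c v assume c: "(\<Sum>v\<in>W ` T. c v *\<^sub>R v) = 0" and v: "v \<in> W ` T"
    have "(\<Sum>t\<in>T. c (W t) *\<^sub>R W t) = 0" using c inj by (simp add: sum.reindex)
    then have "(\<Sum>t\<in>T. c (W t) *\<^sub>R W t) r = 0" for r by simp
    then have "(\<Sum>t\<in>T. c (W t) * V t r) = 0" if "r < d" for r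
      using that unfolding W_sum by (metis (full_types))
    then have "c (W t) = 0" if "t \<in> T" for t
      using indepD[OF assms(2), of "\<lambda>t. c (W t)" t] that by simp
    then show "c v = 0" using v by auto
  qed (use assms(1) in simp)
  then obtain g :: "(nat \<Rightarrow> real) \<Rightarrow> real" where g: "linear g" "\<And>v. v \<in> W ` T \<Longrightarrow> g v = \<epsilon> (inv_into T W v)"
    using linear_independent_extend[of "W ` T" "\<lambda>v. \<epsilon> (inv_into T W v)"] by blast
  define E :: "nat \<Rightarrow> nat \<Rightarrow> real" where "E r = (\<lambda>s. if s = r then 1 else 0)" for r
  show ?thesis
  proof (rule that)
    fix t assume t: "t \<in> T"
    have E_sum: "(\<Sum>r\<in>A. V t r *\<^sub>R E r) s = (\<Sum>r\<in>A. if r = s then V t r else 0)" for A s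
      by (induction A rule: infinite_finite_induct) (auto simp: E_def scaleR_fun_def)
    have "W t = (\<Sum>r<d. V t r *\<^sub>R E r)"
    proof
      fix s show "W t s = (\<Sum>r<d. V t r *\<^sub>R E r) s"
        unfolding E_sum by (simp add: W_def)
    qed
    then have "g (W t) = (\<Sum>r<d. V t r *\<^sub>R g (E r))"
      using g(1) by (simp add: linear_sum linear_scale)
    moreover have "g (W t) = \<epsilon> t" using g(2) t inj by simp
    ultimately show "(\<Sum>r<d. g (E r) * V t r) = \<epsilon> t" by (simp add: mult.commute)
  qed
qed

section \<open>The staircase obstruction cocycle\<close>

lemma sum_bit_involution:
  fixes f :: "'t \<Rightarrow> bit"
  assumes "finite S" "\<And>x. x \<in> S \<Longrightarrow> \<phi> x \<in> S" "\<And>x. x \<in> S \<Longrightarrow> \<phi> (\<phi> x) = x"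
    "\<And>x. x \<in> S \<Longrightarrow> \<phi> x \<noteq> x" "\<And>x. x \<in> S \<Longrightarrow> f (\<phi> x) = f x"
  shows "sum f S = 0"
  using assms
proof (induction "card S" arbitrary: S rule: less_induct)
  case less
  show ?case
  proof (cases "S = {}")
    case False
    then obtain x where x: "x \<in> S" by blast
    define R where "R = S - {x, \<phi> x}"
    have "card R < card S"
      unfolding R_def by (rule psubset_card_mono) (use less.prems(1) x in auto)
    moreover have "\<phi> y \<in> R" if y: "y \<in> R" for y
    proof -
      have "\<phi> y \<noteq> x" "\<phi> y \<noteq> \<phi> x" using y less.prems(3) x unfolding R_def by (metis DiffD1 DiffD2 insertCI)+
      then show ?thesis using less.prems(2) y by (simp add: R_def)
    qed
    ultimately have "sum f R = 0"
      using less.hyps[of R] less.prems by (simp add: R_def)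
    moreover have "sum f S = sum f {x, \<phi> x} + sum f R"
      unfolding R_def by (subst sum.subset_diff[of "{x, \<phi> x}"]) (use less.prems x in \<open>auto simp: add.commute\<close>)
    moreover have "sum f {x, \<phi> x} = 0" using less.prems x by (auto simp: eq_commute[of x])
    ultimately show ?thesis by simp
  qed simp
qed

lemma of_nat_even_bit: "even n \<Longrightarrow> (of_nat n :: bit) = 0"
  by (auto elim!: evenE)

lemma indep_scale:
  assumes "indep d J V" "\<And>t. t \<in> J \<Longrightarrow> s t \<noteq> 0"
  shows "indep d J (\<lambda>t r. s t * V t r)"
  unfolding indep_def
proof (intro allI impI ballI)
  fix c t assume c: "\<forall>r<d. (\<Sum>t\<in>J. c t * (s t * V t r)) = 0" and t: "t \<in> J"
  have "c t * s t = 0"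
    by (rule indepD[OF assms(1)]) (use c t in \<open>auto simp: mult.assoc\<close>)
  then show "c t = 0" using assms(2) t by simp
qed

text \<open>A path \<open>p\<close> encodes a top-dimensional simplex of the staircase triangulation of
  \<open>\<Delta>\<^sup>k \<times> \<Delta>\<^sup>m\<^sup>-\<^sup>1\<close>: in column \<open>i\<close> it visits the rows \<open>p i, \<dots>, p (i + 1)\<close>.\<close>

definition paths :: "nat \<Rightarrow> nat \<Rightarrow> (nat \<Rightarrow> nat) set"
  where "paths m k =
    {p \<in> extensional {..m}. p 0 = 0 \<and> p m = k \<and> (\<forall>i<m. p i \<le> p (Suc i))}"

definition cells :: "nat \<Rightarrow> (nat \<Rightarrow> nat) \<Rightarrow> (nat \<times> nat) set"
  where "cells m p = (SIGMA i:{..<m}. {p i..p (Suc i)})"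

lemma paths_mono:
  assumes "p \<in> paths m k" "i \<le> j" "j \<le> m"
  shows "p i \<le> p j"
  using assms(2,3)
proof (induction rule: dec_induct)
  case (step j)
  then have "p i \<le> p j" "p j \<le> p (Suc j)" using assms(1) by (auto simp: paths_def)
  then show ?case by simp
qed simp

lemma paths_le: "p \<in> paths m k \<Longrightarrow> i \<le> m \<Longrightarrow> p i \<le> k"
  using paths_mono[of p m k i m] by (simp add: paths_def)

lemma finite_paths: "finite (paths m k)"
proof (rule finite_subset)
  show "paths m k \<subseteq> PiE {..m} (\<lambda>_. {..k})"
    using paths_le by (auto simp: PiE_def) (auto simp: paths_def)
qed (simp add: finite_PiE)

lemma finite_cells: "finite (cells m p)"
  by (simp add: cells_def)

lemma cells_subset:
  assumes "p \<in> paths m k"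
  shows "cells m p \<subseteq> {..<m} \<times> {..k}"
proof -
  have "p (Suc i) \<le> k" if "i < m" for i using paths_le[OF assms, of "Suc i"] that by simp
  then show ?thesis unfolding cells_def by (auto intro: order_trans)
qed

lemma card_cells:
  assumes "p \<in> paths m k"
  shows "card (cells m p) = m + k"
proof -
  have "card (cells m p) = (\<Sum>i<m. Suc (p (Suc i)) - p i)"
    by (simp add: cells_def)
  also have "int \<dots> = (\<Sum>i<m. 1 + (int (p (Suc i)) - int (p i)))"
    unfolding of_nat_sum by (rule sum.cong) (use assms in \<open>auto simp: paths_def of_nat_diff le_SucI\<close>)
  also have "\<dots> = int m + (int (p m) - int (p 0))"
    using sum_lessThan_telescope[of "\<lambda>i. int (p i)" m] by (simp add: sum.distrib)
  finally show ?thesis using assms by (simp add: paths_def)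
qed

text \<open>For a fixed sign pattern the vectors with absolute coordinate sum \<open>1\<close> form
  a simplex, with the columns as vertices. Kernel vectors come in opposite pairs, and fixing the
  last sign counts one vector of each pair.\<close>

definition signs :: "nat \<Rightarrow> (nat \<Rightarrow> real) set"
  where "signs m = {\<epsilon> \<in> PiE {..<m} (\<lambda>_. {1, -1}). \<epsilon> (m - 1) = 1}"

lemma finite_signs: "finite (signs m)"
  by (rule finite_subset[of _ "PiE {..<m} (\<lambda>_. {1, -1})"]) (auto simp: signs_def finite_PiE)

lemma signs_cases: "\<epsilon> \<in> signs m \<Longrightarrow> i < m \<Longrightarrow> \<epsilon> i = 1 \<or> \<epsilon> i = -1"
  by (auto simp: signs_def PiE_def Pi_def)

definition signed :: "(nat \<Rightarrow> real) \<Rightarrow> (nat \<Rightarrow> nat \<Rightarrow> nat \<Rightarrow> real) \<Rightarrow> nat \<times> nat \<Rightarrow> nat \<Rightarrow> real"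
  where "signed \<epsilon> M = (\<lambda>(i, j) r. \<epsilon> i * M j i r)"

text \<open>On the staircase triangulation the bilinear map that sends a point of the base simplex
  and a vector of coefficients to a combination of columns becomes piecewise linear. Its zeros are
  counted cell set by cell set, for all sign patterns.\<close>

definition sign_count :: "nat \<Rightarrow> nat \<Rightarrow> (nat \<Rightarrow> nat \<Rightarrow> nat \<Rightarrow> real) \<Rightarrow> (nat \<times> nat) set \<Rightarrow> bit"
  where "sign_count d m M C = (\<Sum>\<epsilon>\<in>signs m. of_bool (balanced d C (signed \<epsilon> M)))"

text \<open>\<open>M j i\<close> is column \<open>i\<close> of a \<open>d \<times> m\<close> matrix attached to vertex \<open>j\<close> of a \<open>k\<close>-simplex, with
  \<open>d = m + k - 1\<close>. The number counts mod 2 the points of the simplex over which the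
  (piecewise linear interpolation of the) matrix has a kernel, so it is an obstruction
  cocycle for the injectivity of these matrices.\<close>

definition obstruction :: "nat \<Rightarrow> nat \<Rightarrow> nat \<Rightarrow> (nat \<Rightarrow> nat \<Rightarrow> nat \<Rightarrow> real) \<Rightarrow> bit"
  where "obstruction d m k M = (\<Sum>p\<in>paths m k. sign_count d m M (cells m p))"

lemma sign_count_cong:
  assumes "\<And>i j r. (i, j) \<in> C \<Longrightarrow> r < d \<Longrightarrow> M j i r = M' j i r"
  shows "sign_count d m M C = sign_count d m M' C"
proof -
  have "balanced d C (signed \<epsilon> M) = balanced d C (signed \<epsilon> M')" for \<epsilon>
    by (rule balanced_cong) (use assms in \<open>auto simp: signed_def\<close>)
  then show ?thesis by (simp add: sign_count_def)
qed

lemma obstruction_cong: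
  assumes "\<And>i j r. i < m \<Longrightarrow> j \<le> k \<Longrightarrow> r < d \<Longrightarrow> M j i r = M' j i r"
  shows "obstruction d m k M = obstruction d m k M'"
  unfolding obstruction_def
proof (rule sum.cong[OF refl])
  fix p assume "p \<in> paths m k"
  then have "cells m p \<subseteq> {..<m} \<times> {..k}" by (rule cells_subset)
  then show "sign_count d m M (cells m p) = sign_count d m M' (cells m p)"
    by (intro sign_count_cong) (use assms in auto)
qed

lemma obstruction_row_permute:
  assumes "\<rho> permutes {..<d}"
  shows "obstruction d m k (\<lambda>j i r. M j i (\<rho> r)) = obstruction d m k M"
proof -
  have "signed \<epsilon> (\<lambda>j i r. M j i (\<rho> r)) = (\<lambda>t r. signed \<epsilon> M t (\<rho> r))" for \<epsilon>
    by (auto simp: signed_def fun_eq_iff)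
  then show ?thesis
    by (simp add: obstruction_def sign_count_def balanced_row_permute[OF assms])
qed

text \<open>Changing the sign at the absent column changes none of the vectors. If the last column
  is absent, whose sign is fixed, all other signs are reversed instead, which negates all vectors.
  In both cases the sign patterns pair off.\<close>

lemma sign_count_missing_column:
  assumes "i < m" "2 \<le> m" "\<And>l j. (l, j) \<in> C \<Longrightarrow> l < m \<and> l \<noteq> i"
  shows "sign_count d m M C = 0"
proof (cases "i = m - 1")
  case False
  define \<phi> :: "(nat \<Rightarrow> real) \<Rightarrow> nat \<Rightarrow> real" where "\<phi> \<epsilon> = \<epsilon>(i := - \<epsilon> i)" for \<epsilon>
  show ?thesis
    unfolding sign_count_def
  proof (rule sum_bit_involution[OF finite_signs, of _ \<phi>])
    fix \<epsilon> assume \<epsilon>: "\<epsilon> \<in> signs m"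
    then have ei: "\<epsilon> i = 1 \<or> \<epsilon> i = -1" using assms signs_cases by blast
    have "\<epsilon> l = 1 \<or> \<epsilon> l = -1" if "l < m" for l using \<epsilon> that signs_cases by blast
    then show "\<phi> \<epsilon> \<in> signs m" using \<epsilon> ei False assms(1)
      unfolding signs_def \<phi>_def by (force simp: PiE_def extensional_def Pi_def)
    show "\<phi> (\<phi> \<epsilon>) = \<epsilon>" by (simp add: \<phi>_def)
    show "\<phi> \<epsilon> \<noteq> \<epsilon>" using ei by (auto simp: \<phi>_def fun_eq_iff)
    have "balanced d C (signed (\<phi> \<epsilon>) M) = balanced d C (signed \<epsilon> M)"
      by (rule balanced_cong) (use assms in \<open>auto simp: signed_def \<phi>_def\<close>)
    then show "of_bool (balanced d C (signed (\<phi> \<epsilon>) M)) = (of_bool (balanced d C (signed \<epsilon> M)) :: bit)"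
      by simp
  qed
next
  case True
  define \<phi> :: "(nat \<Rightarrow> real) \<Rightarrow> nat \<Rightarrow> real"
    where "\<phi> \<epsilon> = (\<lambda>l. if l < m - 1 then - \<epsilon> l else \<epsilon> l)" for \<epsilon>
  show ?thesis
    unfolding sign_count_def
  proof (rule sum_bit_involution[OF finite_signs, of _ \<phi>])
    fix \<epsilon> assume \<epsilon>: "\<epsilon> \<in> signs m"
    then have e0: "\<epsilon> 0 = 1 \<or> \<epsilon> 0 = -1" using assms signs_cases by simp
    show "\<phi> \<epsilon> \<in> signs m"
      using \<epsilon> by (auto simp: signs_def \<phi>_def PiE_def extensional_def Pi_def)
    show "\<phi> (\<phi> \<epsilon>) = \<epsilon>" by (auto simp: \<phi>_def)
    have "\<phi> \<epsilon> 0 \<noteq> \<epsilon> 0" using e0 assms(2) by (auto simp: \<phi>_def)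
    then show "\<phi> \<epsilon> \<noteq> \<epsilon>" by auto
    have "balanced d C (signed (\<phi> \<epsilon>) M) = balanced d C (\<lambda>t r. - signed \<epsilon> M t r)"
      by (rule balanced_cong) (use assms(3) True in \<open>fastforce simp: signed_def \<phi>_def\<close>)
    then show "of_bool (balanced d C (signed (\<phi> \<epsilon>) M)) = (of_bool (balanced d C (signed \<epsilon> M)) :: bit)"
      by (simp add: balanced_uminus)
  qed
qed

text \<open>The coface map of simplices: it enumerates the vertices different from \<open>j\<close>
  in increasing order.\<close>

definition skip :: "nat \<Rightarrow> nat \<Rightarrow> nat"
  where "skip j l = (if l < j then l else Suc l)"

lemma inj_skip: "inj (skip j)"
  by (auto simp: inj_def skip_def split: if_splits)

definition corners_up :: "nat \<Rightarrow> nat \<Rightarrow> ((nat \<Rightarrow> nat) \<times> nat) set"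
  where "corners_up m k = {(p, i). p \<in> paths m k \<and> Suc i < m \<and> p i < p (Suc i)}"

definition corners_low :: "nat \<Rightarrow> nat \<Rightarrow> ((nat \<Rightarrow> nat) \<times> nat) set"
  where "corners_low m k = {(p, i). p \<in> paths m k \<and> Suc i < m \<and> p (Suc i) < p (Suc (Suc i))}"

lemma paths_update:
  assumes "p \<in> paths m k" "Suc i < m" "p i \<le> x" "x \<le> p (Suc (Suc i))"
  shows "p(Suc i := x) \<in> paths m k"
  unfolding paths_def
proof (intro CollectI conjI allI impI)
  fix l assume "l < m"
  then have "p l \<le> p (Suc l)" using assms(1) by (simp add: paths_def)
  then show "(p(Suc i := x)) l \<le> (p(Suc i := x)) (Suc l)" using assms by auto
qed (use assms in \<open>auto simp: paths_def extensional_def\<close>)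

lemma corner_cells:
  assumes "p \<in> paths m k" "Suc i < m" "p i < p (Suc i)"
  shows "p(Suc i := p (Suc i) - 1) \<in> paths m k"
    and "cells m p - {(i, p (Suc i))} =
         cells m (p(Suc i := p (Suc i) - 1)) - {(Suc i, p (Suc i) - 1)}"
proof -
  let ?q = "p(Suc i := p (Suc i) - 1)"
  have p: "p l \<le> p (Suc l)" if "l < m" for l using assms(1) that by (simp add: paths_def)
  show "?q \<in> paths m k"
    using assms p[of "Suc i"] by (intro paths_update) auto
  show "cells m p - {(i, p (Suc i))} = cells m ?q - {(Suc i, p (Suc i) - 1)}"
  proof -
    have "(l, j) \<in> cells m p - {(i, p (Suc i))} \<longleftrightarrow> (l, j) \<in> cells m ?q - {(Suc i, p (Suc i) - 1)}"
      for l j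
      using assms p[of "Suc i"]
      by (cases "l = i"; cases "l = Suc i") (auto simp: cells_def)
    then show ?thesis by (metis (no_types, lifting) equalityI subrelI)
  qed
qed

text \<open>Lowering the turning row by one leads from one path to another that shares the facet:
  every interior facet belongs to two simplices, to one as an upper and to the other as a lower
  corner.\<close>

lemma corners_cancel:
  fixes g :: "(nat \<times> nat) set \<Rightarrow> bit"
  shows "(\<Sum>(p, i)\<in>corners_up m k. g (cells m p - {(i, p (Suc i))})) =
         (\<Sum>(p, i)\<in>corners_low m k. g (cells m p - {(Suc i, p (Suc i))}))"
proof (rule sum.reindex_bij_witness[of _ "\<lambda>(p, i). (p(Suc i := Suc (p (Suc i))), i)"
      "\<lambda>(p, i). (p(Suc i := p (Suc i) - 1), i)"])
  fix a assume "a \<in> corners_up m k"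
  then obtain p i where a: "a = (p, i)" "p \<in> paths m k" "Suc i < m" "p i < p (Suc i)"
    by (auto simp: corners_up_def)
  have le: "p (Suc i) \<le> p (Suc (Suc i))" using a by (auto simp: paths_def)
  show "(case case a of (p, i) \<Rightarrow> (p(Suc i := p (Suc i) - 1), i) of
          (p, i) \<Rightarrow> (p(Suc i := Suc (p (Suc i))), i)) = a"
    using a by simp
  show "(case a of (p, i) \<Rightarrow> (p(Suc i := p (Suc i) - 1), i)) \<in> corners_low m k"
    using a corner_cells(1)[OF a(2-4)] le by (auto simp: corners_low_def)
  show "(case case a of (p, i) \<Rightarrow> (p(Suc i := p (Suc i) - 1), i) of
           (p, i) \<Rightarrow> g (cells m p - {(Suc i, p (Suc i))})) =
        (case a of (p, i) \<Rightarrow> g (cells m p - {(i, p (Suc i))}))"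
    using a corner_cells(2)[OF a(2-4)] by simp
next
  fix b assume "b \<in> corners_low m k"
  then obtain p i where b: "b = (p, i)" "p \<in> paths m k" "Suc i < m" "p (Suc i) < p (Suc (Suc i))"
    by (auto simp: corners_low_def)
  have le: "p i \<le> p (Suc i)" using b by (auto simp: paths_def)
  show "(case case b of (p, i) \<Rightarrow> (p(Suc i := Suc (p (Suc i))), i) of
          (p, i) \<Rightarrow> (p(Suc i := p (Suc i) - 1), i)) = b"
    using b by simp
  have "p(Suc i := Suc (p (Suc i))) \<in> paths m k"
    using b le by (intro paths_update) auto
  then show "(case b of (p, i) \<Rightarrow> (p(Suc i := Suc (p (Suc i))), i)) \<in> corners_up m k"
    using b le by (auto simp: corners_up_def)
qed

text \<open>Cells that are alone in their row but not in their column. The end rows of a column are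
  shared with its neighbours, except in the first and in the last column. Without such a cell the
  simplex lies over the face of the base opposite to vertex \<open>j\<close>.\<close>

definition rowlone :: "nat \<Rightarrow> nat \<Rightarrow> ((nat \<Rightarrow> nat) \<times> nat \<times> nat) set"
  where "rowlone m k = {(p, i, j). p \<in> paths m k \<and> i < m \<and> p i < p (Suc i) \<and> p i \<le> j \<and> j \<le> p (Suc i) \<and>
    (j = p i \<longrightarrow> i = 0) \<and> (j = p (Suc i) \<longrightarrow> Suc i = m)}"

text \<open>Deleting a row that is visited once gives a path for the face, and a given row can be
  inserted into a path of the face in exactly one column. \<open>dn\<close> and \<open>up\<close>
  shift the tail of the path accordingly.\<close>

lemma rowlone_faces:
  fixes g :: "(nat \<times> nat) set \<Rightarrow> bit"
  assumes "0 < m"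
  shows "(\<Sum>(p, i, j)\<in>rowlone m (Suc k). g (cells m p - {(i, j)})) =
         (\<Sum>(j, p)\<in>{..Suc k} \<times> paths m k. g (map_prod id (skip j) ` cells m p))"
proof -
  \<comment> \<open>Row \<open>j\<close> is inserted in the first column in which the path of the
    face reaches it; the top row, which no path of the face reaches, goes to the last
    column.\<close>
  define col where "col j p = (if j = Suc k then m - 1 else (LEAST i. j \<le> p (Suc i)))" for j and p :: "nat \<Rightarrow> nat"
  define dn where "dn p i = restrict (\<lambda>l. if l \<le> i then p l else p l - Suc 0) {..m}" for p :: "nat \<Rightarrow> nat" and i
  define up where "up p i = restrict (\<lambda>l. if l \<le> i then p l else Suc (p l)) {..m}" for p :: "nat \<Rightarrow> nat" and i
  show ?thesis
  proof (rule sum.reindex_bij_witness[of _ "\<lambda>(j, p). (up p (col j p), col j p, j)"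
        "\<lambda>(p, i, j). (j, dn p i)"])
    fix a assume "a \<in> rowlone m (Suc k)"
    then obtain p i j where a: "a = (p, i, j)" "p \<in> paths m (Suc k)" "i < m" "p i < p (Suc i)"
        "p i \<le> j" "j \<le> p (Suc i)" "j = p i \<longrightarrow> i = 0" "j = p (Suc i) \<longrightarrow> Suc i = m"
      by (auto simp: rowlone_def)
    have mono: "p x \<le> p y" if "x \<le> y" "y \<le> m" for x y using paths_mono[OF a(2)] that by blast
    have p0: "p 0 = 0" "p m = Suc k" "p \<in> extensional {..m}" using a(2) by (auto simp: paths_def)
    have jk: "j \<le> Suc k" using a mono[of "Suc i" m] p0 by simp
    have dn_in: "dn p i \<in> paths m k"
      unfolding paths_def
    proof (intro CollectI conjI allI impI)
      fix l assume "l < m"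
      then show "dn p i l \<le> dn p i (Suc l)"
        using mono[of l "Suc l"] mono[of "Suc i" "Suc l"] a by (auto simp: dn_def Suc_le_eq less_Suc_eq)
    qed (use p0 a in \<open>auto simp: dn_def\<close>)
    have col: "col j (dn p i) = i"
    proof (cases "j = Suc k")
      case True
      then have "j = p (Suc i)" using a mono[of "Suc i" m] p0 by auto
      then show ?thesis using a True by (auto simp: col_def)
    next
      case False
      have "j < p (Suc i)"
      proof (rule ccontr)
        assume "\<not> j < p (Suc i)"
        then have "j = p (Suc i)" using a by auto
        then show False using a p0 False by auto
      qed
      then have "j \<le> dn p i (Suc i)" using a by (simp add: dn_def)
      moreover have "\<not> j \<le> dn p i (Suc l)" if "l < i" for l
      proof -
        have "p (Suc l) \<le> p i" using mono that a by simp
        moreover have "p i < j" using a that by (cases "j = p i") auto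
        ultimately show ?thesis using that a by (simp add: dn_def)
      qed
      ultimately have "(LEAST l. j \<le> dn p i (Suc l)) = i"
        by (intro Least_equality) (auto simp flip: not_less)
      then show ?thesis using False by (simp add: col_def)
    qed
    have up: "up (dn p i) i = p"
    proof
      fix l show "up (dn p i) i l = p l"
      proof (cases "l \<le> m")
        case True
        moreover have "0 < p l" if "i < l" using mono[of "Suc i" l] that True a by simp
        ultimately show ?thesis by (auto simp: up_def dn_def)
      next
        case False
        then show ?thesis using p0 by (simp add: up_def extensional_def)
      qed
    qed
    show "(case case a of (p, i, j) \<Rightarrow> (j, dn p i) of (j, p) \<Rightarrow> (up p (col j p), col j p, j)) = a"
      using a col up by simp
    show "(case a of (p, i, j) \<Rightarrow> (j, dn p i)) \<in> {..Suc k} \<times> paths m k"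
      using a dn_in jk by simp
    have "cells m p - {(i, j)} = map_prod id (skip j) ` cells m (dn p i)"
    proof -
      have 1: "(l, x) \<in> map_prod id (skip j) ` cells m (dn p i) \<longleftrightarrow>
          l < m \<and> (\<exists>y. dn p i l \<le> y \<and> y \<le> dn p i (Suc l) \<and> x = skip j y)" for l x
        by (auto simp: cells_def image_iff Bex_def)
      have 2: "(l, x) \<in> cells m p - {(i, j)} \<longleftrightarrow> l < m \<and> p l \<le> x \<and> x \<le> p (Suc l) \<and> \<not> (l = i \<and> x = j)" for l x
        by (auto simp: cells_def)
      have 3: "(p l \<le> x \<and> x \<le> p (Suc l) \<and> \<not> (l = i \<and> x = j)) \<longleftrightarrow>
          (\<exists>y. dn p i l \<le> y \<and> y \<le> dn p i (Suc l) \<and> x = skip j y)" if l: "l < m" for l x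
      proof -
        consider "l < i" | "l = i" | "i < l" by linarith
        then show ?thesis
        proof cases
          case 1
          have "p (Suc l) \<le> p i" using mono[of "Suc l" i] 1 a by simp
          moreover have "p i < j" using a 1 by (cases "j = p i") auto
          ultimately have lj: "p (Suc l) < j" by simp
          have dn1: "dn p i l = p l" "dn p i (Suc l) = p (Suc l)" using 1 l by (simp_all add: dn_def)
          show ?thesis
          proof
            assume "p l \<le> x \<and> x \<le> p (Suc l) \<and> \<not> (l = i \<and> x = j)"
            then show "\<exists>y. dn p i l \<le> y \<and> y \<le> dn p i (Suc l) \<and> x = skip j y"
              unfolding dn1 using lj by (intro exI[of _ x]) (auto simp: skip_def)
          next
            assume "\<exists>y. dn p i l \<le> y \<and> y \<le> dn p i (Suc l) \<and> x = skip j y"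
            then show "p l \<le> x \<and> x \<le> p (Suc l) \<and> \<not> (l = i \<and> x = j)"
              unfolding dn1 using lj 1 by (auto simp: skip_def)
          qed
        next
          case 2
          show ?thesis
          proof
            assume L: "p l \<le> x \<and> x \<le> p (Suc l) \<and> \<not> (l = i \<and> x = j)"
            show "\<exists>y. dn p i l \<le> y \<and> y \<le> dn p i (Suc l) \<and> x = skip j y"
            proof (cases "x < j")
              case True
              then show ?thesis using L 2 l a by (intro exI[of _ x]) (auto simp: dn_def skip_def)
            next
              case False
              then show ?thesis using L 2 l a by (intro exI[of _ "x - 1"]) (auto simp: dn_def skip_def)
            qed
          next
            assume "\<exists>y. dn p i l \<le> y \<and> y \<le> dn p i (Suc l) \<and> x = skip j y"
            then show "p l \<le> x \<and> x \<le> p (Suc l) \<and> \<not> (l = i \<and> x = j)"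
              using 2 l a by (auto simp: dn_def skip_def split: if_splits)
          qed
        next
          case 3
          have "p (Suc i) \<le> p l" using mono[of "Suc i" l] 3 l by simp
          moreover have "j < p (Suc i)" using a 3 l by (cases "j = p (Suc i)") auto
          ultimately have jl: "j < p l" by simp
          show ?thesis
          proof
            assume L: "p l \<le> x \<and> x \<le> p (Suc l) \<and> \<not> (l = i \<and> x = j)"
            then show "\<exists>y. dn p i l \<le> y \<and> y \<le> dn p i (Suc l) \<and> x = skip j y"
              using jl 3 l by (intro exI[of _ "x - 1"]) (auto simp: dn_def skip_def)
          next
            assume "\<exists>y. dn p i l \<le> y \<and> y \<le> dn p i (Suc l) \<and> x = skip j y"
            then show "p l \<le> x \<and> x \<le> p (Suc l) \<and> \<not> (l = i \<and> x = j)"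
              using jl 3 l mono[of l "Suc l"] by (auto simp: dn_def skip_def split: if_splits)
          qed
        qed
      qed
      show ?thesis
      proof (rule Set.set_eqI)
        fix z :: "nat \<times> nat"
        obtain l x where z: "z = (l, x)" by (cases z)
        show "z \<in> cells m p - {(i, j)} \<longleftrightarrow> z \<in> map_prod id (skip j) ` cells m (dn p i)"
          unfolding z 1 2 using 3[of l x] by blast
      qed
    qed
    then show "(case case a of (p, i, j) \<Rightarrow> (j, dn p i) of (j, p) \<Rightarrow> g (map_prod id (skip j) ` cells m p)) =
         (case a of (p, i, j) \<Rightarrow> g (cells m p - {(i, j)}))"
      using a by simp
  next
    fix b assume "b \<in> {..Suc k} \<times> paths m k"
    then obtain j p where b: "b = (j, p)" "j \<le> Suc k" "p \<in> paths m k" by auto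
    have mono: "p x \<le> p y" if "x \<le> y" "y \<le> m" for x y using paths_mono[OF b(3)] that by blast
    have p0: "p 0 = 0" "p m = k" "p \<in> extensional {..m}" using b(3) by (auto simp: paths_def)
    define i where "i = col j p"
    have i: "i < m \<and> p i \<le> j \<and> (j = p i \<longrightarrow> i = 0) \<and> (if j = Suc k then Suc i = m else j \<le> p (Suc i))"
    proof (cases "j = Suc k")
      case True
      then have im: "i = m - 1" by (simp add: i_def col_def)
      then have "p i \<le> k" using mono[of i m] p0 assms by simp
      then show ?thesis using True im assms by auto
    next
      case False
      then have im: "i = (LEAST i. j \<le> p (Suc i))" by (simp add: i_def col_def)
      have ex: "j \<le> p (Suc (m - 1))" using False b p0 assms by simp
      have 1: "j \<le> p (Suc i)" unfolding im by (rule LeastI[where P = "\<lambda>i. j \<le> p (Suc i)", OF ex])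
      have "i \<le> m - 1" unfolding im by (rule Least_le[where P = "\<lambda>i. j \<le> p (Suc i)", OF ex])
      moreover have "p i < j" if "0 < i"
      proof -
        have "\<not> j \<le> p (Suc (i - 1))" unfolding im by (rule not_less_Least) (use that im in auto)
        then show ?thesis using that by simp
      qed
      ultimately show ?thesis using 1 False assms p0 by (cases "i = 0") auto
    qed
    have up_in: "up p i \<in> paths m (Suc k)"
      unfolding paths_def
    proof (intro CollectI conjI allI impI)
      fix l assume "l < m"
      then show "up p i l \<le> up p i (Suc l)"
        using mono[of l "Suc l"] by (auto simp: up_def)
    qed (use p0 i in \<open>auto simp: up_def\<close>)
    have dn: "dn (up p i) i = p"
      using p0(3) by (auto simp: up_def dn_def extensional_def fun_eq_iff)
    show "(case case b of (j, p) \<Rightarrow> (up p (col j p), col j p, j) of (p, i, j) \<Rightarrow> (j, dn p i)) = b"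
      using b dn by (simp flip: i_def)
    have "(up p i, i, j) \<in> rowlone m (Suc k)"
      unfolding rowlone_def using up_in i mono[of i "Suc i"] p0 by (auto simp: up_def split: if_splits)
    then show "(case b of (j, p) \<Rightarrow> (up p (col j p), col j p, j)) \<in> rowlone m (Suc k)"
      using b by (simp flip: i_def)
  qed
qed

text \<open>The product of a \<open>(k + 1)\<close>-simplex and an \<open>(m - 1)\<close>-simplex is
  triangulated by simplices with \<open>d + 2\<close> vertices, each of which has an even number of
  balanced facets for every sign pattern. In the sum over all simplices interior facets cancel,
  facets that miss a column count evenly over the sign patterns, and those that miss a row add up to
  the obstructions of the faces of the base.\<close>

theorem obstruction_cocycle:
  fixes M :: "nat \<Rightarrow> nat \<Rightarrow> nat \<Rightarrow> real" and key :: "nat \<Rightarrow> 's"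
  assumes "2 \<le> m" "d + 1 = m + k"
    and gp: "general_position d ({..<m} \<times> {..Suc k}) (\<lambda>(i, j). (key j, i)) (\<lambda>(i, j). M j i)"
  shows "(\<Sum>j\<le>Suc k. obstruction d m k (\<lambda>l. M (skip j l))) = 0"
proof -
  define g where "g = sign_count d m M"
  define A where "A = (SIGMA p:paths m (Suc k). cells m p)"
  have finA: "finite A" by (simp add: A_def finite_paths finite_cells)
  have "(\<Sum>(p, t)\<in>A. g (cells m p - {t})) = 0"
  proof -
    have "(\<Sum>t\<in>cells m p. of_bool (balanced d (cells m p - {t}) (signed \<epsilon> M)) :: bit) = 0"
      if p: "p \<in> paths m (Suc k)" and \<epsilon>: "\<epsilon> \<in> signs m" for p \<epsilon>
    proof -
      have sub: "cells m p \<subseteq> {..<m} \<times> {..Suc k}" by (rule cells_subset[OF p])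
      have gp': "general_position d (cells m p) (\<lambda>(i, j). (key j, i)) (signed \<epsilon> M)"
        unfolding general_position_def
      proof (intro conjI ballI allI impI)
        fix s t assume st: "s \<in> cells m p" "t \<in> cells m p"
          "(case s of (i, j) \<Rightarrow> (key j, i)) = (case t of (i, j) \<Rightarrow> (key j, i))"
        moreover have "\<forall>s\<in>{..<m} \<times> {..Suc k}. \<forall>t\<in>{..<m} \<times> {..Suc k}.
            (case s of (i, j) \<Rightarrow> (key j, i)) = (case t of (i, j) \<Rightarrow> (key j, i)) \<longrightarrow>
            (case s of (i, j) \<Rightarrow> M j i) = (case t of (i, j) \<Rightarrow> M j i)"
          using gp unfolding general_position_def by blast
        ultimately have "(case s of (i, j) \<Rightarrow> M j i) = (case t of (i, j) \<Rightarrow> M j i)"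
          using sub by blast
        then show "signed \<epsilon> M s = signed \<epsilon> M t"
          using st(3) by (simp add: signed_def split: prod.splits)
      next
        fix J assume J: "J \<subseteq> cells m p" "inj_on (\<lambda>(i, j). (key j, i)) J" "card J \<le> d"
        then have "indep d J (\<lambda>(i, j). M j i)"
          using gp sub unfolding general_position_def by blast
        then have "indep d J (\<lambda>t r. \<epsilon> (fst t) * (case t of (i, j) \<Rightarrow> M j i) r)"
        proof (rule indep_scale)
          fix t assume "t \<in> J"
          then have "fst t < m" using J sub by auto
          then show "\<epsilon> (fst t) \<noteq> 0" using signs_cases[OF \<epsilon>] by fastforce
        qed
        then show "indep d J (signed \<epsilon> M)"
          by (simp add: signed_def case_prod_unfold)
      qed
      have "even (card {t \<in> cells m p. balanced d (cells m p - {t}) (signed \<epsilon> M)})"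
        by (rule facets_even[OF finite_cells _ gp']) (use card_cells[OF p] assms in simp)
      moreover have "(\<Sum>t\<in>cells m p. of_bool (balanced d (cells m p - {t}) (signed \<epsilon> M)) :: bit) =
          (\<Sum>t\<in>{t \<in> cells m p. balanced d (cells m p - {t}) (signed \<epsilon> M)}. 1)"
        by (rule sum.mono_neutral_cong_right) (auto simp: finite_cells)
      ultimately show ?thesis using of_nat_even_bit by simp
    qed
    then have "(\<Sum>t\<in>cells m p. g (cells m p - {t})) = 0" if "p \<in> paths m (Suc k)" for p
      using that unfolding g_def sign_count_def by (subst sum.swap) (simp add: sum.neutral)
    then show ?thesis
      unfolding A_def by (subst sum.Sigma[symmetric]) (simp_all add: finite_paths finite_cells)
  qed
  \<comment> \<open>The dropped cell is alone in its column (\<open>A1\<close>), or an upper or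
    lower corner (\<open>A2\<close>, \<open>A3\<close>), or alone in its row
    (\<open>A4\<close>).\<close>
  moreover define A1 where "A1 = {(p, i, j) \<in> A. p i = p (Suc i)}"
  define A2 where "A2 = (\<lambda>(p, i). (p, i, p (Suc i))) ` corners_up m (Suc k)"
  define A3 where "A3 = (\<lambda>(p, i). (p, Suc i, p (Suc i))) ` corners_low m (Suc k)"
  define A4 where "A4 = rowlone m (Suc k)"
  have A: "A = A1 \<union> A2 \<union> A3 \<union> A4"
  proof (rule Set.set_eqI)
    fix t :: "(nat \<Rightarrow> nat) \<times> nat \<times> nat"
    obtain p i j where t: "t = (p, i, j)" by (cases t)
    show "t \<in> A \<longleftrightarrow> t \<in> A1 \<union> A2 \<union> A3 \<union> A4"
    proof
      assume "t \<in> A"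
      then have p: "p \<in> paths m (Suc k)" "i < m" "p i \<le> j" "j \<le> p (Suc i)"
        by (auto simp: t A_def cells_def)
      consider "p i = p (Suc i)" | "p i < p (Suc i)" "j = p (Suc i)" "Suc i < m"
        | "p i < p (Suc i)" "j = p i" "0 < i"
        | "p i < p (Suc i)" "j = p i \<longrightarrow> i = 0" "j = p (Suc i) \<longrightarrow> Suc i = m"
        using p by linarith
      then show "t \<in> A1 \<union> A2 \<union> A3 \<union> A4"
      proof cases
        case 1 then show ?thesis using \<open>t \<in> A\<close> by (simp add: A1_def t)
      next
        case 2
        then have "(p, i) \<in> corners_up m (Suc k)" using p by (simp add: corners_up_def)
        then have "t \<in> A2" unfolding A2_def by (rule rev_image_eqI) (simp add: t 2)
        then show ?thesis by blast
      next
        case 3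
        then have "(p, i - 1) \<in> corners_low m (Suc k)" using p by (simp add: corners_low_def)
        then have "t \<in> A3" unfolding A3_def by (rule rev_image_eqI) (use 3 in \<open>simp add: t\<close>)
        then show ?thesis by blast
      next
        case 4 then show ?thesis using p by (simp add: A4_def rowlone_def t)
      qed
    next
      assume "t \<in> A1 \<union> A2 \<union> A3 \<union> A4"
      then show "t \<in> A"
        by (auto simp: t A_def A1_def A2_def A3_def A4_def corners_up_def corners_low_def rowlone_def cells_def)
    qed
  qed
  have sub: "A1 \<subseteq> A" "A2 \<subseteq> A" "A3 \<subseteq> A" "A4 \<subseteq> A" using A by auto
  note fin = sub[THEN finite_subset, OF finA]
  have dis: "A1 \<inter> A2 = {}" "(A1 \<union> A2) \<inter> A3 = {}" "(A1 \<union> A2 \<union> A3) \<inter> A4 = {}"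
    by (auto simp: A1_def A2_def A3_def A4_def corners_up_def corners_low_def rowlone_def)
  let ?f = "\<lambda>(p, t). g (cells m p - {t})"
  have "sum ?f A = sum ?f A1 + sum ?f A2 + sum ?f A3 + sum ?f A4"
    unfolding A using fin dis by (simp add: sum.union_disjoint)
  moreover have "sum ?f A1 = 0"
  proof (rule sum.neutral, intro ballI)
    fix t assume "t \<in> A1"
    then obtain p i j where t: "t = (p, i, j)" "p i = p (Suc i)" "(p, i, j) \<in> A" by (auto simp: A1_def)
    have "g (cells m p - {(i, j)}) = 0"
      unfolding g_def by (rule sign_count_missing_column[of i]) (use t assms in \<open>auto simp: A_def cells_def\<close>)
    then show "?f t = 0" using t by simp
  qed
  moreover have "sum ?f A2 = sum ?f A3"
  proof -
    have "sum ?f A2 = (\<Sum>(p, i)\<in>corners_up m (Suc k). g (cells m p - {(i, p (Suc i))}))"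
      unfolding A2_def by (subst sum.reindex) (auto simp: inj_on_def case_prod_unfold)
    moreover have "sum ?f A3 = (\<Sum>(p, i)\<in>corners_low m (Suc k). g (cells m p - {(Suc i, p (Suc i))}))"
      unfolding A3_def by (subst sum.reindex) (auto simp: inj_on_def case_prod_unfold)
    ultimately show ?thesis using corners_cancel by simp
  qed
  moreover have "sum ?f A4 = (\<Sum>j\<le>Suc k. obstruction d m k (\<lambda>l. M (skip j l)))"
  proof -
    have "sum ?f A4 = (\<Sum>(j, p)\<in>{..Suc k} \<times> paths m k. g (map_prod id (skip j) ` cells m p))"
      unfolding A4_def using rowlone_faces[of m g k] assms(1) by (simp add: case_prod_unfold)
    also have "\<dots> = (\<Sum>j\<le>Suc k. \<Sum>p\<in>paths m k. g (map_prod id (skip j) ` cells m p))"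
      by (rule sum.cartesian_product[symmetric])
    also have "\<dots> = (\<Sum>j\<le>Suc k. obstruction d m k (\<lambda>l. M (skip j l)))"
    proof -
      have "balanced d (map_prod id (skip j) ` cells m p) (signed \<epsilon> M) =
          balanced d (cells m p) (signed \<epsilon> (\<lambda>l. M (skip j l)))" for j p \<epsilon>
      proof -
        have "inj_on (map_prod id (skip j)) (cells m p)"
          using inj_skip[of j] by (auto simp: inj_on_def inj_def)
        moreover have "(\<lambda>t. signed \<epsilon> M (map_prod id (skip j) t)) = signed \<epsilon> (\<lambda>l. M (skip j l))"
          by (auto simp: signed_def fun_eq_iff)
        ultimately show ?thesis by (simp add: balanced_reindex)
      qed
      then show ?thesis by (simp add: obstruction_def g_def sign_count_def)
    qed
    finally show ?thesis .
  qed
  ultimately show ?thesis by simp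
qed

text \<open>The vertices of the \<open>l\<close>-th simplex in the prism over a simplex: the bottom
  vertices up to number \<open>l\<close>, followed by the top vertices from number \<open>l\<close>
  on.\<close>

definition prism :: "(nat \<Rightarrow> 'b) \<Rightarrow> (nat \<Rightarrow> 'b) \<Rightarrow> nat \<Rightarrow> nat \<Rightarrow> 'b"
  where "prism M M' l = (\<lambda>j. if j \<le> l then M j else M' (j - 1))"

lemma bit_add_self: "(x :: bit) + x = 0"
  by (cases x) auto

lemma bit_add_eq_0: "x + y = 0 \<Longrightarrow> x = (y :: bit)"
  by (cases x; cases y) auto

text \<open>The boundary formula of the prism operator mod 2, for a cocycle: the faces inside the
  prism telescope to bottom and top, and the other faces are simplices of the prisms over the
  faces.\<close>

lemma prism_sum_identity:
  fixes Ob :: "(nat \<Rightarrow> 'b) \<Rightarrow> bit"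
  assumes cong: "\<And>L L'. (\<And>j. j \<le> k \<Longrightarrow> L j = L' j) \<Longrightarrow> Ob L = Ob L'"
    and cocycle: "\<And>l. l \<le> k \<Longrightarrow> (\<Sum>i\<le>Suc k. Ob (\<lambda>a. prism M M' l (skip i a))) = 0"
  shows "Ob M + Ob M' = (\<Sum>i\<le>k. \<Sum>l<k. Ob (prism (\<lambda>a. M (skip i a)) (\<lambda>a. M' (skip i a)) l))"
proof -
  \<comment> \<open>\<open>X l\<close> is the wall between consecutive simplices: face
    \<open>l\<close> of the \<open>l\<close>-th simplex is \<open>X l\<close>, and face
    \<open>Suc l\<close> is \<open>X (Suc l)\<close>. The first wall is the top, the last one the
    bottom.\<close>
  define X where "X l = (\<lambda>j. if j < l then M j else M' j)" for l
  define F where "F = (\<lambda>(l, i). Ob (\<lambda>a. prism M M' l (skip i a)))"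
  define A1 where "A1 = (\<lambda>l. (l, l)) ` {..k}"
  define A2 where "A2 = (\<lambda>l. (l, Suc l)) ` {..k}"
  define A3 where "A3 = {(l, i). l \<le> k \<and> i \<le> Suc k \<and> (i < l \<or> Suc l < i)}"
  have finA3: "finite A3" by (rule finite_subset[of _ "{..k} \<times> {..Suc k}"]) (auto simp: A3_def)
  have "sum F ({..k} \<times> {..Suc k}) = 0"
    using cocycle by (simp add: F_def sum.cartesian_product[symmetric] del: sum.atMost_Suc)
  moreover have "{..k} \<times> {..Suc k} = A1 \<union> A2 \<union> A3"
    by (auto simp: A1_def A2_def A3_def image_iff)
  moreover have "sum F (A1 \<union> A2 \<union> A3) = sum F A1 + sum F A2 + sum F A3"
  proof -
    have "finite A1" "finite A2" by (simp_all add: A1_def A2_def)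
    moreover have "A1 \<inter> A2 = {}" "(A1 \<union> A2) \<inter> A3 = {}" by (auto simp: A1_def A2_def A3_def)
    ultimately show ?thesis using finA3 by (simp add: sum.union_disjoint)
  qed
  moreover have "sum F A1 = (\<Sum>l\<le>k. Ob (X l))"
  proof -
    have "(\<lambda>a. prism M M' l (skip l a)) = X l" for l
      by (auto simp: prism_def skip_def X_def)
    then show ?thesis unfolding A1_def F_def by (subst sum.reindex) (auto simp: inj_on_def)
  qed
  moreover have "sum F A2 = (\<Sum>l\<le>k. Ob (X (Suc l)))"
  proof -
    have "(\<lambda>a. prism M M' l (skip (Suc l) a)) = X (Suc l)" for l
      by (auto simp: prism_def skip_def X_def)
    then show ?thesis unfolding A2_def F_def by (subst sum.reindex) (auto simp: inj_on_def)
  qed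
  moreover have "(\<Sum>l\<le>k. Ob (X l)) + (\<Sum>l\<le>k. Ob (X (Suc l))) = Ob M + Ob M'"
  proof -
    have "(\<Sum>l\<le>j. Ob (X l)) + (\<Sum>l\<le>j. Ob (X (Suc l))) = Ob (X 0) + Ob (X (Suc j))" for j
    proof (induction j)
      case (Suc j)
      have "(\<Sum>l\<le>Suc j. Ob (X l)) + (\<Sum>l\<le>Suc j. Ob (X (Suc l))) =
          ((\<Sum>l\<le>j. Ob (X l)) + (\<Sum>l\<le>j. Ob (X (Suc l)))) + Ob (X (Suc j)) + Ob (X (Suc (Suc j)))"
        by (simp only: sum.atMost_Suc add_ac)
      also have "\<dots> = Ob (X 0) + (Ob (X (Suc j)) + Ob (X (Suc j))) + Ob (X (Suc (Suc j)))"
        by (simp only: Suc add.assoc)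
      also have "\<dots> = Ob (X 0) + Ob (X (Suc (Suc j)))" by (simp only: bit_add_self add_0_right)
      finally show ?case .
    qed simp
    note * = this[of k]
    have "Ob (X (Suc k)) = Ob M" by (rule cong) (simp add: X_def)
    moreover have "X 0 = M'" by (simp add: X_def)
    ultimately show ?thesis using * by (simp only: add.commute[of "Ob M" "Ob M'"])
  qed
  moreover have "sum F A3 = (\<Sum>(i, l)\<in>{..k} \<times> {..<k}.
      Ob (prism (\<lambda>a. M (skip i a)) (\<lambda>a. M' (skip i a)) l))"
  proof (rule sum.reindex_bij_witness[of _ "\<lambda>(i, l). if i \<le> l then (Suc l, i) else (l, Suc i)"
        "\<lambda>(l, i). if i < l then (i, l - 1) else (i - 1, l)"])
    fix t assume "t \<in> A3"
    then obtain l i where t: "t = (l, i)" "l \<le> k" "i \<le> Suc k" "i < l \<or> Suc l < i"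
      by (auto simp: A3_def)
    show "(case case t of (l, i) \<Rightarrow> if i < l then (i, l - 1) else (i - 1, l) of
            (i, l) \<Rightarrow> if i \<le> l then (Suc l, i) else (l, Suc i)) = t"
      using t by auto
    show "(case t of (l, i) \<Rightarrow> if i < l then (i, l - 1) else (i - 1, l)) \<in> {..k} \<times> {..<k}"
      using t by auto
    have "(\<lambda>a. prism M M' l (skip i a)) = prism (\<lambda>a. M (skip i a)) (\<lambda>a. M' (skip i a)) (l - 1)" if "i < l"
      using that by (auto simp: prism_def skip_def fun_eq_iff)
    moreover have "(\<lambda>a. prism M M' l (skip i a)) =
        prism (\<lambda>a. M (skip (i - 1) a)) (\<lambda>a. M' (skip (i - 1) a)) l" if "Suc l < i"
      using that by (auto simp: prism_def skip_def fun_eq_iff)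
    ultimately show "(case case t of (l, i) \<Rightarrow> if i < l then (i, l - 1) else (i - 1, l) of
        (i, l) \<Rightarrow> Ob (prism (\<lambda>a. M (skip i a)) (\<lambda>a. M' (skip i a)) l)) = F t"
      using t by (auto simp: F_def)
  qed (auto simp: A3_def split: if_splits)
  ultimately have "(Ob M + Ob M') + (\<Sum>(i, l)\<in>{..k} \<times> {..<k}.
      Ob (prism (\<lambda>a. M (skip i a)) (\<lambda>a. M' (skip i a)) l)) = 0" by (simp only:)
  then show ?thesis unfolding sum.cartesian_product by (rule bit_add_eq_0)
qed

section \<open>Genericity under row permutations and the cocycle identities that follow from
  it\<close>

definition generic :: "nat \<Rightarrow> 's set \<Rightarrow> ('s \<Rightarrow> nat \<Rightarrow> real) \<Rightarrow> bool"
  where "generic d S u \<longleftrightarrow>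
    (\<forall>J\<subseteq>S. card J \<le> d \<longrightarrow> (\<forall>\<rho>. (\<forall>x\<in>J. \<rho> x permutes {..<d}) \<longrightarrow> indep d J (\<lambda>x r. u x (\<rho> x r))))"

text \<open>The matrix at vertex \<open>j\<close> is the stored matrix of its key with the rows read
  in the order \<open>\<rho> j\<close>. Equal keys must come with equal orders: genericity admits
  one row permutation per stored vector, and equal keys have to stand for equal vectors.\<close>

lemma general_position_generic:
  fixes key :: "nat \<Rightarrow> 'k" and S :: "('k \<times> nat) set"
  assumes "generic d S u"
    and keyS: "\<And>i j. i < m \<Longrightarrow> j \<le> k \<Longrightarrow> (key j, i) \<in> S"
    and M: "\<And>i j r. i < m \<Longrightarrow> j \<le> k \<Longrightarrow> M j i r = u (key j, i) (\<rho> j r)"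
    and \<rho>: "\<And>j. j \<le> k \<Longrightarrow> \<rho> j permutes {..<d}"
    and key: "\<And>j j'. j \<le> k \<Longrightarrow> j' \<le> k \<Longrightarrow> key j = key j' \<Longrightarrow> \<rho> j = \<rho> j'"
  shows "general_position d ({..<m} \<times> {..k}) (\<lambda>(i, j). (key j, i)) (\<lambda>(i, j). M j i)"
  unfolding general_position_def
proof (intro conjI ballI allI impI)
  fix s t assume st: "s \<in> {..<m} \<times> {..k}" "t \<in> {..<m} \<times> {..k}"
    "(case s of (i, j) \<Rightarrow> (key j, i)) = (case t of (i, j) \<Rightarrow> (key j, i))"
  obtain i j i' j' where e: "s = (i, j)" "t = (i', j')" by (metis surj_pair)
  have "i' = i" "key j = key j'" using st(3) e by auto
  moreover have "\<rho> j = \<rho> j'" by (rule key) (use st e \<open>key j = key j'\<close> in auto)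
  moreover have "M j i r = u (key j, i) (\<rho> j r)" "M j' i r = u (key j', i) (\<rho> j' r)" for r
    using M[of i j r] M[of i j' r] st(1,2) e \<open>i' = i\<close> by auto
  ultimately have "M j i = M j' i'" by (simp add: fun_eq_iff)
  then show "(case s of (i, j) \<Rightarrow> M j i) = (case t of (i, j) \<Rightarrow> M j i)"
    using e by simp
next
  fix J :: "(nat \<times> nat) set"
  assume J: "J \<subseteq> {..<m} \<times> {..k}" "inj_on (\<lambda>(i, j). (key j, i)) J" "card J \<le> d"
  define h where "h = (\<lambda>(i, j). (key j, i :: nat))"
  define \<sigma> where "\<sigma> x = \<rho> (snd (inv_into J h x))" for x
  have inj: "inj_on h J" using J(2) by (simp add: h_def)
  have \<sigma>: "\<sigma> (h t) = \<rho> (snd t)" if "t \<in> J" for t using that inj by (simp add: \<sigma>_def)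
  have "h ` J \<subseteq> S" unfolding h_def using J(1) by (auto intro!: keyS)
  moreover have "card (h ` J) \<le> d" using J(3) inj by (simp add: card_image)
  moreover have "\<forall>x\<in>h ` J. \<sigma> x permutes {..<d}"
  proof (intro ballI)
    fix x assume "x \<in> h ` J"
    then obtain t where t: "t \<in> J" "x = h t" by blast
    moreover have "snd t \<le> k" using t J(1) by auto
    ultimately show "\<sigma> x permutes {..<d}" using \<sigma> \<rho> by simp
  qed
  ultimately have "indep d (h ` J) (\<lambda>x r. u x (\<sigma> x r))"
    using assms(1) unfolding generic_def by blast
  then have "indep d J (\<lambda>t r. u (h t) (\<sigma> (h t) r))" unfolding indep_reindex[OF inj] .
  also have "indep d J (\<lambda>t r. u (h t) (\<sigma> (h t) r)) = indep d J (\<lambda>(i, j). M j i)"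
  proof (rule indep_cong)
    fix t r assume t: "t \<in> J"
    obtain i j where e: "t = (i, j)" by (cases t)
    have "M j i r = u (key j, i) (\<rho> j r)" by (rule M) (use t e J(1) in auto)
    then show "u (h t) (\<sigma> (h t) r) = (case t of (i, j) \<Rightarrow> M j i) r"
      unfolding \<sigma>[OF t] by (simp add: e h_def)
  qed
  finally show "indep d J (\<lambda>(i, j). M j i)" .
qed

lemma obstruction_cocycle_generic:
  fixes key :: "nat \<Rightarrow> 'k" and S :: "('k \<times> nat) set"
  assumes "2 \<le> m" "d + 1 = m + k" "generic d S u"
    and "\<And>i j. i < m \<Longrightarrow> j \<le> Suc k \<Longrightarrow> (key j, i) \<in> S"
    and "\<And>i j r. i < m \<Longrightarrow> j \<le> Suc k \<Longrightarrow> M j i r = u (key j, i) (\<rho> j r)"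
    and "\<And>j. j \<le> Suc k \<Longrightarrow> \<rho> j permutes {..<d}"
    and "\<And>j j'. j \<le> Suc k \<Longrightarrow> j' \<le> Suc k \<Longrightarrow> key j = key j' \<Longrightarrow> \<rho> j = \<rho> j'"
  shows "(\<Sum>j\<le>Suc k. obstruction d m k (\<lambda>l. M (skip j l))) = 0"
  by (rule obstruction_cocycle[OF assms(1,2) general_position_generic[OF assms(3-7)]])

text \<open>Here \<open>M\<close> and \<open>M'\<close> belong to the \<open>k\<close> vertices of a
  \<open>(k - 1)\<close>-simplex, whose prism consists of \<open>k\<close> simplices of dimension
  \<open>k\<close>.\<close>

definition prism_obstruction ::
  "nat \<Rightarrow> nat \<Rightarrow> nat \<Rightarrow> (nat \<Rightarrow> nat \<Rightarrow> nat \<Rightarrow> real) \<Rightarrow> (nat \<Rightarrow> nat \<Rightarrow> nat \<Rightarrow> real) \<Rightarrow> bit"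
  where "prism_obstruction d m k M M' = (\<Sum>l<k. obstruction d m k (prism M M' l))"

text \<open>Keys of the two families never coincide, so no bottom vertex of the prism is identified
  with a top vertex, and the row orders of the two families may be chosen separately.\<close>

lemma obstruction_prism_generic:
  fixes key key' :: "nat \<Rightarrow> 'k" and S :: "('k \<times> nat) set"
  assumes "2 \<le> m" "d + 1 = m + k" "generic d S u"
    and "\<And>i j. i < m \<Longrightarrow> j \<le> k \<Longrightarrow> (key j, i) \<in> S \<and> (key' j, i) \<in> S"
    and "\<And>i j r. i < m \<Longrightarrow> j \<le> k \<Longrightarrow> M j i r = u (key j, i) (\<rho> j r) \<and> M' j i r = u (key' j, i) (\<rho>' j r)"
    and "\<And>j. j \<le> k \<Longrightarrow> \<rho> j permutes {..<d} \<and> \<rho>' j permutes {..<d}"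
    and "\<And>j j'. j \<le> k \<Longrightarrow> j' \<le> k \<Longrightarrow> key j = key j' \<Longrightarrow> \<rho> j = \<rho> j'"
    and "\<And>j j'. j \<le> k \<Longrightarrow> j' \<le> k \<Longrightarrow> key' j = key' j' \<Longrightarrow> \<rho>' j = \<rho>' j'"
    and "\<And>j j'. j \<le> k \<Longrightarrow> j' \<le> k \<Longrightarrow> key j \<noteq> key' j'"
  shows "obstruction d m k M + obstruction d m k M' =
    (\<Sum>i\<le>k. prism_obstruction d m k (\<lambda>a. M (skip i a)) (\<lambda>a. M' (skip i a)))"
  unfolding prism_obstruction_def
proof (rule prism_sum_identity[where Ob = "obstruction d m k"])
  show "obstruction d m k L = obstruction d m k L'" if "\<And>j. j \<le> k \<Longrightarrow> L j = L' j" for L L'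
    by (rule obstruction_cong) (use that in simp)
  fix l assume l: "l \<le> k"
  show "(\<Sum>i\<le>Suc k. obstruction d m k (\<lambda>a. prism M M' l (skip i a))) = 0"
  proof (rule obstruction_cocycle_generic[OF assms(1-3), where key = "prism key key' l" and \<rho> = "prism \<rho> \<rho>' l"])
    fix j assume j: "j \<le> Suc k"
    show "prism \<rho> \<rho>' l j permutes {..<d}" using assms(6) j l by (auto simp: prism_def)
    fix i assume i: "i < m"
    show "(prism key key' l j, i) \<in> S" using assms(4) i j l by (auto simp: prism_def)
    show "prism M M' l j i r = u (prism key key' l j, i) (prism \<rho> \<rho>' l j r)" for r
      using assms(5) i j l by (auto simp: prism_def)
  next
    fix j j' assume jj: "j \<le> Suc k" "j' \<le> Suc k" "prism key key' l j = prism key key' l j'"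
    have a: "j - 1 \<le> k" "j' - 1 \<le> k" using jj by auto
    show "prism \<rho> \<rho>' l j = prism \<rho> \<rho>' l j'"
    proof (cases "j \<le> l"; cases "j' \<le> l")
      assume "j \<le> l" "j' \<le> l"
      then show ?thesis using jj assms(7)[of j j'] l by (simp add: prism_def)
    next
      assume "j \<le> l" "\<not> j' \<le> l"
      then show ?thesis using jj assms(9)[of j "j' - 1"] l a by (simp add: prism_def)
    next
      assume "\<not> j \<le> l" "j' \<le> l"
      then show ?thesis using jj assms(9)[of j' "j - 1"] l a by (simp add: prism_def)
    next
      assume "\<not> j \<le> l" "\<not> j' \<le> l"
      then show ?thesis using jj assms(8)[OF a] by (simp add: prism_def)
    qed
  qed
qed

section \<open>Cochains mod 2 that depend only on the vertices of a singular simplex\<close>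

definition vertices :: "nat \<Rightarrow> ((nat \<Rightarrow> real) \<Rightarrow> 'a) \<Rightarrow> nat \<Rightarrow> 'a"
  where "vertices p f = restrict (\<lambda>i. f (\<lambda>j. if j = i then 1 else 0)) {..p}"

text \<open>Chains keep integral coefficients, so that iterated subdivision and its chain homotopy
  can be applied to them; reduction mod 2 takes place in the evaluation.\<close>

definition chain_eval :: "nat \<Rightarrow> ((nat \<Rightarrow> 'a) \<Rightarrow> bit) \<Rightarrow> 'a chain \<Rightarrow> bit"
  where "chain_eval p \<psi> c =
    (\<Sum>f\<in>Poly_Mapping.keys c. of_int (Poly_Mapping.lookup c f) * \<psi> (vertices p f))"

lemma chain_eval_superset:
  assumes "finite A" "Poly_Mapping.keys c \<subseteq> A"
  shows "chain_eval p \<psi> c = (\<Sum>f\<in>A. of_int (Poly_Mapping.lookup c f) * \<psi> (vertices p f))"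
  unfolding chain_eval_def
  by (rule sum.mono_neutral_left) (use assms in \<open>auto simp: in_keys_iff\<close>)

lemma chain_eval_0 [simp]: "chain_eval p \<psi> 0 = 0"
  by (simp add: chain_eval_def)

lemma chain_eval_add: "chain_eval p \<psi> (a + b) = chain_eval p \<psi> a + chain_eval p \<psi> b"
proof -
  let ?A = "Poly_Mapping.keys a \<union> Poly_Mapping.keys b"
  have "chain_eval p \<psi> x = (\<Sum>f\<in>?A. of_int (Poly_Mapping.lookup x f) * \<psi> (vertices p f))"
    if "Poly_Mapping.keys x \<subseteq> ?A" for x
    by (rule chain_eval_superset) (use that in auto)
  note * = this
  have "Poly_Mapping.keys (a + b) \<subseteq> ?A" by (rule Poly_Mapping.keys_add)
  from *[OF this] *[of a, OF Un_upper1] *[of b, OF Un_upper2] show ?thesis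
    by (simp only: lookup_add of_int_add distrib_right sum.distrib)
qed

lemma chain_eval_minus: "chain_eval p \<psi> (- a) = chain_eval p \<psi> a"
  by (simp add: chain_eval_def)

lemma chain_eval_diff: "chain_eval p \<psi> (a - b) = chain_eval p \<psi> a + chain_eval p \<psi> b"
  using chain_eval_add[of p \<psi> a "- b"] by (simp add: chain_eval_minus)

lemma chain_eval_cmul: "chain_eval p \<psi> (frag_cmul x a) = of_int x * chain_eval p \<psi> a"
proof -
  have "chain_eval p \<psi> (frag_cmul x a) = (\<Sum>f\<in>Poly_Mapping.keys a.
      of_int (Poly_Mapping.lookup (frag_cmul x a) f) * \<psi> (vertices p f))"
    by (rule chain_eval_superset) (auto simp: keys_cmul)
  then show ?thesis
    by (simp only: chain_eval_def sum_distrib_left mult.assoc lookup_frag_cmul of_int_mult)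
qed

lemma chain_eval_double [simp]: "chain_eval p \<psi> (a + a) = 0"
  by (simp add: chain_eval_add bit_add_self)

lemma chain_eval_of [simp]: "chain_eval p \<psi> (frag_of f) = \<psi> (vertices p f)"
proof -
  have "chain_eval p \<psi> (frag_of f) = (\<Sum>g\<in>{f}. of_int (Poly_Mapping.lookup (frag_of f) g) * \<psi> (vertices p g))"
    by (rule chain_eval_superset) auto
  then show ?thesis by (simp only: sum.insert sum.empty finite.emptyI empty_iff lookup_frag_of
        not_False_eq_True if_True simp_thms of_int_1 mult_1 add_0_right)
qed

lemma chain_eval_sum: "chain_eval p \<psi> (sum g A) = (\<Sum>x\<in>A. chain_eval p \<psi> (g x))"
  by (induction A rule: infinite_finite_induct) (auto simp: chain_eval_add)

lemma chain_eval_extend: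
  "chain_eval p \<psi> (frag_extend g c) =
    (\<Sum>f\<in>Poly_Mapping.keys c. of_int (Poly_Mapping.lookup c f) * chain_eval p \<psi> (g f))"
  by (simp add: frag_extend_def chain_eval_sum chain_eval_cmul)

lemma chain_eval_cong:
  assumes "\<And>f. f \<in> Poly_Mapping.keys c \<Longrightarrow> \<psi> (vertices p f) = \<psi>' (vertices p f)"
  shows "chain_eval p \<psi> c = chain_eval p \<psi>' c"
  unfolding chain_eval_def by (rule sum.cong) (use assms in auto)

lemma chain_eval_eq_0I:
  assumes "\<And>f. f \<in> Poly_Mapping.keys c \<Longrightarrow> \<psi> (vertices p f) = 0"
  shows "chain_eval p \<psi> c = 0"
  unfolding chain_eval_def using assms by (simp add: sum.neutral)

lemma vertices_singular_face:
  assumes "i \<le> Suc p"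
  shows "vertices p (singular_face (Suc p) i f) = restrict (\<lambda>l. vertices (Suc p) f (skip i l)) {..p}"
proof
  fix l
  show "vertices p (singular_face (Suc p) i f) l = restrict (\<lambda>l. vertices (Suc p) f (skip i l)) {..p} l"
  proof (cases "l \<le> p")
    case True
    have "simplical_face i (\<lambda>j. if j = l then 1 else 0) = (\<lambda>j. if j = skip i l then 1 else (0::real))"
      by (auto simp: simplical_face_def skip_def fun_eq_iff)
    moreover have "skip i l \<le> Suc p" using True by (simp add: skip_def)
    ultimately show ?thesis using True by (simp add: vertices_def singular_face_def)
  qed (simp add: vertices_def)
qed

lemma chain_eval_boundary:
  "chain_eval p \<psi> (chain_boundary (Suc p) c) = (\<Sum>f\<in>Poly_Mapping.keys c. of_int (Poly_Mapping.lookup c f) *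
     (\<Sum>i\<le>Suc p. \<psi> (restrict (\<lambda>l. vertices (Suc p) f (skip i l)) {..p})))"
proof -
  have "chain_eval p \<psi> (\<Sum>i\<le>Suc p. frag_cmul ((- 1) ^ i) (frag_of (singular_face (Suc p) i f))) =
     (\<Sum>i\<le>Suc p. \<psi> (restrict (\<lambda>l. vertices (Suc p) f (skip i l)) {..p}))" for f
    unfolding chain_eval_sum chain_eval_cmul chain_eval_of
    by (rule sum.cong) (auto simp: vertices_singular_face)
  then show ?thesis by (simp add: chain_boundary_def chain_eval_extend)
qed

lemma vertices_simplex_map: "vertices p (simplex_map p g f) = restrict (\<lambda>i. g (vertices p f i)) {..p}"
  by (auto simp: vertices_def simplex_map_def)

lemma chain_eval_chain_map:
  "chain_eval p \<psi> (chain_map p g c) = chain_eval p (\<lambda>v. \<psi> (restrict (\<lambda>i. g (v i)) {..p})) c"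
  unfolding chain_map_def chain_eval_extend
  by (simp add: chain_eval_def vertices_simplex_map)

section \<open>Cochains on unordered configurations\<close>

definition labels :: "nat \<Rightarrow> 'a set \<Rightarrow> (nat \<Rightarrow> 'a) \<Rightarrow> bool"
  where "labels n D x \<longleftrightarrow> inj_on x {..<n} \<and> x ` {..<n} = D"

text \<open>Labellings of nearby configurations that match each point with the closest one.\<close>

definition compatible :: "nat \<Rightarrow> nat \<Rightarrow> (nat \<Rightarrow> 'a::metric_space set) \<Rightarrow> (nat \<Rightarrow> nat \<Rightarrow> 'a) \<Rightarrow> bool"
  where "compatible n k V L \<longleftrightarrow> (\<forall>j\<le>k. labels n (V j) (L j)) \<and>
    (\<forall>j\<le>k. \<forall>j'\<le>k. \<forall>i<n. \<forall>i'<n. i \<noteq> i' \<longrightarrow> 2 * dist (L j i) (L j' i) < dist (L j i) (L j i'))"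

lemma compatible_labels: "compatible n k V L \<Longrightarrow> j \<le> k \<Longrightarrow> labels n (V j) (L j)"
  unfolding compatible_def by blast

lemma compatible_dist:
  "compatible n k V L \<Longrightarrow> j \<le> k \<Longrightarrow> j' \<le> k \<Longrightarrow> i < n \<Longrightarrow> i' < n \<Longrightarrow> i \<noteq> i' \<Longrightarrow>
    2 * dist (L j i) (L j' i) < dist (L j i) (L j i')"
  unfolding compatible_def by blast

text \<open>The permutation is read off at vertex \<open>0\<close>. If the labellings disagreed with
  it at vertex \<open>j\<close>, two different points there would both be nearer to the same point
  of vertex \<open>0\<close> than half of their mutual distance, contrary to the triangle
  inequality.\<close>

lemma compatible_unique:
  assumes L: "compatible n k V L" and L': "compatible n k V L'"
  obtains \<pi> where "\<pi> permutes {..<n}" "\<And>j i. j \<le> k \<Longrightarrow> i < n \<Longrightarrow> L' j i = L j (\<pi> i)"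
proof -
  have l0: "inj_on (L 0) {..<n}" "L 0 ` {..<n} = V 0" "inj_on (L' 0) {..<n}" "L' 0 ` {..<n} = V 0"
    using compatible_labels[OF L, of 0] compatible_labels[OF L', of 0] by (auto simp: labels_def)
  define \<pi> where "\<pi> i = (if i < n then inv_into {..<n} (L 0) (L' 0 i) else i)" for i
  have \<pi>: "\<pi> i < n" "L 0 (\<pi> i) = L' 0 i" if "i < n" for i
  proof -
    have mem: "L' 0 i \<in> L 0 ` {..<n}" using l0 that by (metis imageI lessThan_iff)
    show "\<pi> i < n" using inv_into_into[OF mem] that by (simp add: \<pi>_def)
    show "L 0 (\<pi> i) = L' 0 i" using f_inv_into_f[OF mem] that by (simp add: \<pi>_def)
  qed
  have "inj_on \<pi> {..<n}"
  proof (rule inj_onI)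
    fix x y assume "x \<in> {..<n}" "y \<in> {..<n}" "\<pi> x = \<pi> y"
    then have "L' 0 x = L' 0 y" using \<pi>(2)[of x] \<pi>(2)[of y] by simp
    then show "x = y" using l0(3) \<open>x \<in> {..<n}\<close> \<open>y \<in> {..<n}\<close> by (simp add: inj_on_eq_iff)
  qed
  moreover have "\<pi> ` {..<n} \<subseteq> {..<n}" using \<pi>(1) by auto
  ultimately have "bij_betw \<pi> {..<n} {..<n}"
    by (simp add: bij_betw_def endo_inj_surj)
  then have perm: "\<pi> permutes {..<n}"
    by (rule bij_imp_permutes) (simp add: \<pi>_def)
  have "L' j i = L j (\<pi> i)" if j: "j \<le> k" and i: "i < n" for j i
  proof (rule ccontr)
    assume ne: "L' j i \<noteq> L j (\<pi> i)"
    have lj: "inj_on (L j) {..<n}" "L j ` {..<n} = V j" "inj_on (L' j) {..<n}" "L' j ` {..<n} = V j"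
      using compatible_labels[OF L j] compatible_labels[OF L' j] by (auto simp: labels_def)
    have "L' j i \<in> L j ` {..<n}" using lj i by (metis imageI lessThan_iff)
    then obtain a where a: "a < n" "L' j i = L j a" by auto
    have "L j (\<pi> i) \<in> L' j ` {..<n}" using lj \<pi>(1)[OF i] by (metis imageI lessThan_iff)
    then obtain b where b: "b < n" "L j (\<pi> i) = L' j b" by auto
    have "\<pi> i \<noteq> a" "i \<noteq> b" using ne a b by auto
    then have "2 * dist (L j (\<pi> i)) (L 0 (\<pi> i)) < dist (L j (\<pi> i)) (L j a)"
        "2 * dist (L' j i) (L' 0 i) < dist (L' j i) (L' j b)"
      using compatible_dist[OF L j, of 0 "\<pi> i" a] compatible_dist[OF L' j, of 0 i b] \<pi>(1)[OF i] i a b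
      by auto
    moreover have "dist (L j (\<pi> i)) (L' j i) \<le> dist (L j (\<pi> i)) (L 0 (\<pi> i)) + dist (L' j i) (L' 0 i)"
      using \<pi>(2)[OF i] dist_triangle2 by metis
    moreover have "dist (L j (\<pi> i)) (L j a) = dist (L j (\<pi> i)) (L' j i)"
        "dist (L' j i) (L' j b) = dist (L j (\<pi> i)) (L' j i)"
      using a b by (simp_all add: dist_commute)
    ultimately show False by linarith
  qed
  then show ?thesis using that perm by blast
qed

text \<open>Otherwise \<open>L j' i\<close> would be a second point of the diagram at vertex
  \<open>j\<close>, and its distance from \<open>L j i\<close> would be less than half of itself.
  This guarantees that repeated vertices read their stored matrix in the same row order.\<close>

lemma compatible_same:
  assumes L: "compatible n k V L" and j: "j \<le> k" "j' \<le> k" "V j = V j'" and i: "i < n"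
  shows "L j i = L j' i"
proof -
  have "L j' i \<in> V j'" using compatible_labels[OF L j(2)] i by (auto simp: labels_def)
  then have "L j' i \<in> L j ` {..<n}" using compatible_labels[OF L j(1)] j by (auto simp: labels_def)
  then obtain i' where i': "i' < n" "L j' i = L j i'" by auto
  have "i' = i"
  proof (rule ccontr)
    assume "i' \<noteq> i"
    then have "2 * dist (L j i) (L j' i) < dist (L j i) (L j' i)"
      using compatible_dist[OF L j(1,2) i i'(1)] i'(2) by simp
    then show False using zero_le_dist[of "L j i" "L j' i"] by linarith
  qed
  then show ?thesis using i' by simp
qed

lemma compatible_face:
  assumes "compatible n (Suc k) V L"
  shows "compatible n k (restrict (\<lambda>l. V (skip i l)) {..k}) (\<lambda>l. L (skip i l))"
proof -
  have s: "skip i l \<le> Suc k" if "l \<le> k" for l using that by (simp add: skip_def)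
  show ?thesis using assms s unfolding compatible_def by simp
qed

text \<open>A cochain on labelled simplices becomes one on simplices of unordered configurations.
  Simplices without a compatible labelling get the default value \<open>0\<close>; after sufficient
  subdivision they no longer occur.\<close>

definition lift_cochain ::
  "nat \<Rightarrow> nat \<Rightarrow> ((nat \<Rightarrow> nat \<Rightarrow> 'a::metric_space) \<Rightarrow> bit) \<Rightarrow> (nat \<Rightarrow> 'a set) \<Rightarrow> bit"
  where "lift_cochain n k G V =
    (if \<exists>L. compatible n k V L then G (SOME L. compatible n k V L) else 0)"

definition label_invariant :: "nat \<Rightarrow> nat \<Rightarrow> ((nat \<Rightarrow> nat \<Rightarrow> 'a) \<Rightarrow> bit) \<Rightarrow> bool"
  where "label_invariant n k G \<longleftrightarrow>
    (\<forall>\<pi> L L'. \<pi> permutes {..<n} \<longrightarrow> (\<forall>j\<le>k. \<forall>i<n. L' j i = L j (\<pi> i)) \<longrightarrow> G L' = G L)"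

lemma lift_cochain_eq:
  assumes "label_invariant n k G" "compatible n k V L"
  shows "lift_cochain n k G V = G L"
proof -
  have *: "compatible n k V (SOME L. compatible n k V L)" by (rule someI[of "compatible n k V", OF assms(2)])
  obtain \<pi> where "\<pi> permutes {..<n}"
      "\<And>j i. j \<le> k \<Longrightarrow> i < n \<Longrightarrow> (SOME L. compatible n k V L) j i = L j (\<pi> i)"
    using compatible_unique[OF assms(2) *] by metis
  then have "G (SOME L. compatible n k V L) = G L"
    using assms(1) unfolding label_invariant_def by blast
  then show ?thesis using assms(2) unfolding lift_cochain_def by auto
qed

text \<open>Matrices are stored once per unordered configuration, with the rows in the order of this
  arbitrarily chosen labelling. \<open>relabel\<close> translates the rows of another labelling into
  this order and leaves all rows from \<open>n\<close> on in place.\<close>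

definition reference :: "nat \<Rightarrow> 'a set \<Rightarrow> nat \<Rightarrow> 'a"
  where "reference n D = (SOME x. labels n D x)"

definition relabel :: "nat \<Rightarrow> (nat \<Rightarrow> 'a) \<Rightarrow> nat \<Rightarrow> nat"
  where "relabel n x r = (if r < n then inv_into {..<n} (reference n (x ` {..<n})) (x r) else r)"

text \<open>The first \<open>n\<close> rows of the matrices are indexed by the points of the configuration.\<close>

definition conf_mat ::
  "nat \<Rightarrow> ('k \<times> nat \<Rightarrow> nat \<Rightarrow> real) \<Rightarrow> ('a set \<Rightarrow> 'k) \<Rightarrow> (nat \<Rightarrow> 'a) \<Rightarrow> nat \<Rightarrow> nat \<Rightarrow> real"
  where "conf_mat n u \<kappa> x = (\<lambda>i r. u (\<kappa> (x ` {..<n}), i) (relabel n x r))"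

lemma labels_reference:
  assumes "inj_on x {..<n}"
  shows "labels n (x ` {..<n}) (reference n (x ` {..<n}))"
  unfolding reference_def by (rule someI[of _ x]) (use assms in \<open>simp add: labels_def\<close>)

lemma relabel_less:
  assumes "inj_on x {..<n}" "r < n"
  shows "relabel n x r < n" "reference n (x ` {..<n}) (relabel n x r) = x r"
proof -
  have mem: "x r \<in> reference n (x ` {..<n}) ` {..<n}"
    using labels_reference[OF assms(1)] assms(2) by (auto simp: labels_def)
  show "relabel n x r < n" using inv_into_into[OF mem] assms(2) by (simp add: relabel_def)
  show "reference n (x ` {..<n}) (relabel n x r) = x r"
    using f_inv_into_f[OF mem] assms(2) by (simp add: relabel_def)
qed

lemma relabel_permutes:
  assumes "inj_on x {..<n}" "n \<le> d"
  shows "relabel n x permutes {..<d}"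
proof -
  have "inj_on (relabel n x) {..<n}"
  proof (rule inj_onI)
    fix r s assume rs: "r \<in> {..<n}" "s \<in> {..<n}" "relabel n x r = relabel n x s"
    then have "x r = x s" using relabel_less(2)[OF assms(1), of r] relabel_less(2)[OF assms(1), of s] by simp
    then show "r = s" using assms(1) rs by (simp add: inj_on_eq_iff)
  qed
  moreover have "relabel n x ` {..<n} \<subseteq> {..<n}" using relabel_less(1)[OF assms(1)] by auto
  ultimately have "bij_betw (relabel n x) {..<n} {..<n}" by (simp add: bij_betw_def endo_inj_surj)
  then have "relabel n x permutes {..<n}"
    by (rule bij_imp_permutes) (simp add: relabel_def)
  then show ?thesis by (rule permutes_subset) (use assms(2) in auto)
qed

lemma relabel_cong: "(\<And>i. i < n \<Longrightarrow> x i = y i) \<Longrightarrow> relabel n x = relabel n y"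
proof -
  assume *: "\<And>i. i < n \<Longrightarrow> x i = y i"
  then have "x ` {..<n} = y ` {..<n}" by (intro image_cong) auto
  then show ?thesis using * by (auto simp: relabel_def fun_eq_iff)
qed

lemma conf_mat_permute:
  assumes "\<pi> permutes {..<n}" "\<And>i. i < n \<Longrightarrow> x' i = x (\<pi> i)"
  shows "conf_mat n u \<kappa> x' = (\<lambda>i r. conf_mat n u \<kappa> x i (\<pi> r))"
proof -
  have "x' ` {..<n} = x ` \<pi> ` {..<n}" using assms(2) by (auto simp: image_image)
  then have im: "x' ` {..<n} = x ` {..<n}" using assms(1) by (simp add: permutes_image)
  have "relabel n x' r = relabel n x (\<pi> r)" for r
  proof (cases "r < n")
    case True
    then have "\<pi> r < n" using permutes_in_image[OF assms(1), of r] by simp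
    then show ?thesis using True im assms(2) by (simp add: relabel_def)
  next
    case False
    then have "\<pi> r = r" using permutes_not_in[OF assms(1), of r] by simp
    then show ?thesis using False by (simp add: relabel_def)
  qed
  then show ?thesis by (simp add: conf_mat_def im)
qed

text \<open>A permutation of the labels permutes the rows of all matrices in the same way, which
  preserves the linear relations between their columns.\<close>

lemma label_invariant_obstruction:
  fixes \<kappa> :: "'a set \<Rightarrow> 'k"
  assumes "n \<le> d"
  shows "label_invariant n k (\<lambda>L. obstruction d m k (\<lambda>j. conf_mat n u \<kappa> (L j)))"
  unfolding label_invariant_def
proof (intro allI impI)
  fix \<pi> and L L' :: "nat \<Rightarrow> nat \<Rightarrow> 'a"
  assume *: "\<pi> permutes {..<n}" "\<forall>j\<le>k. \<forall>i<n. L' j i = L j (\<pi> i)"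
  have "\<pi> permutes {..<d}" by (rule permutes_subset[OF *(1)]) (use assms in auto)
  then have "obstruction d m k (\<lambda>j. conf_mat n u \<kappa> (L j)) =
      obstruction d m k (\<lambda>j i r. conf_mat n u \<kappa> (L j) i (\<pi> r))"
    by (rule obstruction_row_permute[symmetric])
  also have "\<dots> = obstruction d m k (\<lambda>j. conf_mat n u \<kappa> (L' j))"
  proof (rule obstruction_cong)
    fix i j r assume "j \<le> k"
    then show "conf_mat n u \<kappa> (L j) i (\<pi> r) = conf_mat n u \<kappa> (L' j) i r"
      using conf_mat_permute[OF *(1), of "L' j" "L j" u \<kappa>] *(2) by simp
  qed
  finally show "obstruction d m k (\<lambda>j. conf_mat n u \<kappa> (L' j)) =
      obstruction d m k (\<lambda>j. conf_mat n u \<kappa> (L j))" ..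
qed

lemma label_invariant_prism:
  fixes \<kappa> \<kappa>' :: "'a set \<Rightarrow> 'k"
  assumes "n \<le> d"
  shows "label_invariant n q (\<lambda>L. prism_obstruction d m (Suc q)
           (\<lambda>j. conf_mat n u \<kappa> (L j)) (\<lambda>j. conf_mat n u \<kappa>' (L j)))"
  unfolding label_invariant_def
proof (intro allI impI)
  fix \<pi> and L L' :: "nat \<Rightarrow> nat \<Rightarrow> 'a"
  assume *: "\<pi> permutes {..<n}" "\<forall>j\<le>q. \<forall>i<n. L' j i = L j (\<pi> i)"
  have \<pi>: "\<pi> permutes {..<d}" by (rule permutes_subset[OF *(1)]) (use assms in auto)
  let ?M = "\<lambda>L j. conf_mat n u \<kappa> (L j)" and ?M' = "\<lambda>L j. conf_mat n u \<kappa>' (L j)"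
  have "obstruction d m (Suc q) (prism (?M L') (?M' L') l) = obstruction d m (Suc q) (prism (?M L) (?M' L) l)"
    if l: "l < Suc q" for l
  proof -
    have "obstruction d m (Suc q) (prism (?M L) (?M' L) l) =
        obstruction d m (Suc q) (\<lambda>j i r. prism (?M L) (?M' L) l j i (\<pi> r))"
      by (rule obstruction_row_permute[OF \<pi>, symmetric])
    also have "\<dots> = obstruction d m (Suc q) (prism (?M L') (?M' L') l)"
    proof (rule obstruction_cong)
      fix i j r assume "j \<le> Suc q"
      then have "j \<le> l \<Longrightarrow> j \<le> q" "\<not> j \<le> l \<Longrightarrow> j - 1 \<le> q" using l by auto
      moreover have "j \<le> q \<Longrightarrow> conf_mat n u \<kappa> (L' j) = (\<lambda>i r. conf_mat n u \<kappa> (L j) i (\<pi> r))"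
          "j - 1 \<le> q \<Longrightarrow> conf_mat n u \<kappa>' (L' (j - 1)) = (\<lambda>i r. conf_mat n u \<kappa>' (L (j - 1)) i (\<pi> r))"
        using conf_mat_permute[OF *(1)] *(2) by blast+
      ultimately show "prism (?M L) (?M' L) l j i (\<pi> r) = prism (?M L') (?M' L') l j i r"
        by (simp add: prism_def)
    qed
    finally show ?thesis ..
  qed
  then show "prism_obstruction d m (Suc q) (?M L') (?M' L') = prism_obstruction d m (Suc q) (?M L) (?M' L)"
    unfolding prism_obstruction_def by (intro sum.cong) auto
qed

lemma compatible_inj: "compatible n k V L \<Longrightarrow> j \<le> k \<Longrightarrow> inj_on (L j) {..<n}"
  by (simp add: compatible_def labels_def)

lemma compatible_image: "compatible n k V L \<Longrightarrow> j \<le> k \<Longrightarrow> L j ` {..<n} = V j"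
  by (simp add: compatible_def labels_def)

lemma compatible_relabel:
  assumes "compatible n k V L" "j \<le> k" "j' \<le> k" "V j = V j'"
  shows "relabel n (L j) = relabel n (L j')"
  using compatible_same[OF assms] by (rule relabel_cong)

text \<open>On simplices that admit a compatible labelling, this labelling restricts to the faces,
  and the lifted cochain inherits the cocycle property. The key \<open>\<kappa> D\<close> selects
  the stored matrix of \<open>D\<close>.\<close>

lemma configuration_cocycle:
  fixes u :: "'k \<times> nat \<Rightarrow> nat \<Rightarrow> real" and S :: "('k \<times> nat) set"
  assumes "2 \<le> m" "d + 1 = m + k" "n \<le> d" "generic d S u" "inj \<kappa>"
    and small: "\<And>f. f \<in> Poly_Mapping.keys c \<Longrightarrow> \<exists>L. compatible n (Suc k) (vertices (Suc k) f) L"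
    and S: "\<And>f j i. f \<in> Poly_Mapping.keys c \<Longrightarrow> j \<le> Suc k \<Longrightarrow> i < m \<Longrightarrow> (\<kappa> (vertices (Suc k) f j), i) \<in> S"
  shows "chain_eval k (lift_cochain n k (\<lambda>L. obstruction d m k (\<lambda>j. conf_mat n u \<kappa> (L j))))
           (chain_boundary (Suc k) c) = 0"
  unfolding chain_eval_boundary
proof (rule sum.neutral, intro ballI)
  fix f assume f: "f \<in> Poly_Mapping.keys c"
  let ?V = "vertices (Suc k) f"
  obtain L where L: "compatible n (Suc k) ?V L" using small[OF f] by blast
  have "(\<Sum>i\<le>Suc k. lift_cochain n k (\<lambda>L. obstruction d m k (\<lambda>j. conf_mat n u \<kappa> (L j)))
          (restrict (\<lambda>l. ?V (skip i l)) {..k})) =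
      (\<Sum>i\<le>Suc k. obstruction d m k (\<lambda>j. conf_mat n u \<kappa> (L (skip i j))))"
    by (rule sum.cong[OF refl], rule lift_cochain_eq[OF label_invariant_obstruction[OF assms(3)] compatible_face[OF L]])
  also have "\<dots> = 0"
  proof (rule obstruction_cocycle_generic[OF assms(1,2,4), where key = "\<lambda>j. \<kappa> (?V j)"
        and \<rho> = "\<lambda>j. relabel n (L j)"])
    fix j assume j: "j \<le> Suc k"
    show "relabel n (L j) permutes {..<d}" by (rule relabel_permutes[OF compatible_inj[OF L j] assms(3)])
    show "(\<kappa> (?V j), i) \<in> S" if "i < m" for i using S[OF f j that] .
    show "conf_mat n u \<kappa> (L j) i r = u (\<kappa> (?V j), i) (relabel n (L j) r)" for i r
      by (simp add: conf_mat_def compatible_image[OF L j])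
    fix j' assume j': "j' \<le> Suc k" and "\<kappa> (?V j) = \<kappa> (?V j')"
    then have "?V j = ?V j'" using assms(5) by (simp add: inj_eq)
    then show "relabel n (L j) = relabel n (L j')" by (rule compatible_relabel[OF L j j'])
  qed
  finally show "of_int (Poly_Mapping.lookup c f) * (\<Sum>i\<le>Suc k. lift_cochain n k
      (\<lambda>L. obstruction d m k (\<lambda>j. conf_mat n u \<kappa> (L j))) (restrict (\<lambda>l. ?V (skip i l)) {..k})) = 0"
    by (simp only: mult_zero_right)
qed

text \<open>Two families of matrices over the same configurations have cohomologous obstructions,
  with the prism as the connecting cochain. This is what allows the matrices to be deformed without
  writing down a homotopy.\<close>

lemma configuration_prism:
  fixes u :: "'k \<times> nat \<Rightarrow> nat \<Rightarrow> real" and S :: "('k \<times> nat) set"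
  assumes "2 \<le> m" "d + 1 = m + Suc q" "n \<le> d" "generic d S u" "inj \<kappa>" "inj \<kappa>'"
    and disj: "\<And>D D'. \<kappa> D \<noteq> \<kappa>' D'"
    and small: "\<And>f. f \<in> Poly_Mapping.keys c \<Longrightarrow> \<exists>L. compatible n (Suc q) (vertices (Suc q) f) L"
    and S: "\<And>f j i. f \<in> Poly_Mapping.keys c \<Longrightarrow> j \<le> Suc q \<Longrightarrow> i < m \<Longrightarrow>
      (\<kappa> (vertices (Suc q) f j), i) \<in> S \<and> (\<kappa>' (vertices (Suc q) f j), i) \<in> S"
  shows "chain_eval (Suc q) (lift_cochain n (Suc q) (\<lambda>L. obstruction d m (Suc q) (\<lambda>j. conf_mat n u \<kappa> (L j)))) c +
      chain_eval (Suc q) (lift_cochain n (Suc q) (\<lambda>L. obstruction d m (Suc q) (\<lambda>j. conf_mat n u \<kappa>' (L j)))) c =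
      chain_eval q (lift_cochain n q (\<lambda>L. prism_obstruction d m (Suc q) (\<lambda>j. conf_mat n u \<kappa> (L j))
        (\<lambda>j. conf_mat n u \<kappa>' (L j)))) (chain_boundary (Suc q) c)"
  unfolding chain_eval_boundary unfolding chain_eval_def sum.distrib[symmetric] distrib_left[symmetric]
proof (rule sum.cong[OF refl], rule arg_cong[where f = "(*) _"])
  fix f assume f: "f \<in> Poly_Mapping.keys c"
  let ?V = "vertices (Suc q) f"
  obtain L where L: "compatible n (Suc q) ?V L" using small[OF f] by blast
  have eq: "lift_cochain n (Suc q) (\<lambda>L. obstruction d m (Suc q) (\<lambda>j. conf_mat n u K (L j))) ?V =
      obstruction d m (Suc q) (\<lambda>j. conf_mat n u K (L j))" for K
    by (rule lift_cochain_eq[OF label_invariant_obstruction[OF assms(3)] L])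
  have eq': "lift_cochain n q (\<lambda>L. prism_obstruction d m (Suc q) (\<lambda>j. conf_mat n u \<kappa> (L j))
        (\<lambda>j. conf_mat n u \<kappa>' (L j))) (restrict (\<lambda>l. ?V (skip i l)) {..q}) =
      prism_obstruction d m (Suc q) (\<lambda>j. conf_mat n u \<kappa> (L (skip i j))) (\<lambda>j. conf_mat n u \<kappa>' (L (skip i j)))" for i
    by (rule lift_cochain_eq[OF label_invariant_prism[OF assms(3)] compatible_face[OF L]])
  show "lift_cochain n (Suc q) (\<lambda>L. obstruction d m (Suc q) (\<lambda>j. conf_mat n u \<kappa> (L j))) ?V +
      lift_cochain n (Suc q) (\<lambda>L. obstruction d m (Suc q) (\<lambda>j. conf_mat n u \<kappa>' (L j))) ?V =
      (\<Sum>i\<le>Suc q. lift_cochain n q (\<lambda>L. prism_obstruction d m (Suc q) (\<lambda>j. conf_mat n u \<kappa> (L j))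
        (\<lambda>j. conf_mat n u \<kappa>' (L j))) (restrict (\<lambda>l. ?V (skip i l)) {..q}))"
    unfolding eq eq'
  proof (rule obstruction_prism_generic[OF assms(1,2,4), where key = "\<lambda>j. \<kappa> (?V j)" and key' = "\<lambda>j. \<kappa>' (?V j)"
        and \<rho> = "\<lambda>j. relabel n (L j)" and \<rho>' = "\<lambda>j. relabel n (L j)"])
    fix j assume j: "j \<le> Suc q"
    show "relabel n (L j) permutes {..<d} \<and> relabel n (L j) permutes {..<d}"
      using relabel_permutes[OF compatible_inj[OF L j] assms(3)] by simp
    show "(\<kappa> (?V j), i) \<in> S \<and> (\<kappa>' (?V j), i) \<in> S" if "i < m" for i using S[OF f j that] .
    show "conf_mat n u \<kappa> (L j) i r = u (\<kappa> (?V j), i) (relabel n (L j) r) \<and>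
        conf_mat n u \<kappa>' (L j) i r = u (\<kappa>' (?V j), i) (relabel n (L j) r)" for i r
      by (simp add: conf_mat_def compatible_image[OF L j])
    fix j' assume j': "j' \<le> Suc q"
    show "\<kappa> (?V j) \<noteq> \<kappa>' (?V j')" by (rule disj)
    show "relabel n (L j) = relabel n (L j')" if "\<kappa> (?V j) = \<kappa> (?V j')"
      using that assms(5) compatible_relabel[OF L j j'] by (simp add: inj_eq)
    show "relabel n (L j) = relabel n (L j')" if "\<kappa>' (?V j) = \<kappa>' (?V j')"
      using that assms(6) compatible_relabel[OF L j j'] by (simp add: inj_eq)
  qed
qed

text \<open>The variant for simplices of the cube, where the diagrams carry labels throughout, so
  that the row order \<open>\<rho> x\<close> is a function of the vertex.\<close>

definition vertex_mat :: "('k \<times> nat \<Rightarrow> nat \<Rightarrow> real) \<Rightarrow> ('a \<Rightarrow> 'k) \<Rightarrow> ('a \<Rightarrow> nat \<Rightarrow> nat) \<Rightarrow> 'a \<Rightarrow> nat \<Rightarrow> nat \<Rightarrow> real"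
  where "vertex_mat u \<kappa> \<rho> x = (\<lambda>i r. u (\<kappa> x, i) (\<rho> x r))"

lemma vertex_cocycle:
  fixes u :: "'k \<times> nat \<Rightarrow> nat \<Rightarrow> real" and S :: "('k \<times> nat) set"
  assumes "2 \<le> m" "d + 1 = m + k" "generic d S u"
    and V: "\<And>f j. f \<in> Poly_Mapping.keys c \<Longrightarrow> j \<le> Suc k \<Longrightarrow> \<rho> (vertices (Suc k) f j) permutes {..<d}"
    and \<rho>: "\<And>f j j'. f \<in> Poly_Mapping.keys c \<Longrightarrow> j \<le> Suc k \<Longrightarrow> j' \<le> Suc k \<Longrightarrow>
      \<kappa> (vertices (Suc k) f j) = \<kappa> (vertices (Suc k) f j') \<Longrightarrow> \<rho> (vertices (Suc k) f j) = \<rho> (vertices (Suc k) f j')"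
    and S: "\<And>f j i. f \<in> Poly_Mapping.keys c \<Longrightarrow> j \<le> Suc k \<Longrightarrow> i < m \<Longrightarrow> (\<kappa> (vertices (Suc k) f j), i) \<in> S"
  shows "chain_eval k (\<lambda>V. obstruction d m k (\<lambda>j. vertex_mat u \<kappa> \<rho> (V j))) (chain_boundary (Suc k) c) = 0"
  unfolding chain_eval_boundary
proof (rule sum.neutral, intro ballI)
  fix f assume f: "f \<in> Poly_Mapping.keys c"
  let ?V = "vertices (Suc k) f"
  have "(\<Sum>i\<le>Suc k. obstruction d m k (\<lambda>j. vertex_mat u \<kappa> \<rho> (restrict (\<lambda>l. ?V (skip i l)) {..k} j))) =
      (\<Sum>i\<le>Suc k. obstruction d m k (\<lambda>j. vertex_mat u \<kappa> \<rho> (?V (skip i j))))"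
    by (rule sum.cong[OF refl], rule obstruction_cong) simp
  also have "\<dots> = 0"
    by (rule obstruction_cocycle_generic[OF assms(1-3), where key = "\<lambda>j. \<kappa> (?V j)" and \<rho> = "\<lambda>j. \<rho> (?V j)"])
       (rule S[OF f], assumption+, simp add: vertex_mat_def, rule V[OF f], assumption, rule \<rho>[OF f], assumption+)
  finally show "of_int (Poly_Mapping.lookup c f) * (\<Sum>i\<le>Suc k. obstruction d m k
      (\<lambda>j. vertex_mat u \<kappa> \<rho> (restrict (\<lambda>l. ?V (skip i l)) {..k} j))) = 0"
    by (simp only: mult_zero_right)
qed

lemma vertex_prism:
  fixes u :: "'k \<times> nat \<Rightarrow> nat \<Rightarrow> real" and S :: "('k \<times> nat) set"
  assumes "2 \<le> m" "d + 1 = m + Suc q" "generic d S u"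
    and V: "\<And>f j. f \<in> Poly_Mapping.keys c \<Longrightarrow> j \<le> Suc q \<Longrightarrow>
      \<rho> (vertices (Suc q) f j) permutes {..<d} \<and> \<rho>' (vertices (Suc q) f j) permutes {..<d}"
    and \<rho>: "\<And>f j j'. f \<in> Poly_Mapping.keys c \<Longrightarrow> j \<le> Suc q \<Longrightarrow> j' \<le> Suc q \<Longrightarrow>
      \<kappa> (vertices (Suc q) f j) = \<kappa> (vertices (Suc q) f j') \<Longrightarrow> \<rho> (vertices (Suc q) f j) = \<rho> (vertices (Suc q) f j')"
    and \<rho>': "\<And>f j j'. f \<in> Poly_Mapping.keys c \<Longrightarrow> j \<le> Suc q \<Longrightarrow> j' \<le> Suc q \<Longrightarrow>
      \<kappa>' (vertices (Suc q) f j) = \<kappa>' (vertices (Suc q) f j') \<Longrightarrow> \<rho>' (vertices (Suc q) f j) = \<rho>' (vertices (Suc q) f j')"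
    and disj: "\<And>x y. \<kappa> x \<noteq> \<kappa>' y"
    and S: "\<And>f j i. f \<in> Poly_Mapping.keys c \<Longrightarrow> j \<le> Suc q \<Longrightarrow> i < m \<Longrightarrow>
      (\<kappa> (vertices (Suc q) f j), i) \<in> S \<and> (\<kappa>' (vertices (Suc q) f j), i) \<in> S"
  shows "chain_eval (Suc q) (\<lambda>V. obstruction d m (Suc q) (\<lambda>j. vertex_mat u \<kappa> \<rho> (V j))) c +
      chain_eval (Suc q) (\<lambda>V. obstruction d m (Suc q) (\<lambda>j. vertex_mat u \<kappa>' \<rho>' (V j))) c =
      chain_eval q (\<lambda>V. prism_obstruction d m (Suc q) (\<lambda>j. vertex_mat u \<kappa> \<rho> (V j))
        (\<lambda>j. vertex_mat u \<kappa>' \<rho>' (V j))) (chain_boundary (Suc q) c)"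
  unfolding chain_eval_boundary unfolding chain_eval_def sum.distrib[symmetric] distrib_left[symmetric]
proof (rule sum.cong[OF refl], rule arg_cong[where f = "(*) _"])
  fix f assume f: "f \<in> Poly_Mapping.keys c"
  let ?V = "vertices (Suc q) f" and ?M = "vertex_mat u \<kappa> \<rho>" and ?M' = "vertex_mat u \<kappa>' \<rho>'"
  have eq: "prism_obstruction d m (Suc q) (\<lambda>j. ?M (restrict (\<lambda>l. ?V (skip i l)) {..q} j))
        (\<lambda>j. ?M' (restrict (\<lambda>l. ?V (skip i l)) {..q} j)) =
      prism_obstruction d m (Suc q) (\<lambda>j. ?M (?V (skip i j))) (\<lambda>j. ?M' (?V (skip i j)))" for i
    unfolding prism_obstruction_def
    by (rule sum.cong[OF refl], rule obstruction_cong) (auto simp: prism_def)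
  show "obstruction d m (Suc q) (\<lambda>j. ?M (?V j)) + obstruction d m (Suc q) (\<lambda>j. ?M' (?V j)) =
      (\<Sum>i\<le>Suc q. prism_obstruction d m (Suc q) (\<lambda>j. ?M (restrict (\<lambda>l. ?V (skip i l)) {..q} j))
        (\<lambda>j. ?M' (restrict (\<lambda>l. ?V (skip i l)) {..q} j)))"
    unfolding eq
    by (rule obstruction_prism_generic[OF assms(1-3), where key = "\<lambda>j. \<kappa> (?V j)" and \<rho> = "\<lambda>j. \<rho> (?V j)"
          and key' = "\<lambda>j. \<kappa>' (?V j)" and \<rho>' = "\<lambda>j. \<rho>' (?V j)"])
       (rule S[OF f], assumption+, simp add: vertex_mat_def, rule V[OF f], assumption,
        rule \<rho>[OF f], assumption+, rule \<rho>'[OF f], assumption+, rule disj)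
qed

section \<open>Vanishing near a matrix\<close>

text \<open>Changing each coordinate by less than \<open>\<rho>\<close> changes the value of
  \<open>y\<close> by at most \<open>\<rho>\<close> times its absolute coefficient sum.
  \<open>S\<close> exceeds this sum by one, and \<open>\<gamma>\<close> bounds the values on
  \<open>B\<close> from below.\<close>

lemma robust_functional:
  fixes B :: "(nat \<Rightarrow> real) set"
  assumes "finite B" "\<And>b. b \<in> B \<Longrightarrow> 0 < (\<Sum>r<d. y r * b r)"
  obtains \<rho> where "0 < \<rho>"
    "\<And>b v. b \<in> B \<Longrightarrow> (\<And>r. r < d \<Longrightarrow> \<bar>v r - b r\<bar> < \<rho>) \<Longrightarrow> 0 < (\<Sum>r<d. y r * v r)"
proof -
  define \<gamma> where "\<gamma> = Min (insert 1 ((\<lambda>b. \<Sum>r<d. y r * b r) ` B))"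
  define S where "S = 1 + (\<Sum>r<d. \<bar>y r\<bar>)"
  have \<gamma>: "0 < \<gamma>" "\<And>b. b \<in> B \<Longrightarrow> \<gamma> \<le> (\<Sum>r<d. y r * b r)"
    using assms by (auto simp: \<gamma>_def)
  have S: "1 \<le> S" by (simp add: S_def sum_nonneg)
  show ?thesis
  proof
    show "0 < \<gamma> / S" using \<gamma> S by simp
    fix b v assume b: "b \<in> B" and v: "\<And>r. r < d \<Longrightarrow> \<bar>v r - b r\<bar> < \<gamma> / S"
    have "(\<Sum>r<d. y r * b r) - (\<Sum>r<d. y r * v r) = (\<Sum>r<d. y r * (b r - v r))"
      by (simp add: right_diff_distrib sum_subtractf)
    also have "\<dots> \<le> (\<Sum>r<d. \<bar>y r\<bar> * (\<gamma> / S))"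
    proof (rule sum_mono)
      fix r assume "r \<in> {..<d}"
      then have "\<bar>b r - v r\<bar> \<le> \<gamma> / S" using v[of r] by (simp add: abs_minus_commute)
      then have "\<bar>y r\<bar> * \<bar>b r - v r\<bar> \<le> \<bar>y r\<bar> * (\<gamma> / S)" by (rule mult_left_mono) simp
      then show "y r * (b r - v r) \<le> \<bar>y r\<bar> * (\<gamma> / S)"
        using abs_ge_self[of "y r * (b r - v r)"] by (simp add: abs_mult)
    qed
    also have "\<dots> = (S - 1) * (\<gamma> / S)" unfolding sum_distrib_right[symmetric] by (simp add: S_def)
    also have "\<dots> < \<gamma>" using \<gamma>(1) S by (simp add: field_simps)
    finally show "0 < (\<Sum>r<d. y r * v r)" using \<gamma>(2)[OF b] by linarith
  qed
qed

definition near :: "nat \<Rightarrow> nat \<Rightarrow> real \<Rightarrow> (nat \<Rightarrow> nat \<Rightarrow> real) \<Rightarrow> (nat \<Rightarrow> nat \<Rightarrow> real) \<Rightarrow> bool"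
  where "near d m \<rho> M B \<longleftrightarrow> (\<forall>i<m. \<forall>r<d. \<bar>M i r - B i r\<bar> < \<rho>)"

lemma near_mono: "near d m \<rho> M B \<Longrightarrow> \<rho> \<le> \<rho>' \<Longrightarrow> near d m \<rho>' M B"
  unfolding near_def by (meson less_le_trans)

lemma uniform_radius:
  fixes P :: "'i \<Rightarrow> real \<Rightarrow> bool"
  assumes "finite I" "\<And>i. i \<in> I \<Longrightarrow> \<exists>\<rho>>0. P i \<rho>" "\<And>i \<rho> \<rho>'. P i \<rho> \<Longrightarrow> 0 < \<rho>' \<Longrightarrow> \<rho>' \<le> \<rho> \<Longrightarrow> P i \<rho>'"
  obtains \<rho> where "0 < \<rho>" "\<And>i. i \<in> I \<Longrightarrow> P i \<rho>"
proof -
  have "\<exists>\<rho>>0. \<forall>i\<in>I. P i \<rho>"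
    using assms(1,2)
  proof (induction I)
    case (insert i I)
    then obtain a b where "0 < a" "P i a" "0 < b" "\<forall>i\<in>I. P i b" by (meson insertCI)
    then show ?case
      using assms(3)[of i a "min a b"] assms(3)[of _ b "min a b"] by (intro exI[of _ "min a b"]) auto
  qed (auto intro: exI[of _ 1])
  then show ?thesis using that by blast
qed

text \<open>\<open>Bs\<close> contains the model matrices, and \<open>Q i B\<close> tells whether
  column \<open>i\<close> may come from the model \<open>B\<close>. In this way the functional may
  be positive on only some of the models where the last column is concerned.\<close>

lemma robust_not_balanced:
  fixes Bs :: "(nat \<Rightarrow> nat \<Rightarrow> real) set"
  assumes "finite Bs" "finite C"
    and pos: "\<And>i B. i \<in> fst ` C \<Longrightarrow> B \<in> Bs \<Longrightarrow> Q i B \<Longrightarrow> 0 < (\<Sum>r<d. y r * (\<epsilon> i * B i r))"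
    and \<epsilon>: "\<And>i. i < m \<Longrightarrow> \<epsilon> i = 1 \<or> \<epsilon> i = -1" and C: "fst ` C \<subseteq> {..<m}"
  obtains \<rho> where "0 < \<rho>"
    "\<And>M. (\<And>i j. (i, j) \<in> C \<Longrightarrow> \<exists>B\<in>Bs. Q i B \<and> near d m \<rho> (M j) B) \<Longrightarrow> \<not> balanced d C (signed \<epsilon> M)"
proof -
  define B where "B = (\<lambda>(i, B) r. \<epsilon> i * B i r) ` {(i, B) \<in> fst ` C \<times> Bs. Q i B}"
  have "finite {(i, B) \<in> fst ` C \<times> Bs. Q i B}"
    by (rule finite_subset[of _ "fst ` C \<times> Bs"]) (use assms in auto)
  then have "finite B" by (simp add: B_def)
  have posB: "0 < (\<Sum>r<d. y r * b r)" if b: "b \<in> B" for b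
  proof -
    obtain i A where "i \<in> fst ` C" "A \<in> Bs" "Q i A" "b = (\<lambda>r. \<epsilon> i * A i r)"
      using b unfolding B_def by auto
    then show ?thesis using pos by simp
  qed
  obtain \<rho> where \<rho>: "0 < \<rho>"
      "\<And>b v. b \<in> B \<Longrightarrow> (\<And>r. r < d \<Longrightarrow> \<bar>v r - b r\<bar> < \<rho>) \<Longrightarrow> 0 < (\<Sum>r<d. y r * v r)"
  proof (rule robust_functional[OF \<open>finite B\<close> posB])
    fix \<rho> assume *: "0 < \<rho>"
      "\<And>b v. b \<in> B \<Longrightarrow> (\<And>r. r < d \<Longrightarrow> \<bar>v r - b r\<bar> < \<rho>) \<Longrightarrow> 0 < (\<Sum>r<d. y r * v r)"
    show thesis by (rule that[OF *(1)], rule *(2), assumption, blast)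
  qed
  show ?thesis
  proof (rule that[OF \<rho>(1)])
    fix M assume M: "\<And>i j. (i, j) \<in> C \<Longrightarrow> \<exists>B\<in>Bs. Q i B \<and> near d m \<rho> (M j) B"
    show "\<not> balanced d C (signed \<epsilon> M)"
    proof (rule not_balanced_functional[where y = y, OF assms(2)])
      fix t assume "t \<in> C"
      obtain i j where t: "t = (i, j)" by (cases t)
      have i: "i \<in> fst ` C" using \<open>t \<in> C\<close> t by force
      then have im: "i < m" using C by auto
      obtain A where A: "A \<in> Bs" "Q i A" "near d m \<rho> (M j) A" using M \<open>t \<in> C\<close> t by blast
      have "(\<lambda>r. \<epsilon> i * A i r) \<in> B"
        unfolding B_def by (rule image_eqI[of _ _ "(i, A)"]) (use A i in auto)
      moreover have "\<bar>signed \<epsilon> M t r - \<epsilon> i * A i r\<bar> < \<rho>" if "r < d" for r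
      proof -
        have "signed \<epsilon> M t r - \<epsilon> i * A i r = \<epsilon> i * (M j i r - A i r)"
          by (simp add: signed_def t right_diff_distrib)
        moreover have "\<bar>\<epsilon> i\<bar> = 1" using \<epsilon>[OF im] by auto
        ultimately have "\<bar>signed \<epsilon> M t r - \<epsilon> i * A i r\<bar> = \<bar>M j i r - A i r\<bar>" by (simp add: abs_mult)
        then show ?thesis using A(3) im that by (simp add: near_def)
      qed
      ultimately show "0 < (\<Sum>r<d. y r * signed \<epsilon> M t r)" using \<rho>(2) by blast
    qed
  qed
qed

lemma finite_paths_signs: "finite (paths m k \<times> signs m)"
  by (simp add: finite_paths finite_signs)

text \<open>For each sign pattern one functional has to be positive on the signed columns of all
  models at once, because the cells of a path combine columns taken at different vertices.\<close>

lemma obstruction_eq_0_near: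
  fixes Bs :: "(nat \<Rightarrow> nat \<Rightarrow> real) set"
  assumes "finite Bs"
    and ex: "\<And>\<epsilon>. (\<And>i. i < m \<Longrightarrow> \<epsilon> i = 1 \<or> \<epsilon> i = -1) \<Longrightarrow>
      \<exists>y. \<forall>B\<in>Bs. \<forall>i<m. 0 < (\<Sum>r<d. y r * (\<epsilon> i * B i r))"
  obtains \<rho> where "0 < \<rho>"
    "\<And>M. (\<And>j. j \<le> k \<Longrightarrow> \<exists>B\<in>Bs. near d m \<rho> (M j) B) \<Longrightarrow> obstruction d m k M = 0"
proof -
  let ?P = "\<lambda>(p, \<epsilon>) \<rho>. \<forall>M. (\<forall>j\<le>k. \<exists>B\<in>Bs. near d m \<rho> (M j) B) \<longrightarrow> \<not> balanced d (cells m p) (signed \<epsilon> M)"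
  obtain \<rho> where \<rho>: "0 < \<rho>" "\<And>i. i \<in> paths m k \<times> signs m \<Longrightarrow> ?P i \<rho>"
  proof (rule uniform_radius[of "paths m k \<times> signs m" ?P])
    show "finite (paths m k \<times> signs m)" by (rule finite_paths_signs)
    fix i assume "i \<in> paths m k \<times> signs m"
    then obtain p \<epsilon> where i: "i = (p, \<epsilon>)" "p \<in> paths m k" "\<epsilon> \<in> signs m" by auto
    have \<epsilon>: "\<epsilon> i = 1 \<or> \<epsilon> i = -1" if "i < m" for i using signs_cases[OF i(3) that] .
    obtain y where y: "\<And>B i. B \<in> Bs \<Longrightarrow> i < m \<Longrightarrow> 0 < (\<Sum>r<d. y r * (\<epsilon> i * B i r))"
    proof -
      have "\<exists>y. \<forall>B\<in>Bs. \<forall>i<m. 0 < (\<Sum>r<d. y r * (\<epsilon> i * B i r))" by (rule ex, rule \<epsilon>)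
      then show ?thesis using that by blast
    qed
    have sub: "fst ` cells m p \<subseteq> {..<m}" by (auto simp: cells_def)
    obtain \<rho> where "0 < \<rho>" "\<And>M. (\<And>i j. (i, j) \<in> cells m p \<Longrightarrow> \<exists>B\<in>Bs. True \<and> near d m \<rho> (M j) B) \<Longrightarrow>
        \<not> balanced d (cells m p) (signed \<epsilon> M)"
    proof (rule robust_not_balanced[OF assms(1) finite_cells[of m p], where Q = "\<lambda>_ _. True" and d = d
          and y = y and \<epsilon> = \<epsilon> and m = m])
      show "0 < (\<Sum>r<d. y r * (\<epsilon> i * B i r))" if "i \<in> fst ` cells m p" "B \<in> Bs" for i B
        by (rule y) (use that sub in auto)
    qed (use \<epsilon> sub in blast)+
    moreover have "j \<le> k" if "(i, j) \<in> cells m p" for i j using cells_subset[OF i(2)] that by auto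
    ultimately show "\<exists>\<rho>>0. ?P i \<rho>" unfolding i(1) prod.case by blast
  next
    fix i \<rho> \<rho>' assume "?P i \<rho>" "0 < \<rho>'" "\<rho>' \<le> \<rho>"
    obtain p \<epsilon> where i: "i = (p, \<epsilon>)" by (cases i)
    show "?P i \<rho>'" unfolding i prod.case
    proof (intro allI impI)
      fix M assume *: "\<forall>j\<le>k. \<exists>B\<in>Bs. near d m \<rho>' (M j) B"
      have "\<forall>j\<le>k. \<exists>B\<in>Bs. near d m \<rho> (M j) B"
      proof (intro allI impI)
        fix j assume "j \<le> k"
        then obtain B where "B \<in> Bs" "near d m \<rho>' (M j) B" using * by blast
        then show "\<exists>B\<in>Bs. near d m \<rho> (M j) B" using near_mono[OF _ \<open>\<rho>' \<le> \<rho>\<close>] by blast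
      qed
      then show "\<not> balanced d (cells m p) (signed \<epsilon> M)" using \<open>?P i \<rho>\<close> unfolding i prod.case by blast
    qed
  qed blast
  show ?thesis
  proof (rule that[OF \<rho>(1)])
    fix M assume M: "\<And>j. j \<le> k \<Longrightarrow> \<exists>B\<in>Bs. near d m \<rho> (M j) B"
    have "\<not> balanced d (cells m p) (signed \<epsilon> M)" if "p \<in> paths m k" "\<epsilon> \<in> signs m" for p \<epsilon>
      using \<rho>(2)[of "(p, \<epsilon>)"] that M by simp
    then show "obstruction d m k M = 0"
      unfolding obstruction_def sign_count_def by (intro sum.neutral ballI) simp
  qed
qed

text \<open>A functional with the prescribed values on \<open>U\<close> is corrected by a large
  multiple of \<open>h\<close>, which leaves these values alone and makes the values on the finite
  set \<open>X\<close> positive.\<close>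

lemma mixed_functional:
  fixes X :: "(nat \<Rightarrow> real) set" and mm :: nat
  assumes "finite X" "indep d {..<mm} U"
    and hU: "\<And>i. i < mm \<Longrightarrow> (\<Sum>r<d. h r * U i r) = 0"
    and hx: "\<And>x. x \<in> X \<Longrightarrow> 0 < (\<Sum>r<d. h r * x r)"
  obtains y where "\<And>i. i < mm \<Longrightarrow> (\<Sum>r<d. y r * U i r) = \<epsilon> i" "\<And>x. x \<in> X \<Longrightarrow> 0 < (\<Sum>r<d. y r * x r)"
proof -
  obtain y0 where y0: "\<And>i. i < mm \<Longrightarrow> (\<Sum>r<d. y0 r * U i r) = \<epsilon> i"
  proof (rule indep_dual_functional[OF finite_lessThan assms(2), of \<epsilon>])
    fix y assume "\<And>t. t \<in> {..<mm} \<Longrightarrow> (\<Sum>r<d. y r * U t r) = \<epsilon> t"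
    then show thesis by (intro that[of y]) simp
  qed
  \<comment> \<open>A sum instead of a maximum, which makes sense for empty \<open>X\<close> as
    well.\<close>
  define K where "K = (\<Sum>x\<in>X. (1 + \<bar>\<Sum>r<d. y0 r * x r\<bar>) / (\<Sum>r<d. h r * x r))"
  have K: "(1 + \<bar>\<Sum>r<d. y0 r * x r\<bar>) / (\<Sum>r<d. h r * x r) \<le> K" if "x \<in> X" for x
    unfolding K_def by (rule member_le_sum) (use that assms(1) hx in \<open>auto simp: less_imp_le\<close>)
  have split: "(\<Sum>r<d. (y0 r + K * h r) * x r) = (\<Sum>r<d. y0 r * x r) + K * (\<Sum>r<d. h r * x r)" for x
    by (simp add: distrib_right sum.distrib sum_distrib_left mult.assoc)
  show ?thesis
  proof (rule that[of "\<lambda>r. y0 r + K * h r"])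
    show "(\<Sum>r<d. (y0 r + K * h r) * U i r) = \<epsilon> i" if "i < mm" for i
      using y0[OF that] hU[OF that] by (simp add: split)
    fix x assume x: "x \<in> X"
    have "1 + \<bar>\<Sum>r<d. y0 r * x r\<bar> \<le> K * (\<Sum>r<d. h r * x r)"
      using K[OF x] hx[OF x] by (simp add: pos_divide_le_eq)
    then show "0 < (\<Sum>r<d. (y0 r + K * h r) * x r)" unfolding split by linarith
  qed
qed

definition append_col :: "nat \<Rightarrow> (nat \<Rightarrow> nat \<Rightarrow> real) \<Rightarrow> (nat \<Rightarrow> real) \<Rightarrow> nat \<Rightarrow> nat \<Rightarrow> real"
  where "append_col mm U x = (\<lambda>i. if i < mm then U i else x)"

lemma append_col_functional:
  fixes X :: "(nat \<Rightarrow> real) set" and mm :: nat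
  assumes "finite X" "indep d {..<mm} U"
    and hU: "\<And>i. i < mm \<Longrightarrow> (\<Sum>r<d. h r * U i r) = 0"
    and hx: "\<And>x. x \<in> X \<Longrightarrow> 0 < (\<Sum>r<d. h r * x r)"
    and \<epsilon>: "\<And>i. i < Suc mm \<Longrightarrow> \<epsilon> i = 1 \<or> \<epsilon> i = (-1 :: real)"
  obtains y where
    "\<And>i x. i < Suc mm \<Longrightarrow> x \<in> X \<or> i < mm \<Longrightarrow> 0 < (\<Sum>r<d. y r * (\<epsilon> i * append_col mm U x i r))"
proof -
  have \<epsilon>2: "\<epsilon> i * \<epsilon> i = 1" if "i < Suc mm" for i using \<epsilon>[OF that] by auto
  have eq: "(\<Sum>r<d. (\<epsilon> mm * h r) * (\<epsilon> mm * x r)) = (\<Sum>r<d. h r * x r)" for x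
  proof (rule sum.cong[OF refl])
    fix r show "(\<epsilon> mm * h r) * (\<epsilon> mm * x r) = h r * x r"
    proof -
      have "(\<epsilon> mm * h r) * (\<epsilon> mm * x r) = (\<epsilon> mm * \<epsilon> mm) * (h r * x r)" by (simp only: mult_ac)
      then show ?thesis using \<epsilon>2[of mm] by simp
    qed
  qed
  have hU': "(\<Sum>r<d. (\<epsilon> mm * h r) * U i r) = 0" if "i < mm" for i
    using hU[OF that] by (simp add: mult.assoc flip: sum_distrib_left)
  obtain y where y: "\<And>i. i < mm \<Longrightarrow> (\<Sum>r<d. y r * U i r) = \<epsilon> i"
      "\<And>v. v \<in> (\<lambda>x r. \<epsilon> mm * x r) ` X \<Longrightarrow> 0 < (\<Sum>r<d. y r * v r)"
  proof (rule mixed_functional[of "(\<lambda>x r. \<epsilon> mm * x r) ` X" d mm U "\<lambda>r. \<epsilon> mm * h r" \<epsilon>])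
    show "finite ((\<lambda>x r. \<epsilon> mm * x r) ` X)" using assms(1) by simp
    show "0 < (\<Sum>r<d. \<epsilon> mm * h r * v r)" if "v \<in> (\<lambda>x r. \<epsilon> mm * x r) ` X" for v
      using that hx eq by auto
  qed (use assms(2) hU' in auto)
  show ?thesis
  proof (rule that[of y])
    fix i x assume i: "i < Suc mm" "x \<in> X \<or> i < mm"
    show "0 < (\<Sum>r<d. y r * (\<epsilon> i * append_col mm U x i r))"
    proof (cases "i < mm")
      case True
      have "(\<Sum>r<d. y r * (\<epsilon> i * U i r)) = \<epsilon> i * (\<Sum>r<d. y r * U i r)"
        by (simp add: sum_distrib_left mult.left_commute)
      then show ?thesis using True y(1)[OF True] \<epsilon>2[OF i(1)] by (simp add: append_col_def)
    next
      case False
      then have "i = mm" using i by simp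
      then show ?thesis using y(2)[of "\<lambda>r. \<epsilon> mm * x r"] i by (simp add: append_col_def)
    qed
  qed
qed

text \<open>Modulo the span of the fixed columns \<open>U\<close> all last columns lie in one open
  half-space, so no convex combination of them is dependent on \<open>U\<close>. This remains true
  for nearby matrices.\<close>

lemma obstruction_eq_0_half_space:
  fixes X :: "(nat \<Rightarrow> real) set" and mm :: nat
  assumes "finite X" "indep d {..<mm} U"
    and "\<And>i. i < mm \<Longrightarrow> (\<Sum>r<d. h r * U i r) = 0"
    and "\<And>x. x \<in> X \<Longrightarrow> 0 < (\<Sum>r<d. h r * x r)"
  obtains \<rho> where "0 < \<rho>"
    "\<And>M. (\<And>j. j \<le> k \<Longrightarrow> \<exists>x\<in>X. near d (Suc mm) \<rho> (M j) (append_col mm U x)) \<Longrightarrow>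
       obstruction d (Suc mm) k M = 0"
proof -
  have "\<exists>y. \<forall>B\<in>append_col mm U ` X. \<forall>i<Suc mm. 0 < (\<Sum>r<d. y r * (\<epsilon> i * B i r))"
    if \<epsilon>: "\<And>i. i < Suc mm \<Longrightarrow> \<epsilon> i = 1 \<or> \<epsilon> i = -1" for \<epsilon>
  proof (rule append_col_functional[where X = X and d = d and mm = mm and U = U and h = h and \<epsilon> = \<epsilon>])
    fix y assume "\<And>i x. i < Suc mm \<Longrightarrow> x \<in> X \<or> i < mm \<Longrightarrow> 0 < (\<Sum>r<d. y r * (\<epsilon> i * append_col mm U x i r))"
    then show ?thesis by blast
  qed (use assms \<epsilon> in auto)
  note ex = this
  show ?thesis
  proof (rule obstruction_eq_0_near[where Bs = "append_col mm U ` X" and m = "Suc mm" and d = d and k = k])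
    show "finite (append_col mm U ` X)" using assms(1) by simp
    fix \<rho> assume \<rho>: "0 < \<rho>"
      "\<And>M. (\<And>j. j \<le> k \<Longrightarrow> \<exists>B\<in>append_col mm U ` X. near d (Suc mm) \<rho> (M j) B) \<Longrightarrow> obstruction d (Suc mm) k M = 0"
    show thesis
      by (rule that[OF \<rho>(1)], rule \<rho>(2)) blast
  qed (rule ex)
qed

section \<open>The obstruction of the cube\<close>

text \<open>Orders of the coordinates index the simplices of the standard triangulation of the cube:
  the simplex of \<open>e\<close> has the vertices \<open>corner k Nd e j\<close>, at which the
  first \<open>j\<close> coordinates in the order \<open>e\<close> are \<open>1\<close> and the
  others \<open>0\<close>.\<close>

definition orders :: "nat \<Rightarrow> 'v set \<Rightarrow> (nat \<Rightarrow> 'v) set"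
  where "orders k Nd = {e \<in> extensional {..<k}. bij_betw e {..<k} Nd}"

definition position :: "nat \<Rightarrow> (nat \<Rightarrow> 'v) \<Rightarrow> 'v \<Rightarrow> nat"
  where "position k e v = inv_into {..<k} e v"

definition corner :: "nat \<Rightarrow> 'v set \<Rightarrow> (nat \<Rightarrow> 'v) \<Rightarrow> nat \<Rightarrow> 'v \<Rightarrow> real"
  where "corner k Nd e j = (\<lambda>v. if v \<in> Nd \<and> position k e v < j then 1 else 0)"

lemma finite_orders:
  assumes "finite Nd"
  shows "finite (orders k Nd)"
proof (rule finite_subset)
  show "orders k Nd \<subseteq> PiE {..<k} (\<lambda>_. Nd)" by (auto simp: orders_def bij_betw_def PiE_def)
qed (use assms in \<open>simp add: finite_PiE\<close>)

lemma position_nth: "e \<in> orders k Nd \<Longrightarrow> i < k \<Longrightarrow> position k e (e i) = i"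
  by (simp add: orders_def position_def bij_betw_def)

lemma nth_position:
  assumes "e \<in> orders k Nd" "v \<in> Nd"
  shows "position k e v < k" "e (position k e v) = v"
proof -
  have v: "v \<in> e ` {..<k}" using assms by (simp add: orders_def bij_betw_def)
  show "position k e v < k" using inv_into_into[OF v] by (simp add: position_def)
  show "e (position k e v) = v" using f_inv_into_f[OF v] by (simp add: position_def)
qed

lemma nth_in: "e \<in> orders k Nd \<Longrightarrow> i < k \<Longrightarrow> e i \<in> Nd"
  by (auto simp: orders_def bij_betw_def)

lemma corner_nth: "e \<in> orders k Nd \<Longrightarrow> i < k \<Longrightarrow> corner k Nd e j (e i) = (if i < j then 1 else 0)"
  using position_nth[of e k Nd i] nth_in[of e k Nd i] by (simp add: corner_def)

lemma corner_inj:
  assumes "e \<in> orders k Nd" "j \<le> k" "j' \<le> k" "corner k Nd e j = corner k Nd e j'"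
  shows "j = j'"
proof (rule ccontr)
  assume "j \<noteq> j'"
  then have "min j j' < k" "min j j' < max j j'" using assms by auto
  then have "corner k Nd e j (e (min j j')) \<noteq> corner k Nd e j' (e (min j j'))"
    using corner_nth[OF assms(1)] by (auto simp: min_def max_def split: if_splits)
  then show False using assms(4) by simp
qed

text \<open>Matrices over the cube with independent fixed columns \<open>U\<close> and a last column
  \<open>x \<theta>\<close>. The functionals \<open>h v\<close> vanish on \<open>U\<close> and
  measure the coordinates of \<open>\<theta>\<close>, so the columns can be dependent at a single
  point only. Its coordinates, which decrease along \<open>e0\<close> in steps of
  \<open>1 / (k + 1)\<close>, are those of the barycentre of the simplex of \<open>e0\<close>; thus
  the degeneration stays off all walls of the triangulation.\<close>

locale cube_frame =
  fixes Nd :: "'v set" and k d mm :: nat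
    and U :: "nat \<Rightarrow> nat \<Rightarrow> real" and h :: "'v \<Rightarrow> nat \<Rightarrow> real"
    and x :: "('v \<Rightarrow> real) \<Rightarrow> nat \<Rightarrow> real" and w :: "'v \<Rightarrow> real" and e0 :: "nat \<Rightarrow> 'v"
  assumes finNd: "finite Nd"
    and d: "d = mm + k" and kpos: "0 < k"
    and U: "indep d {..<mm} U"
    and hU: "\<And>v i. v \<in> Nd \<Longrightarrow> i < mm \<Longrightarrow> (\<Sum>r<d. h v r * U i r) = 0"
    and e0: "e0 \<in> orders k Nd"
    and w: "\<And>v. v \<in> Nd \<Longrightarrow> 0 < w v"
    and hx: "\<And>v \<theta>. v \<in> Nd \<Longrightarrow>
      (\<Sum>r<d. h v r * x \<theta> r) = w v * ((real k - real (position k e0 v)) / (real k + 1) - \<theta> v)"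
begin

definition center :: "'v \<Rightarrow> real"
  where "center v = (real k - real (position k e0 v)) / (real k + 1)"

definition close :: "real \<Rightarrow> (('v \<Rightarrow> real) \<Rightarrow> nat \<Rightarrow> nat \<Rightarrow> real) \<Rightarrow> bool"
  where "close \<rho> W \<longleftrightarrow> (\<forall>e\<in>orders k Nd. \<forall>j\<le>k.
    near d (Suc mm) \<rho> (W (corner k Nd e j)) (append_col mm U (x (corner k Nd e j))))"

lemma close_mono: "close \<rho> W \<Longrightarrow> \<rho> \<le> \<rho>' \<Longrightarrow> close \<rho>' W"
  unfolding close_def using near_mono by blast

lemma closeD:
  "close \<rho> W \<Longrightarrow> e \<in> orders k Nd \<Longrightarrow> j \<le> k \<Longrightarrow>
    near d (Suc mm) \<rho> (W (corner k Nd e j)) (append_col mm U (x (corner k Nd e j)))"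
  unfolding close_def by blast

lemma functional_combination:
  "(\<Sum>r<d. (\<Sum>v\<in>Nd. a v / w v * h v r) * x \<theta> r) = (\<Sum>v\<in>Nd. a v * (center v - \<theta> v))"
  "i < mm \<Longrightarrow> (\<Sum>r<d. (\<Sum>v\<in>Nd. a v / w v * h v r) * U i r) = 0"
proof -
  have swap: "(\<Sum>r<d. (\<Sum>v\<in>Nd. a v / w v * h v r) * z r) = (\<Sum>v\<in>Nd. a v / w v * (\<Sum>r<d. h v r * z r))" for z
    by (simp only: sum_distrib_left sum_distrib_right sum.swap[of _ Nd "{..<d}"] mult.assoc)
  show "(\<Sum>r<d. (\<Sum>v\<in>Nd. a v / w v * h v r) * x \<theta> r) = (\<Sum>v\<in>Nd. a v * (center v - \<theta> v))"
    unfolding swap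
  proof (rule sum.cong[OF refl])
    fix v assume v: "v \<in> Nd"
    then show "a v / w v * (\<Sum>r<d. h v r * x \<theta> r) = a v * (center v - \<theta> v)"
      using hx[OF v] w[OF v] by (simp add: center_def)
  qed
  show "(\<Sum>r<d. (\<Sum>v\<in>Nd. a v / w v * h v r) * U i r) = 0" if "i < mm"
    unfolding swap
  proof (rule sum.neutral, intro ballI)
    fix v assume v: "v \<in> Nd"
    show "a v / w v * (\<Sum>r<d. h v r * U i r) = 0" by (simp only: hU[OF v that] mult_zero_right)
  qed
qed

text \<open>Otherwise the positions in \<open>e0\<close> would increase along \<open>e\<close>, and
  an increasing map of \<open>{..<k}\<close> to itself is the identity.\<close>

lemma order_inversion:
  assumes e: "e \<in> orders k Nd" and ne: "e \<noteq> e0"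
  obtains a where "Suc a < k" "center (e a) < center (e (Suc a))"
proof -
  have "\<exists>a. Suc a < k \<and> position k e0 (e (Suc a)) < position k e0 (e a)"
  proof (rule ccontr)
    assume no: "\<not> ?thesis"
    define f where "f i = position k e0 (e i)" for i
    have inj: "inj_on f {..<k}"
    proof (rule inj_onI)
      fix i j assume ij: "i \<in> {..<k}" "j \<in> {..<k}" "f i = f j"
      then have k: "i < k" "j < k" by auto
      have "e i = e0 (f i)" "e0 (f j) = e j"
        unfolding f_def using nth_position(2)[OF e0 nth_in[OF e]] k by simp_all
      then have "e i = e j" using ij(3) by simp
      then have "position k e (e i) = position k e (e j)" by (rule arg_cong)
      then show "i = j" unfolding position_nth[OF e k(1)] position_nth[OF e k(2)] .
    qed
    have f_lt: "f i < k" if "i < k" for i using nth_position(1)[OF e0 nth_in[OF e that]] by (simp add: f_def)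
    have step: "f i < f (Suc i)" if "Suc i < k" for i
    proof -
      have "f i \<noteq> f (Suc i)" using inj_on_eq_iff[OF inj, of i "Suc i"] that by simp
      moreover have "\<not> f (Suc i) < f i" using no that unfolding f_def by blast
      ultimately show ?thesis by linarith
    qed
    have ge: "i \<le> f i" if "i < k" for i
      using that
    proof (induction i)
      case (Suc i)
      then show ?case using step[of i] by simp
    qed simp
    \<comment> \<open>Since \<open>i \<le> f i\<close> for all \<open>i\<close>, equality of the two
      sums forces equality of all terms.\<close>
    have "f ` {..<k} = {..<k}" using inj f_lt by (intro endo_inj_surj) auto
    then have "(\<Sum>i<k. f i) = (\<Sum>i<k. i)" using sum.reindex[OF inj, of id] by simp
    then have eq: "i = f i" if "i < k" for i
      using sum_mono_inv[of "\<lambda>i. i" "{..<k}" f] ge that by simp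
    have "e = e0"
    proof
      fix i show "e i = e0 i"
      proof (cases "i < k")
        case True
        then show ?thesis using eq[OF True] nth_position(2)[OF e0 nth_in[OF e True]] by (simp add: f_def)
      next
        case False
        then show ?thesis using e e0 by (simp add: orders_def extensional_def)
      qed
    qed
    then show False using ne by simp
  qed
  then obtain a where "Suc a < k" "position k e0 (e (Suc a)) < position k e0 (e a)" by blast
  then show ?thesis by (intro that[of a]) (simp_all add: center_def divide_strict_right_mono)
qed

text \<open>On the simplex of \<open>e\<close> the coordinate at \<open>e (Suc a)\<close> is at most
  that at \<open>e a\<close>, while it is larger at the center. The difference of these two
  coordinates separates the simplex from the center.\<close>

lemma other_orders:
  assumes e: "e \<in> orders k Nd" and ne: "e \<noteq> e0"
  shows "\<exists>\<rho>>0. \<forall>W. close \<rho> W \<longrightarrow> obstruction d (Suc mm) k (\<lambda>j. W (corner k Nd e j)) = 0"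
proof -
  obtain a where a: "Suc a < k" "center (e a) < center (e (Suc a))" using order_inversion[OF assms] .
  define g where "g v = (if v = e (Suc a) then 1 else if v = e a then -1 else (0 :: real))" for v
  have ea: "e a \<in> Nd" "e (Suc a) \<in> Nd" "e a \<noteq> e (Suc a)"
    using a nth_in[OF e] position_nth[OF e, of a] position_nth[OF e, of "Suc a"] by auto
  have g: "(\<Sum>v\<in>Nd. g v * z v) = z (e (Suc a)) - z (e a)" for z
  proof -
    have "(\<Sum>v\<in>Nd. g v * z v) = (\<Sum>v\<in>{e a, e (Suc a)}. g v * z v)"
      by (rule sum.mono_neutral_right) (use finNd ea in \<open>auto simp: g_def\<close>)
    also have "\<dots> = z (e (Suc a)) - z (e a)" using ea by (simp add: g_def)
    finally show ?thesis .
  qed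
  show ?thesis
  proof (rule obstruction_eq_0_half_space[of "(\<lambda>j. x (corner k Nd e j)) ` {..k}" d mm U
        "\<lambda>r. \<Sum>v\<in>Nd. g v / w v * h v r" k])
    fix y assume "y \<in> (\<lambda>j. x (corner k Nd e j)) ` {..k}"
    then obtain j where j: "j \<le> k" "y = x (corner k Nd e j)" by auto
    have "corner k Nd e j (e (Suc a)) \<le> corner k Nd e j (e a)"
      using a corner_nth[OF e, of a j] corner_nth[OF e, of "Suc a" j] by auto
    then show "0 < (\<Sum>r<d. (\<Sum>v\<in>Nd. g v / w v * h v r) * y r)"
      unfolding j(2) functional_combination(1) g using a by simp
  next
    fix \<rho> assume \<rho>: "0 < \<rho>" "\<And>M. (\<And>j. j \<le> k \<Longrightarrow> \<exists>y\<in>(\<lambda>j. x (corner k Nd e j)) ` {..k}.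
        near d (Suc mm) \<rho> (M j) (append_col mm U y)) \<Longrightarrow> obstruction d (Suc mm) k M = 0"
    have "obstruction d (Suc mm) k (\<lambda>j. W (corner k Nd e j)) = 0" if "close \<rho> W" for W
      by (rule \<rho>(2)) (use that e in \<open>auto simp: close_def\<close>)
    then show ?thesis using \<rho>(1) by blast
  qed (use U functional_combination(2) in auto)
qed

text \<open>It takes the fixed columns at vertex \<open>0\<close> only and the last column at all
  vertices. This is the simplex of the product that contains the degeneration.\<close>

definition diagonal_path :: "nat \<Rightarrow> nat"
  where "diagonal_path = (\<lambda>i. if i \<le> mm then 0 else if i = Suc mm then k else undefined)"

lemma diagonal_path: "diagonal_path \<in> paths (Suc mm) k"
  by (auto simp: paths_def diagonal_path_def extensional_def)

lemma cells_diagonal_path: "cells (Suc mm) diagonal_path = (\<lambda>i. (i, 0)) ` {..<mm} \<union> Pair mm ` {..k}"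
  by (auto simp: cells_def diagonal_path_def image_iff less_Suc_eq split: if_splits)

lemma not_diagonal_path:
  assumes p: "p \<in> paths (Suc mm) k" and ne: "p \<noteq> diagonal_path"
  shows "0 < p mm"
proof (rule ccontr)
  assume "\<not> 0 < p mm"
  then have "p i = 0" if "i \<le> mm" for i using paths_mono[OF p that] by simp
  moreover have "p (Suc mm) = k" "p i = undefined" if "\<not> i \<le> Suc mm" for i
    using p that by (auto simp: paths_def extensional_def)
  moreover have "p (Suc mm) = k" using p by (simp add: paths_def)
  ultimately have "p = diagonal_path"
    by (auto simp: diagonal_path_def fun_eq_iff le_Suc_eq)
  then show False using ne by simp
qed

lemma e0_first: "e0 0 \<in> Nd" "center (e0 0) < 1"
  using nth_in[OF e0 kpos] position_nth[OF e0 kpos] by (simp_all add: center_def)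

lemma functional_single:
  assumes "v \<in> Nd"
  shows "(\<Sum>u\<in>Nd. (if u = v then a else 0) * z u) = a * (z v :: real)"
proof -
  have "(\<Sum>u\<in>Nd. (if u = v then a else 0) * z u) = (\<Sum>u\<in>Nd. if u = v then a * z u else 0)"
    by (rule sum.cong) auto
  then show ?thesis using assms finNd by simp
qed

text \<open>Every other path has left row \<open>0\<close> when it arrives at the last column, so it
  uses that column only at corners whose coordinate \<open>e0 0\<close> is \<open>1\<close>. The
  center has a smaller coordinate there, which yields a separating functional.\<close>

lemma other_paths:
  assumes p: "p \<in> paths (Suc mm) k" and ne: "p \<noteq> diagonal_path" and \<epsilon>: "\<epsilon> \<in> signs (Suc mm)"
  shows "\<exists>\<rho>>0. \<forall>W. close \<rho> W \<longrightarrow>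
    \<not> balanced d (cells (Suc mm) p) (signed \<epsilon> (\<lambda>j. W (corner k Nd e0 j)))"
proof -
  define X where "X = (\<lambda>j. x (corner k Nd e0 j)) ` {1..k}"
  define Bs where "Bs = (\<lambda>j. append_col mm U (x (corner k Nd e0 j))) ` {..k}"
  have eps: "\<epsilon> i = 1 \<or> \<epsilon> i = -1" if "i < Suc mm" for i using signs_cases[OF \<epsilon> that] .
  let ?h = "\<lambda>r. \<Sum>v\<in>Nd. (if v = e0 0 then -1 else 0) / w v * h v r"
  show ?thesis
  proof (rule append_col_functional[where X = X and d = d and mm = mm and U = U and h = ?h and \<epsilon> = \<epsilon>])
    show "finite X" by (simp add: X_def)
    fix y assume "y \<in> X"
    then obtain j where j: "1 \<le> j" "j \<le> k" "y = x (corner k Nd e0 j)" by (auto simp: X_def)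
    have "corner k Nd e0 j (e0 0) = 1" using corner_nth[OF e0 kpos, of j] j by simp
    then show "0 < (\<Sum>r<d. ?h r * y r)"
      unfolding j(3) functional_combination(1) functional_single[OF e0_first(1)] using e0_first(2) by simp
  next
    fix y assume y: "\<And>i z. i < Suc mm \<Longrightarrow> z \<in> X \<or> i < mm \<Longrightarrow> 0 < (\<Sum>r<d. y r * (\<epsilon> i * append_col mm U z i r))"
    show ?thesis
    proof (rule robust_not_balanced[where Bs = Bs and C = "cells (Suc mm) p" and Q = "\<lambda>i B. i < mm \<or> B mm \<in> X" and d = d and y = y and \<epsilon> = \<epsilon> and m = "Suc mm"])
      show "finite Bs" by (simp add: Bs_def)
      show "finite (cells (Suc mm) p)" by (rule finite_cells)
      show sub: "fst ` cells (Suc mm) p \<subseteq> {..<Suc mm}" by (auto simp: cells_def)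
      fix i B assume "i \<in> fst ` cells (Suc mm) p" "B \<in> Bs" "i < mm \<or> B mm \<in> X"
      then obtain j where "B = append_col mm U (x (corner k Nd e0 j))" "i < Suc mm"
          "x (corner k Nd e0 j) \<in> X \<or> i < mm"
        using sub by (auto simp: Bs_def append_col_def)
      then show "0 < (\<Sum>r<d. y r * (\<epsilon> i * B i r))" using y by simp
    next
      fix \<rho> assume \<rho>: "0 < \<rho>" "\<And>M. (\<And>i j. (i, j) \<in> cells (Suc mm) p \<Longrightarrow>
          \<exists>B\<in>Bs. (i < mm \<or> B mm \<in> X) \<and> near d (Suc mm) \<rho> (M j) B) \<Longrightarrow>
          \<not> balanced d (cells (Suc mm) p) (signed \<epsilon> M)"
      have "\<not> balanced d (cells (Suc mm) p) (signed \<epsilon> (\<lambda>j. W (corner k Nd e0 j)))" if W: "close \<rho> W" for W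
      proof (rule \<rho>(2))
        fix i j assume ij: "(i, j) \<in> cells (Suc mm) p"
        have j: "j \<le> k" using cells_subset[OF p] ij by auto
        have "i < mm \<or> 1 \<le> j"
        proof (cases "i < mm")
          case False
          then have im: "i = mm" using ij by (auto simp: cells_def)
          then have "p mm \<le> j" using ij by (auto simp: cells_def)
          then show ?thesis using not_diagonal_path[OF p ne] by simp
        qed simp
        then have "i < mm \<or> append_col mm U (x (corner k Nd e0 j)) mm \<in> X"
          using j by (auto simp: X_def append_col_def)
        moreover have "near d (Suc mm) \<rho> (W (corner k Nd e0 j)) (append_col mm U (x (corner k Nd e0 j)))"
          by (rule closeD[OF W e0 j])
        moreover have "append_col mm U (x (corner k Nd e0 j)) \<in> Bs" using j by (simp add: Bs_def)
        ultimately show "\<exists>B\<in>Bs. (i < mm \<or> B mm \<in> X) \<and> near d (Suc mm) \<rho> (W (corner k Nd e0 j)) B"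
          by (intro bexI[of _ "append_col mm U (x (corner k Nd e0 j))"] conjI)
      qed
      then show ?thesis using \<rho>(1) by blast
    qed (use eps in blast)
  qed (use U functional_combination(2) eps in auto)
qed

lemma abel_sum:
  fixes \<alpha> :: "nat \<Rightarrow> real"
  shows "(\<Sum>i<q. (\<alpha> i - \<alpha> (Suc i)) * (K - real i)) = K * \<alpha> 0 - (K - real q) * \<alpha> q - (\<Sum>i<q. \<alpha> (Suc i))"
  by (induction q) (simp_all add: algebra_simps)

text \<open>The vectors from the corners to the barycentre satisfy no relation except that their sum
  is zero. Hence all values with sum zero are attained; the coefficients are the successive
  differences of the values, and summation by parts verifies them.\<close>

lemma prescribed_functional:
  fixes \<alpha> :: "nat \<Rightarrow> real"
  assumes "(\<Sum>j\<le>k. \<alpha> j) = 0"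
  obtains a where "\<And>j. j \<le> k \<Longrightarrow> (\<Sum>v\<in>Nd. a v * (center v - corner k Nd e0 j v)) = \<alpha> j"
proof -
  define a where "a v = \<alpha> (position k e0 v) - \<alpha> (Suc (position k e0 v))" for v
  have bij: "bij_betw e0 {..<k} Nd" using e0 by (simp add: orders_def)
  have "(\<Sum>v\<in>Nd. a v * (center v - corner k Nd e0 j v)) = \<alpha> j" if j: "j \<le> k" for j
  proof -
    have "(\<Sum>v\<in>Nd. a v * (center v - corner k Nd e0 j v)) =
        (\<Sum>i<k. a (e0 i) * (center (e0 i) - corner k Nd e0 j (e0 i)))"
      by (rule sum.reindex_bij_betw[OF bij, symmetric])
    also have "\<dots> = (\<Sum>i<k. (\<alpha> i - \<alpha> (Suc i)) * (real k - real i) / (real k + 1) -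
        (if i < j then \<alpha> i - \<alpha> (Suc i) else 0))"
      by (rule sum.cong) (auto simp: a_def center_def position_nth[OF e0] corner_nth[OF e0] right_diff_distrib)
    also have "\<dots> = (\<Sum>i<k. (\<alpha> i - \<alpha> (Suc i)) * (real k - real i)) / (real k + 1) -
        (\<Sum>i<k. if i < j then \<alpha> i - \<alpha> (Suc i) else 0)"
      by (simp add: sum_subtractf sum_divide_distrib)
    also have "(\<Sum>i<k. if i < j then \<alpha> i - \<alpha> (Suc i) else 0) = (\<Sum>i<j. \<alpha> i - \<alpha> (Suc i))"
      by (rule sum.mono_neutral_cong_right) (use j in auto)
    also have "\<dots> = \<alpha> 0 - \<alpha> j" by (rule sum_lessThan_telescope')
    also have "(\<Sum>i<k. (\<alpha> i - \<alpha> (Suc i)) * (real k - real i)) = real k * \<alpha> 0 - (\<Sum>i<k. \<alpha> (Suc i))"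
      by (simp add: abel_sum)
    also have "(\<Sum>i<k. \<alpha> (Suc i)) = - \<alpha> 0"
    proof -
      have "(\<Sum>i\<le>k. \<alpha> i) = \<alpha> 0 + (\<Sum>i<k. \<alpha> (Suc i))" by (rule sum.atMost_shift)
      then show ?thesis using assms by simp
    qed
    also have "(real k * \<alpha> 0 - - \<alpha> 0) / (real k + 1) = \<alpha> 0" by (simp add: field_simps)
    finally show ?thesis by simp
  qed
  then show ?thesis using that by blast
qed

text \<open>A relation between the columns of the diagonal path cannot have coefficients of both
  signs at the last column, even after a perturbation: for a pattern \<open>\<tau>\<close> with both
  signs there is a functional whose values at the corners have exactly these signs.\<close>

lemma mixed_signs:
  assumes \<tau>: "\<And>j. j \<le> k \<Longrightarrow> \<tau> j = 1 \<or> \<tau> j = -1" and ab: "a \<le> k" "\<tau> a = 1" "b \<le> k" "\<tau> b = -1"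
    and \<epsilon>: "\<And>i. i < Suc mm \<Longrightarrow> \<epsilon> i = 1 \<or> \<epsilon> i = -1" and \<epsilon>mm: "\<epsilon> mm = 1"
  shows "\<exists>\<rho>>0. \<forall>W. close \<rho> W \<longrightarrow> \<not> balanced d (cells (Suc mm) diagonal_path)
     (\<lambda>(i, j) r. (if i < mm then \<epsilon> i else \<tau> j) * W (corner k Nd e0 j) i r)"
proof -
  define Jp where "Jp = {j. j \<le> k \<and> \<tau> j = 1}"
  define Jn where "Jn = {j. j \<le> k \<and> \<tau> j = -1}"
  have fin: "finite Jp" "finite Jn" by (auto simp: Jp_def Jn_def)
  have "a \<in> Jp" "b \<in> Jn" using ab by (auto simp: Jp_def Jn_def)
  then have card: "0 < card Jp" "0 < card Jn" using fin by (auto simp: card_gt_0_iff)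
  \<comment> \<open>Values with the signs \<open>\<tau>\<close> and sum zero; they exist because
    both signs occur.\<close>
  define \<alpha> where "\<alpha> j = (if \<tau> j = 1 then 1 / real (card Jp) else - 1 / real (card Jn))" for j
  have "(\<Sum>j\<le>k. \<alpha> j) = (\<Sum>j\<in>Jp. \<alpha> j) + (\<Sum>j\<in>Jn. \<alpha> j)"
  proof -
    have "{..k} = Jp \<union> Jn" "Jp \<inter> Jn = {}" using \<tau> by (auto simp: Jp_def Jn_def)
    then show ?thesis using sum.union_disjoint[OF fin] by metis
  qed
  also have "(\<Sum>j\<in>Jp. \<alpha> j) = (\<Sum>j\<in>Jp. 1 / real (card Jp))"
    by (rule sum.cong) (auto simp: \<alpha>_def Jp_def)
  also have "\<dots> = 1" using card by simp
  also have "(\<Sum>j\<in>Jn. \<alpha> j) = (\<Sum>j\<in>Jn. - 1 / real (card Jn))"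
    by (rule sum.cong) (auto simp: \<alpha>_def Jn_def)
  also have "\<dots> = -1" using card by simp
  finally have "(\<Sum>j\<le>k. \<alpha> j) = 0" by simp
  then obtain g where g: "\<And>j. j \<le> k \<Longrightarrow> (\<Sum>v\<in>Nd. g v * (center v - corner k Nd e0 j v)) = \<alpha> j"
    using prescribed_functional by blast
  have \<tau>\<alpha>: "0 < \<tau> j * \<alpha> j" if "j \<le> k" for j
    using \<tau>[OF that] card by (auto simp: \<alpha>_def)
  let ?h = "\<lambda>r. \<Sum>v\<in>Nd. g v / w v * h v r"
  let ?x = "\<lambda>j r. \<tau> j * x (corner k Nd e0 j) r"
  let ?X = "?x ` {..k}"
  show ?thesis
  proof (rule append_col_functional[where X = ?X and d = d and mm = mm and U = U and h = ?h and \<epsilon> = \<epsilon>])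
    fix y assume "y \<in> ?X"
    then obtain j where j: "j \<le> k" "y = ?x j" by auto
    have "(\<Sum>r<d. ?h r * y r) = \<tau> j * (\<Sum>r<d. ?h r * x (corner k Nd e0 j) r)"
      by (simp add: j(2) sum_distrib_left mult.left_commute)
    also have "\<dots> = \<tau> j * \<alpha> j" by (simp only: functional_combination(1) g[OF j(1)])
    finally show "0 < (\<Sum>r<d. ?h r * y r)" using \<tau>\<alpha>[OF j(1)] by simp
  next
    fix y assume y: "\<And>i z. i < Suc mm \<Longrightarrow> z \<in> ?X \<or> i < mm \<Longrightarrow> 0 < (\<Sum>r<d. y r * (\<epsilon> i * append_col mm U z i r))"
    define Bs where "Bs = append_col mm U ` ?X"
    show ?thesis
    proof (rule robust_not_balanced[where Bs = Bs and C = "cells (Suc mm) diagonal_path" and Q = "\<lambda>i B. True" and d = d and y = y and \<epsilon> = \<epsilon> and m = "Suc mm"])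
      show "finite Bs" by (simp add: Bs_def)
      show "finite (cells (Suc mm) diagonal_path)" by (rule finite_cells)
      show sub: "fst ` cells (Suc mm) diagonal_path \<subseteq> {..<Suc mm}" by (auto simp: cells_def)
      fix i B assume i: "i \<in> fst ` cells (Suc mm) diagonal_path" "B \<in> Bs"
      then have "i < Suc mm" using sub by auto
      moreover obtain z where "z \<in> ?X" "B = append_col mm U z" using i unfolding Bs_def by blast
      ultimately show "0 < (\<Sum>r<d. y r * (\<epsilon> i * B i r))" using y[of i z] by simp
    next
      fix \<rho> assume \<rho>: "0 < \<rho>" "\<And>M. (\<And>i j. (i, j) \<in> cells (Suc mm) diagonal_path \<Longrightarrow>
          \<exists>B\<in>Bs. True \<and> near d (Suc mm) \<rho> (M j) B) \<Longrightarrow>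
          \<not> balanced d (cells (Suc mm) diagonal_path) (signed \<epsilon> M)"
      have "\<not> balanced d (cells (Suc mm) diagonal_path)
         (\<lambda>(i, j) r. (if i < mm then \<epsilon> i else \<tau> j) * W (corner k Nd e0 j) i r)" if W: "close \<rho> W" for W
      proof -
        define M where "M j i r = (if i < mm then W (corner k Nd e0 j) i r else \<tau> j * W (corner k Nd e0 j) i r)" for j i r
        have "\<not> balanced d (cells (Suc mm) diagonal_path) (signed \<epsilon> M)"
        proof (rule \<rho>(2))
          fix i j assume "(i, j) \<in> cells (Suc mm) diagonal_path"
          then have j: "j \<le> k" using cells_subset[OF diagonal_path] by auto
          have n: "near d (Suc mm) \<rho> (W (corner k Nd e0 j)) (append_col mm U (x (corner k Nd e0 j)))"
            by (rule closeD[OF W e0 j])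
          have "near d (Suc mm) \<rho> (M j) (append_col mm U (?x j))"
            unfolding near_def
          proof (intro allI impI)
            fix i r assume ir: "i < Suc mm" "r < d"
            have 1: "\<bar>W (corner k Nd e0 j) i r - append_col mm U (x (corner k Nd e0 j)) i r\<bar> < \<rho>"
              using n ir by (simp add: near_def)
            show "\<bar>M j i r - append_col mm U (?x j) i r\<bar> < \<rho>"
            proof (cases "i < mm")
              case True
              then show ?thesis using 1 by (simp add: M_def append_col_def)
            next
              case False
              have "\<bar>\<tau> j\<bar> = 1" using \<tau>[OF j] by auto
              have "M j i r - append_col mm U (?x j) i r =
                  \<tau> j * (W (corner k Nd e0 j) i r - append_col mm U (x (corner k Nd e0 j)) i r)"
                using False by (simp add: M_def append_col_def right_diff_distrib)
              then show ?thesis using 1 \<open>\<bar>\<tau> j\<bar> = 1\<close> by (simp add: abs_mult)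
            qed
          qed
          moreover have "append_col mm U (?x j) \<in> Bs" using j by (simp add: Bs_def)
          ultimately show "\<exists>B\<in>Bs. True \<and> near d (Suc mm) \<rho> (M j) B" by blast
        qed
        moreover have "balanced d (cells (Suc mm) diagonal_path) (signed \<epsilon> M) =
          balanced d (cells (Suc mm) diagonal_path)
            (\<lambda>(i, j) r. (if i < mm then \<epsilon> i else \<tau> j) * W (corner k Nd e0 j) i r)"
        proof (rule balanced_cong)
          fix t r assume t: "t \<in> cells (Suc mm) diagonal_path"
          obtain i j where e: "t = (i, j)" by (cases t)
          have "i < mm \<or> i = mm" using t e by (auto simp: cells_diagonal_path)
          then show "signed \<epsilon> M t r = (case t of (i, j) \<Rightarrow> \<lambda>r. (if i < mm then \<epsilon> i else \<tau> j) * W (corner k Nd e0 j) i r) r"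
            using \<epsilon>mm e by (auto simp: signed_def M_def)
        qed
        ultimately show ?thesis by simp
      qed
      then show ?thesis using \<rho>(1) by blast
    qed (rule \<epsilon>)
  qed (use U functional_combination(2)[of _ g] \<epsilon> in \<open>simp_all del: lessThan_Suc\<close>)
qed

text \<open>The \<open>d + 1\<close> columns satisfy one relation up to a factor, and none of its
  coefficients is zero. By \<open>nomix\<close> its coefficients at the last column have a common
  sign, which can be made positive, and then the signs of the remaining coefficients form the only
  pattern that is counted.\<close>

lemma diagonal_path_count:
  fixes W :: "('v \<Rightarrow> real) \<Rightarrow> nat \<Rightarrow> nat \<Rightarrow> real"
  assumes gp: "general_position d ({..<Suc mm} \<times> {..k}) (\<lambda>(i, j). (corner k Nd e0 j, i))
      (\<lambda>(i, j). W (corner k Nd e0 j) i)"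
    and nomix: "\<And>\<tau> \<epsilon> a b. \<tau> \<in> PiE {..k} (\<lambda>_. {1, -1}) \<Longrightarrow> \<epsilon> \<in> PiE {..<Suc mm} (\<lambda>_. {1, -1}) \<Longrightarrow> \<epsilon> mm = 1 \<Longrightarrow>
      a \<le> k \<Longrightarrow> \<tau> a = 1 \<Longrightarrow> b \<le> k \<Longrightarrow> \<tau> b = -1 \<Longrightarrow> \<not> balanced d (cells (Suc mm) diagonal_path)
      (\<lambda>(i, j) r. (if i < mm then \<epsilon> i else \<tau> j) * W (corner k Nd e0 j) i r)"
  shows "sign_count d (Suc mm) (\<lambda>j. W (corner k Nd e0 j)) (cells (Suc mm) diagonal_path) = 1"
proof -
  define T where "T = cells (Suc mm) diagonal_path"
  define V where "V = (\<lambda>(i, j). W (corner k Nd e0 j) i)"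
  have finT: "finite T" by (simp add: T_def finite_cells)
  have cardT: "card T = Suc d" using card_cells[OF diagonal_path] d by (simp add: T_def)
  have T: "T = (\<lambda>i. (i, 0)) ` {..<mm} \<union> Pair mm ` {..k}" by (simp add: T_def cells_diagonal_path)
  have Tsub: "T \<subseteq> {..<Suc mm} \<times> {..k}" unfolding T_def by (rule cells_subset[OF diagonal_path])
  have t0: "(mm, 0) \<in> T" by (simp add: T)
  have ind: "indep d (T - {t}) V" if t: "t \<in> T" for t
  proof -
    have "inj_on (\<lambda>(i, j). (corner k Nd e0 j, i)) ({..<Suc mm} \<times> {..k})"
    proof (rule inj_onI)
      fix s t :: "nat \<times> nat"
      assume st: "s \<in> {..<Suc mm} \<times> {..k}" "t \<in> {..<Suc mm} \<times> {..k}"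
        "(case s of (i, j) \<Rightarrow> (corner k Nd e0 j, i)) = (case t of (i, j) \<Rightarrow> (corner k Nd e0 j, i))"
      obtain i j i' j' where e: "s = (i, j)" "t = (i', j')" by (cases s; cases t)
      have "j = j'" by (rule corner_inj[OF e0]) (use st e in auto)
      then show "s = t" using st(3) e by simp
    qed
    then have "inj_on (\<lambda>(i, j). (corner k Nd e0 j, i)) (T - {t})"
      by (rule inj_on_subset) (use Tsub in blast)
    moreover have "card (T - {t}) \<le> d" using cardT finT t by simp
    moreover have "T - {t} \<subseteq> {..<Suc mm} \<times> {..k}" using Tsub by blast
    ultimately show ?thesis using gp unfolding general_position_def V_def by blast
  qed
  obtain \<theta>0 where l0: "\<And>r. r < d \<Longrightarrow> (\<Sum>t\<in>T. \<theta>0 t * V t r) = 0" "\<exists>t\<in>T. \<theta>0 t \<noteq> 0"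
    using homogeneous_system_solution[OF finT, of d V] cardT by auto
  have vanish: "\<forall>s\<in>T. c s = 0" if c: "\<And>r. r < d \<Longrightarrow> (\<Sum>t\<in>T. c t * V t r) = 0" and t: "t \<in> T" "c t = 0" for c t
  proof -
    have eq: "(\<Sum>s\<in>T - {t}. c s * V s r) = (\<Sum>s\<in>T. c s * V s r)" for r
      by (rule sum.mono_neutral_left) (use finT t in auto)
    have "c s = 0" if "s \<in> T - {t}" for s
      by (rule indepD[OF ind[OF t(1)] _ that]) (simp add: eq c)
    then show ?thesis using t by blast
  qed
  have nz0: "\<theta>0 t \<noteq> 0" if "t \<in> T" for t using vanish[OF l0(1) that] l0(2) by blast
  \<comment> \<open>Normalized so that the coefficient of the last column at vertex \<open>0\<close>
    is positive.\<close>
  define \<theta> where "\<theta> t = sgn (\<theta>0 (mm, 0)) * \<theta>0 t" for t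
  have rel: "(\<Sum>t\<in>T. \<theta> t * V t r) = 0" if "r < d" for r
  proof -
    have "(\<Sum>t\<in>T. \<theta> t * V t r) = sgn (\<theta>0 (mm, 0)) * (\<Sum>t\<in>T. \<theta>0 t * V t r)"
      by (simp only: \<theta>_def sum_distrib_left mult.assoc)
    then show ?thesis using l0(1)[OF that] by simp
  qed
  have nz: "\<theta> t \<noteq> 0" if "t \<in> T" for t using nz0[OF that] nz0[OF t0] by (simp add: \<theta>_def sgn_zero_iff)
  have pos0: "0 < \<theta> (mm, 0)"   proof -
    have "\<theta> (mm, 0) = \<bar>\<theta>0 (mm, 0)\<bar>" by (simp add: \<theta>_def abs_sgn mult.commute)
    then show ?thesis using nz0[OF t0] by simp
  qed
  have pos: "0 < \<theta> (mm, j)" if j: "j \<le> k" for j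
  proof (rule ccontr)
    assume "\<not> 0 < \<theta> (mm, j)"
    moreover have "\<theta> (mm, j) \<noteq> 0" by (rule nz) (use j in \<open>simp add: T\<close>)
    ultimately have neg: "\<theta> (mm, j) < 0" by simp
    define \<tau> where "\<tau> = restrict (\<lambda>j. sgn (\<theta> (mm, j))) {..k}"
    define \<epsilon> where "\<epsilon> = restrict (\<lambda>i. if i < mm then sgn (\<theta> (i, 0)) else 1) {..<Suc mm}"
    have sg: "sgn a = 1 \<or> sgn a = -1" if "a \<noteq> 0" for a :: real
      using that by (cases "a > 0") (auto simp: sgn_real_def)
    have "\<theta> (mm, i) \<noteq> 0" if "i \<le> k" for i by (rule nz) (use that in \<open>simp add: T\<close>)
    then have \<tau>: "\<tau> \<in> PiE {..k} (\<lambda>_. {1, -1})" using sg by (auto simp: \<tau>_def PiE_def Pi_def)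
    have "\<theta> (i, 0) \<noteq> 0" if "i < mm" for i by (rule nz) (use that in \<open>simp add: T\<close>)
    then have \<epsilon>: "\<epsilon> \<in> PiE {..<Suc mm} (\<lambda>_. {1, -1})" using sg by (auto simp: \<epsilon>_def PiE_def Pi_def)
    have "\<not> balanced d T (\<lambda>(i, j) r. (if i < mm then \<epsilon> i else \<tau> j) * W (corner k Nd e0 j) i r)"
      unfolding T_def by (rule nomix[OF \<tau> \<epsilon>, of 0 j]) (use j neg pos0 in \<open>auto simp: \<tau>_def \<epsilon>_def\<close>)
    moreover have "balanced d T (\<lambda>(i, j) r. (if i < mm then \<epsilon> i else \<tau> j) * W (corner k Nd e0 j) i r)"
      unfolding balanced_def
    proof (intro exI[of _ "\<lambda>t. \<bar>\<theta> t\<bar>"] conjI allI impI ballI)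
      show "\<exists>t\<in>T. 0 < \<bar>\<theta> t\<bar>" using t0 pos0 by (intro bexI[of _ "(mm, 0)"]) auto
      fix r assume r: "r < d"
      have "(\<Sum>t\<in>T. \<bar>\<theta> t\<bar> * (case t of (i, j) \<Rightarrow> \<lambda>r. (if i < mm then \<epsilon> i else \<tau> j) * W (corner k Nd e0 j) i r) r) =
          (\<Sum>t\<in>T. \<theta> t * V t r)"
      proof (rule sum.cong[OF refl])
        fix t assume t: "t \<in> T"
        then consider i where "t = (i, 0)" "i < mm" | j where "t = (mm, j)" "j \<le> k" by (auto simp: T)
        then show "\<bar>\<theta> t\<bar> * (case t of (i, j) \<Rightarrow> \<lambda>r. (if i < mm then \<epsilon> i else \<tau> j) * W (corner k Nd e0 j) i r) r = \<theta> t * V t r"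
          by cases (simp_all add: \<epsilon>_def \<tau>_def V_def abs_mult_sgn mult.assoc[symmetric])
      qed
      then show "(\<Sum>t\<in>T. \<bar>\<theta> t\<bar> * (case t of (i, j) \<Rightarrow> \<lambda>r. (if i < mm then \<epsilon> i else \<tau> j) * W (corner k Nd e0 j) i r) r) = 0"
        using rel[OF r] by simp
    qed simp
    ultimately show False by blast
  qed
  define \<epsilon>0 where "\<epsilon>0 = restrict (\<lambda>i. if i < mm then sgn (\<theta> (i, 0)) else 1) {..<Suc mm}"
  have sg: "sgn a = 1 \<or> sgn a = -1" if "a \<noteq> 0" for a :: real
    using that by (cases "a > 0") (auto simp: sgn_real_def)
  have nzi: "\<theta> (i, 0) \<noteq> 0" if "i < mm" for i by (rule nz) (use that in \<open>simp add: T\<close>)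
  then have e0_in: "\<epsilon>0 \<in> signs (Suc mm)" using sg by (auto simp: \<epsilon>0_def signs_def PiE_def Pi_def)
  have "balanced d T (signed \<epsilon> (\<lambda>j. W (corner k Nd e0 j))) \<longleftrightarrow> \<epsilon> = \<epsilon>0" if \<epsilon>: "\<epsilon> \<in> signs (Suc mm)" for \<epsilon>
  proof
    assume "\<epsilon> = \<epsilon>0"
    show "balanced d T (signed \<epsilon> (\<lambda>j. W (corner k Nd e0 j)))"
      unfolding balanced_def
    proof (intro exI[of _ "\<lambda>t. \<bar>\<theta> t\<bar>"] conjI allI impI ballI)
      show "\<exists>t\<in>T. 0 < \<bar>\<theta> t\<bar>" using t0 pos0 by (intro bexI[of _ "(mm, 0)"]) auto
      fix r assume r: "r < d"
      have "(\<Sum>t\<in>T. \<bar>\<theta> t\<bar> * signed \<epsilon> (\<lambda>j. W (corner k Nd e0 j)) t r) = (\<Sum>t\<in>T. \<theta> t * V t r)"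
      proof (rule sum.cong[OF refl])
        fix t assume t: "t \<in> T"
        then consider i where "t = (i, 0)" "i < mm" | j where "t = (mm, j)" "j \<le> k" by (auto simp: T)
        then show "\<bar>\<theta> t\<bar> * signed \<epsilon> (\<lambda>j. W (corner k Nd e0 j)) t r = \<theta> t * V t r"
        proof cases
          case 1
          then show ?thesis
            by (simp add: \<open>\<epsilon> = \<epsilon>0\<close> \<epsilon>0_def V_def signed_def abs_mult_sgn mult.assoc[symmetric])
        next
          case 2
          then show ?thesis using pos[of j] by (simp add: \<open>\<epsilon> = \<epsilon>0\<close> \<epsilon>0_def V_def signed_def)
        qed
      qed
      then show "(\<Sum>t\<in>T. \<bar>\<theta> t\<bar> * signed \<epsilon> (\<lambda>j. W (corner k Nd e0 j)) t r) = 0" using rel[OF r] by simp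
    qed simp
  next
    assume "balanced d T (signed \<epsilon> (\<lambda>j. W (corner k Nd e0 j)))"
    then obtain \<mu> where \<mu>: "\<And>t. t \<in> T \<Longrightarrow> 0 \<le> \<mu> t" "\<exists>t\<in>T. 0 < \<mu> t"
        "\<And>r. r < d \<Longrightarrow> (\<Sum>t\<in>T. \<mu> t * signed \<epsilon> (\<lambda>j. W (corner k Nd e0 j)) t r) = 0"
      unfolding balanced_def by blast
    \<comment> \<open>The signed weights of a balanced pattern form a relation, hence a positive
      multiple of \<open>\<theta>\<close>; comparing signs gives \<open>\<epsilon>0\<close>.\<close>
    define \<nu> where "\<nu> t = \<mu> t * \<epsilon> (fst t)" for t
    have relnu: "(\<Sum>t\<in>T. \<nu> t * V t r) = 0" if "r < d" for r
    proof -
      have "(\<Sum>t\<in>T. \<nu> t * V t r) = (\<Sum>t\<in>T. \<mu> t * signed \<epsilon> (\<lambda>j. W (corner k Nd e0 j)) t r)"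
        by (rule sum.cong) (auto simp: \<nu>_def V_def signed_def)
      then show ?thesis using \<mu>(3)[OF that] by simp
    qed
    define c where "c = \<nu> (mm, 0) / \<theta> (mm, 0)"
    have "\<forall>t\<in>T. \<nu> t - c * \<theta> t = 0"
    proof (rule vanish[OF _ t0])
      show "(\<Sum>t\<in>T. (\<nu> t - c * \<theta> t) * V t r) = 0" if "r < d" for r
        using relnu[OF that] rel[OF that]
        by (simp add: left_diff_distrib sum_subtractf mult.assoc flip: sum_distrib_left)
      show "\<nu> (mm, 0) - c * \<theta> (mm, 0) = 0" using pos0 by (simp add: c_def)
    qed
    then have nu: "\<mu> t * \<epsilon> (fst t) = c * \<theta> t" if "t \<in> T" for t using that by (simp add: \<nu>_def)
    have emm: "\<epsilon> mm = 1" using \<epsilon> by (simp add: signs_def)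
    have "0 \<le> c" using \<mu>(1)[OF t0] pos0 emm by (simp add: c_def \<nu>_def)
    moreover have "c \<noteq> 0"
    proof
      assume "c = 0"
      obtain t where t: "t \<in> T" "0 < \<mu> t" using \<mu>(2) by blast
      have "fst t < Suc mm" using t Tsub by auto
      then have "\<epsilon> (fst t) \<noteq> 0" using signs_cases[OF \<epsilon>, of "fst t"] by auto
      then show False using nu[OF t(1)] t(2) \<open>c = 0\<close> by simp
    qed
    ultimately have cpos: "0 < c" by simp
    show "\<epsilon> = \<epsilon>0"
    proof
      fix i show "\<epsilon> i = \<epsilon>0 i"
      proof (cases "i < mm")
        case True
        then have tT: "(i, 0) \<in> T" by (simp add: T)
        have eq: "\<mu> (i, 0) * \<epsilon> i = c * \<theta> (i, 0)" using nu[OF tT] by simp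
        have "\<mu> (i, 0) \<noteq> 0"
        proof
          assume "\<mu> (i, 0) = 0"
          then have "c * \<theta> (i, 0) = 0" using eq by simp
          then show False using cpos nzi[OF True] by simp
        qed
        then have mpos: "0 < \<mu> (i, 0)" using \<mu>(1)[OF tT] by simp
        have "sgn (\<mu> (i, 0) * \<epsilon> i) = sgn (c * \<theta> (i, 0))" using eq by simp
        then have "sgn (\<epsilon> i) = sgn (\<theta> (i, 0))" using mpos cpos by (simp add: sgn_mult)
        moreover have "sgn (\<epsilon> i) = \<epsilon> i" using signs_cases[OF \<epsilon>, of i] True by auto
        ultimately show ?thesis using True by (simp add: \<epsilon>0_def)
      next
        case False
        then show ?thesis using emm \<epsilon> by (cases "i = mm") (auto simp: \<epsilon>0_def signs_def PiE_def extensional_def)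
      qed
    qed
  qed
  then have "sign_count d (Suc mm) (\<lambda>j. W (corner k Nd e0 j)) T = (\<Sum>\<epsilon>\<in>signs (Suc mm). if \<epsilon> = \<epsilon>0 then 1 else 0)"
    unfolding sign_count_def by (intro sum.cong) auto
  also have "\<dots> = 1" using e0_in finite_signs by (simp only: sum.delta' sum.delta if_True)
  finally show ?thesis by (simp only: T_def)
qed

text \<open>One simplex, one path in it and one sign pattern contribute: the order
  \<open>e0\<close>, the diagonal path and the signs of its relation. All other cases vanish below
  some radius, and there are finitely many of them.\<close>

lemma cube_count:
  obtains \<rho> where "0 < \<rho>" "\<And>W. close \<rho> W \<Longrightarrow>
    general_position d ({..<Suc mm} \<times> {..k}) (\<lambda>(i, j). (corner k Nd e0 j, i)) (\<lambda>(i, j). W (corner k Nd e0 j) i) \<Longrightarrow>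
    (\<Sum>e\<in>orders k Nd. obstruction d (Suc mm) k (\<lambda>j. W (corner k Nd e j))) = 1"
proof -
  let ?D = "cells (Suc mm) diagonal_path"
  let ?P1 = "\<lambda>e \<rho>. \<forall>W. close \<rho> W \<longrightarrow> obstruction d (Suc mm) k (\<lambda>j. W (corner k Nd e j)) = 0"
  let ?P2 = "\<lambda>t \<rho>. \<forall>W. close \<rho> W \<longrightarrow>
    \<not> balanced d (cells (Suc mm) (fst t)) (signed (snd t) (\<lambda>j. W (corner k Nd e0 j)))"
  let ?P3 = "\<lambda>t \<rho>. \<forall>W. close \<rho> W \<longrightarrow> \<not> balanced d ?D
      (\<lambda>(i, j) r. (if i < mm then snd t i else fst t j) * W (corner k Nd e0 j) i r)"
  obtain \<rho>1 where \<rho>1: "0 < \<rho>1" "\<And>e. e \<in> orders k Nd - {e0} \<Longrightarrow> ?P1 e \<rho>1"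
  proof (rule uniform_radius[of "orders k Nd - {e0}" ?P1])
    show "finite (orders k Nd - {e0})" using finite_orders[OF finNd] by simp
    show "\<exists>\<rho>>0. ?P1 e \<rho>" if "e \<in> orders k Nd - {e0}" for e using other_orders[of e] that by simp
    show "?P1 e \<rho>'" if "?P1 e \<rho>" "\<rho>' \<le> \<rho>" for e \<rho> \<rho>' using that close_mono by blast
  qed blast
  let ?I2 = "(paths (Suc mm) k - {diagonal_path}) \<times> signs (Suc mm)"
  obtain \<rho>2 where \<rho>2: "0 < \<rho>2" "\<And>t. t \<in> ?I2 \<Longrightarrow> ?P2 t \<rho>2"
  proof (rule uniform_radius[of ?I2 ?P2])
    show "finite ?I2" using finite_paths finite_signs by simp
    show "\<exists>\<rho>>0. ?P2 t \<rho>" if "t \<in> ?I2" for t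
      by (rule other_paths) (use that in auto)
    show "?P2 e \<rho>'" if "?P2 e \<rho>" "\<rho>' \<le> \<rho>" for e \<rho> \<rho>' using that close_mono by blast
  qed blast
  let ?I3 = "{t \<in> PiE {..k} (\<lambda>_. {1, -1 :: real}) \<times> PiE {..<Suc mm} (\<lambda>_. {1, -1 :: real}).
      snd t mm = 1 \<and> (\<exists>a\<le>k. fst t a = 1) \<and> (\<exists>b\<le>k. fst t b = -1)}"
  obtain \<rho>3 where \<rho>3: "0 < \<rho>3" "\<And>t. t \<in> ?I3 \<Longrightarrow> ?P3 t \<rho>3"
  proof (rule uniform_radius[of ?I3 ?P3])
    have "finite (PiE {..k} (\<lambda>_. {1, -1::real}))" "finite (PiE {..<Suc mm} (\<lambda>_. {1, -1::real}))"
      by (simp_all add: finite_PiE)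
    then have "finite (PiE {..k} (\<lambda>_. {1, -1::real}) \<times> PiE {..<Suc mm} (\<lambda>_. {1, -1::real}))"
      by (rule finite_cartesian_product)
    then show "finite ?I3" by (rule rev_finite_subset) blast
    show "\<exists>\<rho>>0. ?P3 t \<rho>" if t: "t \<in> ?I3" for t
    proof -
      obtain a b where ab: "a \<le> k" "fst t a = 1" "b \<le> k" "fst t b = -1" using t by blast
      have "fst t j = 1 \<or> fst t j = -1" if "j \<le> k" for j
      proof -
        have "fst t \<in> PiE {..k} (\<lambda>_. {1, -1})" using t by auto
        then have "fst t j \<in> {1, -1}" by (rule PiE_mem) (use that in simp)
        then show ?thesis by simp
      qed
      moreover have "snd t i = 1 \<or> snd t i = -1" if "i < Suc mm" for i
      proof -
        have "snd t \<in> PiE {..<Suc mm} (\<lambda>_. {1, -1})" using t by auto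
        then have "snd t i \<in> {1, -1}" by (rule PiE_mem) (use that in simp)
        then show ?thesis by simp
      qed
      moreover have "snd t mm = 1" using t by simp
      ultimately show ?thesis using mixed_signs[of "fst t" a b "snd t"] ab by blast
    qed
    show "?P3 e \<rho>'" if "?P3 e \<rho>" "\<rho>' \<le> \<rho>" for e \<rho> \<rho>' using that close_mono by blast
  qed blast
  define \<rho> where "\<rho> = min \<rho>1 (min \<rho>2 \<rho>3)"
  show ?thesis
  proof (rule that[of \<rho>])
    show "0 < \<rho>" using \<rho>1 \<rho>2 \<rho>3 by (simp add: \<rho>_def)
    fix W assume W: "close \<rho> W" and gp: "general_position d ({..<Suc mm} \<times> {..k})
      (\<lambda>(i, j). (corner k Nd e0 j, i)) (\<lambda>(i, j). W (corner k Nd e0 j) i)"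
    have W1: "close \<rho>1 W" and W2: "close \<rho>2 W" and W3: "close \<rho>3 W"
      by (rule close_mono[OF W], simp add: \<rho>_def)+
    have "(\<Sum>e\<in>orders k Nd. obstruction d (Suc mm) k (\<lambda>j. W (corner k Nd e j))) =
        obstruction d (Suc mm) k (\<lambda>j. W (corner k Nd e0 j)) +
        (\<Sum>e\<in>orders k Nd - {e0}. obstruction d (Suc mm) k (\<lambda>j. W (corner k Nd e j)))"
      by (rule sum.remove[OF finite_orders[OF finNd] e0])
    also have "(\<Sum>e\<in>orders k Nd - {e0}. obstruction d (Suc mm) k (\<lambda>j. W (corner k Nd e j))) = 0"
      by (rule sum.neutral, intro ballI) (use \<rho>1(2) W1 in blast)
    also have "obstruction d (Suc mm) k (\<lambda>j. W (corner k Nd e0 j)) =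
        sign_count d (Suc mm) (\<lambda>j. W (corner k Nd e0 j)) ?D +
        (\<Sum>p\<in>paths (Suc mm) k - {diagonal_path}. sign_count d (Suc mm) (\<lambda>j. W (corner k Nd e0 j)) (cells (Suc mm) p))"
      unfolding obstruction_def by (rule sum.remove[OF finite_paths diagonal_path])
    also have "(\<Sum>p\<in>paths (Suc mm) k - {diagonal_path}. sign_count d (Suc mm) (\<lambda>j. W (corner k Nd e0 j)) (cells (Suc mm) p)) = 0"
      unfolding sign_count_def
    proof (intro sum.neutral ballI)
      fix p \<epsilon> assume "p \<in> paths (Suc mm) k - {diagonal_path}" "\<epsilon> \<in> signs (Suc mm)"
      then have "(p, \<epsilon>) \<in> ?I2" by simp
      then have "\<not> balanced d (cells (Suc mm) p) (signed \<epsilon> (\<lambda>j. W (corner k Nd e0 j)))"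
        using \<rho>2(2)[of "(p, \<epsilon>)"] W2 by simp
      then show "of_bool (balanced d (cells (Suc mm) p) (signed \<epsilon> (\<lambda>j. W (corner k Nd e0 j)))) = (0 :: bit)" by simp
    qed
    also have "sign_count d (Suc mm) (\<lambda>j. W (corner k Nd e0 j)) ?D = 1"
    proof (rule diagonal_path_count[OF gp])
      fix \<tau> \<epsilon> a b assume *: "\<tau> \<in> PiE {..k} (\<lambda>_. {1, -1 :: real})" "\<epsilon> \<in> PiE {..<Suc mm} (\<lambda>_. {1, -1 :: real})"
        "\<epsilon> mm = 1" "a \<le> k" "\<tau> a = 1" "b \<le> k" "\<tau> b = -1"
      then have "(\<tau>, \<epsilon>) \<in> ?I3" by auto
      then show "\<not> balanced d ?D (\<lambda>(i, j) r. (if i < mm then \<epsilon> i else \<tau> j) * W (corner k Nd e0 j) i r)"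
        using \<rho>3(2)[of "(\<tau>, \<epsilon>)"] W3 unfolding fst_conv snd_conv by blast
    qed
    finally show "(\<Sum>e\<in>orders k Nd. obstruction d (Suc mm) k (\<lambda>j. W (corner k Nd e j))) = 1"
      by (simp only: add_0_right)
  qed
qed

end

section \<open>The fundamental chain of the cube\<close>

definition cube_top :: "'v set \<Rightarrow> ('v \<Rightarrow> real) topology"
  where "cube_top Nd = subtopology (powertop_real UNIV)
    {\<theta>. (\<forall>v\<in>Nd. 0 \<le> \<theta> v \<and> \<theta> v \<le> 1) \<and> (\<forall>v. v \<notin> Nd \<longrightarrow> \<theta> v = 0)}"

lemma topspace_cube_top:
  "\<theta> \<in> topspace (cube_top Nd) \<longleftrightarrow> (\<forall>v\<in>Nd. 0 \<le> \<theta> v \<and> \<theta> v \<le> 1) \<and> (\<forall>v. v \<notin> Nd \<longrightarrow> \<theta> v = 0)"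
  by (simp add: cube_top_def)

text \<open>The affine map of the standard simplex onto the simplex of \<open>e\<close>: vertex
  \<open>j\<close> has coordinate \<open>1\<close> at \<open>v\<close> exactly if \<open>j\<close>
  exceeds the position of \<open>v\<close>.\<close>

definition cube_point :: "nat \<Rightarrow> 'v set \<Rightarrow> (nat \<Rightarrow> 'v) \<Rightarrow> (nat \<Rightarrow> real) \<Rightarrow> 'v \<Rightarrow> real"
  where "cube_point k Nd e t = (\<lambda>v. if v \<in> Nd then \<Sum>j\<in>{position k e v<..k}. t j else 0)"

definition cube_simplex :: "nat \<Rightarrow> 'v set \<Rightarrow> (nat \<Rightarrow> 'v) \<Rightarrow> (nat \<Rightarrow> real) \<Rightarrow> 'v \<Rightarrow> real"
  where "cube_simplex k Nd e = restrict (cube_point k Nd e) (standard_simplex k)"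

lemma continuous_map_cube_point:
  "continuous_map (subtopology (powertop_real UNIV) S) (powertop_real UNIV) (cube_point k Nd e)"
  unfolding continuous_map_componentwise_UNIV
proof
  fix v
  have "continuous_map (subtopology (powertop_real UNIV) S) euclideanreal (\<lambda>t. \<Sum>j\<in>{position k e v<..k}. t j)"
    by (intro continuous_map_sum continuous_map_from_subtopology continuous_map_product_projection) auto
  then show "continuous_map (subtopology (powertop_real UNIV) S) euclideanreal (\<lambda>t. cube_point k Nd e t v)"
    by (cases "v \<in> Nd") (simp_all add: cube_point_def)
qed

lemma cube_point_in:
  assumes "t \<in> standard_simplex k"
  shows "cube_point k Nd e t \<in> topspace (cube_top Nd)"
proof -
  have t: "\<And>j. 0 \<le> t j" "(\<Sum>j\<le>k. t j) = 1" using assms by (auto simp: standard_simplex_def)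
  have "0 \<le> (\<Sum>j\<in>{a<..k}. t j) \<and> (\<Sum>j\<in>{a<..k}. t j) \<le> 1" for a
  proof
    show "0 \<le> (\<Sum>j\<in>{a<..k}. t j)" using t(1) by (simp add: sum_nonneg)
    have "(\<Sum>j\<in>{a<..k}. t j) \<le> (\<Sum>j\<le>k. t j)" by (rule sum_mono2) (use t(1) in auto)
    then show "(\<Sum>j\<in>{a<..k}. t j) \<le> 1" using t(2) by simp
  qed
  then show ?thesis by (simp add: topspace_cube_top cube_point_def)
qed

lemma singular_simplex_restrict:
  assumes "continuous_map (subtopology (powertop_real UNIV) (standard_simplex p)) X f"
  shows "singular_simplex p X (restrict f (standard_simplex p))"
proof -
  have "continuous_map (subtopology (powertop_real UNIV) (standard_simplex p)) X (restrict f (standard_simplex p))"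
    by (rule continuous_map_eq[OF assms]) simp
  then show ?thesis by (simp add: singular_simplex_def)
qed

lemma singular_simplex_cube_simplex: "singular_simplex k (cube_top Nd) (cube_simplex k Nd e)"
  unfolding cube_simplex_def
proof (rule singular_simplex_restrict)
  show "continuous_map (subtopology (powertop_real UNIV) (standard_simplex k)) (cube_top Nd) (cube_point k Nd e)"
    unfolding cube_top_def
    by (rule continuous_map_into_subtopology[OF continuous_map_cube_point])
       (auto dest!: cube_point_in[of _ k Nd e] simp: topspace_cube_top)
qed

lemma vertices_cube_simplex:
  assumes "e \<in> orders k Nd" "j \<le> k"
  shows "vertices k (cube_simplex k Nd e) j = corner k Nd e j"
proof
  fix v
  have "(\<Sum>i\<in>{position k e v<..k}. if i = j then 1 else (0::real)) = (if position k e v < j then 1 else 0)"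
    using assms(2) by simp
  then show "vertices k (cube_simplex k Nd e) j v = corner k Nd e j v"
    using assms(2) by (simp add: vertices_def cube_simplex_def cube_point_def corner_def)
qed

lemma cube_face_eq:
  assumes "l \<le> Suc q"
  shows "singular_face (Suc q) l (cube_simplex (Suc q) Nd e) =
    restrict (\<lambda>t. cube_point (Suc q) Nd e (simplical_face l t)) (standard_simplex q)"
proof
  fix t show "singular_face (Suc q) l (cube_simplex (Suc q) Nd e) t =
    restrict (\<lambda>t. cube_point (Suc q) Nd e (simplical_face l t)) (standard_simplex q) t"
    using simplical_face_in_standard_simplex[of "Suc q" l t] assms
    by (simp add: singular_face_def cube_simplex_def restrict_def)
qed

lemma sum_shift_face:
  fixes t :: "nat \<Rightarrow> real"
  shows "(\<Sum>j\<in>{a<..Suc q}. simplical_face 0 t j) = (\<Sum>j\<in>{a..q}. t j)"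
proof -
  have "(\<Sum>j\<in>{a<..Suc q}. simplical_face 0 t j) = (\<Sum>j\<in>{Suc a..Suc q}. t (j - 1))"
    by (rule sum.cong) (auto simp: simplical_face_def)
  also have "\<dots> = (\<Sum>j\<in>{a..q}. t j)"
    by (rule sum.reindex_bij_witness[of _ Suc "\<lambda>j. j - 1"]) auto
  finally show ?thesis .
qed

lemma sum_last_face:
  fixes t :: "nat \<Rightarrow> real"
  shows "(\<Sum>j\<in>{a<..Suc q}. simplical_face (Suc q) t j) = (\<Sum>j\<in>{a<..q}. t j)"
  by (rule sum.mono_neutral_cong_right) (auto simp: simplical_face_def)

lemma sum_standard_simplex: "t \<in> standard_simplex q \<Longrightarrow> (\<Sum>j\<in>{0..q}. t j) = 1"
  by (simp add: standard_simplex_def atMost_atLeast0)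

definition cube_face :: "'v set \<Rightarrow> 'v \<Rightarrow> real \<Rightarrow> ('v \<Rightarrow> real) topology"
  where "cube_face Nd v b = subtopology (cube_top Nd) {\<theta>. \<theta> v = b}"

lemma singular_face_in_cube_face:
  assumes "singular_simplex (Suc q) (cube_top Nd) f" "l \<le> Suc q"
    and "\<And>t. t \<in> standard_simplex q \<Longrightarrow> singular_face (Suc q) l f t v = b"
  shows "singular_simplex q (cube_face Nd v b) (singular_face (Suc q) l f)"
  unfolding cube_face_def singular_simplex_subtopology
  using singular_simplex_singular_face[OF assms(1) _ assms(2)] assms(3) by auto

text \<open>Omitting the vertex at the origin makes the first coordinate of the order constantly
  \<open>1\<close>; likewise, omitting the vertex with all coordinates \<open>1\<close> makes the
  last coordinate \<open>0\<close>.\<close>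

lemma first_face:
  assumes e: "e \<in> orders (Suc q) Nd"
  shows "singular_simplex q (cube_face Nd (e 0) 1) (singular_face (Suc q) 0 (cube_simplex (Suc q) Nd e))"
proof (rule singular_face_in_cube_face[OF singular_simplex_cube_simplex])
  fix t assume "t \<in> standard_simplex q"
  then show "singular_face (Suc q) 0 (cube_simplex (Suc q) Nd e) t (e 0) = 1"
    using nth_in[OF e, of 0] position_nth[OF e, of 0] sum_standard_simplex[of t q]
    by (simp add: cube_face_eq cube_point_def sum_shift_face)
qed simp

lemma last_face:
  assumes e: "e \<in> orders (Suc q) Nd"
  shows "singular_simplex q (cube_face Nd (e q) 0) (singular_face (Suc q) (Suc q) (cube_simplex (Suc q) Nd e))"
proof (rule singular_face_in_cube_face[OF singular_simplex_cube_simplex])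
  fix t assume "t \<in> standard_simplex q"
  then show "singular_face (Suc q) (Suc q) (cube_simplex (Suc q) Nd e) t (e q) = 0"
    using nth_in[OF e, of q] position_nth[OF e, of q]
    by (simp add: cube_face_eq cube_point_def sum_last_face)
qed simp

definition swap_order :: "nat \<Rightarrow> nat \<Rightarrow> (nat \<Rightarrow> 'v) \<Rightarrow> nat \<Rightarrow> 'v"
  where "swap_order k l e = restrict (\<lambda>i. e (Transposition.transpose (l - 1) l i)) {..<k}"

lemma swap_order:
  assumes e: "e \<in> orders k Nd" and l: "0 < l" "l < k"
  shows "swap_order k l e \<in> orders k Nd" "swap_order k l (swap_order k l e) = e" "swap_order k l e \<noteq> e"
    "\<And>v. v \<in> Nd \<Longrightarrow> position k (swap_order k l e) v = Transposition.transpose (l - 1) l (position k e v)"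
proof -
  let ?\<tau> = "Transposition.transpose (l - 1) l"
  have \<tau>: "?\<tau> i < k" if "i < k" for i using l that by (auto simp: Transposition.transpose_def)
  have b\<tau>: "bij_betw ?\<tau> {..<k} {..<k}"
  proof (rule bij_betw_byWitness[of _ ?\<tau>])
  qed (use \<tau> in auto)
  have "bij_betw (e \<circ> ?\<tau>) {..<k} Nd" using e b\<tau> by (auto simp: orders_def intro: bij_betw_trans)
  then have "bij_betw (swap_order k l e) {..<k} Nd"
    by (rule iffD1[OF bij_betw_cong, rotated]) (simp add: swap_order_def)
  then show in_o: "swap_order k l e \<in> orders k Nd" by (simp add: orders_def swap_order_def)
  show "swap_order k l (swap_order k l e) = e"
  proof
    fix i show "swap_order k l (swap_order k l e) i = e i"
      using \<tau>[of i] e by (cases "i < k") (auto simp: swap_order_def orders_def extensional_def)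
  qed
  have "swap_order k l e l = e (l - 1)" using l by (simp add: swap_order_def)
  moreover have "e (l - 1) \<noteq> e l"
  proof
    assume "e (l - 1) = e l"
    then have "position k e (e (l - 1)) = position k e (e l)" by simp
    moreover have "position k e (e (l - 1)) = l - 1" by (rule position_nth[OF e]) (use l in simp)
    ultimately show False using position_nth[OF e l(2)] l(1) by simp
  qed
  ultimately show "swap_order k l e \<noteq> e" by auto
  fix v assume v: "v \<in> Nd"
  define p where "p = position k e v"
  have p: "p < k" "e p = v" using nth_position[OF e v] by (simp_all add: p_def)
  have "swap_order k l e (?\<tau> p) = v" using \<tau>[OF p(1)] p(2) by (simp add: swap_order_def)
  then show "position k (swap_order k l e) v = ?\<tau> (position k e v)"
    using position_nth[OF in_o \<tau>[OF p(1)]] by (simp add: p_def)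
qed

text \<open>Vertex \<open>l\<close> is the only one at which the coordinates in the places
  \<open>l - 1\<close> and \<open>l\<close> differ, so the face opposite to it is common to the two
  orders that interchange them.\<close>

lemma swap_order_face:
  assumes e: "e \<in> orders (Suc q) Nd" and l: "0 < l" "l < Suc q"
  shows "singular_face (Suc q) l (cube_simplex (Suc q) Nd (swap_order (Suc q) l e)) =
    singular_face (Suc q) l (cube_simplex (Suc q) Nd e)"
proof -
  have "(\<Sum>j\<in>{Transposition.transpose (l - 1) l p<..Suc q}. simplical_face l t j) =
      (\<Sum>j\<in>{p<..Suc q}. simplical_face l t j)" for p and t :: "nat \<Rightarrow> real"
  proof -
    have *: "(\<Sum>j\<in>{l - 1<..Suc q}. simplical_face l t j) = (\<Sum>j\<in>{l<..Suc q}. simplical_face l t j)"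
      by (rule sum.mono_neutral_right) (auto simp: simplical_face_def)
    consider "p = l - 1" | "p = l" | "p \<noteq> l - 1" "p \<noteq> l" by blast
    then show ?thesis using * by cases (simp_all add: Transposition.transpose_def)
  qed
  then have "cube_point (Suc q) Nd (swap_order (Suc q) l e) (simplical_face l t) =
      cube_point (Suc q) Nd e (simplical_face l t)" for t
    using swap_order(4)[OF e l] by (auto simp: cube_point_def fun_eq_iff)
  then show ?thesis using l by (simp add: cube_face_eq)
qed

text \<open>Congruence mod 2 for integral chains. It dispenses with the signs in boundaries and lets
  equal faces cancel in pairs.\<close>

definition cong2 :: "'a chain \<Rightarrow> 'a chain \<Rightarrow> bool"
  where "cong2 a b \<longleftrightarrow> (\<exists>w. a - b = w + w)"

lemma cong2_refl: "cong2 a a" unfolding cong2_def by (rule exI[of _ 0]) simp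

lemma cong2_add: "cong2 a b \<Longrightarrow> cong2 a' b' \<Longrightarrow> cong2 (a + a') (b + b')"
  unfolding cong2_def by (metis (no_types, opaque_lifting) add_diff_add add.left_commute add.assoc)

lemma cong2_trans: "cong2 a b \<Longrightarrow> cong2 b c \<Longrightarrow> cong2 a c"
  using cong2_add[of a b b c] unfolding cong2_def by (simp add: algebra_simps)

lemma cong2_sum: "(\<And>x. x \<in> A \<Longrightarrow> cong2 (g x) (g' x)) \<Longrightarrow> cong2 (sum g A) (sum g' A)"
  by (induction A rule: infinite_finite_induct) (auto simp: cong2_refl cong2_add)

lemma cong2_minus: "cong2 (- a) a"
  unfolding cong2_def by (rule exI[of _ "- a"]) simp

lemma cong2_sign: "cong2 (frag_cmul ((-1) ^ i) a) a"
  by (cases "even i") (simp_all add: cong2_refl cong2_minus)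

lemma cong2_double: "cong2 (a + a) 0"
  unfolding cong2_def by auto

lemma cong2_involution:
  assumes "finite S" "\<And>x. x \<in> S \<Longrightarrow> \<phi> x \<in> S" "\<And>x. x \<in> S \<Longrightarrow> \<phi> (\<phi> x) = x"
    "\<And>x. x \<in> S \<Longrightarrow> \<phi> x \<noteq> x" "\<And>x. x \<in> S \<Longrightarrow> f (\<phi> x) = f x"
  shows "cong2 (sum f S) 0"
  using assms
proof (induction "card S" arbitrary: S rule: less_induct)
  case less
  show ?case
  proof (cases "S = {}")
    case True then show ?thesis by (simp add: cong2_refl)
  next
    case False
    then obtain x where x: "x \<in> S" by blast
    define R where "R = S - {x, \<phi> x}"
    have sub: "{x, \<phi> x} \<subseteq> S" using x less.prems(2) by blast
    have "card R < card S"
      unfolding R_def by (rule psubset_card_mono) (use less.prems(1) x in auto)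
    moreover have "\<phi> y \<in> R" if y: "y \<in> R" for y
    proof -
      have yS: "y \<in> S" "y \<noteq> x" "y \<noteq> \<phi> x" using y by (auto simp: R_def)
      have "\<phi> y \<noteq> x" using less.prems(3)[OF yS(1)] yS(3) by auto
      moreover have "\<phi> y \<noteq> \<phi> x" using less.prems(3)[OF yS(1)] less.prems(3)[OF x] yS(2) by metis
      ultimately show ?thesis using less.prems(2)[OF yS(1)] by (simp add: R_def)
    qed
    ultimately have "cong2 (sum f R) 0"
      using less.hyps[of R] less.prems by (simp add: R_def)
    moreover have "sum f S = sum f R + sum f {x, \<phi> x}"
      unfolding R_def by (rule sum.subset_diff[OF sub less.prems(1)])
    moreover have "sum f {x, \<phi> x} = f x + f x" using less.prems(4)[OF x] less.prems(5)[OF x]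
      by (auto simp: eq_commute[of x])
    ultimately show ?thesis using cong2_add[OF _ cong2_double, of "sum f R" 0 "f x"] by simp
  qed
qed

definition cube_chain :: "nat \<Rightarrow> 'v set \<Rightarrow> ('v \<Rightarrow> real) chain"
  where "cube_chain k Nd = (\<Sum>e\<in>orders k Nd. frag_of (cube_simplex k Nd e))"

lemma singular_chain_cube_chain: "singular_chain k (cube_top Nd) (cube_chain k Nd)"
  unfolding cube_chain_def
  by (intro singular_chain_sum) (simp add: singular_chain_of singular_simplex_cube_simplex)

definition outer_faces :: "nat \<Rightarrow> 'v set \<Rightarrow> (nat \<Rightarrow> 'v) \<Rightarrow> ('v \<Rightarrow> real) chain"
  where "outer_faces q Nd e = frag_of (singular_face (Suc q) 0 (cube_simplex (Suc q) Nd e)) +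
    frag_of (singular_face (Suc q) (Suc q) (cube_simplex (Suc q) Nd e))"

text \<open>Interior faces cancel in pairs by interchanging neighbouring coordinates; what remains
  lies in the sides of the cube.\<close>

lemma boundary_cube_chain:
  fixes Nd :: "'a set"
  assumes "finite Nd"
  shows "cong2 (chain_boundary (Suc q) (cube_chain (Suc q) Nd)) (\<Sum>e\<in>orders (Suc q) Nd. outer_faces q Nd e)"
proof -
  let ?s = "cube_simplex (Suc q) Nd" and ?O = "orders (Suc q) Nd"
  let ?F = "\<lambda>l e. frag_of (singular_face (Suc q) l (?s e))"
  have "chain_boundary (Suc q) (cube_chain (Suc q) Nd) = (\<Sum>e\<in>?O. \<Sum>l\<le>Suc q. frag_cmul ((-1) ^ l) (?F l e))"
    unfolding cube_chain_def chain_boundary_sum by (rule sum.cong) (auto simp: chain_boundary_of)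
  moreover have "cong2 (\<Sum>e\<in>?O. \<Sum>l\<le>Suc q. frag_cmul ((-1) ^ l) (?F l e)) (\<Sum>e\<in>?O. \<Sum>l\<le>Suc q. ?F l e)"
    by (intro cong2_sum cong2_sign)
  moreover have "cong2 (\<Sum>e\<in>?O. \<Sum>l\<le>Suc q. ?F l e) (\<Sum>e\<in>?O. outer_faces q Nd e)"
  proof -
    have split: "(\<Sum>l\<le>Suc q. ?F l e) = outer_faces q Nd e + (\<Sum>l\<in>{1..q}. ?F l e)" for e
    proof -
      have "{..Suc q} = {0, Suc q} \<union> {1..q}" by auto
      then have "(\<Sum>l\<le>Suc q. ?F l e) = (\<Sum>l\<in>{0, Suc q} \<union> {1..q}. ?F l e)" by simp
      also have "\<dots> = (\<Sum>l\<in>{0, Suc q}. ?F l e) + (\<Sum>l\<in>{1..q}. ?F l e)"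
        by (rule sum.union_disjoint) auto
      finally show ?thesis by (simp add: outer_faces_def)
    qed
    have "(\<Sum>e\<in>?O. \<Sum>l\<le>Suc q. ?F l e) = (\<Sum>e\<in>?O. outer_faces q Nd e) + (\<Sum>l\<in>{1..q}. \<Sum>e\<in>?O. ?F l e)"
      unfolding split sum.distrib by (simp only: sum.swap[of _ "{1..q}" ?O])
    moreover have "cong2 (\<Sum>l\<in>{1..q}. \<Sum>e\<in>?O. ?F l e) (\<Sum>l\<in>{1..q}. 0 :: ('a \<Rightarrow> real) chain)"
    proof (rule cong2_sum)
      fix l assume "l \<in> {1..q}"
      then have l: "0 < l" "l < Suc q" by auto
      show "cong2 (\<Sum>e\<in>?O. ?F l e) 0"
        by (rule cong2_involution[of _ "swap_order (Suc q) l"])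
           (simp_all add: finite_orders assms swap_order l swap_order_face)
    qed
    then have "cong2 ((\<Sum>e\<in>?O. outer_faces q Nd e) + (\<Sum>l\<in>{1..q}. \<Sum>e\<in>?O. ?F l e))
        ((\<Sum>e\<in>?O. outer_faces q Nd e) + (\<Sum>l\<in>{1..q}. 0))"
      by (rule cong2_add[OF cong2_refl])
    ultimately show ?thesis by (simp only: sum.neutral_const add_0_right)
  qed
  ultimately show ?thesis using cong2_trans by (simp only:) blast
qed

text \<open>\<open>Q\<close> identifies the side \<open>\<theta> v = 1\<close> with the opposite
  side, up to the permutation \<open>\<omega> v\<close> of the other coordinates. This matches the
  first face of the order \<open>e\<close> with the last face of the order \<open>rot e\<close>,
  which moves \<open>e 0\<close> to the end and transports the other coordinates by
  \<open>\<omega> (e 0)\<close>.\<close>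

lemma outer_faces_cancel:
  fixes Q :: "('v \<Rightarrow> real) \<Rightarrow> 'b"
  assumes \<omega>: "\<And>v u. v \<in> Nd \<Longrightarrow> u \<in> Nd \<Longrightarrow> \<omega> v u \<in> Nd" "\<And>v u. v \<in> Nd \<Longrightarrow> u \<in> Nd \<Longrightarrow> \<omega> v (\<omega> v u) = u"
      "\<And>v. v \<in> Nd \<Longrightarrow> \<omega> v v = v"
    and Q: "\<And>v \<theta>. v \<in> Nd \<Longrightarrow> \<theta> \<in> topspace (cube_top Nd) \<Longrightarrow> \<theta> v = 1 \<Longrightarrow>
      Q \<theta> = Q (\<lambda>u. if u \<in> Nd \<and> u \<noteq> v then \<theta> (\<omega> v u) else 0)"
  shows "cong2 (chain_map q Q (\<Sum>e\<in>orders (Suc q) Nd. outer_faces q Nd e)) 0"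
proof -
  let ?s = "cube_simplex (Suc q) Nd" and ?O = "orders (Suc q) Nd"
  let ?G = "\<lambda>l e. simplex_map q Q (singular_face (Suc q) l (?s e))"
  define rot where "rot e = restrict (\<lambda>i. if i = q then e 0 else \<omega> (e 0) (e (Suc i))) {..<Suc q}" for e
  define unrot where "unrot e = restrict (\<lambda>i. if i = 0 then e q else \<omega> (e q) (e (i - 1))) {..<Suc q}" for e
  have nz: "e i \<in> Nd" if "e \<in> ?O" "i \<le> q" for e i
    by (rule nth_in[OF that(1)]) (use that(2) in simp)
  have inj: "i = j" if e: "e \<in> ?O" and ij: "e i = e j" "i \<le> q" "j \<le> q" for e i j
  proof -
    have "position (Suc q) e (e i) = position (Suc q) e (e j)" using ij(1) by (rule arg_cong)
    moreover have "position (Suc q) e (e i) = i" by (rule position_nth[OF e]) (use ij in simp)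
    moreover have "position (Suc q) e (e j) = j" by (rule position_nth[OF e]) (use ij in simp)
    ultimately show ?thesis by simp
  qed
  have card: "card Nd = Suc q" "finite Nd" if "e \<in> ?O" for e
    using that bij_betw_same_card[of e "{..<Suc q}" Nd] bij_betw_finite[of e "{..<Suc q}" Nd]
    by (auto simp: orders_def)
  have memI: "f \<in> ?O" if "e \<in> ?O" "f \<in> extensional {..<Suc q}" "\<And>i. i \<le> q \<Longrightarrow> f i \<in> Nd" "inj_on f {..<Suc q}" for e f
  proof -
    have "f ` {..<Suc q} \<subseteq> Nd" using that(3) by auto
    moreover have "card (f ` {..<Suc q}) = card Nd" using card[OF that(1)] that(4) by (simp add: card_image)
    ultimately have "f ` {..<Suc q} = Nd" using card_subset_eq card[OF that(1)] by metis
    then show ?thesis using that by (simp add: orders_def bij_betw_def)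
  qed
  have rot_in: "rot e \<in> ?O" if e: "e \<in> ?O" for e
  proof (rule memI[OF e])
    show "rot e \<in> extensional {..<Suc q}" by (simp add: rot_def)
    show "rot e i \<in> Nd" if "i \<le> q" for i using that nz[OF e] \<omega>(1) by (simp add: rot_def)
    have e0: "e 0 \<in> Nd" using nz[OF e, of 0] by simp
    have ne: "\<omega> (e 0) (e (Suc i)) \<noteq> e 0" if "i < q" for i
    proof
      assume "\<omega> (e 0) (e (Suc i)) = e 0"
      then have "\<omega> (e 0) (\<omega> (e 0) (e (Suc i))) = e 0" using \<omega>(3)[OF e0] by simp
      then have "e (Suc i) = e 0" using \<omega>(2)[OF e0 nz[OF e, of "Suc i"]] that by simp
      then show False using inj[OF e, of "Suc i" 0] that by simp
    qed
    have inj2: "i = j" if "\<omega> (e 0) (e (Suc i)) = \<omega> (e 0) (e (Suc j))" "i < q" "j < q" for i j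
    proof -
      have "\<omega> (e 0) (\<omega> (e 0) (e (Suc i))) = \<omega> (e 0) (\<omega> (e 0) (e (Suc j)))" using that(1) by (rule arg_cong)
      moreover have "\<omega> (e 0) (\<omega> (e 0) (e (Suc l))) = e (Suc l)" if "l < q" for l
        by (rule \<omega>(2)[OF e0 nz[OF e]]) (use that in simp)
      ultimately have "e (Suc i) = e (Suc j)" using that(2,3) by simp
      then show ?thesis using inj[OF e, of "Suc i" "Suc j"] that by simp
    qed
    show "inj_on (rot e) {..<Suc q}"
    proof (rule inj_onI)
      fix i j assume ij: "i \<in> {..<Suc q}" "j \<in> {..<Suc q}" "rot e i = rot e j"
      show "i = j"
      proof (cases "i = q"; cases "j = q")
        assume "i = q" "j \<noteq> q" then show ?thesis using ij ne[of j] by (simp add: rot_def)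
      next
        assume "i \<noteq> q" "j = q" then show ?thesis using ij ne[of i] by (simp add: rot_def)
      next
        assume "i \<noteq> q" "j \<noteq> q" then show ?thesis using ij inj2[of i j] by (simp add: rot_def)
      qed simp
    qed
  qed
  have unrot_in: "unrot e \<in> ?O" if e: "e \<in> ?O" for e
  proof (rule memI[OF e])
    show "unrot e \<in> extensional {..<Suc q}" by (simp add: unrot_def)
    show "unrot e i \<in> Nd" if "i \<le> q" for i using that nz[OF e] \<omega>(1) by (simp add: unrot_def)
    have e0: "e q \<in> Nd" using nz[OF e, of q] by simp
    have ne: "\<omega> (e q) (e i) \<noteq> e q" if "i < q" for i
    proof
      assume "\<omega> (e q) (e i) = e q"
      then have "\<omega> (e q) (\<omega> (e q) (e i)) = e q" using \<omega>(3)[OF e0] by simp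
      then have "e i = e q" using \<omega>(2)[OF e0 nz[OF e, of i]] that by simp
      then show False using inj[OF e, of i q] that by simp
    qed
    have inj2: "i = j" if "\<omega> (e q) (e i) = \<omega> (e q) (e j)" "i < q" "j < q" for i j
    proof -
      have "\<omega> (e q) (\<omega> (e q) (e i)) = \<omega> (e q) (\<omega> (e q) (e j))" using that(1) by (rule arg_cong)
      moreover have "\<omega> (e q) (\<omega> (e q) (e l)) = e l" if "l < q" for l
        by (rule \<omega>(2)[OF e0 nz[OF e]]) (use that in simp)
      ultimately have "e i = e j" using that(2,3) by simp
      then show ?thesis using inj[OF e, of i j] that by simp
    qed
    show "inj_on (unrot e) {..<Suc q}"
    proof (rule inj_onI)
      fix i j assume ij: "i \<in> {..<Suc q}" "j \<in> {..<Suc q}" "unrot e i = unrot e j"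
      show "i = j"
      proof (cases "i = 0"; cases "j = 0")
        assume a: "i = 0" "j \<noteq> 0"
        then have "j - 1 < q" using ij by auto
        then show ?thesis using a ij ne[of "j - 1"] by (simp add: unrot_def)
      next
        assume a: "i \<noteq> 0" "j = 0"
        then have "i - 1 < q" using ij by auto
        then show ?thesis using a ij ne[of "i - 1"] by (simp add: unrot_def)
      next
        assume "i \<noteq> 0" "j \<noteq> 0"
        moreover have "i - 1 < q" "j - 1 < q" using ij \<open>i \<noteq> 0\<close> \<open>j \<noteq> 0\<close> by auto
        ultimately have "i - 1 = j - 1" using ij inj2[of "i - 1" "j - 1"] by (simp add: unrot_def)
        then show ?thesis using \<open>i \<noteq> 0\<close> \<open>j \<noteq> 0\<close> by simp
      qed simp
    qed
  qed
  have unrot_rot: "unrot (rot e) = e" if e: "e \<in> ?O" for e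
  proof
    fix i show "unrot (rot e) i = e i"
    proof (cases "i < Suc q")
      case True
      then show ?thesis using \<omega>(2)[OF nz[OF e, of 0] nz[OF e, of i]] by (auto simp: unrot_def rot_def)
    next
      case False
      then show ?thesis using e by (simp add: unrot_def orders_def extensional_def)
    qed
  qed
  have rot_unrot: "rot (unrot e) = e" if e: "e \<in> ?O" for e
  proof
    fix i show "rot (unrot e) i = e i"
    proof (cases "i < Suc q")
      case True
      then show ?thesis using \<omega>(2)[OF nz[OF e, of q] nz[OF e, of i]] by (auto simp: unrot_def rot_def)
    next
      case False
      then show ?thesis using e by (simp add: rot_def orders_def extensional_def)
    qed
  qed
  have face: "?G 0 e = ?G (Suc q) (rot e)" if e: "e \<in> ?O" for e
  proof
    fix t show "?G 0 e t = ?G (Suc q) (rot e) t"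
    proof (cases "t \<in> standard_simplex q")
      case True
      define \<theta> where "\<theta> = cube_point (Suc q) Nd e (simplical_face 0 t)"
      have e0: "e 0 \<in> Nd" using nz[OF e, of 0] by simp
      have \<theta>in: "\<theta> \<in> topspace (cube_top Nd)"
        unfolding \<theta>_def by (rule cube_point_in) (use True simplical_face_in_standard_simplex[of "Suc q" 0 t] in simp)
      have \<theta>: "\<theta> u = (\<Sum>j\<in>{position (Suc q) e u..q}. t j)" if "u \<in> Nd" for u
        using that by (simp add: \<theta>_def cube_point_def sum_shift_face)
      have "\<theta> (e 0) = 1" using \<theta>[OF e0] position_nth[OF e, of 0] sum_standard_simplex[OF True] by simp
      then have "Q \<theta> = Q (\<lambda>u. if u \<in> Nd \<and> u \<noteq> e 0 then \<theta> (\<omega> (e 0) u) else 0)"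
        by (rule Q[OF e0 \<theta>in])
      also have "(\<lambda>u. if u \<in> Nd \<and> u \<noteq> e 0 then \<theta> (\<omega> (e 0) u) else 0) =
          cube_point (Suc q) Nd (rot e) (simplical_face (Suc q) t)"
      proof
        fix u
        show "(if u \<in> Nd \<and> u \<noteq> e 0 then \<theta> (\<omega> (e 0) u) else 0) =
          cube_point (Suc q) Nd (rot e) (simplical_face (Suc q) t) u"
        proof (cases "u \<in> Nd")
          case u: True
          define i where "i = position (Suc q) (rot e) u"
          have i: "i \<le> q" "rot e i = u" using nth_position[OF rot_in[OF e] u] by (simp_all add: i_def)
          have cp: "cube_point (Suc q) Nd (rot e) (simplical_face (Suc q) t) u = (\<Sum>j\<in>{i<..q}. t j)"
            using u by (simp add: cube_point_def sum_last_face i_def)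
          show ?thesis
          proof (cases "i = q")
            case True
            then have "u = e 0" using i by (simp add: rot_def)
            moreover have "(\<Sum>j\<in>{i<..q}. t j) = 0" using True by simp
            ultimately show ?thesis unfolding cp by simp
          next
            case False
            then have "u = \<omega> (e 0) (e (Suc i))" using i by (simp add: rot_def)
            then have w: "\<omega> (e 0) u = e (Suc i)" using \<omega>(2)[OF e0 nz[OF e, of "Suc i"]] False i by simp
            have "u \<noteq> e 0"
            proof
              assume "u = e 0"
              then have "e (Suc i) = e 0" using w \<omega>(3)[OF e0] by simp
              then show False using inj[OF e, of "Suc i" 0] False i by simp
            qed
            moreover have "position (Suc q) e (e (Suc i)) = Suc i"
              by (rule position_nth[OF e]) (use False i in simp)
            moreover have "{Suc i..q} = {i<..q}" by auto
            moreover have "\<theta> (e (Suc i)) = (\<Sum>j\<in>{position (Suc q) e (e (Suc i))..q}. t j)"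
              by (rule \<theta>, rule nz[OF e]) (use False i in simp)
            ultimately show ?thesis unfolding cp using u w by simp
          qed
        qed (simp add: cube_point_def)
      qed
      finally show ?thesis using True by (simp add: simplex_map_def cube_face_eq \<theta>_def)
    qed (simp add: simplex_map_def)
  qed
  have "chain_map q Q (\<Sum>e\<in>?O. outer_faces q Nd e) = (\<Sum>e\<in>?O. frag_of (?G 0 e)) + (\<Sum>e\<in>?O. frag_of (?G (Suc q) e))"
    unfolding outer_faces_def sum.distrib chain_map_add
    by (cases "finite ?O") (simp_all add: chain_map_sum)
  also have "(\<Sum>e\<in>?O. frag_of (?G 0 e)) = (\<Sum>e\<in>?O. frag_of (?G (Suc q) e))"
    by (rule sum.reindex_bij_witness[of _ unrot rot]) (use rot_in unrot_in unrot_rot rot_unrot face in simp_all)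
  finally show ?thesis by (simp only: cong2_double)
qed

section \<open>Clusters\<close>

text \<open>A quantitative form of acyclicity: signed weights on the points of a configuration vanish
  as soon as their sums vanish over all classes of any partitions of the points into classes of
  small width (in one coordinate each).\<close>

definition rigid :: "'p set \<Rightarrow> ('p \<Rightarrow> real) \<Rightarrow> ('p \<Rightarrow> real) \<Rightarrow> real \<Rightarrow> bool"
  where "rigid P x y \<eta> \<longleftrightarrow> (\<forall>(X :: 'p \<Rightarrow> real) (Y :: 'p \<Rightarrow> real) (m :: 'p \<Rightarrow> real).
    (\<forall>p\<in>P. \<forall>q\<in>P. X p = X q \<longrightarrow> \<bar>x p - x q\<bar> < \<eta>) \<longrightarrow>
    (\<forall>p\<in>P. \<forall>q\<in>P. Y p = Y q \<longrightarrow> \<bar>y p - y q\<bar> < \<eta>) \<longrightarrow>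
    (\<forall>l. (\<Sum>p\<in>{p\<in>P. X p = l}. m p) = 0) \<longrightarrow> (\<forall>l. (\<Sum>p\<in>{p\<in>P. Y p = l}. m p) = 0) \<longrightarrow>
    (\<forall>p\<in>P. m p = 0))"

lemma rigidD:
  fixes X Y m :: "'p \<Rightarrow> real"
  assumes "rigid P x y \<eta>"
    "\<And>p q. p \<in> P \<Longrightarrow> q \<in> P \<Longrightarrow> X p = X q \<Longrightarrow> \<bar>x p - x q\<bar> < \<eta>"
    "\<And>p q. p \<in> P \<Longrightarrow> q \<in> P \<Longrightarrow> Y p = Y q \<Longrightarrow> \<bar>y p - y q\<bar> < \<eta>"
    "\<And>l. (\<Sum>p\<in>{p\<in>P. X p = l}. m p) = 0" "\<And>l. (\<Sum>p\<in>{p\<in>P. Y p = l}. m p) = 0" "p \<in> P"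
  shows "m p = 0"
  using assms unfolding rigid_def by blast

lemma rigidI:
  assumes "\<And>(X :: 'p \<Rightarrow> real) (Y :: 'p \<Rightarrow> real) (m :: 'p \<Rightarrow> real) p.
    (\<And>p q. p \<in> P \<Longrightarrow> q \<in> P \<Longrightarrow> X p = X q \<Longrightarrow> \<bar>x p - x q\<bar> < \<eta>) \<Longrightarrow>
    (\<And>p q. p \<in> P \<Longrightarrow> q \<in> P \<Longrightarrow> Y p = Y q \<Longrightarrow> \<bar>y p - y q\<bar> < \<eta>) \<Longrightarrow>
    (\<And>l. (\<Sum>p\<in>{p\<in>P. X p = l}. m p) = 0) \<Longrightarrow> (\<And>l. (\<Sum>p\<in>{p\<in>P. Y p = l}. m p) = 0) \<Longrightarrow> p \<in> P \<Longrightarrow> m p = 0"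
  shows "rigid P x y \<eta>"
  unfolding rigid_def using assms by (intro allI impI ballI) blast

lemma rigid_swap: "rigid P x y \<eta> \<Longrightarrow> rigid P y x \<eta>"
  by (rule rigidI) (rule rigidD[of P x y \<eta>], assumption+)

lemma rigid_mono:
  assumes "rigid P x y \<eta>" "\<eta>' \<le> \<eta>"
  shows "rigid P x y \<eta>'"
proof (rule rigidI)
  fix X Y m :: "'a \<Rightarrow> real" and p
  assume *: "\<And>p q. p \<in> P \<Longrightarrow> q \<in> P \<Longrightarrow> X p = X q \<Longrightarrow> \<bar>x p - x q\<bar> < \<eta>'"
    "\<And>p q. p \<in> P \<Longrightarrow> q \<in> P \<Longrightarrow> Y p = Y q \<Longrightarrow> \<bar>y p - y q\<bar> < \<eta>'"
    "\<And>l. (\<Sum>p\<in>{p\<in>P. X p = l}. m p) = 0" "\<And>l. (\<Sum>p\<in>{p\<in>P. Y p = l}. m p) = 0" "p \<in> P"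
  show "m p = 0"
    by (rule rigidD[OF assms(1) _ _ *(3,4,5)])
       (rule less_le_trans[OF *(1) assms(2)], assumption+, rule less_le_trans[OF *(2) assms(2)], assumption+)
qed

lemma rigid_cong:
  assumes "rigid P x y \<eta>" "\<And>p. p \<in> P \<Longrightarrow> x' p = x p" "\<And>p. p \<in> P \<Longrightarrow> y' p = y p"
  shows "rigid P x' y' \<eta>"
proof (rule rigidI)
  fix X Y m :: "'a \<Rightarrow> real" and p
  assume *: "\<And>p q. p \<in> P \<Longrightarrow> q \<in> P \<Longrightarrow> X p = X q \<Longrightarrow> \<bar>x' p - x' q\<bar> < \<eta>"
    "\<And>p q. p \<in> P \<Longrightarrow> q \<in> P \<Longrightarrow> Y p = Y q \<Longrightarrow> \<bar>y' p - y' q\<bar> < \<eta>"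
    "\<And>l. (\<Sum>p\<in>{p\<in>P. X p = l}. m p) = 0" "\<And>l. (\<Sum>p\<in>{p\<in>P. Y p = l}. m p) = 0" "p \<in> P"
  show "m p = 0"
  proof (rule rigidD[OF assms(1) _ _ *(3,4,5)])
    show "\<bar>x a - x b\<bar> < \<eta>" if "a \<in> P" "b \<in> P" "X a = X b" for a b
      using *(1)[OF that] assms(2)[OF that(1)] assms(2)[OF that(2)] by simp
    show "\<bar>y a - y b\<bar> < \<eta>" if "a \<in> P" "b \<in> P" "Y a = Y b" for a b
      using *(2)[OF that] assms(3)[OF that(1)] assms(3)[OF that(2)] by simp
  qed
qed

lemma rigid_scale:
  assumes "rigid P x y \<eta>" "0 < s"
  shows "rigid P (\<lambda>p. a + s * x p) (\<lambda>p. c + s * y p) (s * \<eta>)"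
proof (rule rigidI)
  fix X Y m :: "'a \<Rightarrow> real" and p
  assume *: "\<And>p q. p \<in> P \<Longrightarrow> q \<in> P \<Longrightarrow> X p = X q \<Longrightarrow> \<bar>(a + s * x p) - (a + s * x q)\<bar> < s * \<eta>"
    "\<And>p q. p \<in> P \<Longrightarrow> q \<in> P \<Longrightarrow> Y p = Y q \<Longrightarrow> \<bar>(c + s * y p) - (c + s * y q)\<bar> < s * \<eta>"
    "\<And>l. (\<Sum>p\<in>{p\<in>P. X p = l}. m p) = 0" "\<And>l. (\<Sum>p\<in>{p\<in>P. Y p = l}. m p) = 0" "p \<in> P"
  have sc: "\<bar>z - w\<bar> < \<eta>" if "\<bar>(b + s * z) - (b + s * w)\<bar> < s * \<eta>" for b z w
  proof -
    have "(b + s * z) - (b + s * w) = s * (z - w)" by (simp add: right_diff_distrib)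
    then show ?thesis using that assms(2) by (simp add: abs_mult)
  qed
  show "m p = 0"
    by (rule rigidD[OF assms(1) _ _ *(3,4,5)]) (rule sc, rule *(1), assumption+, rule sc, rule *(2), assumption+)
qed

lemma rigid_image:
  assumes "inj_on f P" "rigid P (\<lambda>p. x (f p)) (\<lambda>p. y (f p)) \<eta>"
  shows "rigid (f ` P) x y \<eta>"
proof (rule rigidI)
  fix X Y m :: "'b \<Rightarrow> real" and p
  assume *: "\<And>p q. p \<in> f ` P \<Longrightarrow> q \<in> f ` P \<Longrightarrow> X p = X q \<Longrightarrow> \<bar>x p - x q\<bar> < \<eta>"
    "\<And>p q. p \<in> f ` P \<Longrightarrow> q \<in> f ` P \<Longrightarrow> Y p = Y q \<Longrightarrow> \<bar>y p - y q\<bar> < \<eta>"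
    "\<And>l. (\<Sum>p\<in>{p\<in>f ` P. X p = l}. m p) = 0" "\<And>l. (\<Sum>p\<in>{p\<in>f ` P. Y p = l}. m p) = 0" "p \<in> f ` P"
  have re: "(\<Sum>p\<in>{p\<in>P. Z (f p) = l}. m (f p)) = (\<Sum>p\<in>{p\<in>f ` P. Z p = l}. m p)" for Z :: "'b \<Rightarrow> real" and l
  proof -
    have "{p\<in>f ` P. Z p = l} = f ` {p\<in>P. Z (f p) = l}" by blast
    moreover have "inj_on f {p\<in>P. Z (f p) = l}" by (rule inj_on_subset[OF assms(1)]) blast
    ultimately show ?thesis by (simp add: sum.reindex)
  qed
  obtain q where q: "q \<in> P" "p = f q" using *(5) by blast
  have "m (f q) = 0"
    by (rule rigidD[OF assms(2), of "\<lambda>p. X (f p)" "\<lambda>p. Y (f p)" "\<lambda>p. m (f p)"])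
       (use * q re in \<open>auto\<close>)
  then show "m p = 0" using q by simp
qed

lemma class_sums_part:
  fixes X :: "'p \<Rightarrow> real" and m :: "'p \<Rightarrow> real"
  assumes "\<And>l. (\<Sum>p\<in>{p\<in>A \<union> B. X p = l}. m p) = 0" "\<And>a b. a \<in> A \<Longrightarrow> b \<in> B \<Longrightarrow> X a \<noteq> X b"
  shows "(\<Sum>p\<in>{p\<in>A. X p = l}. m p) = 0"
proof (cases "\<exists>a\<in>A. X a = l")
  case True
  then have "{p\<in>A. X p = l} = {p\<in>A \<union> B. X p = l}" using assms(2) by blast
  then show ?thesis using assms(1) by simp
next
  case False
  then have "{p\<in>A. X p = l} = {}" by blast
  then show ?thesis by (simp only: sum.empty)
qed

text \<open>No class of either partition meets both parts, so the parts can be treated one by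
  one.\<close>

lemma rigid_union_separated:
  assumes A: "rigid A x y \<eta>" and B: "rigid B x y \<eta>"
    and sep: "\<And>a b. a \<in> A \<Longrightarrow> b \<in> B \<Longrightarrow> \<eta> \<le> \<bar>x a - x b\<bar> \<and> \<eta> \<le> \<bar>y a - y b\<bar>"
  shows "rigid (A \<union> B) x y \<eta>"
proof (rule rigidI)
  fix X Y m :: "'a \<Rightarrow> real" and p
  assume *: "\<And>p q. p \<in> A \<union> B \<Longrightarrow> q \<in> A \<union> B \<Longrightarrow> X p = X q \<Longrightarrow> \<bar>x p - x q\<bar> < \<eta>"
    "\<And>p q. p \<in> A \<union> B \<Longrightarrow> q \<in> A \<union> B \<Longrightarrow> Y p = Y q \<Longrightarrow> \<bar>y p - y q\<bar> < \<eta>"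
    "\<And>l. (\<Sum>p\<in>{p\<in>A \<union> B. X p = l}. m p) = 0" "\<And>l. (\<Sum>p\<in>{p\<in>A \<union> B. Y p = l}. m p) = 0" "p \<in> A \<union> B"
  have Xne: "X a \<noteq> X b" and Yne: "Y a \<noteq> Y b" if "a \<in> A" "b \<in> B" for a b
    using *(1,2)[of a b] sep[OF that] that by auto
  have comm: "B \<union> A = A \<union> B" by blast
  have "m p = 0" if "p \<in> A" for p
    by (rule rigidD[OF A _ _ class_sums_part[OF *(3)] class_sums_part[OF *(4)] that])
       (use *(1,2) Xne Yne in blast)+
  moreover have "m p = 0" if "p \<in> B" for p
    by (rule rigidD[OF B _ _ class_sums_part[OF *(3)[folded comm]] class_sums_part[OF *(4)[folded comm]] that])
       (use *(1,2) Xne[symmetric] Yne[symmetric] in blast)+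
  ultimately show "m p = 0" using *(5) by blast
qed

text \<open>The parts are separated in the first coordinate only, but \<open>B\<close> is narrow in
  the second. The weights on \<open>A\<close> have total zero by the first partition, and the
  classes of the second one that miss \<open>B\<close> have sum zero, so the merged rest has sum
  zero over \<open>A\<close> as well. Hence the weights on \<open>A\<close> vanish by its coarser
  tolerance, and those on \<open>B\<close> follow.\<close>

lemma rigid_union_mixed:
  assumes fin: "finite A" and A: "rigid A x y \<eta>A" and B: "rigid B x y \<eta>"
    and sep: "\<And>a b. a \<in> A \<Longrightarrow> b \<in> B \<Longrightarrow> \<eta> \<le> \<bar>x a - x b\<bar>"
    and diam: "\<And>b b'. b \<in> B \<Longrightarrow> b' \<in> B \<Longrightarrow> \<bar>y b - y b'\<bar> \<le> D"
    and ineq: "D + 2 * \<eta> \<le> \<eta>A" "\<eta> \<le> \<eta>A"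
  shows "rigid (A \<union> B) x y \<eta>"
proof (rule rigidI)
  fix X Y m :: "'a \<Rightarrow> real" and p
  assume *: "\<And>p q. p \<in> A \<union> B \<Longrightarrow> q \<in> A \<union> B \<Longrightarrow> X p = X q \<Longrightarrow> \<bar>x p - x q\<bar> < \<eta>"
    "\<And>p q. p \<in> A \<union> B \<Longrightarrow> q \<in> A \<union> B \<Longrightarrow> Y p = Y q \<Longrightarrow> \<bar>y p - y q\<bar> < \<eta>"
    "\<And>l. (\<Sum>p\<in>{p\<in>A \<union> B. X p = l}. m p) = 0" "\<And>l. (\<Sum>p\<in>{p\<in>A \<union> B. Y p = l}. m p) = 0" "p \<in> A \<union> B"
  have Xne: "X a \<noteq> X b" if "a \<in> A" "b \<in> B" for a b
    using *(1)[of a b] sep[OF that] that by auto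
  have comm: "B \<union> A = A \<union> B" by blast
  have XA: "(\<Sum>p\<in>{p\<in>A. X p = l}. m p) = 0" for l by (rule class_sums_part[OF *(3) Xne])
  have XB: "(\<Sum>p\<in>{p\<in>B. X p = l}. m p) = 0" for l
    by (rule class_sums_part[OF *(3)[folded comm]]) (use Xne[symmetric] in blast)
  have totA: "(\<Sum>p\<in>A. m p) = 0"
  proof -
    have "(\<Sum>l\<in>X ` A. \<Sum>p\<in>{p\<in>A. X p = l}. m p) = (\<Sum>p\<in>A. m p)"
      by (rule sum.group) (use fin in auto)
    then show ?thesis by (simp only: XA sum.neutral_const)
  qed
  have YA: "(\<Sum>p\<in>{p\<in>A. Y p = l}. m p) = 0" if "l \<notin> Y ` B" for l
  proof -
    have "{p\<in>A. Y p = l} = {p\<in>A \<union> B. Y p = l}" using that by blast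
    then show ?thesis using *(4) by simp
  qed
  define t0 where "t0 = (SOME t. t \<in> Y ` B)"
  have t0: "t0 \<in> Y ` B" if "b \<in> B" for b
    unfolding t0_def by (rule someI[of _ "Y b"]) (use that in blast)
  text \<open>Merging all classes that meet the narrow part \<open>B\<close> keeps the classes of \<open>A\<close> narrow.\<close>
  define Y' where "Y' p = (if Y p \<in> Y ` B then t0 else Y p)" for p
  have mA: "m p = 0" if p: "p \<in> A" for p
  proof (rule rigidD[OF A _ _ XA _ p, of Y'])
    show "\<bar>x a - x b\<bar> < \<eta>A" if "a \<in> A" "b \<in> A" "X a = X b" for a b
      using *(1)[of a b] that ineq by simp
    fix a b assume ab: "a \<in> A" "b \<in> A" "Y' a = Y' b"
    show "\<bar>y a - y b\<bar> < \<eta>A"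
    proof (cases "Y a \<in> Y ` B \<and> Y b \<in> Y ` B")
      case True
      then obtain c c' where c: "c \<in> B" "Y a = Y c" "c' \<in> B" "Y b = Y c'" by blast
      have "\<bar>y a - y c\<bar> < \<eta>" "\<bar>y b - y c'\<bar> < \<eta>" using *(2)[of a c] *(2)[of b c'] c ab by auto
      then show ?thesis using diam[OF c(1,3)] ineq by linarith
    next
      case False
      have "Y a = Y b"
      proof (cases "Y a \<in> Y ` B")
        case True
        then have "Y b = t0" using False ab(3) by (simp add: Y'_def)
        moreover have "t0 \<in> Y ` B" using True t0 by blast
        ultimately show ?thesis using False True by simp
      next
        case na: False
        show ?thesis
        proof (cases "Y b \<in> Y ` B")
          case True
          then have "Y a = t0" using na ab(3) by (simp add: Y'_def)
          moreover have "t0 \<in> Y ` B" using True t0 by blast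
          ultimately show ?thesis using na by simp
        next
          case False
          then show ?thesis using na ab(3) by (simp add: Y'_def)
        qed
      qed
      then show ?thesis using *(2)[of a b] ab ineq by simp
    qed
  next
    fix l
    show "(\<Sum>p\<in>{p\<in>A. Y' p = l}. m p) = 0"
    proof (cases "l \<in> Y ` B")
      case False
      then have "{p\<in>A. Y' p = l} = {p\<in>A. Y p = l}" using t0 by (auto simp: Y'_def)
      then show ?thesis using YA[OF False] by simp
    next
      case True
      show ?thesis
      proof (cases "l = t0")
        case False
        then have "{p\<in>A. Y' p = l} = {}" using True by (auto simp: Y'_def)
        then show ?thesis by (simp only: sum.empty)
      next
        case lt: True
        define A' where "A' = {p\<in>A. Y p \<notin> Y ` B}"
        have "{p\<in>A. Y' p = l} = A - A'" using lt True by (auto simp: Y'_def A'_def)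
        moreover have "(\<Sum>p\<in>A'. m p) = 0"
        proof -
          have "(\<Sum>l\<in>Y ` A'. \<Sum>p\<in>{p\<in>A'. Y p = l}. m p) = (\<Sum>p\<in>A'. m p)"
            by (rule sum.group) (use fin in \<open>auto simp: A'_def\<close>)
          moreover have "(\<Sum>p\<in>{p\<in>A'. Y p = l}. m p) = 0" if "l \<in> Y ` A'" for l
          proof -
            have l: "l \<notin> Y ` B" using that by (auto simp: A'_def)
            then have "{p\<in>A'. Y p = l} = {p\<in>A. Y p = l}" by (auto simp: A'_def)
            then show ?thesis using YA[OF l] by simp
          qed
          ultimately show ?thesis by simp
        qed
        moreover have "(\<Sum>p\<in>A - A'. m p) = (\<Sum>p\<in>A. m p) - (\<Sum>p\<in>A'. m p)"
          by (rule sum_diff) (use fin in \<open>auto simp: A'_def\<close>)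
        ultimately show ?thesis using totA by simp
      qed
    qed
  qed
  have YB: "(\<Sum>p\<in>{p\<in>B. Y p = l}. m p) = 0" for l
  proof (cases "finite B")
    case True
    have "(\<Sum>p\<in>{p\<in>B. Y p = l}. m p) = (\<Sum>p\<in>{p\<in>A \<union> B. Y p = l}. m p)"
      by (rule sum.mono_neutral_left) (use fin True mA in auto)
    then show ?thesis using *(4) by simp
  next
    case False
    show ?thesis
    proof (cases "finite {p\<in>B. Y p = l}")
      case True
      have "(\<Sum>p\<in>{p\<in>B. Y p = l}. m p) = (\<Sum>p\<in>{p\<in>A \<union> B. Y p = l}. m p)"
      proof (rule sum.mono_neutral_left)
        have "{p\<in>A \<union> B. Y p = l} \<subseteq> A \<union> {p\<in>B. Y p = l}" by blast
        then show "finite {p\<in>A \<union> B. Y p = l}" using fin True finite_subset by blast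
      qed (use mA in auto)
      then show ?thesis using *(4) by simp
    qed simp
  qed
  have "m p = 0" if "p \<in> B" for p
    by (rule rigidD[OF B _ _ XB YB that]) (use *(1,2) in blast)+
  then show "m p = 0" using mA *(5) by blast
qed

text \<open>The width up to which a cluster of height \<open>b\<close> is rigid. In a cluster of
  height \<open>b + 1\<close> the smaller half is shrunk by the factor \<open>eta b / 256\<close>,
  and its tolerance \<open>eta b\<close> shrinks with it.\<close>

fun eta :: "nat \<Rightarrow> real" where
  "eta 0 = 1"
| "eta (Suc b) = (eta b)\<^sup>2 / 256"

lemma eta_bounds: "0 < eta b \<and> eta b \<le> 1"
proof (induction b)
  case (Suc b)
  then have "(eta b)\<^sup>2 \<le> 1" by (simp add: power_le_one)
  then show ?case using Suc by simp
qed simp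

text \<open>It rises from \<open>0\<close> to \<open>1\<close> for \<open>t\<close> between
  \<open>5 / 8\<close> and \<open>7 / 8\<close>, where the two halves of a cluster are well apart in
  both coordinates.\<close>

definition ramp :: "real \<Rightarrow> real"
  where "ramp t = min 1 (max 0 (4 * t - 5 / 2))"

definition scale :: "bool \<Rightarrow> real \<Rightarrow> real \<Rightarrow> real"
  where "scale x r t = (if x then 1 - (1 - r) * ramp t else r + (1 - r) * ramp t)"

text \<open>Half a turn along a diamond, from \<open>(1, 0)\<close> through \<open>(0, 1)\<close> to
  \<open>(-1, 0)\<close>.\<close>

definition dir :: "real \<Rightarrow> real \<times> real"
  where "dir t = (1 - 2 * t, 1 - \<bar>1 - 2 * t\<bar>)"

definition side :: "bool \<Rightarrow> real"
  where "side x = (if x then 1 else -1)"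

text \<open>Two subclusters revolve around each other; when they are close to sharing a coordinate,
  one of them is much smaller than the other, and they exchange their sizes in between.\<close>

fun cluster :: "(bool list \<Rightarrow> real) \<Rightarrow> bool list \<Rightarrow> real \<times> real" where
  "cluster \<theta> [] = (0, 0)"
| "cluster \<theta> (x # w) = side x *\<^sub>R dir (\<theta> []) +
     (scale x (eta (length w) / 16) (\<theta> []) / 16) *\<^sub>R cluster (\<lambda>a. \<theta> (x # a)) w"

lemma ramp_bounds: "0 \<le> ramp t" "ramp t \<le> 1"
  by (auto simp: ramp_def)

lemma scale_bounds:
  assumes "0 \<le> r" "r \<le> 1"
  shows "r \<le> scale x r t" "scale x r t \<le> 1"
proof -
  have "0 \<le> (1 - r) * ramp t" "(1 - r) * ramp t \<le> (1 - r) * 1"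
    using assms ramp_bounds[of t] by (auto intro!: mult_nonneg_nonneg mult_left_mono simp del: mult_1_right)
  then show "r \<le> scale x r t" "scale x r t \<le> 1" by (auto simp: scale_def)
qed

lemma cluster_bounds:
  assumes "\<And>a. length a < length w \<Longrightarrow> 0 \<le> \<theta> a \<and> \<theta> a \<le> 1"
  shows "\<bar>fst (cluster \<theta> w)\<bar> \<le> 2 \<and> \<bar>snd (cluster \<theta> w)\<bar> \<le> 2"
  using assms
proof (induction w arbitrary: \<theta>)
  case (Cons x w)
  let ?s = "scale x (eta (length w) / 16) (\<theta> []) / 16"
  let ?c = "cluster (\<lambda>a. \<theta> (x # a)) w"
  have IH: "\<bar>fst ?c\<bar> \<le> 2 \<and> \<bar>snd ?c\<bar> \<le> 2"
    by (rule Cons.IH) (use Cons.prems in simp)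
  have e: "0 \<le> eta (length w) / 16" "eta (length w) / 16 \<le> 1" using eta_bounds[of "length w"] by auto
  have s: "0 \<le> ?s" "?s \<le> 1 / 16" using scale_bounds[OF e, of x "\<theta> []"] e by auto
  have b: "\<bar>?s * z\<bar> \<le> 1 / 8" if "\<bar>z\<bar> \<le> 2" for z
  proof -
    have "\<bar>?s * z\<bar> = ?s * \<bar>z\<bar>" using s by (simp add: abs_mult)
    also have "\<dots> \<le> 1 / 16 * 2" by (rule mult_mono) (use s that in auto)
    finally show ?thesis by simp
  qed
  have t: "0 \<le> \<theta> []" "\<theta> [] \<le> 1" using Cons.prems[of "[]"] by auto
  have "\<bar>side x * (1 - 2 * \<theta> [])\<bar> \<le> 1" "\<bar>side x * (1 - \<bar>1 - 2 * \<theta> []\<bar>)\<bar> \<le> 1"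
    using t by (auto simp: side_def)
  moreover have "\<bar>?s * fst ?c\<bar> \<le> 1 / 8" "\<bar>?s * snd ?c\<bar> \<le> 1 / 8" using b IH by auto
  ultimately have "\<bar>side x * (1 - 2 * \<theta> []) + ?s * fst ?c\<bar> \<le> 2"
      "\<bar>side x * (1 - \<bar>1 - 2 * \<theta> []\<bar>) + ?s * snd ?c\<bar> \<le> 2" by linarith+
  then show ?case by (simp add: dir_def)
qed simp

definition leaves :: "nat \<Rightarrow> bool list set"
  where "leaves b = {w. length w = b}"

lemma leaves_Suc: "leaves (Suc b) = Cons True ` leaves b \<union> Cons False ` leaves b"
  by (auto simp: leaves_def length_Suc_conv image_iff)

lemma finite_leaves: "finite (leaves b)"
  by (induction b) (simp_all add: leaves_Suc, simp add: leaves_def)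

text \<open>If both coordinates of \<open>dir\<close> have absolute value at least
  \<open>1 / 4\<close>, the halves are separated in both coordinates. Otherwise they are separated
  in one coordinate at least, no exchange of sizes is under way, and the smaller half is narrow
  enough to be merged into the classes of the larger one.\<close>

lemma rigid_cluster:
  assumes "\<And>a. length a < b \<Longrightarrow> 0 \<le> \<theta> a \<and> \<theta> a \<le> 1"
  shows "rigid (leaves b) (\<lambda>w. fst (cluster \<theta> w)) (\<lambda>w. snd (cluster \<theta> w)) (eta b)"
  using assms
proof (induction b arbitrary: \<theta>)
  case 0
  show ?case
  proof (rule rigidI)
    fix X Y m :: "bool list \<Rightarrow> real" and p
    assume *: "\<And>l. (\<Sum>p\<in>{p\<in>leaves 0. X p = l}. m p) = 0" "p \<in> leaves 0"
    have "{p\<in>leaves 0. X p = X []} = {[]}" by (auto simp: leaves_def)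
    then show "m p = 0" using *(1)[of "X []"] *(2) by (simp add: leaves_def)
  qed
next
  case (Suc b)
  define t where "t = \<theta> []"
  define r where "r = eta b / 16"
  define s where "s x = scale x r t / 16" for x
  let ?fx = "\<lambda>w. fst (cluster \<theta> w)" and ?fy = "\<lambda>w. snd (cluster \<theta> w)"
  define u1 where "u1 = 1 - 2 * t"
  define u2 where "u2 = 1 - \<bar>1 - 2 * t\<bar>"
  have t: "0 \<le> t" "t \<le> 1" using Suc.prems[of "[]"] by (auto simp: t_def)
  have e: "0 < eta b" "eta b \<le> 1" using eta_bounds[of b] by auto
  have r: "0 < r" "r \<le> 1" using e by (auto simp: r_def)
  have s: "r / 16 \<le> s x" "s x \<le> 1 / 16" "0 < s x" for x
    using scale_bounds[of r x t] r by (auto simp: s_def)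
  have eq: "?fx (x # w) = side x * u1 + s x * fst (cluster (\<lambda>a. \<theta> (x # a)) w)"
      "?fy (x # w) = side x * u2 + s x * snd (cluster (\<lambda>a. \<theta> (x # a)) w)" if "w \<in> leaves b" for x w
    using that by (simp_all add: dir_def u1_def u2_def s_def r_def t_def leaves_def)
  have bd: "\<bar>fst (cluster (\<lambda>a. \<theta> (x # a)) w)\<bar> \<le> 2 \<and> \<bar>snd (cluster (\<lambda>a. \<theta> (x # a)) w)\<bar> \<le> 2"
    if "w \<in> leaves b" for x w
    by (rule cluster_bounds) (use Suc.prems that in \<open>simp add: leaves_def\<close>)
  have small: "\<bar>s x * z\<bar> \<le> s x * 2" if "\<bar>z\<bar> \<le> 2" for x z
    using that s(3)[of x] by (simp add: abs_mult)
  have pos: "\<bar>?fx (x # w) - side x * u1\<bar> \<le> s x * 2 \<and> \<bar>?fy (x # w) - side x * u2\<bar> \<le> s x * 2"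
    if "w \<in> leaves b" for x w
    unfolding eq[OF that] using small bd[OF that] by simp
  have R: "rigid (Cons x ` leaves b) ?fx ?fy (s x * eta b)" for x
  proof (rule rigid_image)
    show "inj_on (Cons x) (leaves b)" by (simp add: inj_on_def)
    have "rigid (leaves b) (\<lambda>w. fst (cluster (\<lambda>a. \<theta> (x # a)) w)) (\<lambda>w. snd (cluster (\<lambda>a. \<theta> (x # a)) w)) (eta b)"
      by (rule Suc.IH) (use Suc.prems in simp)
    from rigid_scale[OF this s(3)[of x], of "side x * u1" "side x * u2"]
    show "rigid (leaves b) (\<lambda>w. ?fx (x # w)) (\<lambda>w. ?fy (x # w)) (s x * eta b)"
      by (rule rigid_cong) (use eq in simp_all)
  qed
  have eta': "eta (Suc b) = r / 16 * eta b" by (simp add: r_def power2_eq_square)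
  have le: "eta (Suc b) \<le> s x * eta b" for x
    unfolding eta' by (rule mult_right_mono) (use s e in auto)
  have R': "rigid (Cons x ` leaves b) ?fx ?fy (eta (Suc b))" for x
    by (rule rigid_mono[OF R le])
  have e4: "eta (Suc b) \<le> 1 / 4"
  proof -
    have "eta (Suc b) \<le> s True * eta b" by (rule le)
    also have "\<dots> \<le> 1 / 16 * 1" by (rule mult_mono) (use s e in auto)
    finally show ?thesis by simp
  qed
  \<comment> \<open>The halves stay within \<open>1 / 8\<close> of their centres, which are at least
    \<open>1 / 2\<close> apart.\<close>
  have gap: "1 / 4 \<le> \<bar>A - B\<bar>"
    if "1 / 4 \<le> \<bar>u\<bar>" "\<bar>A - side x * u\<bar> \<le> 1 / 8" "\<bar>B - side (\<not> x) * u\<bar> \<le> 1 / 8" for A B u :: real and x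
  proof (cases x)
    case True
    then have "\<bar>A - u\<bar> \<le> 1 / 8" "\<bar>B + u\<bar> \<le> 1 / 8" using that by (simp_all add: side_def)
    then show ?thesis using that(1) by linarith
  next
    case False
    then have "\<bar>A + u\<bar> \<le> 1 / 8" "\<bar>B - u\<bar> \<le> 1 / 8" using that by (simp_all add: side_def)
    then show ?thesis using that(1) by linarith
  qed
  have gapx: "eta (Suc b) \<le> \<bar>?fx p - ?fx q\<bar>" if u: "1 / 4 \<le> \<bar>u1\<bar>" and pq: "p \<in> Cons x ` leaves b" "q \<in> Cons (\<not> x) ` leaves b" for x p q
  proof -
    obtain w w' where w: "w \<in> leaves b" "p = x # w" "w' \<in> leaves b" "q = (\<not> x) # w'" using pq by blast
    have "\<bar>?fx p - side x * u1\<bar> \<le> 1 / 8" "\<bar>?fx q - side (\<not> x) * u1\<bar> \<le> 1 / 8"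
      using pos[OF w(1), of x] pos[OF w(3), of "\<not> x"] s(2)[of x] s(2)[of "\<not> x"] w by auto
    then have "1 / 4 \<le> \<bar>?fx p - ?fx q\<bar>" by (rule gap[OF u])
    then show ?thesis using e4 by (rule order_trans[rotated])
  qed
  have gapy: "eta (Suc b) \<le> \<bar>?fy p - ?fy q\<bar>" if u: "1 / 4 \<le> \<bar>u2\<bar>" and pq: "p \<in> Cons x ` leaves b" "q \<in> Cons (\<not> x) ` leaves b" for x p q
  proof -
    obtain w w' where w: "w \<in> leaves b" "p = x # w" "w' \<in> leaves b" "q = (\<not> x) # w'" using pq by blast
    have "\<bar>?fy p - side x * u2\<bar> \<le> 1 / 8" "\<bar>?fy q - side (\<not> x) * u2\<bar> \<le> 1 / 8"
      using pos[OF w(1), of x] pos[OF w(3), of "\<not> x"] s(2)[of x] s(2)[of "\<not> x"] w by auto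
    then have "1 / 4 \<le> \<bar>?fy p - ?fy q\<bar>" by (rule gap[OF u])
    then show ?thesis using e4 by (rule order_trans[rotated])
  qed
  have diam: "\<bar>?fx p - ?fx q\<bar> \<le> s x * 4 \<and> \<bar>?fy p - ?fy q\<bar> \<le> s x * 4"
    if pq: "p \<in> Cons x ` leaves b" "q \<in> Cons x ` leaves b" for x p q
  proof -
    obtain w w' where w: "w \<in> leaves b" "p = x # w" "w' \<in> leaves b" "q = x # w'" using pq by blast
    show ?thesis using pos[OF w(1), of x] pos[OF w(3), of x] w by auto
  qed
  have lv: "leaves (Suc b) = Cons x ` leaves b \<union> Cons (\<not> x) ` leaves b" for x
    by (cases x) (auto simp: leaves_Suc)
  have fin: "finite (Cons x ` leaves b)" for x using finite_leaves by simp
  \<comment> \<open>The width \<open>r / 4\<close> of the small half, where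
    \<open>r = eta b / 16\<close>, together with two tolerances stays below the tolerance
    \<open>eta b / 16\<close> of the large half.\<close>
  have num: "s (\<not> x) * 4 + 2 * eta (Suc b) \<le> s x * eta b" if "s x = 1 / 16" "s (\<not> x) = r / 16" for x
  proof -
    have "eta (Suc b) \<le> eta b / 256" unfolding eta' r_def using e mult_left_le[of "eta b" "eta b"] by simp
    then show ?thesis unfolding that r_def using e by linarith
  qed
  consider "1 / 4 \<le> \<bar>u1\<bar>" "1 / 4 \<le> \<bar>u2\<bar>" | "\<bar>u2\<bar> < 1 / 4" | "\<bar>u1\<bar> < 1 / 4" by linarith
  then show ?case
  proof cases
    case 1
    show ?thesis unfolding lv[of True]
      by (rule rigid_union_separated[OF R' R']) (use gapx[OF 1(1), of _ True] gapy[OF 1(2), of _ True] in simp)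
  next
    case 2
    have u1: "1 / 4 \<le> \<bar>u1\<bar>" using 2 t by (auto simp: u1_def u2_def)
    \<comment> \<open>Both ends of the turn are possible. The half \<open>True\<close> is the large
      one at the start, the half \<open>False\<close> at the end.\<close>
    have "t < 1 / 8 \<or> 7 / 8 < t" using 2 t unfolding u2_def by linarith
    then have "ramp t = 0 \<or> ramp t = 1" by (auto simp: ramp_def)
    then obtain x where x: "s x = 1 / 16" "s (\<not> x) = r / 16"
    proof
      assume "ramp t = 0" then show thesis by (intro that[of True]) (simp_all add: s_def scale_def)
    next
      assume "ramp t = 1" then show thesis by (intro that[of False]) (simp_all add: s_def scale_def)
    qed
    show ?thesis unfolding lv[of x]
      by (rule rigid_union_mixed[OF fin R[of x] R'[of "\<not> x"] gapx[OF u1] _ num[OF x] le]) (use diam in auto)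
  next
    case 3
    have u2: "1 / 4 \<le> \<bar>u2\<bar>" using 3 t by (auto simp: u1_def u2_def)
    \<comment> \<open>In the middle of the turn the exchange of sizes has not begun.\<close>
    have "t < 5 / 8" using 3 t unfolding u1_def by linarith
    then have "ramp t = 0" by (simp add: ramp_def)
    then have x: "s True = 1 / 16" "s (\<not> True) = r / 16" by (simp_all add: s_def scale_def)
    have "rigid (leaves (Suc b)) ?fy ?fx (eta (Suc b))" unfolding lv[of True]
      by (rule rigid_union_mixed[OF fin rigid_swap[OF R[of True]] rigid_swap[OF R'[of "\<not> True"]] gapy[OF u2] _ num[OF x] le])
         (use diam in auto)
    then show ?thesis by (rule rigid_swap)
  qed
qed

section \<open>Forests of clusters\<close>

lemma cluster_cong:
  assumes "\<And>u. length u < length w \<Longrightarrow> \<theta> u = \<theta>' u"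
  shows "cluster \<theta> w = cluster \<theta>' w"
  using assms
proof (induction w arbitrary: \<theta> \<theta>')
  case (Cons x w)
  have "cluster (\<lambda>a. \<theta> (x # a)) w = cluster (\<lambda>a. \<theta>' (x # a)) w"
    by (rule Cons.IH) (use Cons.prems in simp)
  moreover have "\<theta> [] = \<theta>' []" using Cons.prems[of "[]"] by simp
  ultimately show ?case by simp
qed simp

text \<open>The automorphism of the binary tree that exchanges the two subtrees below the node
  \<open>a\<close>.\<close>

fun flip :: "bool list \<Rightarrow> bool list \<Rightarrow> bool list" where
  "flip [] (x # w) = (\<not> x) # w"
| "flip (y # a) (x # w) = (if x = y then x # flip a w else x # w)"
| "flip a [] = []"

lemma length_flip [simp]: "length (flip a w) = length w"
  by (induction a w rule: flip.induct) auto

lemma flip_flip [simp]: "flip a (flip a w) = w"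
  by (induction a w rule: flip.induct) auto

lemma flip_self [simp]: "flip a a = a"
  by (induction a) auto

text \<open>At the end of the half turn of node \<open>a\<close> its two halves have taken over each
  other's place and size. So the cluster is the one at the start of the turn, with the two subtrees
  exchanged.\<close>

lemma cluster_flip:
  assumes "\<theta> a = 1"
  shows "cluster \<theta> w = cluster (\<lambda>u. if u = a then 0 else \<theta> (flip a u)) (flip a w)"
  using assms
proof (induction a w arbitrary: \<theta> rule: flip.induct)
  case (1 x w)
  then show ?case by (cases x) (simp_all add: dir_def side_def scale_def ramp_def)
next
  case (2 y a x w)
  show ?case
  proof (cases "x = y")
    case True
    have "cluster (\<lambda>u. \<theta> (y # u)) w = cluster (\<lambda>u. if u = a then 0 else \<theta> (y # flip a u)) (flip a w)"
      by (rule 2(1)[OF True]) (rule 2(2))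
    moreover define \<theta>' where "\<theta>' u = (if u = y # a then 0 else \<theta> (flip (y # a) u))" for u
    have "(\<lambda>u. \<theta>' (y # u)) = (\<lambda>u. if u = a then 0 else \<theta> (y # flip a u))"
      by (auto simp: fun_eq_iff \<theta>'_def)
    moreover have "\<theta>' [] = \<theta> []" by (simp add: \<theta>'_def)
    ultimately have "cluster \<theta> (y # w) = cluster \<theta>' (y # flip a w)" by simp
    then show ?thesis unfolding \<theta>'_def[abs_def] using True by (simp only: flip.simps if_True refl)
  next
    case False
    define \<theta>' where "\<theta>' u = (if u = y # a then 0 else \<theta> (flip (y # a) u))" for u
    have "(\<lambda>u. \<theta>' (x # u)) = (\<lambda>u. \<theta> (x # u))" using False by (auto simp: fun_eq_iff \<theta>'_def)
    moreover have "\<theta>' [] = \<theta> []" by (simp add: \<theta>'_def)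
    ultimately have "cluster \<theta> (x # w) = cluster \<theta>' (x # w)" by simp
    then show ?thesis unfolding \<theta>'_def[abs_def] using False by (simp only: flip.simps if_False)
  qed
qed simp

text \<open>The Haar function of the inner node \<open>a\<close>: \<open>1\<close> on the leaves
  below its child \<open>True\<close>, \<open>-1\<close> on those below its child
  \<open>False\<close>, and \<open>0\<close> elsewhere.\<close>

fun haar :: "bool list \<Rightarrow> bool list \<Rightarrow> real" where
  "haar [] (x # w) = side x"
| "haar (y # a) (x # w) = (if x = y then haar a w else 0)"
| "haar a [] = 0"

lemma sum_leaves_Suc: "(\<Sum>w\<in>leaves (Suc b). f w) = (\<Sum>w\<in>leaves b. f (True # w)) + (\<Sum>w\<in>leaves b. f (False # w))"
proof -
  have "(\<Sum>w\<in>leaves (Suc b). f w) = (\<Sum>w\<in>Cons True ` leaves b. f w) + (\<Sum>w\<in>Cons False ` leaves b. f w)"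
    unfolding leaves_Suc by (rule sum.union_disjoint) (auto simp: finite_leaves)
  moreover have "(\<Sum>w\<in>Cons x ` leaves b. f w) = (\<Sum>w\<in>leaves b. f (x # w))" for x
    by (rule sum.reindex_cong[of "Cons x"]) (auto simp: inj_on_def)
  ultimately show ?thesis by simp
qed

lemma card_leaves: "card (leaves b) = 2 ^ b"
proof -
  have "(\<Sum>w\<in>leaves b. 1::nat) = 2 ^ b"
  proof (induction b)
    case 0
    have "leaves 0 = {[]}" by (auto simp: leaves_def)
    then show ?case by simp
  next
    case (Suc b)
    show ?case unfolding sum_leaves_Suc Suc by simp
  qed
  then show ?thesis by simp
qed

lemma sum_haar: "length a < b \<Longrightarrow> (\<Sum>w\<in>leaves b. haar a w) = 0"
proof (induction a arbitrary: b)
  case Nil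
  then obtain b' where "b = Suc b'" by (cases b) auto
  then show ?case unfolding \<open>b = Suc b'\<close> sum_leaves_Suc haar.simps side_def by simp
next
  case (Cons y a)
  have "length (y # a) < b" using Cons.prems by blast
  then obtain b' where b: "b = Suc b'" "length a < b'" by (cases b) auto
  show ?case unfolding b(1) sum_leaves_Suc haar.simps using Cons.IH[OF b(2)] by (cases y) simp_all
qed

text \<open>The two halves have equally many leaves and opposite centres.\<close>

lemma sum_cluster: "(\<Sum>w\<in>leaves b. fst (cluster \<theta> w)) = 0"
proof (induction b arbitrary: \<theta>)
  case 0
  have "leaves 0 = {[]}" by (auto simp: leaves_def)
  then show ?case by simp
next
  case (Suc b)
  let ?s = "\<lambda>x. scale x (eta b / 16) (\<theta> []) / 16"
  have "(\<Sum>w\<in>leaves b. fst (cluster \<theta> (x # w))) =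
      (\<Sum>w\<in>leaves b. side x * (1 - 2 * \<theta> []) + ?s x * fst (cluster (\<lambda>a. \<theta> (x # a)) w))" for x
    by (rule sum.cong) (auto simp: leaves_def dir_def)
  note 1 = this
  have "(\<Sum>w\<in>leaves b. fst (cluster \<theta> (x # w))) = card (leaves b) * (side x * (1 - 2 * \<theta> []))" for x
    unfolding 1 sum.distrib sum_distrib_left[symmetric] Suc.IH by simp
  note 2 = this
  show ?case unfolding sum_leaves_Suc 2 side_def by (simp add: algebra_simps)
qed

text \<open>Nodes above \<open>a\<close> shift both of its subtrees by the same vector and scale
  them by a positive factor, and the positions inside each subtree add up to zero. What remains is
  the first coordinate of \<open>dir (\<theta> a)\<close>.\<close>

lemma haar_cluster:
  assumes "\<And>a. length a < b \<Longrightarrow> 0 \<le> \<theta> a \<and> \<theta> a \<le> 1" "length a < b"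
  shows "\<exists>s>0. (\<Sum>w\<in>leaves b. haar a w * fst (cluster \<theta> w)) = s * (1 - 2 * \<theta> a)"
  using assms
proof (induction a arbitrary: b \<theta>)
  case Nil
  then obtain b' where b: "b = Suc b'" by (cases b) auto
  let ?s = "\<lambda>x. scale x (eta b' / 16) (\<theta> []) / 16"
  have side2: "side x * side x = 1" for x by (simp add: side_def)
  have "(\<Sum>w\<in>leaves b'. haar [] (x # w) * fst (cluster \<theta> (x # w))) =
      (\<Sum>w\<in>leaves b'. (1 - 2 * \<theta> []) + side x * ?s x * fst (cluster (\<lambda>a. \<theta> (x # a)) w))" for x
    by (rule sum.cong) (use side2[of x] in \<open>auto simp: leaves_def dir_def distrib_left simp flip: mult.assoc\<close>)
  note 1 = this
  have 2: "(\<Sum>w\<in>leaves b'. haar [] (x # w) * fst (cluster \<theta> (x # w))) = card (leaves b') * (1 - 2 * \<theta> [])" for x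
    unfolding 1 sum.distrib sum_distrib_left[symmetric] sum_cluster by simp
  have "(\<Sum>w\<in>leaves b. haar [] w * fst (cluster \<theta> w)) = (2 * real (card (leaves b'))) * (1 - 2 * \<theta> [])"
    unfolding b sum_leaves_Suc 2 by simp
  then show ?case by (intro exI[of _ "2 * real (card (leaves b'))"]) (simp add: card_leaves)
next
  case (Cons y a)
  have "length (y # a) < b" using Cons.prems by blast
  then obtain b' where b: "b = Suc b'" "length a < b'" by (cases b) auto
  let ?s = "scale y (eta b' / 16) (\<theta> []) / 16"
  have e: "0 \<le> eta b' / 16" "eta b' / 16 \<le> 1" "0 < eta b' / 16" using eta_bounds[of b'] by auto
  have s: "0 < ?s" using scale_bounds[OF e(1,2), of y "\<theta> []"] e by auto
  obtain s' where s': "0 < s'" "(\<Sum>w\<in>leaves b'. haar a w * fst (cluster (\<lambda>a. \<theta> (y # a)) w)) = s' * (1 - 2 * \<theta> (y # a))"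
    using Cons.IH[of b' "\<lambda>a. \<theta> (y # a)"] Cons.prems b by auto
  have "(\<Sum>w\<in>leaves b'. haar (y # a) (y # w) * fst (cluster \<theta> (y # w))) =
      (\<Sum>w\<in>leaves b'. side y * (1 - 2 * \<theta> []) * haar a w + ?s * (haar a w * fst (cluster (\<lambda>a. \<theta> (y # a)) w)))"
    by (rule sum.cong) (auto simp: leaves_def dir_def algebra_simps)
  also have "\<dots> = ?s * (s' * (1 - 2 * \<theta> (y # a)))"
    unfolding sum.distrib sum_distrib_left[symmetric] s'(2) sum_haar[OF b(2)] by simp
  finally have 1: "(\<Sum>w\<in>leaves b'. haar (y # a) (y # w) * fst (cluster \<theta> (y # w))) = (?s * s') * (1 - 2 * \<theta> (y # a))"
    by simp
  have 2: "(\<Sum>w\<in>leaves b'. haar (y # a) ((\<not> y) # w) * fst (cluster \<theta> ((\<not> y) # w))) = 0" by simp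
  have "(\<Sum>w\<in>leaves b. haar (y # a) w * fst (cluster \<theta> w)) = (?s * s') * (1 - 2 * \<theta> (y # a))"
    using 1 2 unfolding b(1) sum_leaves_Suc by (cases y) simp_all
  moreover have "0 < ?s * s'" using s s' by simp
  ultimately show ?case by blast
qed

lemma haar_orthogonal:
  assumes "length a < b" "length a' < b"
  shows "a \<noteq> a' \<Longrightarrow> (\<Sum>w\<in>leaves b. haar a w * haar a' w) = 0"
    and "0 < (\<Sum>w\<in>leaves b. haar a w * haar a w)"
proof -
  have side2: "side x * side x = 1" for x by (simp add: side_def)
  have *: "(a \<noteq> a' \<longrightarrow> (\<Sum>w\<in>leaves b. haar a w * haar a' w) = 0) \<and> 0 < (\<Sum>w\<in>leaves b. haar a w * haar a w)"
    if "length a < b" "length a' < b" for a a'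
    using that
  proof (induction a arbitrary: b a')
    case Nil
    then obtain b' where b: "b = Suc b'" by (cases b) auto
    have "(\<Sum>w\<in>leaves b. haar [] w * haar a' w) = 0" if ne: "a' \<noteq> []"
    proof -
      obtain y r where a': "a' = y # r" "length r < b'" using ne Nil b by (cases a') auto
      then show ?thesis by (cases y) (simp_all add: b sum_leaves_Suc sum_haar flip: sum_distrib_left)
    qed
    moreover have "0 < (\<Sum>w\<in>leaves b. haar [] w * haar [] w)"
      by (simp add: b sum_leaves_Suc side2 card_leaves)
    ultimately show ?case by auto
  next
    case (Cons y a)
    have "length (y # a) < b" using Cons.prems by blast
  then obtain b' where b: "b = Suc b'" "length a < b'" by (cases b) auto
    have "(\<Sum>w\<in>leaves b. haar (y # a) w * haar a' w) = 0" if "a' \<noteq> y # a"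
    proof (cases a')
      case Nil
      then show ?thesis using b by (cases y) (simp_all add: sum_leaves_Suc sum_haar flip: sum_distrib_right)
    next
      case c: (Cons z r)
      then have "length r < b'" using Cons.prems b by simp
      then show ?thesis using Cons.IH[of b' r] b c that by (cases y; cases z) (auto simp: sum_leaves_Suc)
    qed
    moreover have "0 < (\<Sum>w\<in>leaves b. haar (y # a) w * haar (y # a) w)"
      using Cons.IH[of b' a] b by (cases y) (simp_all add: sum_leaves_Suc)
    ultimately show ?case by auto
  qed
  show "a \<noteq> a' \<Longrightarrow> (\<Sum>w\<in>leaves b. haar a w * haar a' w) = 0" using *[OF assms] by blast
  show "0 < (\<Sum>w\<in>leaves b. haar a w * haar a w)" using *[OF assms] by blast
qed

text \<open>A forest consists of \<open>q\<close> complete binary trees, the \<open>c\<close>-th of height \<open>b c\<close>.\<close>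

definition forest_leaves :: "nat \<Rightarrow> (nat \<Rightarrow> nat) \<Rightarrow> (nat \<times> bool list) set"
  where "forest_leaves q b = (SIGMA c:{..<q}. leaves (b c))"

definition forest_nodes :: "nat \<Rightarrow> (nat \<Rightarrow> nat) \<Rightarrow> (nat \<times> bool list) set"
  where "forest_nodes q b = (SIGMA c:{..<q}. {a. length a < b c})"

text \<open>The trees are centred at multiples of \<open>10\<close>, far apart compared to the
  radius \<open>2\<close> of a cluster. The shift of the second coordinate by
  \<open>10 * q + 10\<close> puts every right endpoint beyond all left endpoints.\<close>

definition forest_point :: "nat \<Rightarrow> (nat \<times> bool list \<Rightarrow> real) \<Rightarrow> nat \<times> bool list \<Rightarrow> real \<times> real"
  where "forest_point q \<theta> p = (10 * real (fst p), 10 * real (fst p) + 10 * real q + 10) +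
    cluster (\<lambda>a. \<theta> (fst p, a)) (snd p)"

lemma finite_forest_leaves: "finite (forest_leaves q b)"
  by (simp add: forest_leaves_def finite_leaves)

lemma inner_nodes_eq: "{a :: bool list. length a < b} = (\<Union>i<b. leaves i)"
  by (auto simp: leaves_def)

lemma finite_forest_nodes: "finite (forest_nodes q b)"
  by (simp add: forest_nodes_def inner_nodes_eq finite_leaves)

lemma card_inner_nodes: "card {a :: bool list. length a < b} + 1 = 2 ^ b"
proof (induction b)
  case (Suc b)
  have "{a :: bool list. length a < Suc b} = {a. length a < b} \<union> leaves b" by (auto simp: leaves_def less_Suc_eq)
  moreover have "{a :: bool list. length a < b} \<inter> leaves b = {}" by (auto simp: leaves_def)
  moreover have "finite {a :: bool list. length a < b}" by (simp add: inner_nodes_eq finite_leaves)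
  ultimately have "card {a :: bool list. length a < Suc b} = card {a :: bool list. length a < b} + 2 ^ b"
    by (simp add: card_Un_disjoint finite_leaves card_leaves)
  then show ?case using Suc by simp
qed simp

lemma card_forest_leaves: "card (forest_leaves q b) = (\<Sum>c<q. 2 ^ b c)"
  by (simp add: forest_leaves_def card_leaves finite_leaves)

lemma card_forest_nodes: "card (forest_nodes q b) + q = (\<Sum>c<q. 2 ^ b c)"
proof -
  have "card (forest_nodes q b) = (\<Sum>c<q. card {a :: bool list. length a < b c})"
    by (simp add: forest_nodes_def inner_nodes_eq finite_leaves)
  then have "card (forest_nodes q b) + q = (\<Sum>c<q. card {a :: bool list. length a < b c} + 1)"
    by (simp only: sum.distrib sum_constant card_lessThan) simp
  then show ?thesis by (simp only: card_inner_nodes)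
qed

lemma sum_forest_leaves: "(\<Sum>p\<in>forest_leaves q b. f p) = (\<Sum>c<q. \<Sum>w\<in>leaves (b c). f (c, w))"
  using sum.Sigma[of "{..<q}" "\<lambda>c. leaves (b c)" "\<lambda>c w. f (c, w)"]
  by (simp add: forest_leaves_def finite_leaves)

lemma cube_comp:
  assumes "\<theta> \<in> topspace (cube_top (forest_nodes q b))" "c < q" "length a < b c"
  shows "0 \<le> \<theta> (c, a) \<and> \<theta> (c, a) \<le> 1"
  using assms by (auto simp: topspace_cube_top forest_nodes_def)

lemma forest_point_bounds:
  assumes \<theta>: "\<theta> \<in> topspace (cube_top (forest_nodes q b))" and p: "(c, w) \<in> forest_leaves q b"
  shows "\<bar>fst (forest_point q \<theta> (c, w)) - 10 * real c\<bar> \<le> 2"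
    "\<bar>snd (forest_point q \<theta> (c, w)) - (10 * real c + 10 * real q + 10)\<bar> \<le> 2"
proof -
  have "\<bar>fst (cluster (\<lambda>a. \<theta> (c, a)) w)\<bar> \<le> 2 \<and> \<bar>snd (cluster (\<lambda>a. \<theta> (c, a)) w)\<bar> \<le> 2"
    by (rule cluster_bounds) (use cube_comp[OF \<theta>] p in \<open>auto simp: forest_leaves_def leaves_def\<close>)
  then show "\<bar>fst (forest_point q \<theta> (c, w)) - 10 * real c\<bar> \<le> 2"
    "\<bar>snd (forest_point q \<theta> (c, w)) - (10 * real c + 10 * real q + 10)\<bar> \<le> 2"
    by (simp_all add: forest_point_def)
qed

lemma nat_separation: "\<bar>z - (10 * real c + s)\<bar> \<le> 2 \<Longrightarrow> \<bar>z - (10 * real c' + s)\<bar> \<le> 2 \<Longrightarrow> c = c'"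
proof (rule ccontr)
  assume "\<bar>z - (10 * real c + s)\<bar> \<le> 2" "\<bar>z - (10 * real c' + s)\<bar> \<le> 2" and ne: "c \<noteq> c'"
  then have "\<bar>real c - real c'\<bar> < 1" by linarith
  then show False using ne by linarith
qed

text \<open>The classes are given by equality of coordinates. Different trees have no coordinate
  value in common, so the question reduces to a single tree and the rigidity of its cluster.\<close>

lemma forest_rigid:
  fixes m :: "nat \<times> bool list \<Rightarrow> real"
  assumes \<theta>: "\<theta> \<in> topspace (cube_top (forest_nodes q b))"
    and m1: "\<And>t. (\<Sum>p\<in>{p\<in>forest_leaves q b. fst (forest_point q \<theta> p) = t}. m p) = 0"
    and m2: "\<And>t. (\<Sum>p\<in>{p\<in>forest_leaves q b. snd (forest_point q \<theta> p) = t}. m p) = 0"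
    and p: "p \<in> forest_leaves q b"
  shows "m p = 0"
proof -
  obtain c w where cw: "p = (c, w)" by (cases p)
  have c: "c < q" and w: "w \<in> leaves (b c)" using p by (auto simp: cw forest_leaves_def)
  let ?\<theta> = "\<lambda>a. \<theta> (c, a)"
  have R: "rigid (leaves (b c)) (\<lambda>w. fst (cluster ?\<theta> w)) (\<lambda>w. snd (cluster ?\<theta> w)) (eta (b c))"
    by (rule rigid_cluster) (use cube_comp[OF \<theta> c] in blast)
  have mem: "(c, u) \<in> forest_leaves q b" if "u \<in> leaves (b c)" for u using that c by (simp add: forest_leaves_def)
  have 1: "(\<Sum>u\<in>{u\<in>leaves (b c). fst (forest_point q \<theta> (c, u)) = t}. m (c, u)) = 0" for t
  proof (cases "\<exists>u\<in>leaves (b c). fst (forest_point q \<theta> (c, u)) = t")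
    case True
    then obtain u where u: "u \<in> leaves (b c)" "fst (forest_point q \<theta> (c, u)) = t" by blast
    have "c' = c" if "(c', u') \<in> forest_leaves q b" "fst (forest_point q \<theta> (c', u')) = t" for c' u'
      using nat_separation[of t c' 0 c] forest_point_bounds(1)[OF \<theta> that(1)] forest_point_bounds(1)[OF \<theta> mem[OF u(1)]] that u by simp
    then have "{p\<in>forest_leaves q b. fst (forest_point q \<theta> p) = t} =
        Pair c ` {u\<in>leaves (b c). fst (forest_point q \<theta> (c, u)) = t}"
      using c by (fastforce simp: forest_leaves_def)
    then show ?thesis using m1[of t] by (simp add: sum.reindex inj_on_def)
  next
    case False
    then have "{u\<in>leaves (b c). fst (forest_point q \<theta> (c, u)) = t} = {}" by blast
    then show ?thesis by (simp only: sum.empty)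
  qed
  have 2: "(\<Sum>u\<in>{u\<in>leaves (b c). snd (forest_point q \<theta> (c, u)) = t}. m (c, u)) = 0" for t
  proof (cases "\<exists>u\<in>leaves (b c). snd (forest_point q \<theta> (c, u)) = t")
    case True
    then obtain u where u: "u \<in> leaves (b c)" "snd (forest_point q \<theta> (c, u)) = t" by blast
    have "c' = c" if "(c', u') \<in> forest_leaves q b" "snd (forest_point q \<theta> (c', u')) = t" for c' u'
      using nat_separation[of t c' "10 * real q + 10" c] forest_point_bounds(2)[OF \<theta> that(1)]
        forest_point_bounds(2)[OF \<theta> mem[OF u(1)]] that u by (simp add: add.assoc)
    then have "{p\<in>forest_leaves q b. snd (forest_point q \<theta> p) = t} =
        Pair c ` {u\<in>leaves (b c). snd (forest_point q \<theta> (c, u)) = t}"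
      using c by (fastforce simp: forest_leaves_def)
    then show ?thesis using m2[of t] by (simp add: sum.reindex inj_on_def)
  next
    case False
    then have "{u\<in>leaves (b c). snd (forest_point q \<theta> (c, u)) = t} = {}" by blast
    then show ?thesis by (simp only: sum.empty)
  qed
  have "m (c, w) = 0"
  proof (rule rigidD[OF R _ _ 1 2 w])
    show "\<bar>fst (cluster ?\<theta> u) - fst (cluster ?\<theta> u')\<bar> < eta (b c)"
      if "fst (forest_point q \<theta> (c, u)) = fst (forest_point q \<theta> (c, u'))" for u u'
      using that eta_bounds[of "b c"] by (simp add: forest_point_def)
    show "\<bar>snd (cluster ?\<theta> u) - snd (cluster ?\<theta> u')\<bar> < eta (b c)"
      if "snd (forest_point q \<theta> (c, u)) = snd (forest_point q \<theta> (c, u'))" for u u'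
      using that eta_bounds[of "b c"] by (simp add: forest_point_def)
  qed
  then show ?thesis by (simp add: cw)
qed

text \<open>For two leaves at the same point, the weights \<open>1\<close> and \<open>-1\<close>
  would have zero sum over every class.\<close>

lemma forest_point_inj:
  assumes \<theta>: "\<theta> \<in> topspace (cube_top (forest_nodes q b))"
  shows "inj_on (forest_point q \<theta>) (forest_leaves q b)"
proof (rule inj_onI, rule ccontr)
  fix p p' assume p: "p \<in> forest_leaves q b" "p' \<in> forest_leaves q b"
    "forest_point q \<theta> p = forest_point q \<theta> p'" "p \<noteq> p'"
  define m :: "nat \<times> bool list \<Rightarrow> real" where "m = (\<lambda>u. if u = p then 1 else if u = p' then -1 else 0)"
  have "(\<Sum>u\<in>{u\<in>forest_leaves q b. f (forest_point q \<theta> u) = t}. m u) = 0" for f :: "real \<times> real \<Rightarrow> real" and t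
  proof (cases "f (forest_point q \<theta> p) = t")
    case True
    have "(\<Sum>u\<in>{u\<in>forest_leaves q b. f (forest_point q \<theta> u) = t}. m u) = (\<Sum>u\<in>{p, p'}. m u)"
      by (rule sum.mono_neutral_right) (use p True in \<open>auto simp: m_def finite_forest_leaves\<close>)
    then show ?thesis using p(4) by (simp add: m_def)
  next
    case False
    show ?thesis by (rule sum.neutral) (use p False in \<open>auto simp: m_def\<close>)
  qed
  from forest_rigid[OF \<theta> this this p(1)] have "m p = 0" .
  then show False by (simp add: m_def)
qed

lemma forest_point_half_plane:
  assumes \<theta>: "\<theta> \<in> topspace (cube_top (forest_nodes q b))" and p: "p \<in> forest_leaves q b"
  shows "forest_point q \<theta> p \<in> half_plane"
proof -
  obtain c w where cw: "p = (c, w)" by (cases p)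
  have "fst (forest_point q \<theta> p) < snd (forest_point q \<theta> p)"
    using forest_point_bounds[OF \<theta> p[unfolded cw]] unfolding cw by linarith
  then show ?thesis by (simp add: half_plane_def case_prod_unfold)
qed

lemma forest_point_endpoints:
  assumes \<theta>: "\<theta> \<in> topspace (cube_top (forest_nodes q b))" and p: "p \<in> forest_leaves q b" "p' \<in> forest_leaves q b"
  shows "fst (forest_point q \<theta> p) \<noteq> snd (forest_point q \<theta> p')"
proof -
  obtain c w c' w' where cw: "p = (c, w)" "p' = (c', w')" by (cases p; cases p')
  have "c < q" using p by (simp add: cw forest_leaves_def)
  then have "real c + 1 \<le> real q" by linarith
  then show ?thesis
    using forest_point_bounds(1)[OF \<theta> p(1)[unfolded cw]] forest_point_bounds(2)[OF \<theta> p(2)[unfolded cw]]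
    unfolding cw by linarith
qed

definition node_swap :: "nat \<times> bool list \<Rightarrow> nat \<times> bool list \<Rightarrow> nat \<times> bool list"
  where "node_swap v u = (if fst u = fst v then (fst u, flip (snd v) (snd u)) else u)"

lemma node_swap_nodes: "u \<in> forest_nodes q b \<Longrightarrow> node_swap v u \<in> forest_nodes q b"
  by (auto simp: node_swap_def forest_nodes_def)

lemma node_swap_leaves: "u \<in> forest_leaves q b \<Longrightarrow> node_swap v u \<in> forest_leaves q b"
  by (auto simp: node_swap_def forest_leaves_def leaves_def)

lemma node_swap_node_swap [simp]: "node_swap v (node_swap v u) = u"
  by (simp add: node_swap_def prod_eq_iff)

lemma node_swap_self [simp]: "node_swap v v = v"
  by (simp add: node_swap_def prod_eq_iff)

text \<open>\<open>cluster_flip\<close> in the tree of \<open>v\<close>: the two labelled diagrams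
  differ by a permutation of the leaves and agree as sets. This is the gluing of opposite sides of
  the cube.\<close>

lemma forest_point_swap:
  assumes v: "v \<in> forest_nodes q b" "\<theta> v = 1"
  shows "forest_point q \<theta> ` forest_leaves q b =
    forest_point q (\<lambda>u. if u \<in> forest_nodes q b \<and> u \<noteq> v then \<theta> (node_swap v u) else 0) ` forest_leaves q b"
proof -
  let ?\<theta> = "\<lambda>u. if u \<in> forest_nodes q b \<and> u \<noteq> v then \<theta> (node_swap v u) else 0"
  have eq: "forest_point q \<theta> p = forest_point q ?\<theta> (node_swap v p)" if p: "p \<in> forest_leaves q b" for p
  proof -
    obtain c w where cw: "p = (c, w)" by (cases p)
    obtain cv a where va: "v = (cv, a)" by (cases v)
    have c: "c < q" and w: "length w = b c" using p by (auto simp: cw forest_leaves_def leaves_def)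
    show ?thesis
    proof (cases "c = cv")
      case True
      have "cluster (\<lambda>u. \<theta> (c, u)) w = cluster (\<lambda>u. if u = a then 0 else \<theta> (c, flip a u)) (flip a w)"
        by (rule cluster_flip) (use v va True in simp)
      also have "\<dots> = cluster (\<lambda>u. ?\<theta> (c, u)) (flip a w)"
      proof (rule cluster_cong)
        fix u :: "bool list" assume "length u < length (flip a w)"
        then have "(c, u) \<in> forest_nodes q b" using c w by (simp add: forest_nodes_def)
        then show "(if u = a then 0 else \<theta> (c, flip a u)) = ?\<theta> (c, u)"
          using True by (simp add: va node_swap_def)
      qed
      finally have *: "cluster (\<lambda>u. \<theta> (c, u)) w = cluster (\<lambda>u. ?\<theta> (c, u)) (flip a w)" .
      have sw: "node_swap v (c, w) = (c, flip a w)" using True by (simp add: va node_swap_def)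
      show ?thesis unfolding cw sw forest_point_def fst_conv snd_conv * ..
    next
      case False
      have "cluster (\<lambda>u. \<theta> (c, u)) w = cluster (\<lambda>u. ?\<theta> (c, u)) w"
      proof (rule cluster_cong)
        fix u :: "bool list" assume "length u < length w"
        then have "(c, u) \<in> forest_nodes q b" using c w by (simp add: forest_nodes_def)
        then show "\<theta> (c, u) = ?\<theta> (c, u)" using False by (simp add: va node_swap_def)
      qed
      moreover have "node_swap v (c, w) = (c, w)" using False by (simp add: va node_swap_def)
      ultimately show ?thesis unfolding cw forest_point_def by (simp only: fst_conv snd_conv)
    qed
  qed
  have "node_swap v ` forest_leaves q b = forest_leaves q b"
  proof
    show "node_swap v ` forest_leaves q b \<subseteq> forest_leaves q b" using node_swap_leaves by blast
    show "forest_leaves q b \<subseteq> node_swap v ` forest_leaves q b"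
    proof
      fix u assume "u \<in> forest_leaves q b"
      then show "u \<in> node_swap v ` forest_leaves q b"
        by (intro image_eqI[of _ _ "node_swap v u"] node_swap_leaves) simp_all
    qed
  qed
  then have "forest_point q ?\<theta> ` forest_leaves q b = forest_point q ?\<theta> ` node_swap v ` forest_leaves q b" by (simp only:)
  also have "\<dots> = (\<lambda>p. forest_point q ?\<theta> (node_swap v p)) ` forest_leaves q b" by (rule image_image)
  also have "\<dots> = forest_point q \<theta> ` forest_leaves q b" by (rule image_cong) (use eq in auto)
  finally show ?thesis by simp
qed

definition forest_haar :: "nat \<times> bool list \<Rightarrow> nat \<times> bool list \<Rightarrow> real"
  where "forest_haar v p = (if fst p = fst v then haar (snd v) (snd p) else 0)"

lemma forest_haar_sum:
  assumes "v \<in> forest_nodes q b"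
  shows "(\<Sum>p\<in>forest_leaves q b. forest_haar v p * f p) = (\<Sum>w\<in>leaves (b (fst v)). haar (snd v) w * f (fst v, w))"
proof -
  have v: "fst v < q" using assms by (auto simp: forest_nodes_def)
  have "(\<Sum>p\<in>forest_leaves q b. forest_haar v p * f p) =
      (\<Sum>c<q. if c = fst v then \<Sum>w\<in>leaves (b c). haar (snd v) w * f (c, w) else 0)"
    unfolding sum_forest_leaves by (rule sum.cong) (auto simp: forest_haar_def)
  then show ?thesis using v by simp
qed

lemma forest_haar_component:
  assumes "v \<in> forest_nodes q b"
  shows "(\<Sum>p\<in>forest_leaves q b. forest_haar v p * (if fst p = c then 1 else 0)) = 0"
  unfolding forest_haar_sum[OF assms] using sum_haar[of "snd v" "b (fst v)"] assms
  by (cases "fst v = c") (auto simp: forest_nodes_def)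

lemma forest_haar_orthogonal:
  assumes "v \<in> forest_nodes q b" "u \<in> forest_nodes q b"
  shows "v \<noteq> u \<Longrightarrow> (\<Sum>p\<in>forest_leaves q b. forest_haar v p * forest_haar u p) = 0"
    and "0 < (\<Sum>p\<in>forest_leaves q b. forest_haar v p * forest_haar v p)"
proof -
  have lv: "length (snd v) < b (fst v)" "length (snd u) < b (fst u)" using assms by (auto simp: forest_nodes_def)
  show "0 < (\<Sum>p\<in>forest_leaves q b. forest_haar v p * forest_haar v p)"
    unfolding forest_haar_sum[OF assms(1)] using haar_orthogonal(2)[OF lv(1) lv(1)] by (simp add: forest_haar_def)
  assume ne: "v \<noteq> u"
  show "(\<Sum>p\<in>forest_leaves q b. forest_haar v p * forest_haar u p) = 0"
    unfolding forest_haar_sum[OF assms(1)]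
  proof (cases "fst v = fst u")
    case True
    then have "snd v \<noteq> snd u" using ne by (simp add: prod_eq_iff)
    then show "(\<Sum>w\<in>leaves (b (fst v)). haar (snd v) w * forest_haar u (fst v, w)) = 0"
      using haar_orthogonal(1)[OF lv(1), of "snd u"] lv(2) True by (simp add: forest_haar_def)
  qed (simp add: forest_haar_def)
qed

lemma forest_haar_point:
  assumes \<theta>: "\<theta> \<in> topspace (cube_top (forest_nodes q b))" and v: "v \<in> forest_nodes q b"
  shows "\<exists>s>0. (\<Sum>p\<in>forest_leaves q b. forest_haar v p * fst (forest_point q \<theta> p)) = s * (1 - 2 * \<theta> v)"
proof -
  obtain c a where va: "v = (c, a)" by (cases v)
  have c: "c < q" "length a < b c" using v by (auto simp: va forest_nodes_def)
  obtain s where s: "0 < s" "(\<Sum>w\<in>leaves (b c). haar a w * fst (cluster (\<lambda>u. \<theta> (c, u)) w)) = s * (1 - 2 * \<theta> (c, a))"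
    using haar_cluster[of "b c" "\<lambda>u. \<theta> (c, u)" a] cube_comp[OF \<theta> c(1)] c(2) by blast
  have "(\<Sum>p\<in>forest_leaves q b. forest_haar v p * fst (forest_point q \<theta> p)) =
      (\<Sum>w\<in>leaves (b c). haar a w * fst (forest_point q \<theta> (c, w)))"
    unfolding forest_haar_sum[OF v] by (simp add: va)
  also have "\<dots> = (\<Sum>w\<in>leaves (b c). 10 * real c * haar a w + haar a w * fst (cluster (\<lambda>u. \<theta> (c, u)) w))"
    by (rule sum.cong) (auto simp: forest_point_def algebra_simps)
  also have "\<dots> = s * (1 - 2 * \<theta> v)"
    unfolding sum.distrib sum_distrib_left[symmetric] sum_haar[OF c(2)] s(2) by (simp add: va)
  finally show ?thesis using s(1) by blast
qed

lemma continuous_on_cluster: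
  "continuous_on UNIV (\<lambda>\<theta> :: 'a \<Rightarrow> real. cluster (\<lambda>a. \<theta> (g a)) w)"
proof (induction w arbitrary: g)
  case (Cons x w)
  have 1: "continuous_on UNIV (\<lambda>\<theta> :: 'a \<Rightarrow> real. \<theta> (g []))"
    by (rule continuous_on_product_coordinates)
  have 2: "continuous_on UNIV dir" unfolding dir_def by (intro continuous_intros)
  have 3: "continuous_on UNIV (scale x (eta (length w) / 16))"
    by (cases x) (auto simp: scale_def[abs_def] ramp_def[abs_def] intro!: continuous_intros)
  show ?case unfolding cluster.simps
    by (intro continuous_on_add continuous_on_scaleR continuous_on_const continuous_on_divide
        continuous_on_compose2[OF 2 1] continuous_on_compose2[OF 3 1] Cons.IH) auto
qed simp

section \<open>Independent and exceptional diagrams\<close>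

lemma sum_fun_apply: "(\<Sum>a\<in>A. g a) x = (\<Sum>a\<in>A. g a x)"
  by (induction A rule: infinite_finite_induct) simp_all

lemma scaleR_fun_apply: "(r *\<^sub>R f) x = r *\<^sub>R f x"
  by (simp add: scaleR_fun_def)

lemma sum_scaleR_apply:
  fixes c :: "'a \<Rightarrow> real" and f :: "'a \<Rightarrow> real \<Rightarrow> real"
  shows "(\<Sum>b\<in>B. c b *\<^sub>R f b) x = (\<Sum>b\<in>B. c b * f b x)"
  by (simp add: sum_fun_apply scaleR_fun_apply)

lemma in_satisfying: "f \<in> satisfying D \<longleftrightarrow> (\<forall>z\<in>D. f (snd z) - f (fst z) = 0)"
  by (auto simp: satisfying_def)

text \<open>The chords are edges between left and right endpoints, and \<open>acyclic\<close>
  excludes nonzero edge weights with zero sum at every endpoint. So the functionals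
  \<open>f b - f a\<close> are independent on functions on the finite set of endpoints. Dual
  functions exist there; their continuous extensions represent a basis of the quotient.\<close>

lemma independent_diagramI:
  assumes D: "D \<subseteq> half_plane" "finite D" "card D = n"
    and disj: "\<And>z z'. z \<in> D \<Longrightarrow> z' \<in> D \<Longrightarrow> fst z \<noteq> snd z'"
    and acyclic: "\<And>(m :: real \<times> real \<Rightarrow> real) z. (\<And>t. (\<Sum>z\<in>{z\<in>D. fst z = t}. m z) = 0) \<Longrightarrow>
      (\<And>t. (\<Sum>z\<in>{z\<in>D. snd z = t}. m z) = 0) \<Longrightarrow> z \<in> D \<Longrightarrow> m z = 0"
  shows "D \<in> independent_diagrams n"
proof -
  define E where "E = fst ` D \<union> snd ` D"
  define d where "d = card E"
  have finE: "finite E" using D by (simp add: E_def)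
  obtain e where e: "bij_betw e {..<d} E"
    using ex_bij_betw_nat_finite[OF finE] by (auto simp: d_def atLeast0LessThan)
  have Ee: "E = e ` {..<d}" using e by (simp add: bij_betw_def)
  define V where "V z r = of_bool (snd z = e r) - (of_bool (fst z = e r) :: real)" for z r
  have count: "(\<Sum>z\<in>D. c z * of_bool (g z = t)) = (\<Sum>z\<in>{z\<in>D. g z = t}. c z)" for c :: "real \<times> real \<Rightarrow> real" and g t
    by (rule sum.mono_neutral_cong_right) (use D in auto)
  have "indep d D V" unfolding indep_def
  proof (intro allI impI ballI)
    fix c z assume c: "\<forall>r<d. (\<Sum>z\<in>D. c z * V z r) = 0" and z: "z \<in> D"
    \<comment> \<open>The relation at the endpoint \<open>t\<close>: chords that end at
      \<open>t\<close> against chords that begin there. Since no point is both kinds of endpoint,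
      one of the two sums is empty.\<close>
    have diff: "(\<Sum>z\<in>{z\<in>D. snd z = t}. c z) = (\<Sum>z\<in>{z\<in>D. fst z = t}. c z)" if tE: "t \<in> E" for t
    proof -
      obtain r where r: "r < d" "t = e r" using tE unfolding Ee by blast
      have "(\<Sum>z\<in>D. c z * V z r) = (\<Sum>z\<in>D. c z * of_bool (snd z = t)) - (\<Sum>z\<in>D. c z * of_bool (fst z = t))"
        by (simp add: V_def r right_diff_distrib sum_subtractf)
      then show ?thesis using c r unfolding count by simp
    qed
    have 1: "(\<Sum>z\<in>{z\<in>D. fst z = t}. c z) = 0" for t
    proof (cases "t \<in> fst ` D")
      case True
      then obtain z1 where "z1 \<in> D" "fst z1 = t" by blast
      then have "{z\<in>D. snd z = t} = {}" using disj[of z1] by blast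
      moreover have "t \<in> E" using True by (simp add: E_def)
      ultimately show ?thesis using diff[of t] by (simp only: sum.empty)
    next
      case False
      then have "{z\<in>D. fst z = t} = {}" by blast
      then show ?thesis by (simp only: sum.empty)
    qed
    have 2: "(\<Sum>z\<in>{z\<in>D. snd z = t}. c z) = 0" for t
    proof (cases "t \<in> E")
      case True
      then show ?thesis using diff[of t] 1[of t] by simp
    next
      case False
      then have "{z\<in>D. snd z = t} = {}" unfolding E_def by blast
      then show ?thesis by (simp only: sum.empty)
    qed
    show "c z = 0" by (rule acyclic[OF 1 2 z])
  qed
  note ind = this
  have "\<exists>f :: real \<Rightarrow> real. continuous_on UNIV f \<and> (\<forall>z\<in>D. f (snd z) - f (fst z) = of_bool (z = z0))" for z0
  proof -
    obtain y where y: "\<And>z. z \<in> D \<Longrightarrow> (\<Sum>r<d. y r * V z r) = of_bool (z = z0)"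
      using indep_dual_functional[OF D(2) ind, of "\<lambda>z. of_bool (z = z0)"] by blast
    define g where "g t = y (inv_into {..<d} e t)" for t
    have ge: "g (e r) = y r" if "r < d" for r
      using e that by (simp add: g_def bij_betw_def)
    have pick: "(\<Sum>r<d. y r * of_bool (t = e r)) = g t" if t: "t \<in> E" for t
    proof -
      obtain r0 where r0: "r0 < d" "t = e r0" using t unfolding Ee by blast
      have "(\<Sum>r<d. y r * of_bool (t = e r)) = (\<Sum>r<d. if r = r0 then y r else 0)"
        by (rule sum.cong) (use r0 e in \<open>auto simp: bij_betw_def inj_on_def\<close>)
      then show ?thesis using r0 ge by simp
    qed
    obtain f where f: "continuous_on UNIV f" "\<And>t. t \<in> E \<Longrightarrow> f t = g t"
      using Tietze_unbounded[of E g UNIV] finE continuous_on_finite[OF finE, of g]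
      by (auto simp: finite_imp_closed)
    have "f (snd z) - f (fst z) = of_bool (z = z0)" if z: "z \<in> D" for z
    proof -
      have "fst z \<in> E" "snd z \<in> E" using z by (auto simp: E_def)
      then have "f (snd z) - f (fst z) = (\<Sum>r<d. y r * V z r)"
        by (simp add: f(2) pick[symmetric] V_def right_diff_distrib sum_subtractf)
      then show ?thesis using y[OF z] by (simp only:)
    qed
    note fz = this
    show ?thesis
    proof (rule exI[of _ f], rule conjI)
      show "continuous_on UNIV f" by (rule f(1))
      show "\<forall>z\<in>D. f (snd z) - f (fst z) = of_bool (z = z0)" by (rule ballI) (rule fz)
    qed
  qed
  then have "\<forall>z0. \<exists>f :: real \<Rightarrow> real. continuous_on UNIV f \<and> (\<forall>z\<in>D. f (snd z) - f (fst z) = of_bool (z = z0))" by (rule allI)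
  from choice[OF this] obtain f :: "real \<times> real \<Rightarrow> real \<Rightarrow> real" where f0: "\<forall>z0. continuous_on UNIV (f z0) \<and> (\<forall>z\<in>D. f z0 (snd z) - f z0 (fst z) = of_bool (z = z0))"
    by (elim exE)
  have f: "continuous_on UNIV (f z)" "z' \<in> D \<Longrightarrow> f z (snd z') - f z (fst z') = of_bool (z' = z)" for z z'
    using f0[THEN spec[of _ z]] by blast+
  have inj: "inj_on f D"
  proof (rule inj_onI)
    fix z z' assume z: "z \<in> D" "z' \<in> D" "f z = f z'"
    then show "z = z'" using f(2)[OF z(1), of z] f(2)[OF z(1), of z'] by (cases "z = z'") simp_all
  qed
  have eval: "(\<Sum>b\<in>f ` D. c b *\<^sub>R b) (snd z) - (\<Sum>b\<in>f ` D. c b *\<^sub>R b) (fst z) = c (f z)" if z: "z \<in> D" for c z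
  proof -
    have "(\<Sum>b\<in>f ` D. c b *\<^sub>R b) t = (\<Sum>w\<in>D. c (f w) * f w t)" for t
      by (simp add: sum.reindex[OF inj] sum_scaleR_apply)
    then have "(\<Sum>b\<in>f ` D. c b *\<^sub>R b) (snd z) - (\<Sum>b\<in>f ` D. c b *\<^sub>R b) (fst z) =
        (\<Sum>w\<in>D. c (f w) * (f w (snd z) - f w (fst z)))"
      by (simp add: sum_subtractf right_diff_distrib)
    also have "\<dots> = (\<Sum>w\<in>D. if w = z then c (f w) else 0)"
      by (rule sum.cong) (use f(2)[OF z] in auto)
    finally show ?thesis using z D(2) by simp
  qed
  have "has_codim C0 (C0 \<inter> satisfying D) n" unfolding has_codim_def
  proof (intro exI[of _ "f ` D"] conjI allI impI ballI)
    show "finite (f ` D)" using D by simp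
    show "card (f ` D) = n" using D card_image[OF inj] by simp
    show "f ` D \<subseteq> C0" using f(1) by (auto simp: C0_def)
    show "c b = 0" if "(\<Sum>b\<in>f ` D. c b *\<^sub>R b) \<in> C0 \<inter> satisfying D" "b \<in> f ` D" for c b
      using that eval[of _ c] by (auto simp: in_satisfying)
    fix g assume g: "g \<in> C0"
    obtain c where c: "\<And>z. z \<in> D \<Longrightarrow> c (f z) = g (snd z) - g (fst z)"
    proof
      show "(\<lambda>b. g (snd (inv_into D f b)) - g (fst (inv_into D f b))) (f z) = g (snd z) - g (fst z)" if "z \<in> D" for z
        using inv_into_f_f[OF inj that] by simp
    qed
    let ?s = "\<Sum>b\<in>f ` D. c b *\<^sub>R b"
    have "?s = (\<lambda>t. \<Sum>w\<in>D. c (f w) * f w t)"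
      by (rule ext) (simp add: sum.reindex[OF inj] sum_scaleR_apply)
    moreover have "continuous_on UNIV (\<lambda>t. \<Sum>w\<in>D. c (f w) * f w t)"
      by (intro continuous_intros f(1))
    ultimately have "continuous_on UNIV ?s" by (simp only:)
    then have "continuous_on UNIV (\<lambda>t. g t - ?s t)" using g by (intro continuous_intros) (simp add: C0_def)
    moreover have "g - ?s = (\<lambda>t. g t - ?s t)" by (rule ext) simp
    ultimately have "g - ?s \<in> C0" by (simp only: C0_def mem_Collect_eq)
    moreover have "(g - ?s) (snd z) - (g - ?s) (fst z) = 0" if z: "z \<in> D" for z
      using eval[OF z, of c] c[OF z] by simp
    ultimately show "\<exists>c. g - (\<Sum>b\<in>f ` D. c b *\<^sub>R b) \<in> C0 \<inter> satisfying D"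
      by (intro exI[of _ c]) (simp add: in_satisfying)
  qed
  then show ?thesis using D by (simp add: independent_diagrams_def chord_diagrams_def)
qed

text \<open>A largest subset of \<open>F\<close> that is independent modulo the conditions is a
  basis of the quotient. It has fewer than \<open>n\<close> elements, since a nontrivial combination
  of \<open>n\<close> functions can be made to satisfy the \<open>n - 1\<close> conditions other
  than \<open>z0\<close>, and the relation \<open>\<mu>\<close> then gives the condition
  \<open>z0\<close> too.\<close>

lemma exceptional_diagramI:
  assumes F: "subspace F" and D: "D \<in> independent_diagrams n"
    and rel: "\<And>f. f \<in> F \<Longrightarrow> (\<Sum>z\<in>D. \<mu> z * (f (snd z) - f (fst z))) = 0"
    and z0: "z0 \<in> D" "\<mu> z0 \<noteq> 0"
  shows "D \<in> exceptional_diagrams n F"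
proof -
  have fin: "finite D" and card: "card D = n" using D by (auto simp: independent_diagrams_def chord_diagrams_def)
  define free where "free B \<longleftrightarrow> finite B \<and> B \<subseteq> F \<and> (\<forall>c. (\<Sum>b\<in>B. c b *\<^sub>R b) \<in> satisfying D \<longrightarrow> (\<forall>b\<in>B. c b = 0))"
    for B :: "(real \<Rightarrow> real) set"
  have sumF: "(\<Sum>b\<in>B. c b *\<^sub>R b) \<in> F" if "B \<subseteq> F" for B and c :: "(real \<Rightarrow> real) \<Rightarrow> real"
    by (rule subspace_sum[OF F]) (use that subspace_scale[OF F] in blast)
  have small: "card B < n" if B: "free B" for B
  proof (rule ccontr)
    assume "\<not> card B < n"
    moreover have n: "card (D - {z0}) < n" using fin card z0(1) by (metis card_Diff1_less)
    ultimately have lt: "card (D - {z0}) < card B" by simp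
    obtain e where e: "bij_betw e {..<card (D - {z0})} (D - {z0})"
      using ex_bij_betw_nat_finite[of "D - {z0}"] fin by (auto simp: atLeast0LessThan)
    have finB: "finite B" and BF: "B \<subseteq> F" using B by (auto simp: free_def)
    obtain c where c: "\<And>r. r < card (D - {z0}) \<Longrightarrow> (\<Sum>b\<in>B. c b * (b (snd (e r)) - b (fst (e r)))) = 0"
      "\<exists>b\<in>B. c b \<noteq> 0"
      using homogeneous_system_solution[OF finB lt, of "\<lambda>b r. b (snd (e r)) - b (fst (e r))"] by blast
    let ?g = "\<Sum>b\<in>B. c b *\<^sub>R b"
    have g: "?g (snd z) - ?g (fst z) = (\<Sum>b\<in>B. c b * (b (snd z) - b (fst z)))" for z
      by (simp add: sum_scaleR_apply sum_subtractf right_diff_distrib)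
    have other: "?g (snd z) - ?g (fst z) = 0" if z: "z \<in> D - {z0}" for z
    proof -
      have "D - {z0} = e ` {..<card (D - {z0})}" using e by (simp add: bij_betw_def)
      then obtain r where "r < card (D - {z0})" "z = e r" using z by blast
      then show ?thesis using c(1) unfolding g by simp
    qed
    have "(\<Sum>z\<in>D. \<mu> z * (?g (snd z) - ?g (fst z))) = 0" by (rule rel[OF sumF[OF BF]])
    moreover have "(\<Sum>z\<in>D. \<mu> z * (?g (snd z) - ?g (fst z))) =
        \<mu> z0 * (?g (snd z0) - ?g (fst z0)) + (\<Sum>z\<in>D - {z0}. \<mu> z * (?g (snd z) - ?g (fst z)))"
      by (rule sum.remove[OF fin z0(1)])
    moreover have "(\<Sum>z\<in>D - {z0}. \<mu> z * (?g (snd z) - ?g (fst z))) = 0"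
    proof (rule sum.neutral, rule ballI)
      fix z assume "z \<in> D - {z0}"
      then show "\<mu> z * (?g (snd z) - ?g (fst z)) = 0" by (simp only: other mult_zero_right)
    qed
    ultimately have "\<mu> z0 * (?g (snd z0) - ?g (fst z0)) = 0" by linarith
    then have "?g (snd z0) - ?g (fst z0) = 0" using z0(2) by (simp only: mult_eq_0_iff) simp
    then have "?g (snd z) - ?g (fst z) = 0" if "z \<in> D" for z using other[of z] that by (cases "z = z0") auto
    then have "?g \<in> satisfying D" unfolding in_satisfying by blast
    then show False using B c(2) unfolding free_def by blast
  qed
  have "free {}" by (simp add: free_def)
  then obtain B where B: "free B" "\<And>B'. free B' \<Longrightarrow> card B' \<le> card B"
    using ex_has_greatest_nat[of free "{}" card n] small by (auto simp: less_imp_le)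
  have finB: "finite B" and BF: "B \<subseteq> F" using B(1) by (auto simp: free_def)
  have "has_codim F (F \<inter> satisfying D) (card B)" unfolding has_codim_def
  proof (intro exI[of _ B] conjI allI impI ballI)
    show "c b = 0" if "(\<Sum>b\<in>B. c b *\<^sub>R b) \<in> F \<inter> satisfying D" "b \<in> B" for c b
      using B(1) that unfolding free_def by blast
    fix f assume f: "f \<in> F"
    have "\<exists>c. f - (\<Sum>b\<in>B. c b *\<^sub>R b) \<in> satisfying D"
    proof (cases "f \<in> B")
      case True
      have "(\<Sum>b\<in>B. of_bool (b = f) *\<^sub>R b) = (\<Sum>b\<in>B. if b = f then b else 0)"
        by (rule sum.cong) auto
      then have "f - (\<Sum>b\<in>B. of_bool (b = f) *\<^sub>R b) = 0" using finB True by simp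
      then show ?thesis by (intro exI[of _ "\<lambda>b. of_bool (b = f)"]) (simp add: in_satisfying)
    next
      case False
      then have "card (insert f B) = Suc (card B)" using finB by simp
      then have "\<not> free (insert f B)" using B(2)[of "insert f B"] by auto
      then obtain c b1 where c: "(\<Sum>b\<in>insert f B. c b *\<^sub>R b) \<in> satisfying D" "b1 \<in> insert f B" "c b1 \<noteq> 0"
        using finB BF f unfolding free_def by auto
      have split: "(\<Sum>b\<in>insert f B. c b *\<^sub>R b) = c f *\<^sub>R f + (\<Sum>b\<in>B. c b *\<^sub>R b)"
        using finB False by simp
      have cf: "c f \<noteq> 0"
      proof
        assume cf: "c f = 0"
        then have "(\<Sum>b\<in>B. c b *\<^sub>R b) \<in> satisfying D" using c(1) unfolding split by simp
        then show False using B(1) c(2,3) cf unfolding free_def by blast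
      qed
      define c' where "c' b = - c b / c f" for b
      have "(f - (\<Sum>b\<in>B. c' b *\<^sub>R b)) t = (\<Sum>b\<in>insert f B. c b *\<^sub>R b) t / c f" for t
      proof -
        have "(\<Sum>b\<in>B. c' b * b t) = - (\<Sum>b\<in>B. c b * b t) / c f"
          unfolding c'_def sum_negf[symmetric] sum_divide_distrib by (rule sum.cong) simp_all
        then show ?thesis using cf False finB by (simp add: sum_scaleR_apply scaleR_fun_apply add_divide_distrib)
      qed
      note eq = this
      have "f - (\<Sum>b\<in>B. c' b *\<^sub>R b) \<in> satisfying D"
        using c(1) unfolding in_satisfying eq diff_divide_distrib[symmetric] by simp
      then show ?thesis by blast
    qed
    then obtain c where c: "f - (\<Sum>b\<in>B. c b *\<^sub>R b) \<in> satisfying D" by blast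
    moreover have "f - (\<Sum>b\<in>B. c b *\<^sub>R b) \<in> F" by (rule subspace_diff[OF F f sumF[OF BF]])
    ultimately show "\<exists>c. f - (\<Sum>b\<in>B. c b *\<^sub>R b) \<in> F \<inter> satisfying D" by blast
  qed (use finB BF in auto)
  then show ?thesis using small[OF B(1)] D by (auto simp: exceptional_diagrams_def)
qed

section \<open>Sums of powers of two with a prescribed number of terms\<close>

lemma sum_append:
  fixes n :: nat
  assumes "(\<Sum>c<q. (2::nat) ^ b c) = n"
  shows "(\<Sum>c<Suc q. 2 ^ (b(q := a)) c) = n + 2 ^ a"
proof -
  have "(\<Sum>c<q. (2::nat) ^ (b(q := a)) c) = (\<Sum>c<q. 2 ^ b c)" by (rule sum.cong) auto
  then show ?thesis using assms by simp
qed

lemma binary_expansion: "finite {k. bit n k} \<and> (\<exists>b. (\<Sum>c<binary_ones n. (2::nat) ^ b c) = n)"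
proof (induction n rule: less_induct)
  case (less n)
  show ?case
  proof (cases "n = 0")
    case True
    then show ?thesis by (simp add: binary_ones_def)
  next
    case False
    define h where "h = n div 2"
    have "h < n" using False by (simp add: h_def)
    then obtain b where fin: "finite {k. bit h k}" and b: "(\<Sum>c<binary_ones h. (2::nat) ^ b c) = h" using less.IH[of h] by blast
    have eq: "{k. bit n k} = (if odd n then {0} else {}) \<union> Suc ` {k. bit h k}"
    proof (rule Set.set_eqI)
      fix k show "k \<in> {k. bit n k} \<longleftrightarrow> k \<in> (if odd n then {0} else {}) \<union> Suc ` {k. bit h k}"
        by (cases k) (auto simp: bit_0 bit_Suc h_def)
    qed
    have fin': "finite {k. bit n k}" unfolding eq using fin by simp
    have cd: "card (Suc ` {k. bit h k}) = binary_ones h" by (simp add: card_image binary_ones_def)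
    have dbl: "(\<Sum>c<binary_ones h. (2::nat) ^ Suc (b c)) = 2 * h"
      using b by (simp flip: sum_distrib_left)
    show ?thesis
    proof (cases "odd n")
      case True
      then have n: "n = 2 * h + 2 ^ 0" by (simp add: h_def)
      have "binary_ones n = Suc (binary_ones h)"
        unfolding binary_ones_def[of n] eq using True fin cd by (simp add: card_insert_if)
      then have s: "(\<Sum>c<binary_ones n. (2::nat) ^ ((\<lambda>c. Suc (b c))(binary_ones h := 0)) c) = n"
        using sum_append[OF dbl, of 0] unfolding n[symmetric] by (simp only:)
      show ?thesis by (rule conjI[OF fin' exI[of _ "(\<lambda>c. Suc (b c))(binary_ones h := 0)"]]) (rule s)
    next
      case False
      then have n: "n = 2 * h" by (simp add: h_def)
      have "binary_ones n = binary_ones h"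
        unfolding binary_ones_def[of n] eq using False cd by simp
      then have s: "(\<Sum>c<binary_ones n. (2::nat) ^ Suc (b c)) = n" using dbl unfolding n[symmetric] by (simp only:)
      show ?thesis by (rule conjI[OF fin' exI[of _ "\<lambda>c. Suc (b c)"]]) (rule s)
    qed
  qed
qed

text \<open>Starting with the binary expansion, a term \<open>2 ^ (a + 1)\<close> is split into two
  terms \<open>2 ^ a\<close>. This is possible until all terms are \<open>1\<close>, that is, as
  long as there are fewer than \<open>n\<close> of them.\<close>

lemma sum_of_powers:
  assumes "binary_ones n \<le> q" "q \<le> n"
  shows "\<exists>b. (\<Sum>c<q. (2::nat) ^ b c) = n"
  using assms
proof (induction q rule: dec_induct)
  case base
  then show ?case using binary_expansion by blast
next
  case (step q)
  then obtain b where b: "(\<Sum>c<q. (2::nat) ^ b c) = n" by auto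
  have "\<exists>c<q. b c \<noteq> 0"
  proof (rule ccontr)
    assume "\<not> (\<exists>c<q. b c \<noteq> 0)"
    then have "(\<Sum>c<q. (2::nat) ^ b c) = (\<Sum>c<q. 1)" by (intro sum.cong) auto
    then show False using b step by simp
  qed
  then obtain c a where c: "c < q" "b c = Suc a" using not0_implies_Suc by blast
  have "(\<Sum>i<q. (2::nat) ^ (b(c := a)) i) = 2 ^ a + (\<Sum>i\<in>{..<q} - {c}. 2 ^ b i)"
  proof -
    have "(\<Sum>i<q. (2::nat) ^ (b(c := a)) i) = 2 ^ (b(c := a)) c + (\<Sum>i\<in>{..<q} - {c}. 2 ^ (b(c := a)) i)"
      by (rule sum.remove) (use c in auto)
    then show ?thesis by simp
  qed
  moreover have "n = 2 ^ b c + (\<Sum>i\<in>{..<q} - {c}. 2 ^ b i)"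
    unfolding b[symmetric] by (rule sum.remove) (use c in auto)
  ultimately have "(\<Sum>i<q. (2::nat) ^ (b(c := a)) i) + 2 ^ a = n" using c by simp
  then have "(\<Sum>i<Suc q. (2::nat) ^ ((b(c := a))(q := a)) i) = n"
    using sum_append[OF refl, of "b(c := a)" q a] by (simp only:)
  then show ?case by (rule exI[of _ "(b(c := a))(q := a)"])
qed

lemma forest_independent:
  assumes \<theta>: "\<theta> \<in> topspace (cube_top (forest_nodes q b))" and n: "(\<Sum>c<q. 2 ^ b c) = n"
  shows "forest_point q \<theta> ` forest_leaves q b \<in> independent_diagrams n"
proof (rule independent_diagramI)
  note inj = forest_point_inj[OF \<theta>]
  show "forest_point q \<theta> ` forest_leaves q b \<subseteq> half_plane" using forest_point_half_plane[OF \<theta>] by blast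
  show "finite (forest_point q \<theta> ` forest_leaves q b)" by (simp add: finite_forest_leaves)
  show "card (forest_point q \<theta> ` forest_leaves q b) = n" by (simp add: card_image[OF inj] card_forest_leaves n)
  show "fst z \<noteq> snd z'" if "z \<in> forest_point q \<theta> ` forest_leaves q b" "z' \<in> forest_point q \<theta> ` forest_leaves q b" for z z'
    using that forest_point_endpoints[OF \<theta>] by blast
  fix m :: "real \<times> real \<Rightarrow> real" and z
  assume m: "\<And>t. (\<Sum>z\<in>{z\<in>forest_point q \<theta> ` forest_leaves q b. fst z = t}. m z) = 0"
    "\<And>t. (\<Sum>z\<in>{z\<in>forest_point q \<theta> ` forest_leaves q b. snd z = t}. m z) = 0"
    "z \<in> forest_point q \<theta> ` forest_leaves q b"
  have re: "(\<Sum>p\<in>{p\<in>forest_leaves q b. g (forest_point q \<theta> p) = t}. m (forest_point q \<theta> p)) =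
      (\<Sum>z\<in>{z\<in>forest_point q \<theta> ` forest_leaves q b. g z = t}. m z)" for g :: "real \<times> real \<Rightarrow> real" and t
  proof -
    have "{z\<in>forest_point q \<theta> ` forest_leaves q b. g z = t} = forest_point q \<theta> ` {p\<in>forest_leaves q b. g (forest_point q \<theta> p) = t}"
      by blast
    moreover have "inj_on (forest_point q \<theta>) {p\<in>forest_leaves q b. g (forest_point q \<theta> p) = t}"
      by (rule inj_on_subset[OF inj]) blast
    ultimately show ?thesis by (simp add: sum.reindex)
  qed
  obtain p where p: "p \<in> forest_leaves q b" "z = forest_point q \<theta> p" using m(3) by blast
  show "m z = 0" unfolding p(2)
    by (rule forest_rigid[OF \<theta> _ _ p(1), of "\<lambda>p. m (forest_point q \<theta> p)"]) (simp_all only: re m)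
qed

section \<open>Homology mod 2 and subdivision\<close>

definition mod2 :: "'a chain \<Rightarrow> ('a, bit) coeff_chain"
  where "mod2 = Poly_Mapping.map of_int"

lemma lookup_mod2: "Poly_Mapping.lookup (mod2 c) f = of_int (Poly_Mapping.lookup c f)"
  by (simp add: mod2_def Poly_Mapping.map.rep_eq when_def)

lemma mod2_add: "mod2 (a + b) = mod2 a + mod2 b"
  by (rule poly_mapping_eqI) (simp only: lookup_mod2 lookup_add of_int_add)

lemma mod2_diff: "mod2 (a - b) = mod2 a - mod2 b"
  by (rule poly_mapping_eqI) (simp only: lookup_mod2 lookup_minus of_int_diff)

lemma keys_mod2: "Poly_Mapping.keys (mod2 c) \<subseteq> Poly_Mapping.keys c"
  by (auto simp: in_keys_iff lookup_mod2)

lemma of_int_bit_eq_0: "(of_int x :: bit) = 0 \<longleftrightarrow> even x"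
proof
  assume "even x"
  then obtain y where "x = y + y" by (auto elim!: evenE)
  then show "(of_int x :: bit) = 0" by (simp only: of_int_add bit_add_self)
next
  assume 0: "(of_int x :: bit) = 0"
  show "even x"
  proof (rule ccontr)
    assume "odd x"
    then obtain y where "x = y + y + 1" by (auto elim!: oddE)
    then have "(of_int x :: bit) = 1" by (simp only: of_int_add of_int_1 bit_add_self add_0_left)
    then show False using 0 by (simp only: zero_neq_one)
  qed
qed

lemma mod2_double: "mod2 (w + w) = 0"
  by (rule poly_mapping_eqI) (simp only: lookup_mod2 lookup_add of_int_add bit_add_self lookup_zero)

lemma cong2_iff_mod2: "cong2 a b \<longleftrightarrow> mod2 a = mod2 b"
proof
  assume "cong2 a b"
  then obtain w where "a - b = w + w" by (auto simp: cong2_def)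
  then have "mod2 a - mod2 b = 0" by (simp only: mod2_diff[symmetric] mod2_double)
  then show "mod2 a = mod2 b" by (simp only: right_minus_eq)
next
  assume "mod2 a = mod2 b"
  then have 0: "mod2 (a - b) = 0" by (simp only: mod2_diff right_minus_eq)
  have ev: "even (Poly_Mapping.lookup (a - b) f)" for f
    using lookup_mod2[of "a - b" f] unfolding 0 lookup_zero using of_int_bit_eq_0 by metis
  have "a - b = Poly_Mapping.map (\<lambda>x. x div 2) (a - b) + Poly_Mapping.map (\<lambda>x. x div 2) (a - b)"
  proof (rule poly_mapping_eqI)
    fix f
    have "Poly_Mapping.lookup (a - b) f = Poly_Mapping.lookup (a - b) f div 2 + Poly_Mapping.lookup (a - b) f div 2"
      using ev[of f] by presburger
    then show "Poly_Mapping.lookup (a - b) f = Poly_Mapping.lookup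
        (Poly_Mapping.map (\<lambda>x. x div 2) (a - b) + Poly_Mapping.map (\<lambda>x. x div 2) (a - b)) f"
      by (simp add: lookup_add Poly_Mapping.map.rep_eq when_def)
  qed
  then show "cong2 a b" unfolding cong2_def by blast
qed

text \<open>The lift with coefficients \<open>0\<close> and \<open>1\<close>, which does not enlarge
  the support; a chain that avoids a set thus lifts to an integral chain that avoids it.\<close>

lemma mod2_lift:
  obtains c' :: "'a chain" where "mod2 c' = c" "Poly_Mapping.keys c' \<subseteq> Poly_Mapping.keys c"
proof
  let ?c = "Poly_Mapping.map (\<lambda>x :: bit. of_bool (x = 1) :: int) c"
  have l: "Poly_Mapping.lookup ?c f = of_bool (Poly_Mapping.lookup c f = 1)" for f
    by (simp add: Poly_Mapping.map.rep_eq when_def)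
  show "mod2 ?c = c"
  proof (rule poly_mapping_eqI)
    fix f
    show "Poly_Mapping.lookup (mod2 ?c) f = Poly_Mapping.lookup c f"
      unfolding lookup_mod2 l by (cases "Poly_Mapping.lookup c f") simp_all
  qed
  show "Poly_Mapping.keys ?c \<subseteq> Poly_Mapping.keys c"
    by (auto simp: in_keys_iff l)
qed

lemma lookup_coeff_boundary:
  assumes "finite A" "Poly_Mapping.keys c \<subseteq> A" "p \<noteq> 0"
  shows "Poly_Mapping.lookup (coeff_boundary p c) g =
    (\<Sum>f\<in>A. \<Sum>i\<le>p. if singular_face p i f = g then (-1) ^ i * Poly_Mapping.lookup c f else 0)"
proof -
  have "Poly_Mapping.lookup (coeff_boundary p c) g = (\<Sum>f\<in>Poly_Mapping.keys c. \<Sum>i\<le>p.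
      if singular_face p i f = g then (-1) ^ i * Poly_Mapping.lookup c f else 0)"
    using assms(3) by (simp add: coeff_boundary_def lookup_sum lookup_single when_def)
  also have "\<dots> = (\<Sum>f\<in>A. \<Sum>i\<le>p. if singular_face p i f = g then (-1) ^ i * Poly_Mapping.lookup c f else 0)"
  proof (rule sum.mono_neutral_left[OF assms(1,2)], rule ballI)
    fix f assume "f \<in> A - Poly_Mapping.keys c"
    then have "Poly_Mapping.lookup c f = 0" by (simp add: in_keys_iff)
    then show "(\<Sum>i\<le>p. if singular_face p i f = g then (-1) ^ i * Poly_Mapping.lookup c f else 0) = 0"
      by (simp only: mult_zero_right if_cancel sum.neutral_const)
  qed
  finally show ?thesis .
qed

lemma coeff_boundary_mod2: "coeff_boundary p (mod2 c) = mod2 (chain_boundary p c)"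
proof (cases "p = 0")
  case True
  then show ?thesis by (simp add: coeff_boundary_def chain_boundary_def mod2_def poly_mapping_eqI Poly_Mapping.map.rep_eq)
next
  case False
  show ?thesis
  proof (rule poly_mapping_eqI)
    fix g
    have "Poly_Mapping.lookup (mod2 (chain_boundary p c)) g = (\<Sum>f\<in>Poly_Mapping.keys c. \<Sum>i\<le>p.
        of_int (if singular_face p i f = g then (-1) ^ i * Poly_Mapping.lookup c f else 0))"
      unfolding lookup_mod2 coeff_boundary_int[symmetric] lookup_coeff_boundary[OF finite_keys subset_refl False]
      by (simp only: of_int_sum)
    also have "\<dots> = Poly_Mapping.lookup (coeff_boundary p (mod2 c)) g"
      unfolding lookup_coeff_boundary[OF finite_keys keys_mod2 False]
    proof (intro sum.cong refl)
      fix f i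
      show "(of_int (if singular_face p i f = g then (-1) ^ i * Poly_Mapping.lookup c f else 0) :: bit) =
        (if singular_face p i f = g then (-1) ^ i * Poly_Mapping.lookup (mod2 c) f else 0)"
        unfolding lookup_mod2 by (simp only: of_int_mult of_int_power of_int_minus of_int_1 of_int_0 split: if_split) blast
    qed
    finally show "Poly_Mapping.lookup (coeff_boundary p (mod2 c)) g = Poly_Mapping.lookup (mod2 (chain_boundary p c)) g" ..
  qed
qed

text \<open>The class is the coset of \<open>Z\<close>. A representative that avoids
  \<open>E\<close> lifts to an integral chain in the complement of \<open>E\<close>, congruent to
  \<open>Z\<close> plus a boundary, which \<open>avoid\<close> excludes. The class is nontrivial for
  the same reason, because the zero chain has empty support.\<close>

lemma unavoidable_class:
  assumes Z: "singular_chain p X Z" "cong2 (chain_boundary p Z) 0"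
    and avoid: "\<And>c d. singular_chain p (subtopology X (topspace X - E)) c \<Longrightarrow> singular_chain (Suc p) X d \<Longrightarrow>
      cong2 c (Z + chain_boundary (Suc p) d) \<Longrightarrow> False"
  shows "E \<noteq> {} \<and> (\<exists>h\<in>carrier (homology_group_Z2 p X). h \<noteq> \<one>\<^bsub>homology_group_Z2 p X\<^esub> \<and>
    (\<forall>c\<in>h. chain_support p c \<inter> E \<noteq> {}))"
proof -
  let ?G = "\<lparr>carrier = coeff_cycles p X, monoid.mult = (+), one = 0\<rparr> :: ('a, bit) coeff_chain monoid"
  let ?B = "coeff_boundaries p X :: ('a, bit) coeff_chain set"
  let ?h = "?B #>\<^bsub>?G\<^esub> mod2 Z"
  have group: "homology_group_Z2 p X = ?G Mod ?B" by (simp add: homology_group_Z2_def coeff_homology_group_def)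
  have h: "c \<in> ?h \<longleftrightarrow> (\<exists>b\<in>?B. c = b + mod2 Z)" for c by (auto simp: r_coset_def)
  have boundary: "\<exists>d. singular_chain (Suc p) X d \<and> b = mod2 (chain_boundary (Suc p) d)" if b: "b \<in> ?B" for b
  proof -
    obtain d' :: "('a, bit) coeff_chain" where d': "Poly_Mapping.keys d' \<subseteq> singular_simplex_set (Suc p) X"
      "b = coeff_boundary (Suc p) d'" using b by (auto simp: coeff_boundaries_def)
    obtain d where d: "mod2 d = d'" "Poly_Mapping.keys d \<subseteq> Poly_Mapping.keys d'" by (rule mod2_lift)
    have "singular_chain (Suc p) X d" using d(2) d'(1) unfolding singular_chain_def by (rule order_trans)
    moreover have "b = mod2 (chain_boundary (Suc p) d)" unfolding d'(2) d(1)[symmetric] by (rule coeff_boundary_mod2)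
    ultimately show ?thesis by blast
  qed
  have hit: "chain_support p c \<inter> E \<noteq> {}" if c: "c \<in> ?h" for c
  proof
    assume disj: "chain_support p c \<inter> E = {}"
    obtain b where b: "b \<in> ?B" "c = b + mod2 Z" using c unfolding h by blast
    obtain d where d: "singular_chain (Suc p) X d" "b = mod2 (chain_boundary (Suc p) d)" using boundary[OF b(1)] by blast
    have c_eq: "c = mod2 (Z + chain_boundary (Suc p) d)" unfolding b(2) d(2) mod2_add by (rule add.commute)
    obtain c' where c': "mod2 c' = c" "Poly_Mapping.keys c' \<subseteq> Poly_Mapping.keys c" by (rule mod2_lift)
    have "singular_chain p X (Z + chain_boundary (Suc p) d)"
      using singular_chain_add[OF Z(1)] singular_chain_boundary[OF d(1)] by simp
    then have "Poly_Mapping.keys c \<subseteq> singular_simplex_set p X"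
      using keys_mod2[of "Z + chain_boundary (Suc p) d"] unfolding c_eq singular_chain_def by blast
    then have "singular_simplex p (subtopology X (topspace X - E)) f" if f: "f \<in> Poly_Mapping.keys c'" for f
    proof -
      assume "Poly_Mapping.keys c \<subseteq> singular_simplex_set p X"
      then have s: "singular_simplex p X f" using f c'(2) by blast
      have "f ` standard_simplex p \<subseteq> topspace X" using s by (auto simp: singular_simplex_def continuous_map_def)
      moreover have "f ` standard_simplex p \<inter> E = {}" using disj f c'(2) unfolding chain_support_def by blast
      ultimately show ?thesis using s unfolding singular_simplex_subtopology by blast
    qed
    then have "singular_chain p (subtopology X (topspace X - E)) c'" unfolding singular_chain_def by blast
    moreover have "cong2 c' (Z + chain_boundary (Suc p) d)" unfolding cong2_iff_mod2 c'(1) by (rule c_eq)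
    ultimately show False using avoid d(1) by blast
  qed
  have zero: "0 \<in> ?B"
  proof -
    have "coeff_boundary (Suc p) (0 :: ('a, bit) coeff_chain) = 0" by (simp add: coeff_boundary_def)
    then show ?thesis unfolding coeff_boundaries_def by (intro image_eqI[of _ _ 0]) simp_all
  qed
  have "mod2 Z \<in> ?h" unfolding h using zero by (intro bexI[of _ 0]) simp_all
  from hit[OF this] have "E \<noteq> {}" by blast
  moreover have "?h \<in> carrier (homology_group_Z2 p X)"
  proof -
    have "coeff_boundary p (mod2 Z) = 0" using Z(2) unfolding coeff_boundary_mod2 cong2_iff_mod2
      using mod2_double[of 0] by simp
    moreover have "Poly_Mapping.keys (mod2 Z) \<subseteq> singular_simplex_set p X"
      using keys_mod2 Z(1) unfolding singular_chain_def by (rule order_trans)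
    ultimately have "mod2 Z \<in> coeff_cycles p X" by (simp add: coeff_cycles_def)
    then show ?thesis unfolding group carrier_FactGroup by auto
  qed
  moreover have "?h \<noteq> \<one>\<^bsub>homology_group_Z2 p X\<^esub>"
  proof
    assume "?h = \<one>\<^bsub>homology_group_Z2 p X\<^esub>"
    then have "0 \<in> ?h" unfolding group one_FactGroup using zero by simp
    from hit[OF this] show False by (simp add: chain_support_def)
  qed
  ultimately show ?thesis using hit by blast
qed

section \<open>Iterated subdivision\<close>

lemma small_subdivision:
  assumes c: "singular_chain p X c" and "\<And>x. x \<in> topspace X \<Longrightarrow> \<exists>V. openin X V \<and> x \<in> V \<and> P V"
  shows "\<exists>r. \<forall>s\<ge>r. \<forall>f\<in>Poly_Mapping.keys ((singular_subdivision p ^^ s) c). \<exists>V. P V \<and> f ` standard_simplex p \<subseteq> V"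
proof -
  let ?C = "{V. openin X V \<and> P V}"
  have "topspace X \<subseteq> \<Union>?C" using assms(2) by blast
  then obtain r where r: "\<And>m f. r \<le> m \<Longrightarrow> f \<in> Poly_Mapping.keys ((singular_subdivision p ^^ m) c) \<Longrightarrow>
      \<exists>V\<in>?C. f \<in> standard_simplex p \<rightarrow> V"
    using sufficient_iterated_singular_subdivision_exists[of ?C X p c] c by blast
  show ?thesis
  proof (intro exI[of _ r] allI impI ballI)
    fix s f assume "r \<le> s" "f \<in> Poly_Mapping.keys ((singular_subdivision p ^^ s) c)"
    from r[OF this] obtain V where "P V" "f \<in> standard_simplex p \<rightarrow> V" by blast
    then show "\<exists>V. P V \<and> f ` standard_simplex p \<subseteq> V" by blast
  qed
qed

lemma singular_chain_iterated_subdivision: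
  assumes "singular_chain p X c"
  shows "singular_chain p X ((singular_subdivision p ^^ r) c)"
  by (induction r) (simp_all add: assms singular_chain_singular_subdivision)

lemma chain_boundary_iterated_subdivision:
  assumes "singular_chain (Suc p) X c"
  shows "chain_boundary (Suc p) ((singular_subdivision (Suc p) ^^ r) c) =
    (singular_subdivision p ^^ r) (chain_boundary (Suc p) c)"
proof (induction r)
  case (Suc r)
  show ?case
    using chain_boundary_singular_subdivision[OF singular_chain_iterated_subdivision[OF assms, of r]] Suc by simp
qed simp

lemma chain_map_iterated_subdivision:
  assumes "singular_chain p X c"
  shows "(singular_subdivision p ^^ r) (chain_map p g c) = chain_map p g ((singular_subdivision p ^^ r) c)"
proof (induction r)
  case (Suc r)
  show ?case
    using naturality_singular_subdivision[OF singular_chain_iterated_subdivision[OF assms, of r], of g] Suc by simp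
qed simp

lemma iterated_subdivision_add:
  "(singular_subdivision p ^^ r) (a + b) = (singular_subdivision p ^^ r) a + (singular_subdivision p ^^ r) b"
  by (induction r) (simp_all add: singular_subdivision_add)

lemma iterated_subdivision_diff:
  "(singular_subdivision p ^^ r) (a - b) = (singular_subdivision p ^^ r) a - (singular_subdivision p ^^ r) b"
  by (induction r) (simp_all add: singular_subdivision_diff)

lemma iterated_subdivision_0: "(singular_subdivision p ^^ r) 0 = 0"
  by (induction r) simp_all

lemma cong2_iterated_subdivision:
  assumes "cong2 a b"
  shows "cong2 ((singular_subdivision p ^^ r) a) ((singular_subdivision p ^^ r) b)"
proof -
  obtain w where "a - b = w + w" using assms by (auto simp: cong2_def)
  then have "(singular_subdivision p ^^ r) a - (singular_subdivision p ^^ r) b =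
      (singular_subdivision p ^^ r) w + (singular_subdivision p ^^ r) w"
    by (simp only: iterated_subdivision_diff[symmetric] iterated_subdivision_add[symmetric])
  then show ?thesis unfolding cong2_def by blast
qed

lemma chain_eval_cong2:
  assumes "cong2 a b"
  shows "chain_eval p \<psi> a = chain_eval p \<psi> b"
proof -
  obtain w where w: "a - b = w + w" using assms by (auto simp: cong2_def)
  have "chain_eval p \<psi> a + chain_eval p \<psi> b = 0"
    unfolding chain_eval_diff[symmetric] w chain_eval_double ..
  then show ?thesis by (rule bit_add_eq_0)
qed

section \<open>Topology of the diagram space and its matrices\<close>

lemma labels_permuted:
  assumes x: "inj_on x {..<n}" and y: "labels n (x ` {..<n}) y"
  obtains \<pi> where "\<pi> permutes {..<n}" "\<And>i. i < n \<Longrightarrow> y i = x (\<pi> i)"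
proof
  let ?\<pi> = "\<lambda>i. if i < n then inv_into {..<n} x (y i) else i"
  have "bij_betw y {..<n} (x ` {..<n})" using y by (simp add: labels_def bij_betw_def)
  moreover have "bij_betw (inv_into {..<n} x) (x ` {..<n}) {..<n}"
    by (rule bij_betw_inv_into) (use x in \<open>simp add: bij_betw_def\<close>)
  ultimately have "bij_betw (inv_into {..<n} x \<circ> y) {..<n} {..<n}" by (rule bij_betw_trans)
  then have "bij_betw ?\<pi> {..<n} {..<n}" by (rule bij_betw_cong[THEN iffD1, rotated]) simp
  then show "?\<pi> permutes {..<n}" by (rule bij_imp_permutes) simp
  show "y i = x (?\<pi> i)" if i: "i < n" for i
  proof -
    have "y i \<in> x ` {..<n}" using y i by (auto simp: labels_def)
    then show ?thesis using i f_inv_into_f[of "y i" x "{..<n}"] by simp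
  qed
qed

definition diagram_nbhd :: "nat \<Rightarrow> (nat \<Rightarrow> real \<times> real) \<Rightarrow> real \<Rightarrow> (real \<times> real) set set"
  where "diagram_nbhd n l \<delta> =
    {D \<in> independent_diagrams n. \<exists>x. labels n D x \<and> (\<forall>i<n. dist (x i) (l i) < \<delta>)}"

text \<open>By the quotient topology, openness is tested on ordered configurations. There the
  preimage is a union of product neighbourhoods, one for each permutation of the labels.\<close>

lemma openin_diagram_nbhd: "openin (diagram_space n) (diagram_nbhd n l \<delta>)"
proof -
  let ?P = "product_topology (\<lambda>_. top_of_set half_plane) {..<n}"
  let ?O = "ordered_configurations n (top_of_set half_plane)"
  define T where "T = {S \<in> topspace (unordered_configurations n (top_of_set half_plane)).
    \<exists>x. labels n S x \<and> (\<forall>i<n. dist (x i) (l i) < \<delta>)}"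
  define W where "W \<pi> = {x \<in> topspace ?P. \<forall>i<n. dist (x (\<pi> i)) (l i) < \<delta>}" for \<pi> :: "nat \<Rightarrow> nat"
  have W: "openin ?P (W \<pi>)" if \<pi>: "\<pi> permutes {..<n}" for \<pi>
  proof -
    have "openin ?P {x \<in> topspace ?P. x (\<pi> i) \<in> half_plane \<inter> ball (l i) \<delta>}" if i: "i < n" for i
    proof (rule openin_continuous_map_preimage)
      have "\<pi> i \<in> {..<n}" using permutes_in_image[OF \<pi>, of i] i by simp
      then show "continuous_map ?P (top_of_set half_plane) (\<lambda>x. x (\<pi> i))"
        by (rule continuous_map_product_projection)
      show "openin (top_of_set half_plane) (half_plane \<inter> ball (l i) \<delta>)" by (simp add: openin_open_Int)
    qed
    then have "openin ?P ((\<Inter>i\<in>{..<n}. {x \<in> topspace ?P. x (\<pi> i) \<in> half_plane \<inter> ball (l i) \<delta>}) \<inter> topspace ?P)"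
      by (intro openin_INT) simp_all
    moreover have "(\<Inter>i\<in>{..<n}. {x \<in> topspace ?P. x (\<pi> i) \<in> half_plane \<inter> ball (l i) \<delta>}) \<inter> topspace ?P = W \<pi>"
    proof -
      have mem: "x (\<pi> i) \<in> half_plane" if "x \<in> topspace ?P" "i < n" for x i
        using that permutes_in_image[OF \<pi>, of i] by (auto simp: PiE_iff)
      show ?thesis unfolding W_def using mem by (auto simp: dist_commute)
    qed
    ultimately show ?thesis by (simp only:)
  qed
  have top: "x \<in> topspace ?O \<longleftrightarrow> x \<in> topspace ?P \<and> inj_on x {..<n}" for x
    by (auto simp: ordered_configurations_def)
  have "{x \<in> topspace ?O. x ` {..<n} \<in> T} = (\<Union>\<pi>\<in>{\<pi>. \<pi> permutes {..<n}}. W \<pi>) \<inter> {x. inj_on x {..<n}}"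
  proof (intro subset_antisym subsetI)
    fix x assume "x \<in> {x \<in> topspace ?O. x ` {..<n} \<in> T}"
    then have x: "x \<in> topspace ?P" "inj_on x {..<n}" "x ` {..<n} \<in> T" using top by auto
    then obtain y where y: "labels n (x ` {..<n}) y" "\<forall>i<n. dist (y i) (l i) < \<delta>" by (auto simp: T_def)
    obtain \<pi> where \<pi>: "\<pi> permutes {..<n}" "\<And>i. i < n \<Longrightarrow> y i = x (\<pi> i)" using labels_permuted[OF x(2) y(1)] by blast
    have "x \<in> W \<pi>" using x(1) y(2) \<pi>(2) by (simp add: W_def)
    then show "x \<in> (\<Union>\<pi>\<in>{\<pi>. \<pi> permutes {..<n}}. W \<pi>) \<inter> {x. inj_on x {..<n}}" using x(2) \<pi>(1) by blast
  next
    fix x assume "x \<in> (\<Union>\<pi>\<in>{\<pi>. \<pi> permutes {..<n}}. W \<pi>) \<inter> {x. inj_on x {..<n}}"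
    then obtain \<pi> where \<pi>: "\<pi> permutes {..<n}" "x \<in> W \<pi>" and x: "inj_on x {..<n}" by blast
    have xt: "x \<in> topspace ?O" using \<pi>(2) x top by (simp add: W_def)
    then have "x ` {..<n} \<in> (\<lambda>x. x ` {..<n}) ` topspace ?O" by blast
    then have "x ` {..<n} \<in> topspace (unordered_configurations n (top_of_set half_plane))"
      unfolding unordered_configurations_def topspace_quotient_topology .
    moreover have "labels n (x ` {..<n}) (x \<circ> \<pi>)"
      using x \<pi>(1) unfolding labels_def image_comp[symmetric]
      by (simp add: comp_inj_on permutes_inj_on permutes_image)
    moreover have "\<forall>i<n. dist ((x \<circ> \<pi>) i) (l i) < \<delta>" using \<pi>(2) by (simp add: W_def)
    ultimately show "x \<in> {x \<in> topspace ?O. x ` {..<n} \<in> T}" using xt unfolding T_def by blast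
  qed
  moreover have "openin ?P (\<Union>\<pi>\<in>{\<pi>. \<pi> permutes {..<n}}. W \<pi>)" by (rule openin_Union) (use W in blast)
  ultimately have "openin ?O {x \<in> topspace ?O. x ` {..<n} \<in> T}"
    unfolding ordered_configurations_def openin_subtopology by blast
  moreover have "T \<subseteq> (\<lambda>x. x ` {..<n}) ` topspace ?O"
    unfolding T_def unordered_configurations_def topspace_quotient_topology by blast
  ultimately have "openin (unordered_configurations n (top_of_set half_plane)) T"
    unfolding unordered_configurations_def openin_quotient_topology by blast
  moreover have "diagram_nbhd n l \<delta> = T \<inter> independent_diagrams n"
    unfolding diagram_nbhd_def T_def
    using topspace_diagram_space[of n] unfolding diagram_space_def by auto
  ultimately show ?thesis unfolding diagram_space_def openin_subtopology by blast
qed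

lemma continuous_map_diagram_space:
  assumes cont: "\<And>i. i < n \<Longrightarrow> continuous_map X (top_of_set half_plane) (\<lambda>x. y x i)"
    and inj: "\<And>x. x \<in> topspace X \<Longrightarrow> inj_on (y x) {..<n}"
    and indep: "\<And>x. x \<in> topspace X \<Longrightarrow> y x ` {..<n} \<in> independent_diagrams n"
  shows "continuous_map X (diagram_space n) (\<lambda>x. y x ` {..<n})"
proof -
  let ?O = "ordered_configurations n (top_of_set half_plane)"
  have "continuous_map X ?O (\<lambda>x. restrict (y x) {..<n})"
    unfolding ordered_configurations_def continuous_map_in_subtopology[of X "product_topology _ _"]
      continuous_map_componentwise[of X]
  proof (intro conjI ballI)
    show "continuous_map X (top_of_set half_plane) (\<lambda>x. restrict (y x) {..<n} i)" if "i \<in> {..<n}" for i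
      using cont[of i] that by simp
    show "(\<lambda>x. restrict (y x) {..<n}) \<in> topspace X \<rightarrow> {x. inj_on x {..<n}}"
      using inj by (simp add: inj_on_restrict_eq)
  qed auto
  moreover have "continuous_map ?O (unordered_configurations n (top_of_set half_plane)) (\<lambda>x. x ` {..<n})"
    unfolding unordered_configurations_def by (rule quotient_imp_continuous_map[OF quotient_map_quotient_topology])
  ultimately have "continuous_map X (unordered_configurations n (top_of_set half_plane))
      ((\<lambda>x. x ` {..<n}) \<circ> (\<lambda>x. restrict (y x) {..<n}))" by (rule continuous_map_compose)
  moreover have "((\<lambda>x. x ` {..<n}) \<circ> (\<lambda>x. restrict (y x) {..<n})) = (\<lambda>x. y x ` {..<n})"
    by (rule ext) (simp add: image_restrict_eq)
  ultimately show ?thesis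
    unfolding diagram_space_def continuous_map_in_subtopology using indep by auto
qed

section \<open>Neighbourhoods of labelled diagrams and the continuity of their matrices\<close>

lemma common_radius:
  fixes P :: "'i \<Rightarrow> real \<Rightarrow> bool"
  assumes "finite I" "\<forall>i\<in>I. \<exists>\<rho>>0. P i \<rho>" "\<forall>i \<rho> \<rho>'. P i \<rho> \<longrightarrow> 0 < \<rho>' \<longrightarrow> \<rho>' \<le> \<rho> \<longrightarrow> P i \<rho>'"
  shows "\<exists>\<rho>>0. \<forall>i\<in>I. P i \<rho>"
  using uniform_radius[of I P] assms by metis

lemma separation_radius:
  fixes l :: "nat \<Rightarrow> 'a::metric_space"
  assumes "inj_on l {..<n}"
  obtains \<delta> where "0 < \<delta>" "\<And>i i'. i < n \<Longrightarrow> i' < n \<Longrightarrow> i \<noteq> i' \<Longrightarrow> 8 * \<delta> \<le> dist (l i) (l i')"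
proof -
  let ?I = "{(i, i'). i < n \<and> i' < n \<and> i \<noteq> i'}"
  have "?I \<subseteq> {..<n} \<times> {..<n}" by auto
  then have fin: "finite ?I" by (rule finite_subset) simp
  have pos: "\<exists>\<rho>>0. (\<lambda>(i, i') \<delta>. 8 * \<delta> \<le> dist (l i) (l i')) p \<rho>" if p: "p \<in> ?I" for p
  proof -
    obtain i i' where i: "p = (i, i')" "i < n" "i' < n" "i \<noteq> i'" using p by auto
    then have "l i \<noteq> l i'" using inj_onD[OF assms, of i i'] by auto
    then show ?thesis by (intro exI[of _ "dist (l i) (l i') / 8"]) (simp add: i(1))
  qed
  obtain \<rho> where \<rho>: "0 < \<rho>" "\<And>p. p \<in> ?I \<Longrightarrow> (\<lambda>(i, i') \<delta>. 8 * \<delta> \<le> dist (l i) (l i')) p \<rho>"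
    by (rule uniform_radius[of ?I "\<lambda>(i, i') \<delta>. 8 * \<delta> \<le> dist (l i) (l i')", OF fin pos]) auto
  show thesis
  proof (rule that[OF \<rho>(1)])
    fix i i' assume "i < n" "i' < n" "i \<noteq> i'"
    then show "8 * \<rho> \<le> dist (l i) (l i')" using \<rho>(2)[of "(i, i')"] by simp
  qed
qed

text \<open>Labels within \<open>\<delta>\<close> of \<open>l\<close> differ from vertex to vertex
  by less than \<open>2 * \<delta>\<close>, while different points of one diagram are more than
  \<open>6 * \<delta>\<close> apart. This explains the factor \<open>8\<close> in the
  separation.\<close>

lemma compatible_near:
  fixes l :: "nat \<Rightarrow> 'a::metric_space"
  assumes sep: "\<And>i i'. i < n \<Longrightarrow> i' < n \<Longrightarrow> i \<noteq> i' \<Longrightarrow> 8 * \<delta> \<le> dist (l i) (l i')"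
    and L: "\<And>j. j \<le> k \<Longrightarrow> labels n (V j) (L j)"
    and near: "\<And>j i. j \<le> k \<Longrightarrow> i < n \<Longrightarrow> dist (L j i) (l i) < \<delta>"
  shows "compatible n k V L"
  unfolding compatible_def
proof (intro conjI allI impI)
  show "labels n (V j) (L j)" if "j \<le> k" for j by (rule L[OF that])
  fix j j' i i' assume j: "j \<le> k" "j' \<le> k" and i: "i < n" "i' < n" "i \<noteq> i'"
  have 1: "dist (L j i) (L j' i) \<le> dist (L j i) (l i) + dist (L j' i) (l i)" by (rule dist_triangle2)
  have 2: "dist (l i) (l i') \<le> dist (L j i) (l i) + dist (L j i) (L j i') + dist (L j i') (l i')"
    using dist_triangle[of "l i" "l i'" "L j i"] dist_triangle[of "L j i" "l i'" "L j i'"] by (simp add: dist_commute)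
  show "2 * dist (L j i) (L j' i) < dist (L j i) (L j i')"
    using zero_le_dist[of "L j i" "l i"] 1 2 sep[OF i] near[OF j(1) i(1)] near[OF j(2) i(1)] near[OF j(1) i(2)] by linarith
qed

text \<open>The matrix of the linear map which sends a complex polynomial \<open>P\<close> of degree less than \<open>n\<close> to
  the real parts of its values at the points of the diagram, followed by the combinations of the
  values of \<open>g\<close> with the imaginary parts as coefficients. Columns come in pairs, for the real and
  imaginary parts of the coefficients of \<open>P\<close>.\<close>

definition power_col :: "nat \<Rightarrow> real \<times> real \<Rightarrow> complex"
  where "power_col i z = (if even i then 1 else \<i>) * Complex (fst z) (snd z) ^ (i div 2)"

definition diagram_mat :: "nat \<Rightarrow> (nat \<Rightarrow> real \<times> real \<Rightarrow> real) \<Rightarrow> (nat \<Rightarrow> real \<times> real) \<Rightarrow> nat \<Rightarrow> nat \<Rightarrow> real"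
  where "diagram_mat n g l i r =
    (if r < n then Re (power_col i (l r)) else \<Sum>s<n. Im (power_col i (l s)) * g (r - n) (l s))"

lemma continuous_power_col: "continuous_on UNIV (power_col i)"
  unfolding power_col_def Complex_eq by (intro continuous_intros)

lemma continuous_near:
  fixes \<phi> :: "'a::metric_space \<Rightarrow> real"
  assumes "continuous_on UNIV \<phi>" "0 < \<rho>"
  shows "\<exists>\<delta>>0. \<forall>z. dist z z0 < \<delta> \<longrightarrow> \<bar>\<phi> z - \<phi> z0\<bar> < \<rho>"
  using assms unfolding continuous_on_iff by (auto simp: dist_real_def)

lemma sum_near:
  fixes \<phi> :: "'a::metric_space \<Rightarrow> real" and n :: nat
  assumes "continuous_on UNIV \<phi>" "0 < \<rho>"
  shows "\<exists>\<delta>>0. \<forall>l. (\<forall>s<n. dist (l s) (l0 s) < \<delta>) \<longrightarrow> \<bar>(\<Sum>s<n. \<phi> (l s)) - (\<Sum>s<n. \<phi> (l0 s))\<bar> < \<rho>"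
proof -
  \<comment> \<open>The denominator \<open>n + 1\<close> covers \<open>n = 0\<close> and keeps the
    sum of \<open>n\<close> errors strictly below \<open>\<rho>\<close>.\<close>
  have \<rho>: "0 < \<rho> / (real n + 1)" using assms(2) by simp
  obtain \<delta> where \<delta>: "0 < \<delta>"
    "\<And>s. s \<in> {..<n} \<Longrightarrow> (\<lambda>s \<delta>. \<forall>z. dist z (l0 s) < \<delta> \<longrightarrow> \<bar>\<phi> z - \<phi> (l0 s)\<bar> < \<rho> / (real n + 1)) s \<delta>"
    by (rule uniform_radius[of "{..<n}" "\<lambda>s \<delta>. \<forall>z. dist z (l0 s) < \<delta> \<longrightarrow> \<bar>\<phi> z - \<phi> (l0 s)\<bar> < \<rho> / (real n + 1)"])
       (use continuous_near[OF assms(1) \<rho>] in auto)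
  have "\<bar>(\<Sum>s<n. \<phi> (l s)) - (\<Sum>s<n. \<phi> (l0 s))\<bar> < \<rho>" if l: "\<forall>s<n. dist (l s) (l0 s) < \<delta>" for l
  proof -
    have "\<bar>(\<Sum>s<n. \<phi> (l s)) - (\<Sum>s<n. \<phi> (l0 s))\<bar> \<le> (\<Sum>s<n. \<bar>\<phi> (l s) - \<phi> (l0 s)\<bar>)"
      unfolding sum_subtractf[symmetric] by (rule sum_abs)
    also have "\<dots> \<le> (\<Sum>s<n. \<rho> / (real n + 1))"
      by (rule sum_mono) (use \<delta>(2) l in \<open>auto intro: less_imp_le\<close>)
    also have "\<dots> < \<rho>" using assms(2) by (simp add: field_simps)
    finally show ?thesis .
  qed
  then show ?thesis using \<delta>(1) by blast
qed

lemma diagram_mat_near: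
  assumes g: "\<And>t. t < N \<Longrightarrow> continuous_on UNIV (g t)" and \<rho>: "0 < \<rho>"
  shows "\<exists>\<delta>>0. \<forall>l. (\<forall>s<n. dist (l s) (l0 s) < \<delta>) \<longrightarrow>
    near (n + N) m \<rho> (diagram_mat n g l) (diagram_mat n g l0)"
proof -
  define P where "P p \<delta> \<longleftrightarrow> (\<forall>l. (\<forall>s<n. dist (l s) (l0 s) < \<delta>) \<longrightarrow>
    \<bar>diagram_mat n g l (fst p) (snd p) - diagram_mat n g l0 (fst p) (snd p)\<bar> < \<rho>)" for p \<delta>
  have ex: "\<exists>\<delta>>0. P p \<delta>" if p: "p \<in> {..<m} \<times> {..<n + N}" for p
  proof -
    obtain i r where ir: "p = (i, r)" "r < n + N" using p by auto
    show ?thesis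
    proof (cases "r < n")
      case True
      have "continuous_on UNIV (\<lambda>z. Re (power_col i z))" by (intro continuous_intros continuous_power_col)
      from continuous_near[OF this \<rho>, of "l0 r"] obtain \<delta> where
        \<delta>: "0 < \<delta>" "\<forall>z. dist z (l0 r) < \<delta> \<longrightarrow> \<bar>Re (power_col i z) - Re (power_col i (l0 r))\<bar> < \<rho>" by blast
      have "P p \<delta>" unfolding P_def
      proof (intro allI impI)
        fix l assume "\<forall>s<n. dist (l s) (l0 s) < \<delta>"
        then have "\<bar>Re (power_col i (l r)) - Re (power_col i (l0 r))\<bar> < \<rho>" using \<delta>(2) True by blast
        then show "\<bar>diagram_mat n g l (fst p) (snd p) - diagram_mat n g l0 (fst p) (snd p)\<bar> < \<rho>"
          using True by (simp add: ir diagram_mat_def)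
      qed
      then show ?thesis using \<delta>(1) by blast
    next
      case False
      have "continuous_on UNIV (\<lambda>z. Im (power_col i z) * g (r - n) z)"
        by (intro continuous_intros continuous_power_col g) (use False ir in simp)
      from sum_near[OF this \<rho>, of n l0] show ?thesis using False unfolding P_def ir diagram_mat_def by simp
    qed
  qed
  have mono: "P p \<delta>'" if "P p \<delta>" "\<delta>' \<le> \<delta>" for p \<delta> \<delta>'
    using that unfolding P_def by (meson less_le_trans)
  have "\<exists>\<rho>>0. \<forall>p\<in>{..<m} \<times> {..<n + N}. P p \<rho>"
    by (rule common_radius) (simp, use ex in blast, use mono in blast)
  then obtain \<delta> where \<delta>: "0 < \<delta>" "\<forall>p\<in>{..<m} \<times> {..<n + N}. P p \<delta>" by blast
  show ?thesis
  proof (intro exI[of _ \<delta>] conjI \<delta>(1) allI impI)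
    fix l assume l: "\<forall>s<n. dist (l s) (l0 s) < \<delta>"
    show "near (n + N) m \<rho> (diagram_mat n g l) (diagram_mat n g l0)" unfolding near_def
    proof (intro allI impI)
      fix i r assume "i < m" "r < n + N"
      then have "P (i, r) \<delta>" using \<delta>(2) by blast
      then show "\<bar>diagram_mat n g l i r - diagram_mat n g l0 i r\<bar> < \<rho>" using l unfolding P_def by simp
    qed
  qed
qed

text \<open>Relabelling permutes the first \<open>n\<close> rows; the other rows are symmetric in
  the points.\<close>

lemma diagram_mat_relabel:
  assumes "inj_on l {..<n}"
  shows "diagram_mat n g (reference n (l ` {..<n})) i (relabel n l r) = diagram_mat n g l i r"
proof (cases "r < n")
  case True
  then show ?thesis using relabel_less[OF assms True] by (simp add: diagram_mat_def)
next
  case False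
  have *: "(\<Sum>s<n. \<phi> (x s)) = sum \<phi> (l ` {..<n})" if "labels n (l ` {..<n}) x" for x and \<phi> :: "real \<times> real \<Rightarrow> real"
    using that sum.reindex[of x "{..<n}" \<phi>] by (simp add: labels_def)
  have "labels n (l ` {..<n}) l" using assms by (simp add: labels_def)
  then show ?thesis using False *[OF labels_reference[OF assms], of "\<lambda>z. Im (power_col i z) * g (r - n) z"]
      *[of l "\<lambda>z. Im (power_col i z) * g (r - n) z"]
    by (simp add: diagram_mat_def relabel_def)
qed

lemma sum_pairs:
  fixes h :: "nat \<Rightarrow> 'b::comm_monoid_add"
  shows "(\<Sum>i<2 * n. h i) = (\<Sum>p<n. h (2 * p) + h (Suc (2 * p)))"
  by (induction n) (simp_all add: add.assoc)

text \<open>A relation between the columns is a complex polynomial of degree less than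
  \<open>n\<close>. Its real parts vanish at the points by the first rows, its imaginary parts by
  the other rows and nondegeneracy, and \<open>n\<close> distinct roots leave only the zero
  polynomial.\<close>

lemma indep_diagram_mat:
  assumes l: "inj_on l {..<n}"
    and nondegenerate: "\<And>\<mu> s. (\<And>t. t < N \<Longrightarrow> (\<Sum>s<n. \<mu> s * g t (l s)) = 0) \<Longrightarrow> s < n \<Longrightarrow> \<mu> s = 0"
  shows "indep (n + N) {..<2 * n} (diagram_mat n g l)"
  unfolding indep_def
proof (intro allI impI ballI)
  fix c :: "nat \<Rightarrow> real" and i assume c: "\<forall>r<n + N. (\<Sum>i<2 * n. c i * diagram_mat n g l i r) = 0" and i: "i \<in> {..<2 * n}"
  define \<gamma> where "\<gamma> p = Complex (c (2 * p)) (c (Suc (2 * p)))" for p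
  define P where "P = (\<Sum>p<n. monom (\<gamma> p) p)"
  let ?z = "\<lambda>s. Complex (fst (l s)) (snd (l s))"
  have eval: "poly P (?z s) = (\<Sum>i<2 * n. of_real (c i) * power_col i (l s))" for s
  proof -
    have "of_real (c (2 * p)) * power_col (2 * p) (l s) + of_real (c (Suc (2 * p))) * power_col (Suc (2 * p)) (l s) =
        \<gamma> p * ?z s ^ p" for p
      by (simp add: power_col_def \<gamma>_def Complex_eq distrib_right mult.assoc)
    then show ?thesis unfolding sum_pairs P_def by (simp add: poly_sum poly_monom)
  qed
  have re: "Re (poly P (?z s)) = 0" if "s < n" for s
  proof -
    have "Re (poly P (?z s)) = (\<Sum>i<2 * n. c i * diagram_mat n g l i s)"
      unfolding eval using that by (simp add: diagram_mat_def)
    then show ?thesis using c that by simp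
  qed
  have "(\<Sum>s<n. Im (poly P (?z s)) * g t (l s)) = 0" if t: "t < N" for t
  proof -
    have "(\<Sum>s<n. Im (poly P (?z s)) * g t (l s)) = (\<Sum>s<n. \<Sum>i<2 * n. c i * (Im (power_col i (l s)) * g t (l s)))"
      unfolding eval by (simp add: sum_distrib_right mult.assoc)
    also have "\<dots> = (\<Sum>i<2 * n. \<Sum>s<n. c i * (Im (power_col i (l s)) * g t (l s)))" by (rule sum.swap)
    also have "\<dots> = (\<Sum>i<2 * n. c i * diagram_mat n g l i (n + t))"
      by (simp add: diagram_mat_def sum_distrib_left)
    finally show ?thesis using c t by simp
  qed
  then have im: "Im (poly P (?z s)) = 0" if "s < n" for s
    using nondegenerate[of "\<lambda>s. Im (poly P (?z s))" s] that by blast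
  have root: "poly P (?z s) = 0" if "s < n" for s using re[OF that] im[OF that] by (simp add: complex_eq_iff)
  have coeff: "coeff P p = (if p < n then \<gamma> p else 0)" for p
    by (simp add: P_def coeff_sum)
  have "P = 0"
  proof (rule ccontr)
    assume P: "P \<noteq> 0"
    have inj: "inj_on ?z {..<n}" using l by (auto simp: inj_on_def prod_eq_iff)
    have "n = card (?z ` {..<n})" using card_image[OF inj] by simp
    also have "\<dots> \<le> card {x. poly P x = 0}"
      by (rule card_mono[OF poly_roots_finite[OF P]]) (use root in auto)
    also have "\<dots> \<le> degree P" by (rule card_poly_roots_bound[OF P])
    finally have "n \<le> degree P" .
    then have "coeff P (degree P) = 0" unfolding coeff by simp
    then show False using P by simp
  qed
  moreover have "i div 2 < n" using i less_mult_imp_div_less[of i n 2] by (simp add: mult.commute)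
  ultimately have "\<gamma> (i div 2) = 0" using coeff[of "i div 2"] by simp
  then show "c i = 0"
    by (cases "even i") (auto simp: \<gamma>_def complex_eq_iff elim!: evenE oddE)
qed

text \<open>The contrapositive of \<open>exceptional_diagramI\<close>: a relation that holds for the
  functions \<open>f t\<close> holds on their span and hence on \<open>F\<close>.\<close>

lemma nondegenerate_diagram:
  fixes f :: "nat \<Rightarrow> real \<Rightarrow> real"
  assumes F: "subspace F" "F \<subseteq> span (f ` {..<N})"
    and D: "D \<in> independent_diagrams n" "D \<notin> exceptional_diagrams n F" and l: "labels n D l"
    and \<mu>: "\<And>t. t < N \<Longrightarrow> (\<Sum>s<n. \<mu> s * (f t (snd (l s)) - f t (fst (l s)))) = 0" and s: "s < n"
  shows "\<mu> s = 0"
proof (rule ccontr)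
  assume ne: "\<mu> s \<noteq> 0"
  have inj: "inj_on l {..<n}" and D_eq: "l ` {..<n} = D" using l by (auto simp: labels_def)
  let ?\<mu> = "\<lambda>z. \<mu> (inv_into {..<n} l z)"
  have re: "(\<Sum>z\<in>D. ?\<mu> z * (h (snd z) - h (fst z))) = (\<Sum>s<n. \<mu> s * (h (snd (l s)) - h (fst (l s))))" for h :: "real \<Rightarrow> real"
    unfolding D_eq[symmetric] by (simp add: sum.reindex[OF inj] inv_into_f_f[OF inj])
  let ?S = "{h :: real \<Rightarrow> real. (\<Sum>s<n. \<mu> s * (h (snd (l s)) - h (fst (l s)))) = 0}"
  have "subspace ?S"
  proof (rule subspaceI)
    show "0 \<in> ?S" by simp
    fix h h' assume h: "h \<in> ?S" "h' \<in> ?S"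
    have "(\<Sum>s<n. \<mu> s * ((h + h') (snd (l s)) - (h + h') (fst (l s)))) =
      (\<Sum>s<n. \<mu> s * (h (snd (l s)) - h (fst (l s)))) + (\<Sum>s<n. \<mu> s * (h' (snd (l s)) - h' (fst (l s))))"
      unfolding sum.distrib[symmetric] by (rule sum.cong) (simp_all add: algebra_simps)
    then show "h + h' \<in> ?S" using h by simp
  next
    fix c h assume h: "h \<in> ?S"
    have "(\<Sum>s<n. \<mu> s * ((c *\<^sub>R h) (snd (l s)) - (c *\<^sub>R h) (fst (l s)))) =
      c * (\<Sum>s<n. \<mu> s * (h (snd (l s)) - h (fst (l s))))"
      unfolding sum_distrib_left by (rule sum.cong) (simp_all add: algebra_simps scaleR_fun_apply)
    then show "c *\<^sub>R h \<in> ?S" using h by simp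
  qed
  then have "span (f ` {..<N}) \<subseteq> ?S" by (rule span_minimal[rotated]) (use \<mu> in auto)
  then have rel: "(\<Sum>z\<in>D. ?\<mu> z * (h (snd z) - h (fst z))) = 0" if "h \<in> F" for h
    unfolding re using that F(2) by blast
  have "D \<in> exceptional_diagrams n F"
  proof (rule exceptional_diagramI[OF F(1) D(1) rel])
    show "l s \<in> D" using s D_eq by auto
    show "?\<mu> (l s) \<noteq> 0" using ne s inv_into_f_f[OF inj] by simp
  qed
  then show False using D(2) by simp
qed

section \<open>The cycle of a forest\<close>

text \<open>\<open>Suc p\<close> is the dimension of the cube and of the cycle. \<open>lf\<close>
  numbers the leaves and thereby labels the chords of all diagrams of the forest; \<open>e0\<close>
  is an order of the inner nodes, whose simplex will contain the degeneration.\<close>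

locale forest_frame =
  fixes n N q p :: nat and b :: "nat \<Rightarrow> nat" and lf :: "nat \<Rightarrow> nat \<times> bool list"
    and e0 :: "nat \<Rightarrow> nat \<times> bool list"
  assumes leaves_sum: "(\<Sum>c<q. 2 ^ b c) = n" and n_eq: "n = q + Suc p" and N_eq: "N = n + p"
    and lf: "bij_betw lf {..<n} (forest_leaves q b)"
    and e0: "e0 \<in> orders (Suc p) (forest_nodes q b)"
begin

abbreviation "Nd \<equiv> forest_nodes q b"
abbreviation "cube \<equiv> topspace (cube_top Nd)"

definition labelling :: "(nat \<times> bool list \<Rightarrow> real) \<Rightarrow> nat \<Rightarrow> real \<times> real"
  where "labelling \<theta> r = forest_point q \<theta> (lf r)"

definition diagram :: "(nat \<times> bool list \<Rightarrow> real) \<Rightarrow> (real \<times> real) set"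
  where "diagram \<theta> = labelling \<theta> ` {..<n}"

lemma lf_leaf: "r < n \<Longrightarrow> lf r \<in> forest_leaves q b"
  using lf by (auto simp: bij_betw_def)

lemma diagram_eq: "diagram \<theta> = forest_point q \<theta> ` forest_leaves q b"
proof -
  have "forest_leaves q b = lf ` {..<n}" using lf by (simp add: bij_betw_def)
  then show ?thesis by (simp add: diagram_def labelling_def image_image)
qed

lemma labelling_inj:
  assumes "\<theta> \<in> cube"
  shows "inj_on (labelling \<theta>) {..<n}"
proof -
  have "inj_on (forest_point q \<theta> \<circ> lf) {..<n}"
    by (rule comp_inj_on) (use lf forest_point_inj[OF assms] in \<open>simp_all add: bij_betw_def\<close>)
  then show ?thesis by (simp add: labelling_def[abs_def] o_def)
qed

lemma labels_diagram: "\<theta> \<in> cube \<Longrightarrow> labels n (diagram \<theta>) (labelling \<theta>)"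
  using labelling_inj by (simp add: labels_def diagram_def)

lemma diagram_independent: "\<theta> \<in> cube \<Longrightarrow> diagram \<theta> \<in> independent_diagrams n"
  unfolding diagram_eq by (rule forest_independent[OF _ leaves_sum])

lemma continuous_labelling: "continuous_map (cube_top Nd) euclidean (\<lambda>\<theta>. labelling \<theta> r)"
proof -
  have "continuous_on UNIV (\<lambda>\<theta>. labelling \<theta> r)"
    unfolding labelling_def forest_point_def
    by (intro continuous_on_add continuous_on_const continuous_on_cluster)
  then have "continuous_map (powertop_real UNIV) euclidean (\<lambda>\<theta>. labelling \<theta> r)"
    unfolding euclidean_product_topology by simp
  then show ?thesis unfolding cube_top_def by (rule continuous_map_from_subtopology)
qed

lemma continuous_diagram: "continuous_map (cube_top Nd) (diagram_space n) diagram"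
proof -
  have "continuous_map (cube_top Nd) (diagram_space n) (\<lambda>\<theta>. labelling \<theta> ` {..<n})"
  proof (rule continuous_map_diagram_space)
    fix i assume i: "i < n"
    show "continuous_map (cube_top Nd) (top_of_set half_plane) (\<lambda>\<theta>. labelling \<theta> i)"
      unfolding continuous_map_in_subtopology
      using continuous_labelling[of i] forest_point_half_plane[OF _ lf_leaf[OF i]] by (auto simp: labelling_def)
  next
    fix \<theta> assume \<theta>: "\<theta> \<in> cube"
    show "inj_on (labelling \<theta>) {..<n}" by (rule labelling_inj[OF \<theta>])
    show "labelling \<theta> ` {..<n} \<in> independent_diagrams n" using diagram_independent[OF \<theta>] by (simp add: diagram_def)
  qed
  then show ?thesis by (simp add: diagram_def[abs_def])
qed

text \<open>Opposite sides of the cube carry the same unordered diagrams, so the faces left over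
  from the triangulation cancel mod 2.\<close>

lemma diagram_cycle: "cong2 (chain_boundary (Suc p) (chain_map (Suc p) diagram (cube_chain (Suc p) Nd))) 0"
proof -
  have "chain_boundary (Suc p) (chain_map (Suc p) diagram (cube_chain (Suc p) Nd)) =
      chain_map p diagram (chain_boundary (Suc p) (cube_chain (Suc p) Nd))"
    using chain_boundary_chain_map[OF singular_chain_cube_chain[of "Suc p" Nd], of diagram] by simp
  moreover obtain w where w: "chain_boundary (Suc p) (cube_chain (Suc p) Nd) -
      (\<Sum>e\<in>orders (Suc p) Nd. outer_faces p Nd e) = w + w"
    using boundary_cube_chain[OF finite_forest_nodes[of q b], of p] unfolding cong2_def by blast
  have "cong2 (chain_map p diagram (chain_boundary (Suc p) (cube_chain (Suc p) Nd)))
      (chain_map p diagram (\<Sum>e\<in>orders (Suc p) Nd. outer_faces p Nd e))"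
    unfolding cong2_def chain_map_diff[symmetric] w chain_map_add by blast
  moreover have "cong2 (chain_map p diagram (\<Sum>e\<in>orders (Suc p) Nd. outer_faces p Nd e)) 0"
  proof (rule outer_faces_cancel[where \<omega> = node_swap])
    show "diagram \<theta> = diagram (\<lambda>u. if u \<in> Nd \<and> u \<noteq> v then \<theta> (node_swap v u) else 0)"
      if "v \<in> Nd" "\<theta> v = 1" for v \<theta>
      unfolding diagram_eq by (rule forest_point_swap[of v q b \<theta>]) (rule that)+
  qed (simp_all add: node_swap_nodes)
  ultimately show ?thesis by (simp only:) (rule cong2_trans)
qed

text \<open>Deforming the matrices of a labelled diagram to these ones leaves the obstruction of the
  cycle unchanged, and here only the last column depends on the diagram.\<close>

definition column_mat :: "(nat \<Rightarrow> real \<times> real) \<Rightarrow> nat \<Rightarrow> nat \<Rightarrow> real"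
  where "column_mat l i r =
    (if i < N then of_bool (r = n + i)
     else if r < n then if i < N + q then of_bool (\<bar>fst (l r) - 10 * real (i - N)\<bar> < 5) else fst (l r)
     else 0)"

definition fixed_cols :: "nat \<Rightarrow> nat \<Rightarrow> real"
  where "fixed_cols i r =
    (if i < N then of_bool (r = n + i) else if r < n then of_bool (fst (lf r) = i - N) else 0)"

definition point_col :: "(nat \<times> bool list \<Rightarrow> real) \<Rightarrow> nat \<Rightarrow> real"
  where "point_col \<theta> r = (if r < n then fst (labelling \<theta> r) else 0)"

definition haar_row :: "nat \<times> bool list \<Rightarrow> nat \<Rightarrow> real"
  where "haar_row v r = (if r < n then forest_haar v (lf r) else 0)"

definition mid :: "nat \<times> bool list \<Rightarrow> real"
  where "mid v = (real (Suc p) - real (position (Suc p) e0 v)) / (real (Suc p) + 1)"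

text \<open>An affine model of the last column. The Haar row of \<open>v\<close> pairs with it to a
  constant multiple of \<open>mid v - \<theta> v\<close>, whereas for the left endpoints the factor
  in front of \<open>1 - 2 * \<theta> v\<close> is positive but may vary with
  \<open>\<theta>\<close>.\<close>

definition haar_col :: "(nat \<times> bool list \<Rightarrow> real) \<Rightarrow> nat \<Rightarrow> real"
  where "haar_col \<theta> r = (if r < n then \<Sum>v\<in>Nd. (mid v - \<theta> v) * forest_haar v (lf r) else 0)"

definition haar_norm :: "nat \<times> bool list \<Rightarrow> real"
  where "haar_norm v = (\<Sum>l\<in>forest_leaves q b. forest_haar v l * forest_haar v l)"

lemma column_mat_relabel:
  assumes "inj_on l {..<n}"
  shows "column_mat (reference n (l ` {..<n})) i (relabel n l r) = column_mat l i r"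
proof (cases "r < n")
  case True
  then show ?thesis using relabel_less[OF assms True] by (simp add: column_mat_def)
qed (simp add: column_mat_def relabel_def)

text \<open>A left endpoint is within \<open>2\<close> of the centre of its own tree and at least
  \<open>8\<close> away from any other centre. The threshold \<open>5\<close> therefore recognizes
  the tree from the position of the chord alone, which makes \<open>column_mat\<close> compatible
  with relabelling.\<close>

lemma column_mat_labelling:
  assumes \<theta>: "\<theta> \<in> cube" and i: "i < 2 * n"
  shows "column_mat (labelling \<theta>) i r = append_col (N + q) fixed_cols (point_col \<theta>) i r"
proof -
  have "\<bar>fst (labelling \<theta> r) - 10 * real c\<bar> < 5 \<longleftrightarrow> fst (lf r) = c" if r: "r < n" for c
  proof -
    obtain c' w where cw: "lf r = (c', w)" by (cases "lf r")
    have near: "\<bar>fst (labelling \<theta> r) - 10 * real c'\<bar> \<le> 2"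
      using forest_point_bounds(1)[OF \<theta>, of c' w] lf_leaf[OF r] cw by (simp add: labelling_def)
    show ?thesis
    proof
      assume far: "\<bar>fst (labelling \<theta> r) - 10 * real c\<bar> < 5"
      then have "\<bar>real c' - real c\<bar> < 1" using near by linarith
      then show "fst (lf r) = c" using cw by simp
    qed (use near cw in simp)
  qed
  from this[of "i - N"] show ?thesis
    by (cases "i < N"; cases "r < n") (simp_all add: column_mat_def append_col_def fixed_cols_def point_col_def)
qed

lemma rows_sum: "(\<Sum>r<n + N. if r < n then \<phi> (lf r) else 0) = (\<Sum>l\<in>forest_leaves q b. \<phi> l)"
proof -
  have "(\<Sum>r<n + N. if r < n then \<phi> (lf r) else 0) = (\<Sum>r<n. \<phi> (lf r))"
    by (rule sum.mono_neutral_cong_right) auto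
  then show ?thesis by (simp add: sum.reindex_bij_betw[OF lf])
qed

lemma haar_row_sum:
  assumes "\<And>r. r < n \<Longrightarrow> x r = \<phi> (lf r)"
  shows "(\<Sum>r<n + N. haar_row v r * x r) = (\<Sum>l\<in>forest_leaves q b. forest_haar v l * \<phi> l)"
  unfolding rows_sum[symmetric] by (rule sum.cong) (simp_all add: haar_row_def assms)

lemma indep_fixed_cols: "indep (n + N) {..<N + q} fixed_cols"
  unfolding indep_def
proof (intro allI impI ballI)
  fix c :: "nat \<Rightarrow> real" and i
  assume c: "\<forall>r<n + N. (\<Sum>i<N + q. c i * fixed_cols i r) = 0" and i: "i \<in> {..<N + q}"
  show "c i = 0"
  proof (cases "i < N")
    case True
    have "(\<Sum>j<N + q. c j * fixed_cols j (n + i)) = (\<Sum>j<N + q. if j = i then c j else 0)"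
      by (rule sum.cong) (use True in \<open>auto simp: fixed_cols_def\<close>)
    then show ?thesis using c True i by simp
  next
    case False
    define cc where "cc = i - N"
    have cc: "cc < q" "i = N + cc" using False i by (auto simp: cc_def)
    \<comment> \<open>Any leaf of the tree \<open>cc\<close> would do: among the fixed columns, its
      row is nonzero in the indicator of this tree only.\<close>
    have "(cc, replicate (b cc) True) \<in> forest_leaves q b" using cc by (simp add: forest_leaves_def leaves_def)
    moreover have "forest_leaves q b = lf ` {..<n}" using lf by (simp add: bij_betw_def)
    ultimately obtain r where r: "r < n" "lf r = (cc, replicate (b cc) True)" by (metis imageE lessThan_iff)
    have "(\<Sum>j<N + q. c j * fixed_cols j r) = (\<Sum>j<N + q. if j = i then c j else 0)"
      by (rule sum.cong) (use r cc in \<open>auto simp: fixed_cols_def\<close>)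
    then show ?thesis using c r i by simp
  qed
qed

lemma haar_row_fixed_cols:
  assumes v: "v \<in> Nd" and i: "i < N + q"
  shows "(\<Sum>r<n + N. haar_row v r * fixed_cols i r) = 0"
proof (cases "i < N")
  case True
  then show ?thesis by (intro sum.neutral) (auto simp: haar_row_def fixed_cols_def)
next
  case False
  have "(\<Sum>r<n + N. haar_row v r * fixed_cols i r) =
      (\<Sum>l\<in>forest_leaves q b. forest_haar v l * (if fst l = i - N then 1 else 0))"
    by (rule haar_row_sum) (use False in \<open>simp add: fixed_cols_def\<close>)
  then show ?thesis using forest_haar_component[OF v] by simp
qed

lemma haar_norm_pos: "v \<in> Nd \<Longrightarrow> 0 < haar_norm v"
  unfolding haar_norm_def by (rule forest_haar_orthogonal(2))

lemma haar_row_haar_col: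
  assumes v: "v \<in> Nd"
  shows "(\<Sum>r<n + N. haar_row v r * haar_col \<theta> r) = haar_norm v * (mid v - \<theta> v)"
proof -
  have "(\<Sum>r<n + N. haar_row v r * haar_col \<theta> r) =
      (\<Sum>l\<in>forest_leaves q b. forest_haar v l * (\<Sum>u\<in>Nd. (mid u - \<theta> u) * forest_haar u l))"
    by (rule haar_row_sum) (simp add: haar_col_def)
  also have "\<dots> = (\<Sum>l\<in>forest_leaves q b. \<Sum>u\<in>Nd. (mid u - \<theta> u) * (forest_haar v l * forest_haar u l))"
    by (simp add: sum_distrib_left algebra_simps)
  also have "\<dots> = (\<Sum>u\<in>Nd. \<Sum>l\<in>forest_leaves q b. (mid u - \<theta> u) * (forest_haar v l * forest_haar u l))"
    by (rule sum.swap)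
  also have "\<dots> = (\<Sum>u\<in>Nd. if u = v then (mid u - \<theta> u) * haar_norm v else 0)"
  proof (rule sum.cong[OF refl])
    fix u assume u: "u \<in> Nd"
    show "(\<Sum>l\<in>forest_leaves q b. (mid u - \<theta> u) * (forest_haar v l * forest_haar u l)) =
        (if u = v then (mid u - \<theta> u) * haar_norm v else 0)"
      unfolding sum_distrib_left[symmetric] haar_norm_def using forest_haar_orthogonal(1)[OF v u] by auto
  qed
  also have "\<dots> = haar_norm v * (mid v - \<theta> v)" using v finite_forest_nodes by (simp add: mult.commute)
  finally show ?thesis .
qed

sublocale cube_frame Nd "Suc p" "n + N" "N + q" fixed_cols haar_row haar_col haar_norm e0
proof
  show "n + N = N + q + Suc p" using n_eq by simp
  show "(\<Sum>r<n + N. haar_row v r * haar_col \<theta> r) =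
      haar_norm v * ((real (Suc p) - real (position (Suc p) e0 v)) / (real (Suc p) + 1) - \<theta> v)" if "v \<in> Nd" for v \<theta>
    using haar_row_haar_col[OF that] by (simp add: mid_def)
qed (use finite_forest_nodes indep_fixed_cols haar_row_fixed_cols e0 haar_norm_pos in auto)

lemma mid_bounds:
  assumes "v \<in> Nd"
  shows "0 < mid v" "mid v < 1"
  using nth_position(1)[OF e0 assms] by (simp_all add: mid_def)

text \<open>On the side \<open>\<theta> v = \<beta>\<close> both versions of the last column pair
  with the Haar row of \<open>v\<close> to a number with the sign of \<open>1 - 2 * \<beta>\<close>,
  since \<open>mid v\<close> lies strictly between \<open>0\<close> and \<open>1\<close>. So nothing
  degenerates on the sides of the cube when one version is replaced by the other.\<close>

lemma face_functional:
  assumes v: "v \<in> Nd" and \<theta>: "\<theta> \<in> cube" and \<beta>: "\<theta> v = \<beta>" "\<beta> = 0 \<or> \<beta> = 1"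
    and x: "x = point_col \<theta> \<or> x = haar_col \<theta>"
  shows "0 < (\<Sum>r<n + N. (1 - 2 * \<beta>) * haar_row v r * x r)"
proof -
  have eq: "(\<Sum>r<n + N. (1 - 2 * \<beta>) * haar_row v r * x r) = (1 - 2 * \<beta>) * (\<Sum>r<n + N. haar_row v r * x r)"
    by (simp add: sum_distrib_left mult.assoc)
  show ?thesis
  proof (cases "x = haar_col \<theta>")
    case True
    have "0 < (1 - 2 * \<beta>) * (mid v - \<theta> v)" using \<beta> mid_bounds[OF v] by auto
    then have "0 < haar_norm v * ((1 - 2 * \<beta>) * (mid v - \<theta> v))" using haar_norm_pos[OF v] by simp
    then show ?thesis unfolding eq unfolding True haar_row_haar_col[OF v] by (simp add: mult.left_commute)
  next
    case False
    then have x: "x = point_col \<theta>" using x by simp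
    obtain s where s: "0 < s" "(\<Sum>l\<in>forest_leaves q b. forest_haar v l * fst (forest_point q \<theta> l)) = s * (1 - 2 * \<theta> v)"
      using forest_haar_point[OF \<theta> v] by blast
    have "(\<Sum>r<n + N. haar_row v r * x r) = s * (1 - 2 * \<theta> v)"
      unfolding s(2)[symmetric] by (rule haar_row_sum) (simp add: x point_col_def labelling_def)
    moreover have "0 < (1 - 2 * \<beta>) * (s * (1 - 2 * \<theta> v))" using s(1) \<beta> by auto
    ultimately show ?thesis unfolding eq by simp
  qed
qed

end

section \<open>Vertices of chains, and simplices small enough to be labelled\<close>

definition chain_vertices :: "nat \<Rightarrow> 'a chain \<Rightarrow> 'a set"
  where "chain_vertices p c = (\<Union>f\<in>Poly_Mapping.keys c. vertices p f ` {..p})"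

lemma finite_chain_vertices: "finite (chain_vertices p c)"
  by (simp add: chain_vertices_def)

lemma vertices_in_chain_vertices: "f \<in> Poly_Mapping.keys c \<Longrightarrow> j \<le> p \<Longrightarrow> vertices p f j \<in> chain_vertices p c"
  unfolding chain_vertices_def by blast

lemma vertices_image:
  assumes "f ` standard_simplex p \<subseteq> V" "j \<le> p"
  shows "vertices p f j \<in> V"
proof -
  have "(\<lambda>i. if i = j then 1 else 0) \<in> standard_simplex p" using assms(2) by (simp add: basis_in_standard_simplex)
  then show ?thesis using assms by (auto simp: vertices_def)
qed

lemma vertices_topspace:
  assumes "singular_chain p X c" "f \<in> Poly_Mapping.keys c" "j \<le> p"
  shows "vertices p f j \<in> topspace X"
proof (rule vertices_image[OF _ assms(3)])
  have "singular_simplex p X f" using assms by (auto simp: singular_chain_def)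
  then show "f ` standard_simplex p \<subseteq> topspace X" by (auto simp: singular_simplex_def continuous_map_def)
qed

lemma chain_vertices_topspace: "singular_chain p X c \<Longrightarrow> chain_vertices p c \<subseteq> topspace X"
  unfolding chain_vertices_def using vertices_topspace by fastforce

lemma nbhd_compatible:
  assumes f: "f ` standard_simplex k \<subseteq> diagram_nbhd n l \<delta>"
    and sep: "\<And>i i'. i < n \<Longrightarrow> i' < n \<Longrightarrow> i \<noteq> i' \<Longrightarrow> 8 * \<delta> \<le> dist (l i) (l i')"
  obtains L where "compatible n k (vertices k f) L" "\<And>j i. j \<le> k \<Longrightarrow> i < n \<Longrightarrow> dist (L j i) (l i) < \<delta>"
proof -
  have "\<forall>j\<in>{..k}. \<exists>x. labels n (vertices k f j) x \<and> (\<forall>i<n. dist (x i) (l i) < \<delta>)"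
    using vertices_image[OF f] by (simp add: diagram_nbhd_def)
  from bchoice[OF this] obtain L where L: "\<forall>j\<in>{..k}. labels n (vertices k f j) (L j) \<and> (\<forall>i<n. dist (L j i) (l i) < \<delta>)"
    by (elim exE)
  have "compatible n k (vertices k f) L"
    by (rule compatible_near[where l = l and \<delta> = \<delta>]) (use sep L in auto)
  then show thesis by (rule that) (use L in auto)
qed

lemma diagram_labels:
  assumes "D \<in> independent_diagrams n"
  obtains l where "labels n D l"
proof -
  have "finite D" "card D = n" using assms by (auto simp: independent_diagrams_def chord_diagrams_def)
  then obtain h where "bij_betw h {..<n} D" using ex_bij_betw_nat_finite[of D] by (auto simp: atLeast0LessThan)
  then show thesis by (intro that[of h]) (simp add: labels_def bij_betw_def)
qed

lemma in_diagram_nbhd: "D \<in> independent_diagrams n \<Longrightarrow> labels n D l \<Longrightarrow> 0 < \<delta> \<Longrightarrow> D \<in> diagram_nbhd n l \<delta>"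
  by (auto simp: diagram_nbhd_def intro!: exI[of _ l])

lemma small_diagram_simplices:
  assumes c: "singular_chain k (diagram_space n) c"
  shows "\<exists>r. \<forall>s\<ge>r. \<forall>f\<in>Poly_Mapping.keys ((singular_subdivision k ^^ s) c). \<exists>L. compatible n k (vertices k f) L"
proof -
  define P where "P V \<longleftrightarrow> (\<exists>l \<delta>. V = diagram_nbhd n l \<delta> \<and>
    (\<forall>i i'. i < n \<longrightarrow> i' < n \<longrightarrow> i \<noteq> i' \<longrightarrow> 8 * \<delta> \<le> dist (l i) (l i')))" for V
  have cover: "\<exists>V. openin (diagram_space n) V \<and> D \<in> V \<and> P V" if "D \<in> topspace (diagram_space n)" for D
  proof -
    have D: "D \<in> independent_diagrams n" using that by (simp add: topspace_diagram_space)
    obtain l where l: "labels n D l" by (rule diagram_labels[OF D])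
    then have inj: "inj_on l {..<n}" by (simp add: labels_def)
    obtain \<delta> where \<delta>: "0 < \<delta>" "\<And>i i'. i < n \<Longrightarrow> i' < n \<Longrightarrow> i \<noteq> i' \<Longrightarrow> 8 * \<delta> \<le> dist (l i) (l i')"
      using separation_radius[OF inj] by blast
    have "P (diagram_nbhd n l \<delta>)" unfolding P_def using \<delta>(2) by blast
    then show ?thesis using openin_diagram_nbhd in_diagram_nbhd[OF D l \<delta>(1)] by blast
  qed
  have "\<exists>r. \<forall>s\<ge>r. \<forall>f\<in>Poly_Mapping.keys ((singular_subdivision k ^^ s) c). \<exists>V. P V \<and> f ` standard_simplex k \<subseteq> V"
    by (rule small_subdivision[OF c]) (rule cover)
  then obtain r where r: "\<forall>s\<ge>r. \<forall>f\<in>Poly_Mapping.keys ((singular_subdivision k ^^ s) c). \<exists>V. P V \<and> f ` standard_simplex k \<subseteq> V"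
    by (elim exE)
  show ?thesis
  proof (intro exI[of _ r] allI impI ballI)
    fix s f assume "r \<le> s" "f \<in> Poly_Mapping.keys ((singular_subdivision k ^^ s) c)"
    from r[rule_format, OF this] obtain V where V: "P V" "f ` standard_simplex k \<subseteq> V" by blast
    from V(1) obtain l \<delta> where l: "V = diagram_nbhd n l \<delta>"
      and \<delta>: "\<forall>i i'. i < n \<longrightarrow> i' < n \<longrightarrow> i \<noteq> i' \<longrightarrow> 8 * \<delta> \<le> dist (l i) (l i')" unfolding P_def by (elim exE conjE)
    obtain L where "compatible n k (vertices k f) L"
      by (rule nbhd_compatible[OF V(2)[unfolded l]]) (use \<delta> in blast)+
    then show "\<exists>L. compatible n k (vertices k f) L" by blast
  qed
qed

text \<open>Around a diagram that is not exceptional the matrices stay close to a matrix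
  \<open>B\<close> with independent columns. The tolerance has two halves: one \<open>\<rho>\<close>
  for the variation over a small simplex, the other for the generic perturbation to come.\<close>

lemma small_avoiding_simplices:
  fixes f :: "nat \<Rightarrow> real \<Rightarrow> real"
  defines "g \<equiv> \<lambda>t z. f t (snd z) - f t (fst z)"
  assumes F: "subspace F" "F \<subseteq> span (f ` {..<N})" and f: "\<forall>t<N. continuous_on UNIV (f t)"
    and c: "singular_chain k (subtopology (diagram_space n) (topspace (diagram_space n) - exceptional_diagrams n F)) c"
  shows "\<exists>r. \<forall>s\<ge>r. \<forall>\<sigma>\<in>Poly_Mapping.keys ((singular_subdivision k ^^ s) c). \<exists>L B \<rho>. 0 < \<rho> \<and>
    compatible n k (vertices k \<sigma>) L \<and> (\<forall>j\<le>k. near (n + N) (2 * n) \<rho> (diagram_mat n g (L j)) B) \<and>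
    (\<forall>M. (\<forall>j\<le>k. near (n + N) (2 * n) (\<rho> + \<rho>) (M j) B) \<longrightarrow> obstruction (n + N) (2 * n) k M = 0)"
proof -
  let ?E = "exceptional_diagrams n F"
  let ?X = "subtopology (diagram_space n) (topspace (diagram_space n) - ?E)"
  define P where "P V \<longleftrightarrow> (\<exists>l \<delta> \<rho>. 0 < \<rho> \<and> V \<subseteq> diagram_nbhd n l \<delta> \<and>
    (\<forall>i i'. i < n \<longrightarrow> i' < n \<longrightarrow> i \<noteq> i' \<longrightarrow> 8 * \<delta> \<le> dist (l i) (l i')) \<and>
    (\<forall>x. (\<forall>s<n. dist (x s) (l s) < \<delta>) \<longrightarrow> near (n + N) (2 * n) \<rho> (diagram_mat n g x) (diagram_mat n g l)) \<and>
    (\<forall>M. (\<forall>j\<le>k. near (n + N) (2 * n) (\<rho> + \<rho>) (M j) (diagram_mat n g l)) \<longrightarrow> obstruction (n + N) (2 * n) k M = 0))" for V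
  have g: "continuous_on UNIV (g t)" if "t < N" for t
    unfolding g_def
    by (intro continuous_on_diff continuous_on_compose2[OF f[rule_format, OF that]] continuous_on_fst continuous_on_snd continuous_on_id) auto
  have cover: "\<exists>V. openin ?X V \<and> D \<in> V \<and> P V" if D': "D \<in> topspace ?X" for D
  proof -
    have D: "D \<in> independent_diagrams n" "D \<notin> ?E" using D' by (simp_all add: topspace_diagram_space)
    obtain l where l: "labels n D l" by (rule diagram_labels[OF D(1)])
    then have inj: "inj_on l {..<n}" by (simp add: labels_def)
    have ind: "indep (n + N) {..<2 * n} (diagram_mat n g l)"
      by (rule indep_diagram_mat[OF inj], rule nondegenerate_diagram[OF F D l, rotated], assumption) (simp add: g_def)
    have ex: "\<exists>y. \<forall>B\<in>{diagram_mat n g l}. \<forall>i<2 * n. 0 < (\<Sum>r<n + N. y r * (\<epsilon> i * B i r))"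
      if \<epsilon>: "\<And>i. i < 2 * n \<Longrightarrow> \<epsilon> i = 1 \<or> \<epsilon> i = -1" for \<epsilon> :: "nat \<Rightarrow> real"
    proof -
      obtain y where y: "\<And>i. i \<in> {..<2 * n} \<Longrightarrow> (\<Sum>r<n + N. y r * diagram_mat n g l i r) = \<epsilon> i"
        using indep_dual_functional[OF finite_lessThan ind, of \<epsilon>] by blast
      have "0 < (\<Sum>r<n + N. y r * (\<epsilon> i * diagram_mat n g l i r))" if i: "i < 2 * n" for i
      proof -
        have "(\<Sum>r<n + N. y r * (\<epsilon> i * diagram_mat n g l i r)) = \<epsilon> i * (\<Sum>r<n + N. y r * diagram_mat n g l i r)"
          by (simp add: sum_distrib_left mult.left_commute)
        then show ?thesis using y[of i] \<epsilon>[OF i] i by auto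
      qed
      then show ?thesis by blast
    qed
    obtain \<rho> where \<rho>: "0 < \<rho>" "\<And>M. (\<And>j. j \<le> k \<Longrightarrow> \<exists>B\<in>{diagram_mat n g l}. near (n + N) (2 * n) \<rho> (M j) B) \<Longrightarrow>
        obstruction (n + N) (2 * n) k M = 0"
      using obstruction_eq_0_near[of "{diagram_mat n g l}" "2 * n" "n + N" k, OF _ ex] by blast
    obtain \<delta>1 where \<delta>1: "0 < \<delta>1" "\<And>i i'. i < n \<Longrightarrow> i' < n \<Longrightarrow> i \<noteq> i' \<Longrightarrow> 8 * \<delta>1 \<le> dist (l i) (l i')"
      using separation_radius[OF inj] by blast
    have \<rho>2: "0 < \<rho> / 2" using \<rho>(1) by simp
    have "\<exists>\<delta>>0. \<forall>x. (\<forall>s<n. dist (x s) (l s) < \<delta>) \<longrightarrow>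
        near (n + N) (2 * n) (\<rho> / 2) (diagram_mat n g x) (diagram_mat n g l)"
      by (rule diagram_mat_near[OF _ \<rho>2]) (rule g)
    then obtain \<delta>2 where \<delta>2: "0 < \<delta>2" "\<forall>x. (\<forall>s<n. dist (x s) (l s) < \<delta>2) \<longrightarrow>
        near (n + N) (2 * n) (\<rho> / 2) (diagram_mat n g x) (diagram_mat n g l)"
      by (elim exE conjE)
    let ?V = "diagram_nbhd n l (min \<delta>1 \<delta>2) \<inter> (topspace (diagram_space n) - ?E)"
    have "P ?V" unfolding P_def
    proof (rule exI[of _ l], rule exI[of _ "min \<delta>1 \<delta>2"], rule exI[of _ "\<rho> / 2"], intro conjI allI impI)
      show "8 * min \<delta>1 \<delta>2 \<le> dist (l i) (l i')" if "i < n" "i' < n" "i \<noteq> i'" for i i'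
        using \<delta>1(2)[OF that] by simp
      show "near (n + N) (2 * n) (\<rho> / 2) (diagram_mat n g x) (diagram_mat n g l)"
        if "\<forall>s<n. dist (x s) (l s) < min \<delta>1 \<delta>2" for x
        by (rule \<delta>2(2)[rule_format]) (use that in simp)
      show "obstruction (n + N) (2 * n) k M = 0"
        if "\<forall>j\<le>k. near (n + N) (2 * n) (\<rho> / 2 + \<rho> / 2) (M j) (diagram_mat n g l)" for M
        by (rule \<rho>(2)) (use that in simp)
    qed (use \<rho>2 in auto)
    moreover have "openin ?X ?V" unfolding openin_subtopology using openin_diagram_nbhd by blast
    moreover have "D \<in> ?V" using in_diagram_nbhd[OF D(1) l, of "min \<delta>1 \<delta>2"] \<delta>1(1) \<delta>2(1) D' by simp
    ultimately show ?thesis by blast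
  qed
  have "\<exists>r. \<forall>s\<ge>r. \<forall>f\<in>Poly_Mapping.keys ((singular_subdivision k ^^ s) c). \<exists>V. P V \<and> f ` standard_simplex k \<subseteq> V"
    by (rule small_subdivision[OF c]) (rule cover)
  then obtain r where r: "\<forall>s\<ge>r. \<forall>f\<in>Poly_Mapping.keys ((singular_subdivision k ^^ s) c). \<exists>V. P V \<and> f ` standard_simplex k \<subseteq> V"
    by (elim exE)
  show ?thesis
  proof (intro exI[of _ r] allI impI ballI)
    fix s \<sigma> assume "r \<le> s" "\<sigma> \<in> Poly_Mapping.keys ((singular_subdivision k ^^ s) c)"
    from r[rule_format, OF this] obtain V where V: "P V" "\<sigma> ` standard_simplex k \<subseteq> V" by blast
    obtain l \<delta> \<rho> where \<rho>: "0 < \<rho>" and sub: "V \<subseteq> diagram_nbhd n l \<delta>"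
      and \<delta>: "\<And>i i'. i < n \<Longrightarrow> i' < n \<Longrightarrow> i \<noteq> i' \<Longrightarrow> 8 * \<delta> \<le> dist (l i) (l i')"
      and nr: "\<And>x. (\<forall>s<n. dist (x s) (l s) < \<delta>) \<Longrightarrow> near (n + N) (2 * n) \<rho> (diagram_mat n g x) (diagram_mat n g l)"
      and ob: "\<forall>M. (\<forall>j\<le>k. near (n + N) (2 * n) (\<rho> + \<rho>) (M j) (diagram_mat n g l)) \<longrightarrow> obstruction (n + N) (2 * n) k M = 0"
      using V(1) unfolding P_def by blast
    have f: "\<sigma> ` standard_simplex k \<subseteq> diagram_nbhd n l \<delta>" using V(2) sub by blast
    obtain L where L: "compatible n k (vertices k \<sigma>) L" "\<And>j i. j \<le> k \<Longrightarrow> i < n \<Longrightarrow> dist (L j i) (l i) < \<delta>"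
      using nbhd_compatible[OF f \<delta>] by blast
    show "\<exists>L B \<rho>. 0 < \<rho> \<and>
      compatible n k (vertices k \<sigma>) L \<and> (\<forall>j\<le>k. near (n + N) (2 * n) \<rho> (diagram_mat n g (L j)) B) \<and>
      (\<forall>M. (\<forall>j\<le>k. near (n + N) (2 * n) (\<rho> + \<rho>) (M j) B) \<longrightarrow> obstruction (n + N) (2 * n) k M = 0)"
    proof (rule exI[of _ L], rule exI[of _ "diagram_mat n g l"], rule exI[of _ \<rho>], intro conjI \<rho> L(1) allI impI)
      show "near (n + N) (2 * n) \<rho> (diagram_mat n g (L j)) (diagram_mat n g l)" if "j \<le> k" for j
        by (rule nr) (use L(2) that in blast)
    qed (use ob in blast)
  qed
qed

context forest_frame
begin

text \<open>The labelling given on the whole cube has to be compatible itself, since the matrices on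
  the cube are read in its row order.\<close>

lemma small_cube_simplices:
  assumes c: "singular_chain k (cube_top Nd) c"
  shows "\<exists>r. \<forall>s\<ge>r. \<forall>f\<in>Poly_Mapping.keys ((singular_subdivision k ^^ s) c).
    compatible n k (\<lambda>i. diagram (vertices k f i)) (\<lambda>i. labelling (vertices k f i))"
proof -
  define P where "P V \<longleftrightarrow> V \<subseteq> cube \<and> (\<exists>l \<delta>. (\<forall>\<theta>\<in>V. \<forall>i<n. dist (labelling \<theta> i) (l i) < \<delta>) \<and>
    (\<forall>i i'. i < n \<longrightarrow> i' < n \<longrightarrow> i \<noteq> i' \<longrightarrow> 8 * \<delta> \<le> dist (l i) (l i')))" for V
  have cover: "\<exists>V. openin (cube_top Nd) V \<and> \<theta>0 \<in> V \<and> P V" if \<theta>0: "\<theta>0 \<in> cube" for \<theta>0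
  proof -
    obtain \<delta> where \<delta>: "0 < \<delta>" "\<And>i i'. i < n \<Longrightarrow> i' < n \<Longrightarrow> i \<noteq> i' \<Longrightarrow> 8 * \<delta> \<le> dist (labelling \<theta>0 i) (labelling \<theta>0 i')"
      using separation_radius[OF labelling_inj[OF \<theta>0]] by blast
    let ?V = "(\<Inter>i\<in>{..<n}. {\<theta> \<in> cube. labelling \<theta> i \<in> ball (labelling \<theta>0 i) \<delta>}) \<inter> cube"
    have "openin (cube_top Nd) ?V"
      by (intro openin_INT openin_continuous_map_preimage[OF continuous_labelling]) simp_all
    moreover have "\<theta>0 \<in> ?V" using \<theta>0 \<delta>(1) by simp
    moreover have "P ?V" unfolding P_def
      by (intro conjI exI[of _ "labelling \<theta>0"] exI[of _ \<delta>]) (use \<delta>(2) in \<open>auto simp: dist_commute\<close>)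
    ultimately show ?thesis by blast
  qed
  have "\<exists>r. \<forall>s\<ge>r. \<forall>f\<in>Poly_Mapping.keys ((singular_subdivision k ^^ s) c). \<exists>V. P V \<and> f ` standard_simplex k \<subseteq> V"
    by (rule small_subdivision[OF c]) (rule cover)
  then obtain r where r: "\<forall>s\<ge>r. \<forall>f\<in>Poly_Mapping.keys ((singular_subdivision k ^^ s) c). \<exists>V. P V \<and> f ` standard_simplex k \<subseteq> V"
    by (elim exE)
  show ?thesis
  proof (intro exI[of _ r] allI impI ballI)
    fix s f assume "r \<le> s" "f \<in> Poly_Mapping.keys ((singular_subdivision k ^^ s) c)"
    from r[rule_format, OF this] obtain V where V: "P V" "f ` standard_simplex k \<subseteq> V" by blast
    obtain l \<delta> where \<delta>: "V \<subseteq> cube" "\<And>\<theta> i. \<theta> \<in> V \<Longrightarrow> i < n \<Longrightarrow> dist (labelling \<theta> i) (l i) < \<delta>"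
      "\<And>i i'. i < n \<Longrightarrow> i' < n \<Longrightarrow> i \<noteq> i' \<Longrightarrow> 8 * \<delta> \<le> dist (l i) (l i')"
      using V(1) unfolding P_def by blast
    show "compatible n k (\<lambda>i. diagram (vertices k f i)) (\<lambda>i. labelling (vertices k f i))"
    proof (rule compatible_near[where l = l and \<delta> = \<delta>, OF \<delta>(3)])
      fix j assume "j \<le> k"
      then have "vertices k f j \<in> V" by (rule vertices_image[OF V(2)])
      then show "labels n (diagram (vertices k f j)) (labelling (vertices k f j))"
        "\<And>i. i < n \<Longrightarrow> dist (labelling (vertices k f j) i) (l i) < \<delta>"
        using \<delta>(1,2) labels_diagram by blast+
    qed
  qed
qed

end

text \<open>Keys of the stored matrices: \<open>Inl (D, False)\<close> stands for the matrix of the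
  diagram \<open>D\<close> built from \<open>F\<close>, \<open>Inl (D, True)\<close> for its
  replacement \<open>column_mat\<close>, and \<open>Inr \<theta>\<close> for the affine model at a
  point of the cube.\<close>

type_synonym matrix_key = "((real \<times> real) set \<times> bool) + (nat \<times> bool list \<Rightarrow> real)"

lemma generic_image:
  assumes gen: "generic d S u" and h: "inj_on h T" "h ` T \<subseteq> S"
  shows "generic d T (\<lambda>x. u (h x))"
  unfolding generic_def
proof (intro allI impI)
  fix J \<rho> assume J: "J \<subseteq> T" "card J \<le> d" and \<rho>: "\<forall>x\<in>J. \<rho> x permutes {..<d}"
  have inj: "inj_on h J" by (rule inj_on_subset[OF h(1) J(1)])
  let ?\<rho> = "\<lambda>y. \<rho> (inv_into J h y)"
  have "indep d (h ` J) (\<lambda>y r. u y (?\<rho> y r))"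
  proof (rule gen[unfolded generic_def, rule_format])
    show "h ` J \<subseteq> S" using J(1) h(2) by blast
    show "card (h ` J) \<le> d" using J(2) card_image[OF inj] by simp
    fix y assume "y \<in> h ` J"
    then have "inv_into J h y \<in> J" by (rule inv_into_into)
    then show "?\<rho> y permutes {..<d}" using \<rho> by blast
  qed
  then have "indep d J (\<lambda>x r. u (h x) (?\<rho> (h x) r))" unfolding indep_reindex[OF inj] .
  then show "indep d J (\<lambda>x r. u (h x) (\<rho> x r))"
    by (rule indep_cong[THEN iffD1, rotated]) (simp add: inv_into_f_f[OF inj])
qed

text \<open>A single perturbation \<open>u\<close> serves all three families of matrices. It is
  generic on finitely many keys in the application: \<open>\<Theta>\<close> collects vertices in the
  cube, \<open>DD\<close> vertices in the diagram space. The assumption \<open>face\<close>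
  expresses that \<open>\<eta>\<close> is small enough for the sides of the cube.\<close>

locale perturbed_frame = forest_frame n N q p b lf e0 for n N q p b lf e0 +
  fixes u :: "matrix_key \<times> nat \<Rightarrow> nat \<Rightarrow> real" and DD :: "(real \<times> real) set set"
    and \<Theta> :: "(nat \<times> bool list \<Rightarrow> real) set" and \<eta> :: real
  assumes gen: "generic (n + N) ((Inl ` (DD \<times> UNIV) \<union> Inr ` \<Theta>) \<times> {..<2 * n}) u"
    and \<Theta>: "\<Theta> \<subseteq> cube" "diagram ` \<Theta> \<subseteq> DD"
    and close_column: "\<And>D i r. \<bar>u (Inl (D, True), i) r - column_mat (reference n D) i r\<bar> < \<eta>"
    and close_haar: "\<And>\<theta> i r. \<bar>u (Inr \<theta>, i) r - append_col (N + q) fixed_cols (haar_col \<theta>) i r\<bar> < \<eta>"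
    and face: "\<And>v \<beta> M. v \<in> Nd \<Longrightarrow> \<beta> = 0 \<or> \<beta> = 1 \<Longrightarrow>
      (\<And>j. j \<le> Suc p \<Longrightarrow> \<exists>x\<in>{x. \<exists>\<theta>\<in>\<Theta>. \<theta> v = \<beta> \<and> (x = point_col \<theta> \<or> x = haar_col \<theta>)}.
        near (n + N) (2 * n) \<eta> (M j) (append_col (N + q) fixed_cols x)) \<Longrightarrow>
      obstruction (n + N) (2 * n) (Suc p) M = 0"
begin

definition point_mat :: "(nat \<times> bool list \<Rightarrow> real) \<Rightarrow> nat \<Rightarrow> nat \<Rightarrow> real"
  where "point_mat = vertex_mat u (\<lambda>\<theta>. Inl (diagram \<theta>, True)) (\<lambda>\<theta>. relabel n (labelling \<theta>))"

definition haar_mat :: "(nat \<times> bool list \<Rightarrow> real) \<Rightarrow> nat \<Rightarrow> nat \<Rightarrow> real"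
  where "haar_mat = vertex_mat u Inr (\<lambda>_. id)"

lemma dims: "2 \<le> 2 * n" "n + N + 1 = 2 * n + Suc p" "n \<le> n + N" "2 * n = Suc (N + q)"
  using n_eq N_eq by auto

lemma near_point_mat:
  assumes \<theta>: "\<theta> \<in> cube"
  shows "near (n + N) (2 * n) \<eta> (point_mat \<theta>) (append_col (N + q) fixed_cols (point_col \<theta>))"
  unfolding near_def
proof (intro allI impI)
  fix i r assume i: "i < 2 * n" and "r < n + N"
  note inj = labelling_inj[OF \<theta>]
  have "\<bar>u (Inl (diagram \<theta>, True), i) (relabel n (labelling \<theta>) r) -
      column_mat (reference n (diagram \<theta>)) i (relabel n (labelling \<theta>) r)\<bar> < \<eta>" by (rule close_column)
  then show "\<bar>point_mat \<theta> i r - append_col (N + q) fixed_cols (point_col \<theta>) i r\<bar> < \<eta>"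
    unfolding column_mat_labelling[OF \<theta> i, symmetric] column_mat_relabel[OF inj, symmetric]
    by (simp add: point_mat_def vertex_mat_def diagram_def)
qed

lemma near_haar_mat: "near (n + N) (2 * n) \<eta> (haar_mat \<theta>) (append_col (N + q) fixed_cols (haar_col \<theta>))"
  using close_haar by (simp add: near_def haar_mat_def vertex_mat_def)

definition is_face :: "nat \<Rightarrow> (nat \<times> bool list \<Rightarrow> real) chain \<Rightarrow> bool"
  where "is_face j C \<longleftrightarrow> chain_vertices j C \<subseteq> \<Theta> \<and>
    (\<exists>v\<in>Nd. \<exists>\<beta>. (\<beta> = 0 \<or> \<beta> = 1) \<and> singular_chain j (cube_face Nd v \<beta>) C)"

lemma is_face_vertices:
  assumes "is_face j C"
  obtains v \<beta> where "v \<in> Nd" "\<beta> = 0 \<or> \<beta> = 1"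
    "\<And>f i. f \<in> Poly_Mapping.keys C \<Longrightarrow> i \<le> j \<Longrightarrow> vertices j f i \<in> \<Theta> \<and> vertices j f i v = \<beta>"
proof -
  obtain v \<beta> where v: "v \<in> Nd" "\<beta> = 0 \<or> \<beta> = 1" and C: "singular_chain j (cube_face Nd v \<beta>) C"
    using assms unfolding is_face_def by blast
  have sub: "chain_vertices j C \<subseteq> \<Theta>" using assms unfolding is_face_def by blast
  show thesis
  proof (rule that[OF v])
    fix f i assume f: "f \<in> Poly_Mapping.keys C" "i \<le> j"
    have "vertices j f i \<in> topspace (cube_face Nd v \<beta>)" by (rule vertices_topspace[OF C f])
    then show "vertices j f i \<in> \<Theta> \<and> vertices j f i v = \<beta>"
      using sub vertices_in_chain_vertices[OF f] by (auto simp: cube_face_def)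
  qed
qed

lemma haar_face:
  assumes "is_face (Suc p) C"
  shows "chain_eval (Suc p) (\<lambda>V. obstruction (n + N) (2 * n) (Suc p) (\<lambda>j. haar_mat (V j))) C = 0"
proof -
  obtain v \<beta> where v: "v \<in> Nd" "\<beta> = 0 \<or> \<beta> = 1" and
    C: "\<And>f i. f \<in> Poly_Mapping.keys C \<Longrightarrow> i \<le> Suc p \<Longrightarrow> vertices (Suc p) f i \<in> \<Theta> \<and> vertices (Suc p) f i v = \<beta>"
    using is_face_vertices[OF assms] by blast
  show ?thesis
  proof (rule chain_eval_eq_0I, rule face[OF v])
    fix f j assume "f \<in> Poly_Mapping.keys C" "j \<le> Suc p"
    from C[OF this] show "\<exists>x\<in>{x. \<exists>\<theta>\<in>\<Theta>. \<theta> v = \<beta> \<and> (x = point_col \<theta> \<or> x = haar_col \<theta>)}.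
        near (n + N) (2 * n) \<eta> (haar_mat (vertices (Suc p) f j)) (append_col (N + q) fixed_cols x)"
      using near_haar_mat by blast
  qed
qed

lemma prism_face:
  assumes "is_face p C"
  shows "chain_eval p (\<lambda>V. prism_obstruction (n + N) (2 * n) (Suc p) (\<lambda>j. point_mat (V j)) (\<lambda>j. haar_mat (V j))) C = 0"
proof -
  obtain v \<beta> where v: "v \<in> Nd" "\<beta> = 0 \<or> \<beta> = 1" and
    C: "\<And>f i. f \<in> Poly_Mapping.keys C \<Longrightarrow> i \<le> p \<Longrightarrow> vertices p f i \<in> \<Theta> \<and> vertices p f i v = \<beta>"
    using is_face_vertices[OF assms] by blast
  show ?thesis unfolding prism_obstruction_def
  proof (rule chain_eval_eq_0I, rule sum.neutral, rule ballI, rule face[OF v])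
    fix f l j assume f: "f \<in> Poly_Mapping.keys C" and l: "l \<in> {..<Suc p}" and j: "j \<le> Suc p"
    show "\<exists>x\<in>{x. \<exists>\<theta>\<in>\<Theta>. \<theta> v = \<beta> \<and> (x = point_col \<theta> \<or> x = haar_col \<theta>)}.
        near (n + N) (2 * n) \<eta> (prism (\<lambda>j. point_mat (vertices p f j)) (\<lambda>j. haar_mat (vertices p f j)) l j)
          (append_col (N + q) fixed_cols x)"
    proof (cases "j \<le> l")
      case True
      then have "vertices p f j \<in> \<Theta> \<and> vertices p f j v = \<beta>" using C[OF f, of j] l by simp
      moreover from this have "vertices p f j \<in> cube" using \<Theta>(1) by blast
      ultimately show ?thesis using near_point_mat[of "vertices p f j"] True unfolding prism_def by auto
    next
      case False
      then have "vertices p f (j - 1) \<in> \<Theta> \<and> vertices p f (j - 1) v = \<beta>" using C[OF f, of "j - 1"] j by simp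
      then show ?thesis using near_haar_mat[of "vertices p f (j - 1)"] False unfolding prism_def by auto
    qed
  qed
qed

lemma haar_boundary:
  assumes C: "singular_chain (Suc (Suc p)) (cube_top Nd) C" "chain_vertices (Suc (Suc p)) C \<subseteq> \<Theta>"
  shows "chain_eval (Suc p) (\<lambda>V. obstruction (n + N) (2 * n) (Suc p) (\<lambda>j. haar_mat (V j)))
    (chain_boundary (Suc (Suc p)) C) = 0"
  unfolding haar_mat_def
proof (rule vertex_cocycle[OF dims(1,2) gen])
  fix f j i assume "f \<in> Poly_Mapping.keys C" "j \<le> Suc (Suc p)" "i < 2 * n"
  then show "(Inr (vertices (Suc (Suc p)) f j), i) \<in> (Inl ` (DD \<times> UNIV) \<union> Inr ` \<Theta>) \<times> {..<2 * n}"
    using C(2) vertices_in_chain_vertices[of f C j "Suc (Suc p)"] by auto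
qed (simp_all add: permutes_id)

text \<open>On small simplices the labelling of the cube is a compatible one, and a lifted cochain
  may be evaluated with any compatible labelling.\<close>

lemma point_eval:
  assumes C: "singular_chain (Suc p) (cube_top Nd) C"
    and small: "\<And>f. f \<in> Poly_Mapping.keys C \<Longrightarrow>
      compatible n (Suc p) (\<lambda>i. diagram (vertices (Suc p) f i)) (\<lambda>i. labelling (vertices (Suc p) f i))"
  shows "chain_eval (Suc p) (lift_cochain n (Suc p) (\<lambda>L. obstruction (n + N) (2 * n) (Suc p)
      (\<lambda>j. conf_mat n u (\<lambda>D. Inl (D, True)) (L j)))) (chain_map (Suc p) diagram C) =
    chain_eval (Suc p) (\<lambda>V. obstruction (n + N) (2 * n) (Suc p) (\<lambda>j. point_mat (V j))) C"
  unfolding chain_eval_chain_map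
proof (rule chain_eval_cong)
  fix f assume f: "f \<in> Poly_Mapping.keys C"
  let ?V = "restrict (\<lambda>i. diagram (vertices (Suc p) f i)) {..Suc p}"
  have "compatible n (Suc p) ?V (\<lambda>i. labelling (vertices (Suc p) f i))"
    using small[OF f] by (simp add: compatible_def)
  from lift_cochain_eq[OF label_invariant_obstruction[OF dims(3)] this]
  have "lift_cochain n (Suc p) (\<lambda>L. obstruction (n + N) (2 * n) (Suc p) (\<lambda>j. conf_mat n u (\<lambda>D. Inl (D, True)) (L j))) ?V =
    obstruction (n + N) (2 * n) (Suc p) (\<lambda>j. conf_mat n u (\<lambda>D. Inl (D, True)) (labelling (vertices (Suc p) f j)))" .
  also have "\<dots> = obstruction (n + N) (2 * n) (Suc p) (\<lambda>j. point_mat (vertices (Suc p) f j))"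
    by (simp add: conf_mat_def point_mat_def vertex_mat_def diagram_def)
  finally show "lift_cochain n (Suc p) (\<lambda>L. obstruction (n + N) (2 * n) (Suc p) (\<lambda>j. conf_mat n u (\<lambda>D. Inl (D, True)) (L j))) ?V =
    obstruction (n + N) (2 * n) (Suc p) (\<lambda>j. point_mat (vertices (Suc p) f j))" .
qed

text \<open>The prism between the two families reduces the difference to the boundary of the chain,
  which lies in the sides of the cube, where the prism cochain vanishes.\<close>

lemma point_haar_eval:
  assumes C: "singular_chain (Suc p) (cube_top Nd) C" "chain_vertices (Suc p) C \<subseteq> \<Theta>"
    and small: "\<And>f. f \<in> Poly_Mapping.keys C \<Longrightarrow>
      compatible n (Suc p) (\<lambda>i. diagram (vertices (Suc p) f i)) (\<lambda>i. labelling (vertices (Suc p) f i))"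
    and bd: "cong2 (chain_boundary (Suc p) C) (\<Sum>x\<in>I. B x)" "\<And>x. x \<in> I \<Longrightarrow> is_face p (B x)"
  shows "chain_eval (Suc p) (\<lambda>V. obstruction (n + N) (2 * n) (Suc p) (\<lambda>j. point_mat (V j))) C =
    chain_eval (Suc p) (\<lambda>V. obstruction (n + N) (2 * n) (Suc p) (\<lambda>j. haar_mat (V j))) C"
proof -
  have mem: "vertices (Suc p) f j \<in> \<Theta>" if "f \<in> Poly_Mapping.keys C" "j \<le> Suc p" for f j
    using vertices_in_chain_vertices[OF that] C(2) by blast
  have "chain_eval (Suc p) (\<lambda>V. obstruction (n + N) (2 * n) (Suc p) (\<lambda>j. point_mat (V j))) C +
      chain_eval (Suc p) (\<lambda>V. obstruction (n + N) (2 * n) (Suc p) (\<lambda>j. haar_mat (V j))) C =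
      chain_eval p (\<lambda>V. prism_obstruction (n + N) (2 * n) (Suc p) (\<lambda>j. point_mat (V j)) (\<lambda>j. haar_mat (V j)))
        (chain_boundary (Suc p) C)"
    unfolding haar_mat_def point_mat_def
  proof (rule vertex_prism[OF dims(1,2) gen])
    fix f j assume f: "f \<in> Poly_Mapping.keys C" and j: "j \<le> Suc p"
    have "vertices (Suc p) f j \<in> cube" using mem[OF f j] \<Theta>(1) by blast
    then show "relabel n (labelling (vertices (Suc p) f j)) permutes {..<n + N} \<and> id permutes {..<n + N}"
      using relabel_permutes[OF labelling_inj dims(3)] permutes_id by blast
    fix i assume "i < 2 * n"
    moreover have "diagram (vertices (Suc p) f j) \<in> DD" using mem[OF f j] \<Theta>(2) by blast
    ultimately show "(Inl (diagram (vertices (Suc p) f j), True), i) \<in> (Inl ` (DD \<times> UNIV) \<union> Inr ` \<Theta>) \<times> {..<2 * n} \<and>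
        (Inr (vertices (Suc p) f j), i) \<in> (Inl ` (DD \<times> UNIV) \<union> Inr ` \<Theta>) \<times> {..<2 * n}"
      using mem[OF f j] by auto
  next
    fix f j j' assume f: "f \<in> Poly_Mapping.keys C" and j: "j \<le> Suc p" "j' \<le> Suc p"
      and eq: "(Inl (diagram (vertices (Suc p) f j), True) :: matrix_key) = Inl (diagram (vertices (Suc p) f j'), True)"
    show "relabel n (labelling (vertices (Suc p) f j)) = relabel n (labelling (vertices (Suc p) f j'))"
      by (rule compatible_relabel[OF small[OF f] j]) (use eq in simp)
  qed simp_all
  also have "\<dots> = (\<Sum>x\<in>I. chain_eval p (\<lambda>V. prism_obstruction (n + N) (2 * n) (Suc p) (\<lambda>j. point_mat (V j)) (\<lambda>j. haar_mat (V j))) (B x))"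
    unfolding chain_eval_cong2[OF bd(1)] chain_eval_sum ..
  also have "\<dots> = 0" by (rule sum.neutral) (use prism_face[OF bd(2)] in blast)
  finally show ?thesis by (rule bit_add_eq_0)
qed

lemma haar_general_position:
  assumes "\<And>j. j \<le> Suc p \<Longrightarrow> corner (Suc p) Nd e0 j \<in> \<Theta>"
  shows "general_position (n + N) ({..<2 * n} \<times> {..Suc p}) (\<lambda>(i, j). (corner (Suc p) Nd e0 j, i))
    (\<lambda>(i, j). haar_mat (corner (Suc p) Nd e0 j) i)"
proof -
  have "generic (n + N) (\<Theta> \<times> {..<2 * n}) (\<lambda>x. u ((\<lambda>(\<theta>, i). (Inr \<theta>, i)) x))"
    by (rule generic_image[OF gen]) (auto simp: inj_on_def)
  then show ?thesis
    by (rule general_position_generic[where \<rho> = "\<lambda>_. id"])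
       (use assms in \<open>simp_all add: haar_mat_def vertex_mat_def permutes_id\<close>)
qed

end

section \<open>The cube cycle cannot avoid the exceptional diagrams\<close>

lemma near_triangle:
  assumes "near d m \<rho> M M'" "near d m \<rho>' M' B"
  shows "near d m (\<rho> + \<rho>') M B"
  unfolding near_def
proof (intro allI impI)
  fix i r assume "i < m" "r < d"
  then have "\<bar>M i r - M' i r\<bar> < \<rho>" "\<bar>M' i r - B i r\<bar> < \<rho>'" using assms by (auto simp: near_def)
  then show "\<bar>M i r - B i r\<bar> < \<rho> + \<rho>'" by linarith
qed

lemma additive_chain_operator:
  assumes h0: "h p 0 = (0 :: 'b chain)" and hd: "\<And>a b. h p (a - b) = h p a - (h p b :: 'b chain)"
  shows "h p (a + b) = h p a + h p b" "finite I \<Longrightarrow> h p (\<Sum>x\<in>I. F x) = (\<Sum>x\<in>I. h p (F x))"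
    "cong2 a b \<Longrightarrow> cong2 (h p a) (h p b)"
proof -
  have hm: "h p (- b) = - h p b" for b using hd[of 0 b] h0 by simp
  have ha: "h p (a + b) = h p a + h p b" for a b using hd[of a "- b"] hm[of b] by simp
  show "h p (a + b) = h p a + h p b" by (rule ha)
  show "h p (\<Sum>x\<in>I. F x) = (\<Sum>x\<in>I. h p (F x))" if "finite I"
    using that by induction (simp_all add: h0 ha)
  assume "cong2 a b"
  then obtain w where "a - b = w + w" unfolding cong2_def by blast
  then have "h p a - h p b = h p w + h p w" by (simp only: hd[symmetric] ha[symmetric])
  then show "cong2 (h p a) (h p b)" unfolding cong2_def by blast
qed

context forest_frame
begin

definition outer_face :: "(nat \<Rightarrow> nat \<times> bool list) \<times> bool \<Rightarrow> (nat \<times> bool list \<Rightarrow> real) chain"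
  where "outer_face x = frag_of (singular_face (Suc p) (if snd x then 0 else Suc p) (cube_simplex (Suc p) Nd (fst x)))"

lemma singular_chain_outer_face:
  assumes "fst x \<in> orders (Suc p) Nd"
  shows "\<exists>v\<in>Nd. \<exists>\<beta>. (\<beta> = 0 \<or> \<beta> = 1) \<and> singular_chain p (cube_face Nd v \<beta>) (outer_face x)"
proof (cases "snd x")
  case True
  then show ?thesis using first_face[OF assms] nth_in[OF assms, of 0]
    by (intro bexI[of _ "fst x 0"] exI[of _ 1]) (simp_all add: outer_face_def singular_chain_of)
next
  case False
  then show ?thesis using last_face[OF assms] nth_in[OF assms, of p]
    by (intro bexI[of _ "fst x p"] exI[of _ 0]) (simp_all add: outer_face_def singular_chain_of)
qed

lemma boundary_outer_faces:
  "cong2 (chain_boundary (Suc p) (cube_chain (Suc p) Nd)) (\<Sum>x\<in>orders (Suc p) Nd \<times> UNIV. outer_face x)"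
proof -
  have "(\<Sum>x\<in>orders (Suc p) Nd \<times> UNIV. outer_face x) = (\<Sum>e\<in>orders (Suc p) Nd. \<Sum>\<beta>\<in>UNIV. outer_face (e, \<beta>))"
    by (simp add: sum.cartesian_product)
  also have "\<dots> = (\<Sum>e\<in>orders (Suc p) Nd. outer_faces p Nd e)"
    by (rule sum.cong) (simp_all add: outer_faces_def outer_face_def UNIV_bool add.commute)
  finally show ?thesis using boundary_cube_chain[OF finite_forest_nodes[of q b], of p] by simp
qed

lemma corner_in_cube: "corner (Suc p) Nd e j \<in> cube"
  by (simp add: topspace_cube_top corner_def)

text \<open>For each side one functional serves all the finitely many last columns that occur on it,
  and there are finitely many sides.\<close>

lemma face_radius:
  assumes "finite \<Theta>" "\<Theta> \<subseteq> cube"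
  shows "\<exists>\<rho>>0. \<forall>v\<in>Nd. \<forall>\<beta>\<in>{0, 1}. \<forall>M.
    (\<forall>j\<le>Suc p. \<exists>x\<in>{x. \<exists>\<theta>\<in>\<Theta>. \<theta> v = \<beta> \<and> (x = point_col \<theta> \<or> x = haar_col \<theta>)}.
      near (n + N) (2 * n) \<rho> (M j) (append_col (N + q) fixed_cols x)) \<longrightarrow>
    obstruction (n + N) (2 * n) (Suc p) M = 0"
proof -
  define X where "X v \<beta> = {x. \<exists>\<theta>\<in>\<Theta>. \<theta> v = \<beta> \<and> (x = point_col \<theta> \<or> x = haar_col \<theta>)}" for v \<beta>
  define P where "P z \<rho> \<longleftrightarrow> (\<forall>M.
    (\<forall>j\<le>Suc p. \<exists>x\<in>X (fst z) (snd z). near (n + N) (2 * n) \<rho> (M j) (append_col (N + q) fixed_cols x)) \<longrightarrow>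
    obstruction (n + N) (2 * n) (Suc p) M = 0)" for z \<rho>
  have m: "2 * n = Suc (N + q)" using n_eq N_eq by simp
  have "\<exists>\<rho>>0. \<forall>z\<in>Nd \<times> {0, 1}. P z \<rho>"
  proof (rule common_radius, simp add: finite_forest_nodes, rule ballI)
    fix z assume "z \<in> Nd \<times> {0, 1 :: real}"
    then obtain v \<beta> where z: "z = (v, \<beta>)" "v \<in> Nd" "\<beta> = 0 \<or> \<beta> = 1" by auto
    have "X v \<beta> \<subseteq> point_col ` \<Theta> \<union> haar_col ` \<Theta>" unfolding X_def by blast
    then have fin: "finite (X v \<beta>)" by (rule finite_subset) (simp add: assms(1))
    have pos: "0 < (\<Sum>r<n + N. (1 - 2 * \<beta>) * haar_row v r * x r)" if "x \<in> X v \<beta>" for x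
      using that face_functional[OF z(2) _ _ z(3)] assms(2) unfolding X_def by blast
    have zero: "(\<Sum>r<n + N. (1 - 2 * \<beta>) * haar_row v r * fixed_cols i r) = 0" if "i < N + q" for i
      using haar_row_fixed_cols[OF z(2) that] by (simp add: mult.assoc flip: sum_distrib_left)
    show "\<exists>\<rho>>0. P z \<rho>"
    proof (rule obstruction_eq_0_half_space[of "X v \<beta>" "n + N" "N + q" fixed_cols "\<lambda>r. (1 - 2 * \<beta>) * haar_row v r" "Suc p",
          OF fin indep_fixed_cols zero pos])
      fix \<rho> :: real assume \<rho>: "0 < \<rho>" "\<And>M. (\<And>j. j \<le> Suc p \<Longrightarrow> \<exists>x\<in>X v \<beta>. near (n + N) (Suc (N + q)) \<rho> (M j)
          (append_col (N + q) fixed_cols x)) \<Longrightarrow> obstruction (n + N) (Suc (N + q)) (Suc p) M = 0"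
      have "P z \<rho>" unfolding P_def z(1) fst_conv snd_conv m
        by (intro allI impI \<rho>(2)) blast
      then show ?thesis using \<rho>(1) by blast
    qed
  next
    show "\<forall>z \<rho> \<rho>'. P z \<rho> \<longrightarrow> 0 < \<rho>' \<longrightarrow> \<rho>' \<le> \<rho> \<longrightarrow> P z \<rho>'"
    proof (intro allI impI)
      fix z \<rho> \<rho>' assume P: "P z \<rho>" and le: "\<rho>' \<le> \<rho>"
      show "P z \<rho>'" unfolding P_def
      proof (intro allI impI)
        fix M assume M: "\<forall>j\<le>Suc p. \<exists>x\<in>X (fst z) (snd z). near (n + N) (2 * n) \<rho>' (M j) (append_col (N + q) fixed_cols x)"
        have "\<forall>j\<le>Suc p. \<exists>x\<in>X (fst z) (snd z). near (n + N) (2 * n) \<rho> (M j) (append_col (N + q) fixed_cols x)"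
          using M near_mono[OF _ le] by blast
        then show "obstruction (n + N) (2 * n) (Suc p) M = 0" using P unfolding P_def by blast
      qed
    qed
  qed
  then obtain \<rho> where \<rho>: "0 < \<rho>" "\<forall>z\<in>Nd \<times> {0, 1}. P z \<rho>" by blast
  have "P (v, \<beta>) \<rho>" if "v \<in> Nd" "\<beta> \<in> {0, 1}" for v \<beta> using \<rho>(2) that by blast
  then show ?thesis unfolding P_def X_def fst_conv snd_conv using \<rho>(1) by blast
qed

text \<open>Less than \<open>\<rho>\<close> from the perturbation and less than
  \<open>\<rho>\<close> from the variation over the simplex keep all matrices within
  \<open>\<rho> + \<rho>\<close> of \<open>B\<close>, where the obstruction vanishes.\<close>

lemma avoiding_radius:
  fixes g :: "nat \<Rightarrow> real \<times> real \<Rightarrow> real"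
  assumes "\<exists>L B \<rho>. 0 < \<rho> \<and> compatible n k V L \<and>
      (\<forall>j\<le>k. near (n + N) (2 * n) \<rho> (diagram_mat n g (L j)) B) \<and>
      (\<forall>M. (\<forall>j\<le>k. near (n + N) (2 * n) (\<rho> + \<rho>) (M j) B) \<longrightarrow> obstruction (n + N) (2 * n) k M = 0)"
  shows "\<exists>\<rho>>0. \<forall>u :: matrix_key \<times> nat \<Rightarrow> nat \<Rightarrow> real.
    (\<forall>D i r. \<bar>u (Inl (D, False), i) r - diagram_mat n g (reference n D) i r\<bar> < \<rho>) \<longrightarrow>
    lift_cochain n k (\<lambda>L. obstruction (n + N) (2 * n) k (\<lambda>j. conf_mat n u (\<lambda>D. Inl (D, False)) (L j))) V = 0"
proof -
  obtain L B \<rho> where \<rho>: "0 < \<rho>" and L: "compatible n k V L"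
    and near: "\<forall>j\<le>k. near (n + N) (2 * n) \<rho> (diagram_mat n g (L j)) B"
    and zero: "\<forall>M. (\<forall>j\<le>k. near (n + N) (2 * n) (\<rho> + \<rho>) (M j) B) \<longrightarrow> obstruction (n + N) (2 * n) k M = 0"
    using assms by (elim exE conjE)
  show ?thesis
  proof (intro exI[of _ \<rho>] conjI \<rho> allI impI)
    fix u :: "matrix_key \<times> nat \<Rightarrow> nat \<Rightarrow> real"
    assume u: "\<forall>D i r. \<bar>u (Inl (D, False), i) r - diagram_mat n g (reference n D) i r\<bar> < \<rho>"
    have le: "n \<le> n + N" by simp
    have "near (n + N) (2 * n) (\<rho> + \<rho>) (conf_mat n u (\<lambda>D. Inl (D, False)) (L j)) B" if j: "j \<le> k" for j
    proof (rule near_triangle[OF _ near[rule_format, OF j]])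
      note inj = compatible_inj[OF L j]
      show "near (n + N) (2 * n) \<rho> (conf_mat n u (\<lambda>D. Inl (D, False)) (L j)) (diagram_mat n g (L j))"
        unfolding near_def conf_mat_def diagram_mat_relabel[OF inj, symmetric, of g]
        by (intro allI impI u[rule_format])
    qed
    then have "obstruction (n + N) (2 * n) k (\<lambda>j. conf_mat n u (\<lambda>D. Inl (D, False)) (L j)) = 0"
      by (intro zero[rule_format])
    then show "lift_cochain n k (\<lambda>L. obstruction (n + N) (2 * n) k (\<lambda>j. conf_mat n u (\<lambda>D. Inl (D, False)) (L j))) V = 0"
      unfolding lift_cochain_eq[OF label_invariant_obstruction[OF le] L] .
  qed
qed

end

context forest_frame
begin

text \<open>\<open>A\<close>, \<open>B\<close> and \<open>C\<close> are the obstruction cochains of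
  the three families. \<open>A\<close> vanishes on the subdivided avoiding chain and on the
  subdivided boundary, hence on the subdivided cycle \<open>Z1\<close>; so does \<open>B\<close>,
  which differs from \<open>A\<close> by a prism on the boundary of \<open>Z1\<close>. On the
  subdivided cube \<open>B\<close> has the same value as \<open>C\<close>, and \<open>C\<close> has
  the same value on the cube before subdivision. But there this value is \<open>1\<close>.\<close>

lemma no_avoiding_chain:
  fixes f :: "nat \<Rightarrow> real \<Rightarrow> real"
  assumes F: "subspace F" "F \<subseteq> span (f ` {..<N})" and f: "\<forall>t<N. continuous_on UNIV (f t)"
    and c: "singular_chain (Suc p) (subtopology (diagram_space n) (topspace (diagram_space n) - exceptional_diagrams n F)) c"
    and d: "singular_chain (Suc (Suc p)) (diagram_space n) d"
    and rel: "cong2 c (chain_map (Suc p) diagram (cube_chain (Suc p) Nd) + chain_boundary (Suc (Suc p)) d)"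
  shows False
proof -
  define g where "g = (\<lambda>t z. f t (snd z) - f t (fst z))"
  define K where "K = cube_chain (Suc p) Nd"
  have K: "singular_chain (Suc p) (cube_top Nd) K" unfolding K_def by (rule singular_chain_cube_chain)
  obtain r1 where r1: "\<forall>s\<ge>r1. \<forall>f\<in>Poly_Mapping.keys ((singular_subdivision (Suc (Suc p)) ^^ s) d).
      \<exists>L. compatible n (Suc (Suc p)) (vertices (Suc (Suc p)) f) L"
    using small_diagram_simplices[OF d] by (elim exE)
  obtain r2 where r2: "\<forall>s\<ge>r2. \<forall>\<sigma>\<in>Poly_Mapping.keys ((singular_subdivision (Suc p) ^^ s) c). \<exists>L B \<rho>. 0 < \<rho> \<and>
    compatible n (Suc p) (vertices (Suc p) \<sigma>) L \<and> (\<forall>j\<le>Suc p. near (n + N) (2 * n) \<rho> (diagram_mat n g (L j)) B) \<and>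
    (\<forall>M. (\<forall>j\<le>Suc p. near (n + N) (2 * n) (\<rho> + \<rho>) (M j) B) \<longrightarrow> obstruction (n + N) (2 * n) (Suc p) M = 0)"
    using small_avoiding_simplices[OF F f c] unfolding g_def by (elim exE)
  obtain r3 where r3: "\<forall>s\<ge>r3. \<forall>f\<in>Poly_Mapping.keys ((singular_subdivision (Suc p) ^^ s) K).
    compatible n (Suc p) (\<lambda>i. diagram (vertices (Suc p) f i)) (\<lambda>i. labelling (vertices (Suc p) f i))"
    using small_cube_simplices[OF K] by (elim exE)
  define r where "r = max r1 (max r2 r3)"
  have r: "r1 \<le> r" "r2 \<le> r" "r3 \<le> r" by (simp_all add: r_def)
  define d1 where "d1 = (singular_subdivision (Suc (Suc p)) ^^ r) d"
  define c1 where "c1 = (singular_subdivision (Suc p) ^^ r) c"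
  define K1 where "K1 = (singular_subdivision (Suc p) ^^ r) K"
  define Z1 where "Z1 = chain_map (Suc p) diagram K1"
  \<comment> \<open>The chain homotopy from iterated subdivision to the identity, which leads from
    the subdivided cube back to the original one.\<close>
  have "\<exists>h :: nat \<Rightarrow> (nat \<times> bool list \<Rightarrow> real) chain \<Rightarrow> (nat \<times> bool list \<Rightarrow> real) chain.
    (\<forall>p. h p 0 = 0) \<and> (\<forall>p a b. h p (a - b) = h p a - h p b) \<and>
    (\<forall>p X c. singular_chain p X c \<longrightarrow> singular_chain (Suc p) X (h p c)) \<and>
    (\<forall>p X c. singular_chain p X c \<longrightarrow>
      chain_boundary (Suc p) (h p c) + h (p - Suc 0) (chain_boundary p c) = (singular_subdivision p ^^ r) c - c)"
    (is "\<exists>h. ?h h")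
  proof (rule chain_homotopic_iterated_singular_subdivision[where n = r])
    fix h :: "nat \<Rightarrow> (nat \<times> bool list \<Rightarrow> real) chain \<Rightarrow> (nat \<times> bool list \<Rightarrow> real) chain"
    assume "\<And>p. h p 0 = 0" "\<And>p a b. h p (a - b) = h p a - h p b"
      "\<And>p X c. singular_chain p X c \<Longrightarrow> singular_chain (Suc p) X (h p c)"
      "\<And>p X c. singular_chain p X c \<Longrightarrow>
        chain_boundary (Suc p) (h p c) + h (p - Suc 0) (chain_boundary p c) = (singular_subdivision p ^^ r) c - c"
    then have "?h h" by simp
    then show ?thesis by (rule exI[of ?h])
  qed
  then obtain h :: "nat \<Rightarrow> (nat \<times> bool list \<Rightarrow> real) chain \<Rightarrow> (nat \<times> bool list \<Rightarrow> real) chain" where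
    hh: "\<forall>p. h p 0 = 0" "\<forall>p a b. h p (a - b) = h p a - h p b"
    "\<forall>p X c. singular_chain p X c \<longrightarrow> singular_chain (Suc p) X (h p c)"
    "\<forall>p X c. singular_chain p X c \<longrightarrow>
      chain_boundary (Suc p) (h p c) + h (p - Suc 0) (chain_boundary p c) = (singular_subdivision p ^^ r) c - c"
    by (elim exE conjE)
  note h0 = hh(1)[rule_format] and hd = hh(2)[rule_format] and hX = hh(3)[rule_format] and hb = hh(4)[rule_format]
  define H where "H = h (Suc p) K"
  define I where "I = orders (Suc p) Nd \<times> (UNIV :: bool set)"
  have finI: "finite I" by (simp add: I_def finite_orders finite_forest_nodes)
  define Bs where "Bs x = (singular_subdivision p ^^ r) (outer_face x)" for x
  define Hs where "Hs x = h p (outer_face x)" for x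
  \<comment> \<open>All points of the cube that occur as vertices below, including those of the
    chain homotopy. They are finitely many, as the choice of a generic perturbation
    requires.\<close>
  define \<Theta> where "\<Theta> = chain_vertices (Suc p) K1 \<union> chain_vertices (Suc (Suc p)) H \<union>
    (\<Union>x\<in>I. chain_vertices p (Bs x) \<union> chain_vertices (Suc p) (Hs x)) \<union>
    (\<Union>e\<in>orders (Suc p) Nd. corner (Suc p) Nd e ` {..Suc p})"
  define DD where "DD = diagram ` \<Theta> \<union> chain_vertices (Suc (Suc p)) d1"
  have K1: "singular_chain (Suc p) (cube_top Nd) K1"
    unfolding K1_def by (rule singular_chain_iterated_subdivision[OF K])
  have H: "singular_chain (Suc (Suc p)) (cube_top Nd) H" unfolding H_def by (rule hX[OF K])
  have faces: "\<exists>v\<in>Nd. \<exists>\<beta>. (\<beta> = 0 \<or> \<beta> = 1) \<and> singular_chain p (cube_face Nd v \<beta>) (Bs x) \<and>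
      singular_chain (Suc p) (cube_face Nd v \<beta>) (Hs x)" if x: "x \<in> I" for x
  proof -
    have "fst x \<in> orders (Suc p) Nd" using x by (auto simp: I_def)
    then obtain v \<beta> where v: "v \<in> Nd" "\<beta> = 0 \<or> \<beta> = 1" "singular_chain p (cube_face Nd v \<beta>) (outer_face x)"
      using singular_chain_outer_face by blast
    show ?thesis unfolding Bs_def Hs_def
      using v singular_chain_iterated_subdivision[OF v(3)] hX[OF v(3)] by blast
  qed
  have fin\<Theta>: "finite \<Theta>" unfolding \<Theta>_def
    by (simp add: finite_chain_vertices finI finite_orders finite_forest_nodes)
  have finDD: "finite DD" unfolding DD_def by (simp add: fin\<Theta> finite_chain_vertices)
  have face_cube: "topspace (cube_face Nd v \<beta>) \<subseteq> cube" for v \<beta> by (simp add: cube_face_def)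
  have \<Theta>: "\<Theta> \<subseteq> cube"
  proof -
    have "chain_vertices p (Bs x) \<subseteq> cube \<and> chain_vertices (Suc p) (Hs x) \<subseteq> cube" if "x \<in> I" for x
      using faces[OF that] chain_vertices_topspace face_cube by (meson order_trans)
    then show ?thesis unfolding \<Theta>_def
      using chain_vertices_topspace[OF K1] chain_vertices_topspace[OF H] corner_in_cube by blast
  qed
  text \<open>The radii below which the obstruction is insensitive to perturbations.\<close>
  define A where "A u = lift_cochain n (Suc p) (\<lambda>L. obstruction (n + N) (2 * n) (Suc p)
    (\<lambda>j. conf_mat n u (\<lambda>D. Inl (D, False)) (L j)))" for u :: "matrix_key \<times> nat \<Rightarrow> nat \<Rightarrow> real"
  define P where "P \<sigma> \<rho> \<longleftrightarrow> (\<forall>u :: matrix_key \<times> nat \<Rightarrow> nat \<Rightarrow> real.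
    (\<forall>D i r. \<bar>u (Inl (D, False), i) r - diagram_mat n g (reference n D) i r\<bar> < \<rho>) \<longrightarrow>
    A u (vertices (Suc p) \<sigma>) = 0)" for \<sigma> \<rho>
  have "\<exists>\<rho>>0. \<forall>\<sigma>\<in>Poly_Mapping.keys c1. P \<sigma> \<rho>"
  proof (rule common_radius[OF finite_keys], rule ballI)
    fix \<sigma> assume "\<sigma> \<in> Poly_Mapping.keys c1"
    then show "\<exists>\<rho>>0. P \<sigma> \<rho>" unfolding P_def A_def c1_def
      by (intro avoiding_radius r2[rule_format, OF r(2)])
  next
    show "\<forall>\<sigma> \<rho> \<rho>'. P \<sigma> \<rho> \<longrightarrow> 0 < \<rho>' \<longrightarrow> \<rho>' \<le> \<rho> \<longrightarrow> P \<sigma> \<rho>'" unfolding P_def by (meson less_le_trans)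
  qed
  then obtain \<rho>1 where \<rho>1: "0 < \<rho>1" "\<forall>\<sigma>\<in>Poly_Mapping.keys c1. P \<sigma> \<rho>1" by blast
  obtain \<rho>2 where \<rho>2: "0 < \<rho>2" "\<forall>v\<in>Nd. \<forall>\<beta>\<in>{0, 1}. \<forall>M.
    (\<forall>j\<le>Suc p. \<exists>x\<in>{x. \<exists>\<theta>\<in>\<Theta>. \<theta> v = \<beta> \<and> (x = point_col \<theta> \<or> x = haar_col \<theta>)}.
      near (n + N) (2 * n) \<rho>2 (M j) (append_col (N + q) fixed_cols x)) \<longrightarrow>
    obstruction (n + N) (2 * n) (Suc p) M = 0"
    using face_radius[OF fin\<Theta> \<Theta>] by (elim exE conjE)
  obtain \<rho>3 where \<rho>3: "0 < \<rho>3" "\<And>W. close \<rho>3 W \<Longrightarrow>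
    general_position (n + N) ({..<Suc (N + q)} \<times> {..Suc p}) (\<lambda>(i, j). (corner (Suc p) Nd e0 j, i)) (\<lambda>(i, j). W (corner (Suc p) Nd e0 j) i) \<Longrightarrow>
    (\<Sum>e\<in>orders (Suc p) Nd. obstruction (n + N) (Suc (N + q)) (Suc p) (\<lambda>j. W (corner (Suc p) Nd e j))) = 1"
    using cube_count by blast
  define \<eta> where "\<eta> = min \<rho>1 (min \<rho>2 \<rho>3)"
  have \<eta>: "0 < \<eta>" "\<eta> \<le> \<rho>1" "\<eta> \<le> \<rho>2" "\<eta> \<le> \<rho>3" using \<rho>1(1) \<rho>2(1) \<rho>3(1) by (auto simp: \<eta>_def)
  define S where "S = (Inl ` (DD \<times> UNIV) \<union> Inr ` \<Theta> :: matrix_key set) \<times> {..<2 * n}"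
  have finS: "finite S" unfolding S_def by (simp add: finDD fin\<Theta>)
  define u0 :: "matrix_key \<times> nat \<Rightarrow> nat \<Rightarrow> real" where "u0 z =
    (case fst z of Inl y \<Rightarrow> if snd y then column_mat (reference n (fst y)) (snd z) else diagram_mat n g (reference n (fst y)) (snd z)
      | Inr \<theta> \<Rightarrow> append_col (N + q) fixed_cols (haar_col \<theta>) (snd z))" for z
  obtain u where u: "\<And>z r. \<bar>u z r - u0 z r\<bar> < \<eta>" "\<And>J \<rho>. J \<subseteq> S \<Longrightarrow> card J \<le> n + N \<Longrightarrow>
      (\<And>x. x \<in> J \<Longrightarrow> \<rho> x permutes {..<n + N}) \<Longrightarrow> indep (n + N) J (\<lambda>x r. u x (\<rho> x r))"
    using generic_perturbation[OF finS \<eta>(1), of u0 "n + N"] by blast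
  have genS: "generic (n + N) S u" unfolding generic_def
    by (intro allI impI u(2)) blast+
  interpret perturbed_frame n N q p b lf e0 u DD \<Theta> \<eta>
  proof
    show "generic (n + N) ((Inl ` (DD \<times> UNIV) \<union> Inr ` \<Theta>) \<times> {..<2 * n}) u" using genS unfolding S_def .
    show "\<Theta> \<subseteq> cube" by (rule \<Theta>)
    show "diagram ` \<Theta> \<subseteq> DD" by (simp add: DD_def)
    show "\<bar>u (Inl (D, True), i) r - column_mat (reference n D) i r\<bar> < \<eta>" for D i r
      using u(1)[of "(Inl (D, True), i)" r] by (simp add: u0_def)
    show "\<bar>u (Inr \<theta>, i) r - append_col (N + q) fixed_cols (haar_col \<theta>) i r\<bar> < \<eta>" for \<theta> i r
      using u(1)[of "(Inr \<theta>, i)" r] by (simp add: u0_def)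
    fix v \<beta> M assume v: "v \<in> Nd" "\<beta> = 0 \<or> \<beta> = (1 :: real)"
      and M: "\<And>j. j \<le> Suc p \<Longrightarrow> \<exists>x\<in>{x. \<exists>\<theta>\<in>\<Theta>. \<theta> v = \<beta> \<and> (x = point_col \<theta> \<or> x = haar_col \<theta>)}.
        near (n + N) (2 * n) \<eta> (M j) (append_col (N + q) fixed_cols x)"
    show "obstruction (n + N) (2 * n) (Suc p) M = 0"
    proof (rule \<rho>2(2)[rule_format])
      show "v \<in> Nd" "\<beta> \<in> {0, 1}" using v by auto
      show "\<exists>x\<in>{x. \<exists>\<theta>\<in>\<Theta>. \<theta> v = \<beta> \<and> (x = point_col \<theta> \<or> x = haar_col \<theta>)}.
        near (n + N) (2 * n) \<rho>2 (M j) (append_col (N + q) fixed_cols x)" if "j \<le> Suc p" for j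
        using M[OF that] near_mono[OF _ \<eta>(3)] by blast
    qed
  qed
  define B where "B = lift_cochain n (Suc p) (\<lambda>L. obstruction (n + N) (2 * n) (Suc p)
    (\<lambda>j. conf_mat n u (\<lambda>D. Inl (D, True)) (L j)))"
  define C where "C = (\<lambda>V. obstruction (n + N) (2 * n) (Suc p) (\<lambda>j. haar_mat (V j)))"
  have Z_sub: "(singular_subdivision (Suc p) ^^ r) (chain_map (Suc p) diagram K) = Z1"
    unfolding Z1_def K1_def by (rule chain_map_iterated_subdivision[OF K])
  have d1_bd: "chain_boundary (Suc (Suc p)) d1 = (singular_subdivision (Suc p) ^^ r) (chain_boundary (Suc (Suc p)) d)"
    unfolding d1_def by (rule chain_boundary_iterated_subdivision[OF d])
  have rel1: "cong2 c1 (Z1 + chain_boundary (Suc (Suc p)) d1)"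
    using cong2_iterated_subdivision[OF rel[folded K_def], where p = "Suc p" and r = r]
    unfolding c1_def d1_bd iterated_subdivision_add Z_sub .
  have dims': "n + N + 1 = 2 * n + Suc p" "2 \<le> 2 * n" "n \<le> n + N" using dims by auto
  have small_d1: "\<exists>L. compatible n (Suc (Suc p)) (vertices (Suc (Suc p)) \<sigma>) L" if "\<sigma> \<in> Poly_Mapping.keys d1" for \<sigma>
    by (rule r1[rule_format, OF r(1)]) (use that in \<open>simp add: d1_def\<close>)
  have small_K1: "compatible n (Suc p) (\<lambda>i. diagram (vertices (Suc p) \<sigma> i)) (\<lambda>i. labelling (vertices (Suc p) \<sigma> i))"
    if "\<sigma> \<in> Poly_Mapping.keys K1" for \<sigma>
    by (rule r3[rule_format, OF r(3)]) (use that in \<open>simp add: K1_def\<close>)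
  have "chain_eval (Suc p) (A u) c1 = 0"
  proof (rule chain_eval_eq_0I)
    fix \<sigma> assume "\<sigma> \<in> Poly_Mapping.keys c1"
    then have "P \<sigma> \<rho>1" using \<rho>1(2) by blast
    moreover have "\<bar>u (Inl (D, False), i) r - diagram_mat n g (reference n D) i r\<bar> < \<rho>1" for D i r
      using u(1)[of "(Inl (D, False), i)" r] \<eta>(2) by (simp add: u0_def)
    ultimately show "A u (vertices (Suc p) \<sigma>) = 0" unfolding P_def by blast
  qed
  moreover have "chain_eval (Suc p) (A u) (chain_boundary (Suc (Suc p)) d1) = 0"
    unfolding A_def
  proof (rule configuration_cocycle[OF dims'(2,1,3) genS])
    show "inj (\<lambda>D. Inl (D, False) :: matrix_key)" by (simp add: inj_def)
    fix \<sigma> assume \<sigma>: "\<sigma> \<in> Poly_Mapping.keys d1"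
    then show "\<exists>L. compatible n (Suc (Suc p)) (vertices (Suc (Suc p)) \<sigma>) L" by (rule small_d1)
    fix j i assume "j \<le> Suc (Suc p)" "i < 2 * n"
    then show "(Inl (vertices (Suc (Suc p)) \<sigma> j, False), i) \<in> S"
      using vertices_in_chain_vertices[OF \<sigma>, of j "Suc (Suc p)"] by (simp add: S_def DD_def)
  qed
  ultimately have S1: "chain_eval (Suc p) (A u) Z1 = 0"
    using chain_eval_cong2[OF rel1, of "Suc p" "A u"] by (simp add: chain_eval_add)
  have Z1_cycle: "cong2 (chain_boundary (Suc p) Z1) 0"
  proof -
    have "singular_chain (Suc p) (diagram_space n) (chain_map (Suc p) diagram K)"
      by (rule singular_chain_chain_map[OF K continuous_diagram])
    from chain_boundary_iterated_subdivision[OF this, of r]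
    have "chain_boundary (Suc p) Z1 = (singular_subdivision p ^^ r) (chain_boundary (Suc p) (chain_map (Suc p) diagram K))"
      unfolding Z_sub .
    then show ?thesis
      using cong2_iterated_subdivision[OF diagram_cycle[folded K_def], where p = p and r = r] by (simp add: iterated_subdivision_0)
  qed
  \<comment> \<open>Cancellation in the image chain can only remove simplices, so all simplices of
    \<open>Z1\<close> inherit their labels from the cube.\<close>
  have key_Z1: "\<exists>\<tau>\<in>Poly_Mapping.keys K1. \<sigma> = simplex_map (Suc p) diagram \<tau>" if "\<sigma> \<in> Poly_Mapping.keys Z1" for \<sigma>
  proof -
    have "\<sigma> \<in> (\<Union>\<tau>\<in>Poly_Mapping.keys K1. Poly_Mapping.keys ((frag_of \<circ> simplex_map (Suc p) diagram) \<tau>))"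
      using that keys_frag_extend[of "frag_of \<circ> simplex_map (Suc p) diagram" K1] unfolding Z1_def chain_map_def by blast
    then show ?thesis by auto
  qed
  have "chain_eval (Suc p) (A u) Z1 + chain_eval (Suc p) B Z1 =
      chain_eval p (lift_cochain n p (\<lambda>L. prism_obstruction (n + N) (2 * n) (Suc p)
        (\<lambda>j. conf_mat n u (\<lambda>D. Inl (D, False)) (L j)) (\<lambda>j. conf_mat n u (\<lambda>D. Inl (D, True)) (L j)))) (chain_boundary (Suc p) Z1)"
    unfolding A_def B_def
  proof (rule configuration_prism[OF dims'(2,1,3) genS])
    show "inj (\<lambda>D. Inl (D, False) :: matrix_key)" "inj (\<lambda>D. Inl (D, True) :: matrix_key)" by (simp_all add: inj_def)
    show "(Inl (D, False) :: matrix_key) \<noteq> Inl (D', True)" for D D' by simp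
    fix \<sigma> assume "\<sigma> \<in> Poly_Mapping.keys Z1"
    then obtain \<tau> where \<tau>: "\<tau> \<in> Poly_Mapping.keys K1" "\<sigma> = simplex_map (Suc p) diagram \<tau>" using key_Z1 by blast
    have V: "vertices (Suc p) \<sigma> = restrict (\<lambda>i. diagram (vertices (Suc p) \<tau> i)) {..Suc p}"
      unfolding \<tau>(2) by (rule vertices_simplex_map)
    have "compatible n (Suc p) (vertices (Suc p) \<sigma>) (\<lambda>i. labelling (vertices (Suc p) \<tau> i))"
      using small_K1[OF \<tau>(1)] unfolding V by (simp add: compatible_def)
    then show "\<exists>L. compatible n (Suc p) (vertices (Suc p) \<sigma>) L" by blast
    fix j i assume j: "j \<le> Suc p" and i: "i < 2 * n"
    have "vertices (Suc p) \<tau> j \<in> \<Theta>" using vertices_in_chain_vertices[OF \<tau>(1) j] by (simp add: \<Theta>_def)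
    then have "vertices (Suc p) \<sigma> j \<in> DD" unfolding V using j by (simp add: DD_def)
    then show "(Inl (vertices (Suc p) \<sigma> j, False), i) \<in> S \<and> (Inl (vertices (Suc p) \<sigma> j, True), i) \<in> S"
      using i by (simp add: S_def)
  qed
  also have "\<dots> = 0" unfolding chain_eval_cong2[OF Z1_cycle] by simp
  finally have S2: "chain_eval (Suc p) B Z1 = 0" using S1 by simp
  have subfaces: "cong2 (chain_boundary (Suc p) K1) (\<Sum>x\<in>I. Bs x)"
  proof -
    have sum: "(singular_subdivision p ^^ r) (\<Sum>x\<in>I. outer_face x) = (\<Sum>x\<in>I. Bs x)"
      unfolding Bs_def
      by (rule additive_chain_operator(2)[of "\<lambda>p. singular_subdivision p ^^ r"])
         (simp_all add: iterated_subdivision_0 iterated_subdivision_diff finI)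
    show ?thesis
      using cong2_iterated_subdivision[OF boundary_outer_faces[folded K_def I_def], where p = p and r = r]
      unfolding sum K1_def chain_boundary_iterated_subdivision[OF K] .
  qed
  have face_B: "is_face p (Bs x)" and face_H: "is_face (Suc p) (Hs x)" if x: "x \<in> I" for x
  proof -
    have "chain_vertices p (Bs x) \<subseteq> \<Theta>" "chain_vertices (Suc p) (Hs x) \<subseteq> \<Theta>" using x unfolding \<Theta>_def by blast+
    then show "is_face p (Bs x)" "is_face (Suc p) (Hs x)" using faces[OF x] unfolding is_face_def by blast+
  qed
  have "chain_eval (Suc p) C K1 = chain_eval (Suc p) (\<lambda>V. obstruction (n + N) (2 * n) (Suc p) (\<lambda>j. point_mat (V j))) K1"
    unfolding C_def
    by (rule point_haar_eval[OF K1 _ small_K1 subfaces face_B, symmetric]) (auto simp: \<Theta>_def)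
  also have "\<dots> = chain_eval (Suc p) B Z1" unfolding B_def Z1_def
    by (rule point_eval[OF K1 small_K1, symmetric])
  finally have S3: "chain_eval (Suc p) C K1 = 0" unfolding S2 .
  \<comment> \<open>The homotopy carries chains in a side of the cube to chains in the same side,
    where \<open>C\<close> vanishes; so the second term contributes nothing.\<close>
  have hK: "chain_boundary (Suc (Suc p)) H + h p (chain_boundary (Suc p) K) = K1 - K"
    using hb[OF K] unfolding H_def K1_def by simp
  have "chain_eval (Suc p) C (h p (chain_boundary (Suc p) K)) = chain_eval (Suc p) C (\<Sum>x\<in>I. Hs x)"
  proof -
    have "cong2 (h p (chain_boundary (Suc p) K)) (h p (\<Sum>x\<in>I. outer_face x))"
      by (rule additive_chain_operator(3)[OF h0 hd boundary_outer_faces[folded K_def I_def]])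
    moreover have "h p (\<Sum>x\<in>I. outer_face x) = (\<Sum>x\<in>I. Hs x)"
      unfolding Hs_def by (rule additive_chain_operator(2)[OF h0 hd finI])
    ultimately show ?thesis by (intro chain_eval_cong2) simp
  qed
  also have "\<dots> = 0" unfolding chain_eval_sum C_def
    by (rule sum.neutral) (use haar_face[OF face_H] in blast)
  finally have "chain_eval (Suc p) C (h p (chain_boundary (Suc p) K)) = 0" .
  moreover have "chain_eval (Suc p) C (chain_boundary (Suc (Suc p)) H) = 0"
    unfolding C_def by (rule haar_boundary[OF H]) (auto simp: \<Theta>_def)
  ultimately have "chain_eval (Suc p) C (K1 - K) = 0" unfolding hK[symmetric] chain_eval_add by simp
  then have S4: "chain_eval (Suc p) C K = 0" unfolding chain_eval_diff S3 by simp
  have "chain_eval (Suc p) C K = (\<Sum>e\<in>orders (Suc p) Nd. obstruction (n + N) (2 * n) (Suc p) (\<lambda>j. haar_mat (corner (Suc p) Nd e j)))"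
    unfolding K_def cube_chain_def chain_eval_sum chain_eval_of C_def
  proof (rule sum.cong[OF refl])
    fix e assume e: "e \<in> orders (Suc p) Nd"
    show "obstruction (n + N) (2 * n) (Suc p) (\<lambda>j. haar_mat (vertices (Suc p) (cube_simplex (Suc p) Nd e) j)) =
        obstruction (n + N) (2 * n) (Suc p) (\<lambda>j. haar_mat (corner (Suc p) Nd e j))"
      by (rule obstruction_cong) (simp add: vertices_cube_simplex[OF e])
  qed
  also have "\<dots> = 1" unfolding dims(4)
  proof (rule \<rho>3(2))
    show "close \<rho>3 haar_mat" unfolding close_def
      using near_mono[OF near_haar_mat \<eta>(4)] dims(4) by simp
    have "corner (Suc p) Nd e0 j \<in> \<Theta>" if "j \<le> Suc p" for j using that e0 unfolding \<Theta>_def by blast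
    from haar_general_position[OF this]
    show "general_position (n + N) ({..<Suc (N + q)} \<times> {..Suc p}) (\<lambda>(i, j). (corner (Suc p) Nd e0 j, i))
        (\<lambda>(i, j). haar_mat (corner (Suc p) Nd e0 j) i)" unfolding dims(4) .
  qed
  finally show False using S4 by simp
qed

end

theorem theorem1:
  fixes n N :: nat and F :: "(real \<Rightarrow> real) set"
  assumes "n \<le> N" and "N < 2 * n - binary_ones n"
    and "subspace F" and "F \<subseteq> C0" and "dim F = N"
  shows "exceptional_diagrams n F \<noteq> {} \<and>
    (\<exists>h \<in> carrier (homology_group_Z2 (N - n + 1) (diagram_space n)).
        h \<noteq> \<one>\<^bsub>homology_group_Z2 (N - n + 1) (diagram_space n)\<^esub> \<and>
        (\<forall>c\<in>h. chain_support (N - n + 1) c \<inter> exceptional_diagrams n F \<noteq> {}))"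
proof -
  define p where "p = N - n"
  define q where "q = n - Suc p"
  have N: "N = n + p" using assms(1) by (simp add: p_def)
  \<comment> \<open>The upper bound on \<open>N\<close> amounts to
    \<open>binary_ones n \<le> q\<close>, which is the condition under which \<open>n\<close> is a
    sum of \<open>q\<close> powers of two.\<close>
  have q: "n = q + Suc p" "binary_ones n \<le> q" "q \<le> n" using assms(2) N by (auto simp: q_def)
  obtain b where b: "(\<Sum>c<q. (2::nat) ^ b c) = n" using sum_of_powers[OF q(2,3)] by blast
  have "card (forest_leaves q b) = n" by (simp add: card_forest_leaves b)
  then obtain lf where lf: "bij_betw lf {..<n} (forest_leaves q b)"
    using ex_bij_betw_nat_finite[OF finite_forest_leaves[of q b]] by (auto simp: atLeast0LessThan)
  have "card (forest_nodes q b) = Suc p" using card_forest_nodes[of q b] b q(1) by simp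
  then obtain e where "bij_betw e {..<Suc p} (forest_nodes q b)"
    using ex_bij_betw_nat_finite[OF finite_forest_nodes[of q b]] by (auto simp: atLeast0LessThan)
  then have e0: "restrict e {..<Suc p} \<in> orders (Suc p) (forest_nodes q b)"
    using bij_betw_cong[of "{..<Suc p}" "restrict e {..<Suc p}" e] unfolding orders_def by simp
  interpret forest_frame n N q p b lf "restrict e {..<Suc p}"
    by unfold_locales (use b q(1) N lf e0 in auto)
  obtain Bs where Bs: "Bs \<subseteq> F" "independent Bs" "F \<subseteq> span Bs" "card Bs = dim F" by (rule basis_exists)
  \<comment> \<open>Finiteness follows from the positive cardinality, because \<open>N\<close> is at
    least \<open>Suc p\<close>.\<close>
  have "finite Bs" using Bs(4) assms(5) N q(1) by (intro card_ge_0_finite) simp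
  then obtain f where f: "bij_betw f {..<N} Bs"
    using ex_bij_betw_nat_finite[of Bs] Bs(4) assms(5) by (auto simp: atLeast0LessThan)
  have fB: "f ` {..<N} = Bs" using f by (simp add: bij_betw_def)
  have "f t \<in> C0" if "t < N" for t using that fB Bs(1) assms(4) by blast
  then have cont: "\<forall>t<N. continuous_on UNIV (f t)" by (simp add: C0_def)
  have dim: "N - n + 1 = Suc p" by (simp add: p_def)
  show ?thesis unfolding dim
  proof (rule unavoidable_class)
    show "singular_chain (Suc p) (diagram_space n) (chain_map (Suc p) diagram (cube_chain (Suc p) Nd))"
      by (rule singular_chain_chain_map[OF singular_chain_cube_chain continuous_diagram])
    show "cong2 (chain_boundary (Suc p) (chain_map (Suc p) diagram (cube_chain (Suc p) Nd))) 0" by (rule diagram_cycle)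
    have F: "F \<subseteq> span (f ` {..<N})" unfolding fB by (rule Bs(3))
    show False if "singular_chain (Suc p) (subtopology (diagram_space n)
          (topspace (diagram_space n) - exceptional_diagrams n F)) c"
        "singular_chain (Suc (Suc p)) (diagram_space n) d"
        "cong2 c (chain_map (Suc p) diagram (cube_chain (Suc p) Nd) + chain_boundary (Suc (Suc p)) d)" for c d
      by (rule no_avoiding_chain[OF assms(3) F cont that])
  qed
qed

end
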